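(* Let $n\ge 3$ be an odd integer. (i) Let $\Gamma\subseteq\mathrm{Isom}(H^n)$ be an arithmetic lattice of the simplest type defined over a totally real number field $K$. Let $\gamma$ be a hyperbolic element of $\Gamma$, and let $\lambda=e^{2\ell(\gamma)}$. Then $\lambda$ is a Salem number which is square-rootable over $K$. (ii) Conversely, if $\lambda$ is a Salem number, $K$ is a subfield of $\mathbb{Q}(\lambda+\lambda^{-1})$ with $\deg_K(\lambda)\le n+1$, and $\lambda$ is square-rootable over $K$, then there exist an arithmetic lattice $\Gamma\subseteq\mathrm{Isom}(H^n)$ of the simplest type defined over $K$ and a hyperbolic element $\gamma$ in $\Gamma$ such that $\lambda^{1/2}=e^{\ell(\gamma)}$.
   Context: A Salem number is a real algebraic integer $\lambda>1$ that is conjugate (over $\mathbb{Q}$) to $\lambda^{-1}$ and whose remaining conjugates lie on the unit circle; degree $2$ is allowed. For a number field $K\subseteq\mathbb{C}$ and an algebraic number $\lambda$, $\deg_K(\lambda)=[K(\lambda):K]$. Square-rootability: let $\lambda$ be a Salem number, $K$ a subfield of $\mathbb{Q}(\lambda+\lambda^{-1})$ (this containment is part of the definition), and $p(x)$ the minimal polynomial of $\lambda$ over $K$. Then $\lambda$ is square-rootable over $K$ if there exist a totally positive element $\alpha$ of $K$ (i.e. $\sigma(\alpha)>0$ for every embedding $\sigma:K\to\mathbb{R}$) and a monic palindromic polynomial $q(x)$ (i.e. $q(x)=x^{\deg q}q(x^{-1})$), whose even degree coefficients are in $K$ and whose odd degree coefficients are in $\sqrt{\alpha}K$, such that $q(x)q(-x)=p(x^2)$.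 Let $f_n(x)=x_1^2+\cdots+x_n^2-x_{n+1}^2$ and $H^n=\{x\in\mathbb{R}^{n+1}: f_n(x)=-1,\ x_{n+1}>0\}$ (hyperboloid model of hyperbolic $n$-space). $\mathrm{O}^+(n,1)$ is the group of real matrices preserving $f_n$ and leaving $H^n$ invariant; it is identified with $\mathrm{Isom}(H^n)$. An element $\gamma\in\mathrm{Isom}(H^n)$ is hyperbolic if there is a unique geodesic in $H^n$ (its axis) along which $\gamma$ acts as a translation by a positive distance $\ell(\gamma)$, called the translation length of $\gamma$. Totally real number fields $K$ are taken as subfields of $\mathbb{R}$, with ring of integers $\mathfrak{o}_K$. A quadratic form $f(x)=x^tAx$ over $K$ in $n+1$ variables (with $A$ a symmetric matrix over $K$) is admissible if $f$ has signature $(n,1)$ and, for each nonidentity embedding $\sigma:K\to\mathbb{R}$, the form $f^\sigma$ obtained by applying $\sigma$ to the entries of $A$ is positive definite. For a subring $R\subseteq\mathbb{R}$, $\mathrm{O}'(f,R)$ is the group of $T\in\mathrm{GL}(n+1,R)$ with $T^tAT=A$ that leave invariant both components of the cone $\{x\in\mathbb{R}^{n+1}:f(x)<0\}$. A subgroup $\Gamma\subseteq\mathrm{O}^+(n,1)=\mathrm{Isom}(H^n)$ is an arithmetic lattice of the simplest type defined over $K$ if there exist an admissible quadratic form $f$ over $K$ in $n+1$ variables and $M\in\mathrm{GL}(n+1,\mathbb{R})$ such that $f(Mx)=f_n(x)$ for all $x\in\mathbb{R}^{n+1}$ and $M\Gamma M^{-1}$ is commensurable with $\mathrm{O}'(f,\mathfrak{o}_K)$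 (their intersection has finite index in both). *)

theory Defs
  imports
    "HOL-Analysis.Abstract_Topology_2"
    "HOL-Analysis.Function_Topology"
    "HOL-Algebra.Embedded_Algebras"
    "HOL-Algebra.Generated_Fields"
    "Jordan_Normal_Form.VS_Connect"
    "HOL-Computational_Algebra.Polynomial"
begin

section \<open>Subfields of the reals\<close>

text \<open>
  Number fields are sets of reals. The ring structure on all of \<open>\<real>\<close> (or \<open>\<complex>\<close>) is the record
  \<open>class_ring\<close>; on a subset \<open>K\<close> it is \<open>class_ring\<lparr>carrier := K\<rparr>\<close>.
\<close>

definition embeddings :: "real set \<Rightarrow> (real \<Rightarrow> 'a::field) set" where
  "embeddings K = Ring.ring_hom (class_ring\<lparr>carrier := K\<rparr>) class_ring"

definition totally_real_number_field :: "real set \<Rightarrow> bool" where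
  "totally_real_number_field K \<longleftrightarrow>
     subfield K class_ring \<and> ring.finite_dimension class_ring \<rat> K \<and>
     (\<forall>\<sigma> \<in> (embeddings K :: (real \<Rightarrow> complex) set). \<sigma> ` K \<subseteq> \<real>)"

definition ring_of_integers :: "real set \<Rightarrow> real set" where
  "ring_of_integers K = {x \<in> K. algebraic_int x}"

definition totally_positive :: "real set \<Rightarrow> real \<Rightarrow> bool" where
  "totally_positive K \<alpha> \<longleftrightarrow> \<alpha> \<in> K \<and> (\<forall>\<sigma> \<in> (embeddings K :: (real \<Rightarrow> real) set). \<sigma> \<alpha> > 0)"

definition field_adjoin :: "real set \<Rightarrow> real \<Rightarrow> real set" where
  "field_adjoin K x = generate_field class_ring (insert x K)"

definition deg_over :: "real set \<Rightarrow> real \<Rightarrow> nat" where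
  "deg_over K x = ring.dim class_ring K (field_adjoin K x)"

text \<open>The minimal polynomial is only meaningful for \<open>x\<close> algebraic over the subfield \<open>K\<close>.\<close>

definition min_poly :: "real set \<Rightarrow> real \<Rightarrow> real poly" where
  "min_poly K x =
     (THE p. set (coeffs p) \<subseteq> K \<and> lead_coeff p = 1 \<and> poly p x = 0 \<and>
        (\<forall>q. q \<noteq> 0 \<and> set (coeffs q) \<subseteq> K \<and> poly q x = 0 \<longrightarrow> degree p \<le> degree q))"

definition conjugates :: "real \<Rightarrow> complex set" where
  "conjugates x = {z. poly (map_poly complex_of_real (min_poly \<rat> x)) z = 0}"


section \<open>Salem numbers and square-rootability\<close>

definition salem :: "real \<Rightarrow> bool" where
  "salem l \<longleftrightarrow>
     algebraic_int l \<and> l > 1 \<and> complex_of_real (inverse l) \<in> conjugates l \<and>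
     (\<forall>z \<in> conjugates l - {complex_of_real l, complex_of_real (inverse l)}. cmod z = 1)"

definition square_rootable :: "real set \<Rightarrow> real \<Rightarrow> bool" where
  "square_rootable K l \<longleftrightarrow>
     salem l \<and> subfield K class_ring \<and> K \<subseteq> field_adjoin \<rat> (l + inverse l) \<and>
     (\<exists>\<alpha> q. totally_positive K \<alpha> \<and>
        lead_coeff q = 1 \<and> reflect_poly q = q \<and>
        (\<forall>i. even i \<longrightarrow> coeff q i \<in> K) \<and>
        (\<forall>i. odd i \<longrightarrow> coeff q i \<in> (\<lambda>k. sqrt \<alpha> * k) ` K) \<and>
        q * pcompose q [:0, -1:] = pcompose (min_poly K l) [:0, 0, 1:])"


section \<open>Hyperbolic space\<close>

text \<open>Coordinates are numbered from \<open>0\<close>, so the last coordinate of a vector in \<open>\<real>\<^sup>n\<^sup>+\<^sup>1\<close> is \<open>x $ n\<close>.\<close>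

definition lorentz :: "nat \<Rightarrow> real vec \<Rightarrow> real vec \<Rightarrow> real" where
  "lorentz n x y = (\<Sum>i<n. x $ i * y $ i) - x $ n * y $ n"

definition lorentz_form :: "nat \<Rightarrow> real vec \<Rightarrow> real" where
  "lorentz_form n x = (\<Sum>i<n. (x $ i)\<^sup>2) - (x $ n)\<^sup>2"

definition hyp_space :: "nat \<Rightarrow> real vec set" where
  "hyp_space n = {x \<in> carrier_vec (n + 1). lorentz_form n x = -1 \<and> x $ n > 0}"

definition hyp_dist :: "nat \<Rightarrow> real vec \<Rightarrow> real vec \<Rightarrow> real" where
  "hyp_dist n x y = arcosh (- lorentz n x y)"

definition O_plus :: "nat \<Rightarrow> real mat set" where
  "O_plus n = {T \<in> carrier_mat (n + 1) (n + 1).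
     (\<forall>x \<in> carrier_vec (n + 1). lorentz_form n (T *\<^sub>v x) = lorentz_form n x) \<and>
     (\<lambda>x. T *\<^sub>v x) ` hyp_space n = hyp_space n}"

definition geodesic_line :: "nat \<Rightarrow> (real \<Rightarrow> real vec) \<Rightarrow> bool" where
  "geodesic_line n c \<longleftrightarrow>
     range c \<subseteq> hyp_space n \<and> (\<forall>s t. hyp_dist n (c s) (c t) = \<bar>s - t\<bar>)"

text \<open>\<open>L\<close> is a geodesic along which \<open>g\<close> acts as a translation by the distance \<open>d > 0\<close>.\<close>

definition translates_along :: "nat \<Rightarrow> real mat \<Rightarrow> real vec set \<Rightarrow> real \<Rightarrow> bool" where
  "translates_along n g L d \<longleftrightarrow>
     d > 0 \<and> (\<exists>c. geodesic_line n c \<and> L = range c \<and> (\<forall>t. g *\<^sub>v c t = c (t + d)))"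

definition hyperbolic :: "nat \<Rightarrow> real mat \<Rightarrow> bool" where
  "hyperbolic n g \<longleftrightarrow> g \<in> O_plus n \<and> (\<exists>!L. \<exists>d. translates_along n g L d)"

definition translation_length :: "nat \<Rightarrow> real mat \<Rightarrow> real" where
  "translation_length n g = (THE d. \<exists>L. translates_along n g L d)"


section \<open>Arithmetic lattices of the simplest type\<close>

abbreviation GL :: "nat \<Rightarrow> real mat monoid" where
  "GL m \<equiv> units_of (ring_mat TYPE(real) m ())"

definition GL_over :: "nat \<Rightarrow> real set \<Rightarrow> real mat set" where
  "GL_over m R = {T \<in> carrier_mat m m. elements_mat T \<subseteq> R \<and>
     (\<exists>S \<in> carrier_mat m m. elements_mat S \<subseteq> R \<and> T * S = 1\<^sub>m m \<and> S * T = 1\<^sub>m m)}"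

definition quad_form :: "real mat \<Rightarrow> real vec \<Rightarrow> real" where
  "quad_form A x = x \<bullet> (A *\<^sub>v x)"

definition has_signature :: "real mat \<Rightarrow> nat \<Rightarrow> nat \<Rightarrow> bool" where
  "has_signature A p q \<longleftrightarrow>
     (\<exists>S \<in> carrier (GL (p + q)). S\<^sup>T * A * S = mat_diag (p + q) (\<lambda>i. if i < p then 1 else -1))"

definition positive_definite :: "nat \<Rightarrow> real mat \<Rightarrow> bool" where
  "positive_definite m A \<longleftrightarrow> (\<forall>x \<in> carrier_vec m. x \<noteq> 0\<^sub>v m \<longrightarrow> quad_form A x > 0)"

text \<open>
  Elements of \<open>embeddings K\<close> are functions on all of \<open>\<real>\<close> that are only constrained on \<open>K\<close>, so
  being the identity embedding is tested on \<open>K\<close>.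
\<close>

definition admissible :: "nat \<Rightarrow> real set \<Rightarrow> real mat \<Rightarrow> bool" where
  "admissible n K A \<longleftrightarrow>
     totally_real_number_field K \<and>
     A \<in> carrier_mat (n + 1) (n + 1) \<and> elements_mat A \<subseteq> K \<and> A\<^sup>T = A \<and>
     has_signature A n 1 \<and>
     (\<forall>\<sigma> \<in> (embeddings K :: (real \<Rightarrow> real) set).
        (\<exists>x \<in> K. \<sigma> x \<noteq> x) \<longrightarrow> positive_definite (n + 1) (map_mat \<sigma> A))"

text \<open>The Euclidean topology on \<open>carrier_vec m\<close>, transported from the product \<open>\<real>\<^sup>m\<close>.\<close>

definition vec_topology :: "nat \<Rightarrow> real vec topology" where
  "vec_topology m =
     pullback_topology (carrier_vec m) (\<lambda>x. \<lambda>i\<in>{..<m}. x $ i)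
       (product_topology (\<lambda>_. euclideanreal) {..<m})"

definition cone_components :: "nat \<Rightarrow> real mat \<Rightarrow> real vec set set" where
  "cone_components m A =
     connected_components_of
       (subtopology (vec_topology m) {x \<in> carrier_vec m. quad_form A x < 0})"

definition O_prime :: "nat \<Rightarrow> real mat \<Rightarrow> real set \<Rightarrow> real mat set" where
  "O_prime m A R = {T \<in> GL_over m R. T\<^sup>T * A * T = A \<and>
     (\<forall>C \<in> cone_components m A. (\<lambda>x. T *\<^sub>v x) ` C = C)}"

definition commensurable :: "('a, 'b) monoid_scheme \<Rightarrow> 'a set \<Rightarrow> 'a set \<Rightarrow> bool" where
  "commensurable G H1 H2 \<longleftrightarrow>
     finite (rcosets\<^bsub>G\<lparr>carrier := H1\<rparr>\<^esub> (H1 \<inter> H2)) \<and>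
     finite (rcosets\<^bsub>G\<lparr>carrier := H2\<rparr>\<^esub> (H1 \<inter> H2))"

definition arithmetic_simplest_type :: "nat \<Rightarrow> real set \<Rightarrow> real mat set \<Rightarrow> bool" where
  "arithmetic_simplest_type n K \<Gamma> \<longleftrightarrow>
     subgroup \<Gamma> (GL (n + 1)) \<and> \<Gamma> \<subseteq> O_plus n \<and>
     (\<exists>A M. admissible n K A \<and> M \<in> carrier (GL (n + 1)) \<and>
        (\<forall>x \<in> carrier_vec (n + 1). quad_form A (M *\<^sub>v x) = lorentz_form n x) \<and>
        commensurable (GL (n + 1))
          ((\<lambda>T. M * T * inv\<^bsub>GL (n + 1)\<^esub> M) ` \<Gamma>)
          (O_prime (n + 1) A (ring_of_integers K)))"

end

theory Submission
  imports Defs "HOL-Computational_Algebra.Fundamental_Theorem_Algebra" "Jordan_Normal_Form.Char_Poly"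
    "HOL-Analysis.Convex"
begin

text \<open>
  (i) Let \<open>T\<close> be the image of \<open>\<gamma>\<close> in the isometry group of the form \<open>f\<close>. A power of \<open>T\<close> is integral
  and \<open>T\<close> commensurates \<open>O'(f, \<oo>\<^sub>K)\<close>. Conjugation by \<open>T\<close> maps a suitable power of each element of
  \<open>O'(f, \<oo>\<^sub>K)\<close> to a matrix over \<open>K\<close>; powers of conjugates of the hyperbolic power of \<open>T\<close> span the
  full matrix algebra, so conjugation by \<open>T\<close> preserves matrices over \<open>K\<close> and \<open>t T\<close> has entries in \<open>K\<close>
  for some \<open>t > 0\<close> with \<open>t\<^sup>2 \<in> K\<close> totally positive. Total definiteness of the conjugate forms makes
  the eigenvalue \<open>l = exp (2 \<ell>)\<close> of \<open>T\<^sup>2\<close> a Salem number with \<open>K \<subseteq> \<rat>(l + l\<^sup>-\<^sup>1)\<close>, and the minimal polynomial of the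
  eigenvalue \<open>t \<surd>l\<close> of \<open>t T\<close>, rescaled by \<open>t\<close>, is the required square root polynomial.

  (ii) Let \<open>p\<close> be the minimal polynomial of \<open>l\<close> over \<open>K\<close>. The trace form \<open>Tr (g(X) h(X\<^sup>-\<^sup>1))\<close> on
  \<open>K[X]/(p)\<close>, extended by \<open>\<langle>1, \<alpha>, 1, \<alpha>, \<dots>\<rangle>\<close>, is admissible. Square-rootability provides \<open>c \<in> K[X]/(p)\<close>
  with \<open>c(X)\<^sup>2 = \<alpha> X\<close> and \<open>c(X) c(X\<^sup>-\<^sup>1) = \<alpha>\<close>. Multiplication by \<open>c\<close>, divided by \<open>\<surd>\<alpha>\<close>, is an isometry \<open>T\<close>
  with eigenvalues \<open>\<surd>l\<close> and \<open>1/\<surd>l\<close> whose square is integral, and adjoining \<open>T\<close> to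
  \<open>H \<inter> T H T\<^sup>-\<^sup>1\<close> with \<open>H = O'(f, \<oo>\<^sub>K)\<close> gives the lattice.
\<close>

text \<open>The difficulty in (i) is that \<gamma> lies only in a group commensurable with the
  integral one: the entries of \<open>T\<close> need not lie in K, and passing to a power would lose
  the exact translation length. Conjugation by \<open>T\<close> determines \<open>T\<close> up to a
  scalar, and the form determines the square of that scalar; this is the origin of \<alpha> = t^2.
  Density of the lattice is replaced by an explicit argument: rescaled powers of a hyperbolic
  isometry converge to a rank one operator built from its two isotropic eigenlines, and reflections
  in vectors over K move these lines enough to detect every matrix. In (ii) the trace form becomes a
  sum over the roots z of a conjugate of p. For |z| = 1 the inverse of z is its complex conjugate
  and the term of g is |g(z)|^2, while the pair l, 1/l contributes a hyperbolic plane, and this only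
  at the identity embedding. Both deg p and n + 1 are even, so the padding coordinates come in
  pairs, each carrying a similitude of \<langle>1, \<alpha>\<rangle> with factor \<alpha>.\<close>

notation ring_of_integers ("\<O>")

abbreviation Mat :: "nat => 'a mat set" where "Mat k \<equiv> carrier_mat k k"

abbreviation Vec :: "nat => 'a vec set" where "Vec k \<equiv> carrier_vec k"

section \<open>Algebra inside the reals and complexes: minimal polynomials, conjugates, algebraic
  integers, residues\<close>

section \<open>Subrings and subfields of a field\<close>

text \<open>A predicate on subsets of a field type, so that K, its ring of integers, the complex
  algebraic integers and simple extensions are all instances without new types.\<close>

locale subring_of_field =
 fixes R :: "'a::field set"
 assumes one_mem: "1 \<in> R"
  and add_mem: "[|x \<in> R; y \<in> R|] ==> x + y \<in> R"
  and mult_mem: "[|x \<in> R; y \<in> R|] ==> x * y \<in> R"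
  and uminus_mem: "x \<in> R ==> - x \<in> R"
begin

lemma diff_mem: "[|x \<in> R; y \<in> R|] ==> x - y \<in> R"
 using add_mem[of x "- y"] uminus_mem[of y] by simp

lemma zero_mem: "0 \<in> R"
 using diff_mem[OF one_mem one_mem] by simp

lemma power_mem: "x \<in> R ==> x ^ k \<in> R"
 by (induction k) (auto intro: one_mem mult_mem)

lemma sum_mem: "(!!i. i \<in> I ==> f i \<in> R) ==> sum f I \<in> R"
 by (induction I rule: infinite_finite_induct) (auto intro: zero_mem add_mem)

lemma prod_mem: "(!!i. i \<in> I ==> f i \<in> R) ==> prod f I \<in> R"
 by (induction I rule: infinite_finite_induct) (auto intro: one_mem mult_mem)

lemma of_nat_mem: "of_nat k \<in> R"
 by (induction k) (auto intro: zero_mem one_mem add_mem)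

lemma of_int_mem: "of_int k \<in> R"
 by (cases k) (auto intro: of_nat_mem uminus_mem diff_mem one_mem)

lemmas ring_mems = zero_mem one_mem add_mem mult_mem uminus_mem diff_mem power_mem of_nat_mem of_int_mem

definition poly_over :: "'a poly => bool" where
 "poly_over p \<longleftrightarrow> (\<forall>i. coeff p i \<in> R)"

lemma poly_over_iff: "poly_over p \<longleftrightarrow> set (coeffs p) \<subseteq> R"
proof
 show "set (coeffs p) \<subseteq> R ==> poly_over p"
  unfolding poly_over_def using zero_mem
  by (metis coeff_in_coeffs coeff_eq_0 not_less subset_iff coeff_0)
qed (auto simp: poly_over_def coeffs_def)

lemma poly_over_coeff: "poly_over p ==> coeff p i \<in> R"
 by (simp add: poly_over_def)

lemma poly_over_0: "poly_over 0" and poly_over_1: "poly_over 1"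
 by (auto simp: poly_over_def coeff_1 intro: ring_mems)

lemma poly_over_pCons: "a \<in> R ==> poly_over p ==> poly_over (pCons a p)"
 by (auto simp: poly_over_def coeff_pCons split: nat.splits)

lemma poly_over_add: "poly_over p ==> poly_over q ==> poly_over (p + q)"
 and poly_over_diff: "poly_over p ==> poly_over q ==> poly_over (p - q)"
 and poly_over_uminus: "poly_over p ==> poly_over (- p)"
 by (auto simp: poly_over_def intro: ring_mems)

lemma poly_over_smult: "a \<in> R ==> poly_over p ==> poly_over (Polynomial.smult a p)"
 by (auto simp: poly_over_def intro: ring_mems)

lemma poly_over_mult: "poly_over p ==> poly_over q ==> poly_over (p * q)"
 by (auto simp: poly_over_def coeff_mult intro!: sum_mem mult_mem)

lemma poly_over_sum: "(!!i. i \<in> I ==> poly_over (f i)) ==> poly_over (sum f I)"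
 by (auto simp: poly_over_def coeff_sum intro: sum_mem)

lemma poly_over_monom: "a \<in> R ==> poly_over (Polynomial.monom a k)"
 by (auto simp: poly_over_def intro: zero_mem)

lemma poly_over_pcompose: "poly_over p ==> poly_over q ==> poly_over (pcompose p q)"
proof (induction p)
 case (pCons a p)
 then have "a \<in> R" "poly_over p"
  by (auto simp: poly_over_def coeff_pCons split: nat.splits)
 with pCons show ?case
  by (auto simp: pcompose_pCons intro!: poly_over_add poly_over_mult poly_over_pCons poly_over_0)
qed (auto intro: poly_over_0)

lemma poly_over_reflect: "poly_over p ==> poly_over (reflect_poly p)"
 by (auto simp: poly_over_def coeff_reflect_poly intro: zero_mem)

text \<open>Division by a monic polynomial inverts no coefficient, so quotient and remainder stay
  over the subring. It serves over a field K as well as over the ring of integers.\<close>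

lemma poly_over_divide_monic:
 assumes p: "poly_over p" "lead_coeff p = 1" and "poly_over q"
 shows "\<exists>a r. poly_over a \<and> poly_over r \<and> q = p * a + r \<and> (r = 0 \<or> degree r < degree p)"
 using \<open>poly_over q\<close>
proof (induction "degree q" arbitrary: q rule: less_induct)
 case less
 show ?case
 proof (cases "q = 0 \<or> degree q < degree p")
  case True
  with less show ?thesis
   by (intro exI[of _ 0] exI[of _ q]) (auto intro: poly_over_0)
 next
  case False
  define c where "c = Polynomial.monom (lead_coeff q) (degree q - degree p)"
  define q' where "q' = q - p * c"
  have c: "poly_over c"
   using less.prems unfolding c_def by (intro poly_over_monom poly_over_coeff)
  have q': "poly_over q'"
   unfolding q'_def by (intro poly_over_diff poly_over_mult less.prems p c)
  have "p ~= 0"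
   using p by auto
  have "c ~= 0"
   using False by (simp add: c_def)
  have "degree (p * c) = degree q"
   using False \<open>p ~= 0\<close> \<open>c ~= 0\<close> by (simp add: degree_mult_eq c_def degree_monom_eq)
  moreover have "lead_coeff (p * c) = lead_coeff q"
   using p False by (simp add: lead_coeff_mult c_def degree_monom_eq)
  ultimately have q'_deg: "q' = 0 \<or> degree q' < degree q"
   unfolding q'_def
   by (metis coeff_diff degree_diff_le diff_self leading_coeff_0_iff le_neq_implies_less order_refl)
  have "\<exists>a r. poly_over a \<and> poly_over r \<and> q' = p * a + r \<and> (r = 0 \<or> degree r < degree p)"
  proof (cases "q' = 0")
   case True
   then show ?thesis
    by (intro exI[of _ 0]) (auto intro: poly_over_0)
  next
   case False
   then show ?thesis
    using less.hyps[of q'] q' q'_deg by blast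
  qed
  then obtain a r where "poly_over a" "poly_over r" "q' = p * a + r" "r = 0 \<or> degree r < degree p"
   by blast
  then show ?thesis
   using c by (intro exI[of _ "c + a"] exI[of _ r]) (auto simp: q'_def algebra_simps intro: poly_over_add)
 qed
qed

end

locale subfield_of_field = subring_of_field K for K :: "'a::field set" +
 assumes inverse_mem: "x \<in> K ==> inverse x \<in> K"
begin

lemma divide_mem: "x \<in> K ==> y \<in> K ==> x / y \<in> K"
 by (simp add: divide_inverse mult_mem inverse_mem)

lemma monic_multiple:
 assumes "poly_over p" "p ~= 0"
 shows "poly_over (Polynomial.smult (inverse (lead_coeff p)) p)"
  "lead_coeff (Polynomial.smult (inverse (lead_coeff p)) p) = 1"
 using assms by (auto intro!: poly_over_smult inverse_mem poly_over_coeff)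

end

lemma subfield_class_ring_iff: "subfield K (class_ring :: 'a::field ring) \<longleftrightarrow> subfield_of_field K"
proof
 assume K: "subfield K (class_ring :: 'a ring)"
 note S = subfieldE(1)[OF K]
 show "subfield_of_field K"
 proof
  show "1 \<in> K" using subringE(3)[OF S] by simp
  show "x + y \<in> K" "x * y \<in> K" if "x \<in> K" "y \<in> K" for x y
   using subringE(6,7)[OF S that] by simp_all
  show "- x \<in> K" if "x \<in> K" for x
   using subringE(5)[OF S that] by (simp add: class_ring_simps)
  show "inverse x \<in> K" if "x \<in> K" for x
  proof (cases "x = 0")
   case False
   then show ?thesis
    using ring.subfield_m_inv(1)[OF class_ring.ring_axioms K, of x] that by (simp add: class_ring_simps)
  qed (use that in simp)
 qed
next
 assume "subfield_of_field K"
 then interpret K: subfield_of_field K .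
 show "subfield K (class_ring :: 'a ring)"
 proof (rule field.subfieldI'[OF class_field])
  show "subring K (class_ring :: 'a ring)"
   by (rule ring.subringI[OF class_ring.ring_axioms]) (auto simp: class_ring_simps intro: K.ring_mems)
  fix k assume "k \<in> K - {\<zero>\<^bsub>class_ring\<^esub>}"
  then show "inv\<^bsub>class_ring\<^esub> k \<in> K"
   using K.inverse_mem[of k] by (simp add: class_ring_simps)
 qed
qed

lemma subfield_Rats: "subfield_of_field (\<rat> :: 'a::field_char_0 set)"
 by unfold_locales auto

lemma subfield_UNIV: "subfield_of_field UNIV"
 by unfold_locales auto

section \<open>Minimal polynomials and simple extensions\<close>

definition algebraic_over :: "'a::field set => 'a => bool" where
 "algebraic_over K x \<longleftrightarrow> (\<exists>q. q ~= 0 \<and> subring_of_field.poly_over K q \<and> poly q x = 0)"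

locale real_subfield = subfield_of_field K for K :: "real set"
begin

lemma min_poly_props:
 assumes "algebraic_over K x"
 shows "poly_over (min_poly K x)" "lead_coeff (min_poly K x) = 1" "poly (min_poly K x) x = 0"
  and "!!q. q ~= 0 ==> poly_over q ==> poly q x = 0 ==> degree (min_poly K x) \<le> degree q"
proof -
 define P where "P = (\<lambda>p. set (coeffs p) \<subseteq> K \<and> lead_coeff p = 1 \<and> poly p x = 0 \<and>
    (\<forall>q. q ~= 0 \<and> set (coeffs q) \<subseteq> K \<and> poly q x = 0 --> degree p \<le> degree q))"
 obtain q0 where "q0 ~= 0 \<and> poly_over q0 \<and> poly q0 x = 0"
  using assms by (auto simp: algebraic_over_def)
 then obtain q where q: "q ~= 0" "poly_over q" "poly q x = 0"
  and min: "!!q'. q' ~= 0 \<and> poly_over q' \<and> poly q' x = 0 ==> degree q \<le> degree q'"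
  using ex_has_least_nat[of "\<lambda>q. q ~= 0 \<and> poly_over q \<and> poly q x = 0" q0 degree] by blast
 have "\<exists>!p. P p"
 proof (rule ex1I)
  show P: "P (Polynomial.smult (inverse (lead_coeff q)) q)"
   unfolding P_def poly_over_iff[symmetric]
   using q monic_multiple[OF q(2,1)] min by auto
  fix p assume p: "P p"
  define q1 where "q1 = Polynomial.smult (inverse (lead_coeff q)) q"
  have q1: "P q1" using P by (simp add: q1_def)
  have deg: "degree p = degree q1"
  proof (rule antisym)
   have "p ~= 0" "q1 ~= 0" using p q1 by (auto simp: P_def)
   then show "degree p \<le> degree q1" "degree q1 \<le> degree p"
    using p q1 unfolding P_def by blast+
  qed
  show "p = Polynomial.smult (inverse (lead_coeff q)) q"
  proof (rule ccontr)
   assume "p ~= Polynomial.smult (inverse (lead_coeff q)) q"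
   then have ne: "p - q1 ~= 0" by (simp add: q1_def)
   have ov: "poly_over (p - q1)"
    using p q1 by (intro poly_over_diff) (auto simp: P_def poly_over_iff)
   have "degree p \<le> degree (p - q1)"
    using p q1 ne ov unfolding P_def poly_over_iff[symmetric] by auto
   moreover have "coeff (p - q1) (degree p) = 0"
    using p q1 deg by (auto simp: P_def)
   moreover have "degree (p - q1) \<le> degree p"
    using deg by (simp add: degree_diff_le)
   ultimately show False
    using ne by (metis antisym leading_coeff_0_iff)
  qed
 qed
 then have "P (min_poly K x)"
  unfolding min_poly_def P_def by (rule theI')
 then show "poly_over (min_poly K x)" "lead_coeff (min_poly K x) = 1" "poly (min_poly K x) x = 0"
  "!!q. q ~= 0 ==> poly_over q ==> poly q x = 0 ==> degree (min_poly K x) \<le> degree q"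
  by (auto simp: P_def poly_over_iff)
qed

lemma min_poly_nonzero: "algebraic_over K x ==> min_poly K x ~= 0"
 using min_poly_props(2) by fastforce

lemma min_poly_dvd_over:
 assumes "algebraic_over K x" "poly_over q" "poly q x = 0"
 shows "\<exists>a. poly_over a \<and> q = min_poly K x * a"
proof -
 let ?p = "min_poly K x"
 note p = min_poly_props[OF assms(1)]
 obtain a r where ar: "poly_over a" "poly_over r" "q = ?p * a + r" "r = 0 \<or> degree r < degree ?p"
  using poly_over_divide_monic[OF p(1,2) assms(2)] by blast
 have "poly r x = 0"
  using ar(3) assms(3) p(3) by simp
 with p(4)[of r] ar have "r = 0" by fastforce
 with ar show ?thesis by auto
qed

lemma min_poly_degree_pos:
 assumes "algebraic_over K x"
 shows "degree (min_poly K x) > 0"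
proof (rule ccontr)
 assume "\<not> ?thesis"
 then obtain c where "min_poly K x = [:c:]"
  by (metis degree_eq_zeroE gr_zeroI)
 with min_poly_props(2,3)[OF assms] show False by auto
qed

text \<open>Splitting off X - y leaves a cofactor of smaller degree, which cannot vanish at x, so x
  - y must. It excludes 1 and -1 as roots of the minimal polynomial of a Salem number.\<close>

lemma min_poly_root_in:
 assumes "algebraic_over K x" "y \<in> K" "poly (min_poly K x) y = 0"
 shows "x = y"
proof -
 let ?p = "min_poly K x"
 have ne: "?p ~= 0" using assms by (rule_tac min_poly_nonzero)
 have "poly_over [:- y, 1:]"
  using assms by (intro poly_over_pCons poly_over_0 ring_mems)
 from poly_over_divide_monic[OF this _ min_poly_props(1)[OF assms(1)]]
 obtain a r where ar: "poly_over a" "poly_over r" "?p = [:- y, 1:] * a + r" "r = 0 \<or> degree r < 1"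
  by auto
 then obtain c where c: "r = [:c:]"
  by (metis degree_0 degree_eq_zeroE less_one)
 have "poly ?p y = c" by (subst ar(3)) (simp add: c)
 with assms c have "r = 0" by simp
 with ar have pa: "?p = [:- y, 1:] * a" by simp
 then have "a ~= 0" using ne by auto
 have "poly ?p x = 0" using min_poly_props[OF assms(1)] by simp
 then have "(x - y) * poly a x = 0" by (subst (asm) pa) (simp add: algebra_simps)
 moreover have "poly a x ~= 0"
 proof
  assume "poly a x = 0"
  then have "degree ?p \<le> degree a"
   using min_poly_props(4)[OF assms(1) \<open>a ~= 0\<close>] ar by simp
  moreover have "degree ?p = Suc (degree a)"
   unfolding pa using \<open>a ~= 0\<close> by (subst degree_mult_eq) auto
  ultimately show False by simp
 qed
 ultimately show ?thesis by simp
qed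

text \<open>Euclid's algorithm evaluated at x: dividing the minimal polynomial by the monic
  associate c1 of c leaves r with r(x) = - c1(x) s(x), so an inverse of r(x) yields one of c(x). The
  remainder vanishes at x only if c is constant.\<close>

lemma poly_value_inverse_aux:
 assumes x: "algebraic_over K x"
 shows "degree c < degree (min_poly K x) ==> poly_over c ==> poly c x ~= 0 ==>
  \<exists>a. poly_over a \<and> poly a x * poly c x = 1"
proof (induction "degree c" arbitrary: c rule: less_induct)
 case less
 let ?p = "min_poly K x"
 note p = min_poly_props[OF x]
 define l where "l = lead_coeff c"
 have "c ~= 0" using less.prems by auto
 then have "l ~= 0" by (simp add: l_def)
 have "l \<in> K" using less.prems by (auto simp: l_def intro: poly_over_coeff)
 define c1 where "c1 = Polynomial.smult (inverse l) c"
 have c1: "poly_over c1" "lead_coeff c1 = 1"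
  using monic_multiple[OF less.prems(2) \<open>c ~= 0\<close>] by (auto simp: c1_def l_def)
 obtain s r where sr: "poly_over s" "poly_over r" "?p = c1 * s + r" "r = 0 \<or> degree r < degree c1"
  using poly_over_divide_monic[OF c1 p(1)] by blast
 have c1x: "poly c1 x ~= 0" and degc: "degree c1 = degree c"
  using less.prems \<open>l ~= 0\<close> by (auto simp: c1_def)
 have eq: "poly r x = - poly c1 x * poly s x"
  using p(3) by (subst (asm) sr(3)) (simp add: algebra_simps add_eq_0_iff2)
 show ?case
 proof (cases "poly r x = 0")
  case True
  have "r = 0"
  proof (rule ccontr)
   assume "r ~= 0"
   then have "degree ?p \<le> degree r" "degree r < degree c1"
    using True sr p(4)[of r] by auto
   then show False using less.prems degc by simp
  qed
  with sr have ps: "?p = c1 * s" by simp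
  have "s ~= 0" using ps min_poly_nonzero[OF x] by auto
  have "poly s x = 0" using eq True c1x by simp
  then have "degree ?p \<le> degree s" using p(4)[of s] sr \<open>s ~= 0\<close> by simp
  moreover have "degree ?p = degree c1 + degree s"
   using ps \<open>s ~= 0\<close> c1 by (metis degree_mult_eq leading_coeff_0_iff zero_neq_one)
  ultimately have "degree c = 0" using degc by simp
  then obtain k where "c = [:k:]" by (rule degree_eq_zeroE)
  with \<open>c ~= 0\<close> less.prems poly_over_coeff[OF less.prems(2), of 0] show ?thesis
   by (intro exI[of _ "[:inverse k:]"]) (auto intro!: poly_over_pCons poly_over_0 inverse_mem)
 next
  case False
  then have "degree r < degree c" using sr degc by auto
  with less.prems have "degree r < degree ?p" by simp
  from less.hyps[OF \<open>degree r < degree c\<close> this sr(2) False] obtain a where a: "poly_over a" "poly a x * poly r x = 1"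
   by blast
  have "poly (Polynomial.smult (- inverse l) (a * s)) x * poly c x = 1"
   using a(2) eq \<open>l ~= 0\<close> by (simp add: c1_def algebra_simps)
  then show ?thesis
   using a sr \<open>l \<in> K\<close>
   by (intro exI[of _ "Polynomial.smult (- inverse l) (a * s)"])
    (auto intro!: poly_over_uminus poly_over_smult poly_over_mult inverse_mem)
 qed
qed

lemma poly_value_inverse:
 assumes x: "algebraic_over K x" and c: "poly_over c" "poly c x ~= 0"
 shows "\<exists>a. poly_over a \<and> poly a x * poly c x = 1"
proof -
 note p = min_poly_props[OF x]
 obtain s r where sr: "poly_over s" "poly_over r" "c = min_poly K x * s + r"
   "r = 0 \<or> degree r < degree (min_poly K x)"
  using poly_over_divide_monic[OF p(1,2) c(1)] by blast
 have "poly r x = poly c x" by (subst sr(3)) (simp add: p(3))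
 moreover from this have "degree r < degree (min_poly K x)"
  using sr(4) c by auto
 ultimately show ?thesis
  using poly_value_inverse_aux[OF x, of r] sr(2) c by simp
qed

lemma simple_extension_subfield:
 assumes x: "algebraic_over K x"
 shows "subfield_of_field {poly c x | c. poly_over c}"
proof
 show "1 \<in> {poly c x | c. poly_over c}"
  by (auto intro!: exI[of _ 1] poly_over_1)
 fix a assume "a \<in> {poly c x | c. poly_over c}"
 then obtain c where c: "a = poly c x" "poly_over c" by blast
 show "- a \<in> {poly c x | c. poly_over c}"
  using c by (auto intro!: exI[of _ "- c"] poly_over_uminus)
 show "inverse a \<in> {poly c x | c. poly_over c}"
 proof (cases "a = 0")
  case True
  then show ?thesis by (auto intro!: exI[of _ 0] poly_over_0)
 next
  case False
  then obtain b where "poly_over b" "poly b x * poly c x = 1"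
   using poly_value_inverse[OF x c(2)] c by auto
  moreover from this have "poly b x = inverse a"
   using c False by (simp add: field_simps)
  ultimately show ?thesis by force
 qed
 fix b assume "b \<in> {poly c x | c. poly_over c}"
 then obtain d where d: "b = poly d x" "poly_over d" by blast
 show "a + b \<in> {poly c x | c. poly_over c}"
  using c d by (auto intro!: exI[of _ "c + d"] poly_over_add)
 show "a * b \<in> {poly c x | c. poly_over c}"
  using c d by (auto intro!: exI[of _ "c * d"] poly_over_mult)
qed

lemma field_adjoin_eq:
 assumes x: "algebraic_over K x"
 shows "field_adjoin K x = {poly c x | c. poly_over c}"
proof
 have E: "subfield {poly c x | c. poly_over c} class_ring"
  using simple_extension_subfield[OF x] by (simp add: subfield_class_ring_iff)
 have "x \<in> {poly c x | c. poly_over c}"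
  by (auto intro!: exI[of _ "[:0, 1:]"] poly_over_pCons poly_over_0 ring_mems)
 moreover have "k \<in> {poly c x | c. poly_over c}" if "k \<in> K" for k
  using that by (auto intro!: exI[of _ "[:k:]"] poly_over_pCons poly_over_0)
 ultimately show "field_adjoin K x \<subseteq> {poly c x | c. poly_over c}"
  unfolding field_adjoin_def by (intro field.generate_field_min_subfield1[OF class_field] E) auto
next
 have "subfield (field_adjoin K x) class_ring"
  unfolding field_adjoin_def by (rule field.generate_field_is_subfield[OF class_field]) simp
 then interpret E: subfield_of_field "field_adjoin K x"
  by (simp add: subfield_class_ring_iff)
 have "x \<in> field_adjoin K x" "K \<subseteq> field_adjoin K x"
  unfolding field_adjoin_def by (auto intro: generate_field.incl)
 then show "{poly c x | c. poly_over c} \<subseteq> field_adjoin K x"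
  by (auto simp: poly_altdef poly_over_def intro!: E.sum_mem E.mult_mem E.power_mem)
qed

end

lemma real_subfieldI: "subfield_of_field K ==> real_subfield K"
 by (simp add: real_subfield_def)

interpretation Rats: real_subfield "\<rat>"
 by (intro real_subfieldI subfield_Rats)

section \<open>Rational polynomials and conjugates\<close>

text \<open>One rational polynomial is evaluated at real and complex points alike, so that relations
  found at a real number can be carried to its conjugates. The type \<open>rat poly\<close> also
  supplies division with remainder and divisibility.\<close>

definition ev :: "rat poly => 'a::field_char_0 => 'a" where
 "ev c z = poly (map_poly of_rat c) z"

lemma ev_0 [simp]: "ev 0 z = 0" and ev_1 [simp]: "ev 1 z = 1"
 and ev_pCons [simp]: "ev (pCons a c) z = of_rat a + z * ev c z"
 by (simp_all add: ev_def of_rat_hom.map_poly_pCons_hom)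

lemma ev_add [simp]: "ev (a + b) z = ev a z + ev b z"
 by (simp add: ev_def of_rat_hom.map_poly_hom_add)

lemma ev_smult [simp]: "ev (Polynomial.smult r c) z = of_rat r * ev c z"
 by (simp add: ev_def of_rat_hom.map_poly_hom_smult)

lemma ev_mult [simp]: "ev (a * b) z = ev a z * ev b z"
 by (induction a) (simp_all add: algebra_simps)

lemma ev_uminus [simp]: "ev (- a) z = - ev a z"
 using ev_smult[of "-1" a z] by simp

lemma ev_diff [simp]: "ev (a - b) z = ev a z - ev b z"
 using ev_add[of a "- b" z] by simp

lemma ev_power [simp]: "ev (a ^ k) z = ev a z ^ k"
 by (induction k) simp_all

lemma ev_sum: "ev (sum f I) z = (\<Sum>i\<in>I. ev (f i) z)"
 by (induction I rule: infinite_finite_induct) simp_all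

lemma ev_pcompose [simp]: "ev (pcompose a b) z = ev a (ev b z)"
 by (induction a) (simp_all add: pcompose_pCons)

lemma of_real_of_rat [simp]: "(of_real (of_rat a) :: 'a::real_field) = of_rat a"
 by (cases a) (simp add: of_rat_rat)

lemma ev_of_real: "ev c (of_real x :: 'a::{real_field}) = of_real (ev c x)"
by (induction c) simp_all

lemma ev_comm_ring_hom: "comm_ring_hom (\<lambda>c. ev c z)"
 by unfold_locales simp_all

lemma map_poly_of_rat_eq_0:
 "map_poly of_rat c = (0 :: 'a::field_char_0 poly) \<longleftrightarrow> c = 0"
 by (simp add: poly_eq_iff coeff_map_poly)

lemma poly_over_Rats_iff: "subring_of_field.poly_over \<rat> p \<longleftrightarrow> (\<exists>c. p = map_poly of_rat c)"
 for p :: "real poly"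
proof
 assume "subring_of_field.poly_over \<rat> p"
 then have "set (coeffs p) \<subseteq> \<rat>" by (simp add: Rats.poly_over_iff)
 define r :: "real => rat" where "r = the_inv of_rat"
 define c where "c = map_poly r p"
 have inj: "inj (of_rat :: rat => real)" by (simp add: inj_def)
 have inv: "of_rat (r q) = q" if "q \<in> \<rat>" for q :: real
  unfolding r_def using that by (intro f_the_inv_into_f inj) (simp add: Rats_def)
 have "r 0 = 0"
  using the_inv_f_f[OF inj, of 0] by (simp add: r_def)
 then have "coeff (map_poly of_rat c) i = coeff p i" for i
  using inv Rats.poly_over_coeff[OF \<open>subring_of_field.poly_over \<rat> p\<close>]
  by (simp add: c_def coeff_map_poly)
 then show "\<exists>c. p = map_poly of_rat c"
  by (intro exI[of _ c] poly_eqI) simp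
qed (auto simp: Rats.poly_over_def coeff_map_poly)

lemma algebraic_over_Rats_iff: "algebraic_over \<rat> x \<longleftrightarrow> (\<exists>c. c ~= 0 \<and> ev c x = 0)"
 for x :: real
proof
 assume "algebraic_over \<rat> x"
 then obtain q where "q ~= 0" "subring_of_field.poly_over \<rat> q" "poly q x = 0"
  by (auto simp: algebraic_over_def)
 moreover from this obtain c where "q = map_poly of_rat c" using poly_over_Rats_iff by blast
 ultimately show "\<exists>c. c ~= 0 \<and> ev c x = 0" unfolding ev_def by auto
next
 assume "\<exists>c. c ~= 0 \<and> ev c x = 0"
 then obtain c where "c ~= 0" "ev c x = 0" by blast
 then show "algebraic_over \<rat> x"
  unfolding algebraic_over_def
  by (intro exI[of _ "map_poly of_rat c"])
   (simp add: ev_def map_poly_of_rat_eq_0 Rats.poly_over_def coeff_map_poly)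
qed

lemma conjugates_iff:
 assumes "algebraic_over \<rat> x"
 shows "z \<in> conjugates x \<longleftrightarrow> (\<forall>c. ev c x = 0 --> ev c z = 0)"
proof
 have C: "map_poly complex_of_real (map_poly of_rat c) = map_poly of_rat c" for c
  by (rule poly_eqI) (simp add: coeff_map_poly)
 note m = Rats.min_poly_props[OF assms]
 obtain m where m': "min_poly \<rat> x = map_poly of_rat m"
  using m(1) poly_over_Rats_iff by blast
 {
  assume "z \<in> conjugates x"
  then have z: "poly (map_poly complex_of_real (min_poly \<rat> x)) z = 0"
   by (simp add: conjugates_def)
  show "\<forall>c. ev c x = 0 --> ev c z = 0"
  proof (intro allI impI)
   fix c assume "ev c x = 0"
   then obtain a where "map_poly of_rat c = min_poly \<rat> x * a" "subring_of_field.poly_over \<rat> a"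
    using Rats.min_poly_dvd_over[OF assms, of "map_poly of_rat c"] poly_over_Rats_iff
    by (metis ev_def)
   moreover from this obtain a' where "a = map_poly of_rat a'"
    using poly_over_Rats_iff by blast
   ultimately have "map_poly real_of_rat c = map_poly of_rat (m * a')"
    using m' by (intro poly_eqI) (simp add: coeff_mult coeff_map_poly of_rat_sum of_rat_mult)
   then have "coeff (map_poly real_of_rat c) i = coeff (map_poly of_rat (m * a')) i" for i
    by simp
   then have "c = m * a'"
    by (intro poly_eqI) (simp add: coeff_map_poly)
   moreover have "ev m z = 0"
    using z by (simp add: m' C ev_def)
   ultimately show "ev c z = 0" by simp
  qed
 }
 {
  assume "\<forall>c. ev c x = 0 --> ev c z = 0"
  moreover have "ev m x = 0" using m(3) by (simp add: m' ev_def)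
  ultimately show "z \<in> conjugates x" by (simp add: conjugates_def m' C ev_def[symmetric])
 }
qed

lemma vanishing_rat_poly:
 fixes x :: "'a::field_char_0"
 assumes "c ~= 0" "ev c x = 0"
 obtains m where "m ~= 0" "ev m x = 0" "!!c. ev c x = 0 ==> m dvd c" "degree m > 0"
proof -
 obtain m where m: "m ~= 0" "ev m x = 0" and min: "!!c. c ~= 0 \<and> ev c x = 0 ==> degree m \<le> degree c"
  using assms ex_has_least_nat[of "\<lambda>c. c ~= 0 \<and> ev c x = 0" c degree] by blast
 have dvd: "m dvd c" if "ev c x = 0" for c
 proof -
  have "ev (c mod m) x = ev (c - m * (c div m)) x" by (simp add: minus_mult_div_eq_mod)
  then have "ev (c mod m) x = 0" using that m by simp
  then have "c mod m = 0"
   using min[of "c mod m"] degree_mod_less[OF m(1), of c] by fastforce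
  then show ?thesis by auto
 qed
 have "degree m > 0"
 proof (rule ccontr)
  assume "\<not> ?thesis"
  then obtain a where "m = [:a:]" by (metis degree_eq_zeroE gr_zeroI)
  with m show False by auto
 qed
 then show ?thesis using that m dvd by blast
qed

text \<open>Let d generate the relations of a multiple root z, so that d divides both m and its
  derivative. If d(x) = 0, then m divides its own derivative, which is nonzero of smaller degree;
  otherwise m divides the cofactor of d in m, again of smaller degree.\<close>

lemma minimal_rat_poly:
 fixes x :: real
 assumes "algebraic_over \<rat> x"
 obtains m where "m ~= 0" "ev m x = 0" "!!c. ev c x = 0 ==> m dvd c"
  "!!z :: complex. ev m z = 0 ==> ev (pderiv m) z ~= 0"
proof -
 obtain m where m: "m ~= 0" "ev m x = 0" "degree m > 0" and dvd: "!!c. ev c x = 0 ==> m dvd c"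
  using assms vanishing_rat_poly unfolding algebraic_over_Rats_iff by metis
 have m'0: "pderiv m ~= 0" using m by (simp add: pderiv_eq_0_iff)
 have m'x: "ev (pderiv m) x ~= 0"
  using dvd[of "pderiv m"] m'0 \<open>degree m > 0\<close> dvd_imp_degree_le[of m "pderiv m"]
  by (auto simp: degree_pderiv)
 have simple: "ev (pderiv m) z ~= 0" if z: "ev m z = 0" for z :: complex
 proof
  assume z': "ev (pderiv m) z = 0"
  obtain d where d: "d ~= 0" "ev d z = 0" "!!c. ev c z = 0 ==> d dvd c" "degree d > 0"
   using vanishing_rat_poly[OF m(1) z] by metis
  obtain h where h: "m = d * h" using d(3)[OF z] by (auto elim: dvdE)
  have "ev d x ~= 0"
  proof
   assume "ev d x = 0"
   then have "m dvd pderiv m" using dvd d(3)[OF z'] dvd_trans by blast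
   then show False using m'x m by (auto elim!: dvdE)
  qed
  then have "m dvd h" using m(2) dvd h by simp
  moreover have "h ~= 0" using h m by auto
  ultimately have "degree m \<le> degree h" by (rule dvd_imp_degree_le)
  moreover have "degree m = degree d + degree h"
   unfolding h using d(1) \<open>h ~= 0\<close> by (rule degree_mult_eq)
  ultimately show False using d(4) by simp
 qed
 show ?thesis
  by (rule that[OF m(1,2) dvd simple])
qed

lemma finite_ev_roots: "c ~= 0 ==> finite {z :: 'a::field_char_0. ev c z = 0}"
 unfolding ev_def by (rule poly_roots_finite) (simp add: map_poly_of_rat_eq_0)

lemma field_adjoin_Rats:
 assumes "algebraic_over \<rat> x"
 shows "field_adjoin \<rat> x = range (\<lambda>c. ev c x)"
 unfolding Rats.field_adjoin_eq[OF assms] poly_over_Rats_iff ev_def by auto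

context real_subfield
begin

lemma Rats_mem: "of_rat q \<in> K"
 by (cases q) (auto simp: of_rat_rat intro: divide_mem ring_mems)

lemma ev_mem: "x \<in> K ==> ev c x \<in> K"
 by (induction c) (auto intro: ring_mems Rats_mem)

lemma poly_over_map_of_rat: "poly_over (map_poly of_rat c)"
 by (auto simp: poly_over_def coeff_map_poly intro: Rats_mem)

text \<open>
 If \<open>b\<close> is the only common complex root of two polynomials over a field, then its minimal
 polynomial has no other root, hence is linear.
\<close>

lemma unique_common_root_mem:
 assumes g: "g ~= 0" "ev g b = 0" and simple: "ev (pderiv g) (complex_of_real b) ~= 0"
  and h: "poly_over h" "poly h b = 0"
  and uniq: "!!z :: complex. ev g z = 0 ==> poly (map_poly of_real h) z = 0 ==> z = of_real b"
 shows "b \<in> K"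
proof -
 interpret oh: map_poly_comm_ring_hom "of_real :: real => complex" ..
 have "map_poly real_of_rat g ~= 0"
  using g(1) by (simp add: map_poly_of_rat_eq_0)
 then have alg: "algebraic_over K b"
  unfolding algebraic_over_def using g(2) poly_over_map_of_rat[of g]
  by (intro exI[of _ "map_poly of_rat g"]) (auto simp: ev_def)
 define \<pi> where "\<pi> = min_poly K b"
 note p = min_poly_props[OF alg, folded \<pi>_def]
 obtain a1 where a1: "map_poly of_rat g = \<pi> * a1"
  using min_poly_dvd_over[OF alg poly_over_map_of_rat[of g]] g(2) by (auto simp: \<pi>_def ev_def)
 obtain a2 where a2: "h = \<pi> * a2"
  using min_poly_dvd_over[OF alg h] by (auto simp: \<pi>_def)
 define \<pi>C where "\<pi>C = map_poly complex_of_real \<pi>"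
 have C: "map_poly complex_of_real (map_poly of_rat g) = map_poly of_rat g"
  by (rule poly_eqI) (simp add: coeff_map_poly)
 have gC: "map_poly of_rat g = \<pi>C * map_poly of_real a1"
  by (metis C \<pi>C_def a1 oh.hom_mult)
 have hC: "map_poly of_real h = \<pi>C * map_poly of_real a2"
  by (metis \<pi>C_def a2 oh.hom_mult)
 have root: "z = of_real b" if "poly \<pi>C z = 0" for z
  using that by (intro uniq) (simp_all add: ev_def gC hC)
 have "poly \<pi>C (of_real b) = 0"
  unfolding \<pi>C_def by (simp add: p(3))
 then obtain \<rho> where rho: "\<pi>C = [:- of_real b, 1:] * \<rho>"
  by (meson poly_eq_0_iff_dvd dvdE)
 \<comment> \<open>A further root of the minimal polynomial is again a common root, hence b itself;
   then b is a double root of g, against simplicity.\<close>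
 have "degree \<rho> = 0"
 proof (rule ccontr)
  assume "degree \<rho> ~= 0"
  then obtain z where z: "poly \<rho> z = 0"
   using fundamental_theorem_of_algebra[of \<rho>] constant_degree[of \<rho>] by auto
  then have "z = of_real b" using root rho by simp
  with z obtain \<rho>' where "\<rho> = [:- of_real b, 1:] * \<rho>'"
   by (meson poly_eq_0_iff_dvd dvdE)
  then have "map_poly of_rat g = [:- of_real b, 1:] * ([:- of_real b, 1:] * (\<rho>' * map_poly of_real a1))"
   unfolding gC rho by (simp only: mult.assoc)
  then have "poly (pderiv (map_poly of_rat g)) (complex_of_real b) = 0"
   by (simp add: pderiv_mult del: mult_pCons_left)
  then show False
   using simple by (simp add: ev_def of_rat_hom.map_poly_pderiv)
 qed
 then obtain r where "\<rho> = [:r:]" by (rule degree_eq_zeroE)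
 moreover have "\<rho> ~= 0"
  using rho p(2) by (auto simp: \<pi>C_def)
 ultimately have "degree \<pi>C = 1" using rho by simp
 then have "degree \<pi> = 1" by (simp add: \<pi>C_def)
 with p(2) have "\<pi> = [:coeff \<pi> 0, 1:]"
  by (intro poly_eqI) (auto simp: coeff_pCons coeff_eq_0 split: nat.splits)
 then have "poly \<pi> b = coeff \<pi> 0 + b"
  by (metis add.commute mult.right_neutral mult_zero_right poly_pCons poly_0 add_0_right mult.commute)
 then have "b = - coeff \<pi> 0" using p(3) by simp
 then show ?thesis using p(1) by (metis poly_over_coeff uminus_mem)
qed

end

text \<open>The classical choice: c avoids the finitely many quotients (x' - x)/(y - y') formed from
  roots x' of f and y' of g. For such c the polynomials g(X) and f(x + c y - c X) have only the root
  y in common.\<close>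

lemma primitive_element:
 fixes x y :: real
 assumes x: "algebraic_over \<rat> x" and y: "algebraic_over \<rat> y"
  and alg: "!!c :: nat. algebraic_over \<rat> (x + of_nat c * y)"
 obtains c :: nat where "x \<in> field_adjoin \<rat> (x + of_nat c * y)" "y \<in> field_adjoin \<rat> (x + of_nat c * y)"
proof -
 obtain f where f: "f ~= 0" "ev f x = 0"
  using x algebraic_over_Rats_iff by blast
 obtain g where g: "g ~= 0" "ev g y = 0" "!!z :: complex. ev g z = 0 ==> ev (pderiv g) z ~= 0"
  using minimal_rat_poly[OF y] by metis
 define B where "B = (\<lambda>(x',y'). (x' - of_real x) / (of_real y - y')) `
   ({z :: complex. ev f z = 0} \<times> {z. ev g z = 0})"
 have "finite B"
  unfolding B_def by (intro finite_imageI finite_cartesian_product finite_ev_roots f g)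
 then have "finite ((of_nat :: nat => complex) -` B)"
  by (rule finite_vimageI) (simp add: inj_def)
 then obtain c :: nat where c: "of_nat c \<notin> B"
  by (metis ex_new_if_finite infinite_UNIV_nat vimageI)
 define t where "t = x + of_nat c * y"
 have "subfield_of_field (field_adjoin \<rat> t)"
  using Rats.field_adjoin_eq Rats.simple_extension_subfield alg t_def by simp
 then interpret F: real_subfield "field_adjoin \<rat> t" by (rule real_subfieldI)
 have t: "t \<in> field_adjoin \<rat> t"
  unfolding field_adjoin_def by (rule generate_field.incl) simp
 define h where "h = pcompose (map_poly of_rat f) [:t, - of_nat c:]"
 have yF: "y \<in> field_adjoin \<rat> t"
 proof (rule F.unique_common_root_mem[OF g(1,2), of h])
  show "ev (pderiv g) (complex_of_real y) ~= 0"
   using g by (intro g(3)) (simp add: ev_of_real)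
  show "F.poly_over h"
   unfolding h_def by (intro F.poly_over_pcompose F.poly_over_map_of_rat F.poly_over_pCons
     F.poly_over_0 t F.ring_mems)
  show "poly h y = 0"
   using f by (simp add: h_def poly_pcompose t_def ev_def algebra_simps)
  fix z :: complex assume z: "ev g z = 0" "poly (map_poly of_real h) z = 0"
  have "map_poly complex_of_real (map_poly of_rat f) = map_poly of_rat f"
   by (rule poly_eqI) (simp add: coeff_map_poly)
  then have "map_poly complex_of_real h = pcompose (map_poly of_rat f) [:of_real t, - of_nat c:]"
   unfolding h_def by (simp add: of_real_hom.map_poly_pcompose of_real_hom.map_poly_pCons_hom)
  with z have fz: "ev f (of_real t - of_nat c * z) = 0"
   by (simp add: poly_pcompose ev_def algebra_simps)
  show "z = of_real y"
  proof (rule ccontr)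
   assume "z ~= of_real y"
   then have "of_nat c = ((of_real t - of_nat c * z) - of_real x) / (of_real y - z)"
    by (simp add: field_simps t_def)
   then have "of_nat c \<in> B"
    unfolding B_def using fz z by force
   then show False using c by simp
  qed
 qed
 have "x = t - of_nat c * y" by (simp add: t_def)
 then have "x \<in> field_adjoin \<rat> t"
  using yF t F.ring_mems by metis
 with yF show ?thesis using that t_def by blast
qed

section \<open>Algebraic integers\<close>

text \<open>
 A number that multiplies a finite family into its integral span is an eigenvalue of an
 integer matrix.
\<close>

lemma algebraic_int_eigenvalue:
 fixes z :: "'a::field_char_0" and v :: "nat => 'a"
 assumes "i < k" "v i ~= 0" and eq: "!!i. i < k ==> z * v i = (\<Sum>j<k. of_int (A i j) * v j)"
 shows "algebraic_int z"
proof -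
 define B where "B = mat k k (\<lambda>(i, j). A i j)"
 have B: "B \<in> Mat k" by (simp add: B_def)
 define w where "w = vec k v"
 have "eigenvector (map_mat of_int B) w z"
  unfolding eigenvector_def
 proof (intro conjI)
  show "w ~= 0\<^sub>v (dim_row (map_mat of_int B))"
   using assms(1,2) by (metis B_def w_def dim_row_mat(1) index_map_mat(2) index_vec index_zero_vec(1))
  show "map_mat of_int B *\<^sub>v w = z \<cdot>\<^sub>v w"
   by (rule eq_vecI) (auto simp: w_def B_def scalar_prod_def eq atLeast0LessThan)
 qed (auto simp: w_def B_def)
 then have "eigenvalue (map_mat of_int B) z"
  by (auto simp: eigenvalue_def)
 then have "poly (char_poly (map_mat of_int B)) z = 0"
  using eigenvalue_root_char_poly[of "map_mat of_int B" k z] B by simp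
 then have "poly (map_poly of_int (char_poly B)) z = 0"
  by (simp add: of_int_hom.char_poly_hom[OF B])
 moreover have "lead_coeff (char_poly B) = 1"
  using degree_monic_char_poly[OF B] by simp
 ultimately show ?thesis
  unfolding algebraic_int_altdef_ipoly by blast
qed

definition int_span :: "'i set => ('i => 'a::field_char_0) => 'a set" where
 "int_span I v = {\<Sum>i\<in>I. of_int (c i) * v i | c. True}"

lemma int_span_add: "x \<in> int_span I v ==> y \<in> int_span I v ==> x + y \<in> int_span I v"
 unfolding int_span_def
 by (auto simp: sum.distrib[symmetric] distrib_right[symmetric] of_int_add[symmetric] simp del: of_int_add)

lemma int_span_smult: "x \<in> int_span I v ==> of_int n * x \<in> int_span I v"
proof -
 assume "x \<in> int_span I v"
 then obtain c where "x = (\<Sum>i\<in>I. of_int (c i) * v i)" by (auto simp: int_span_def)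
 then have "of_int n * x = (\<Sum>i\<in>I. of_int (n * c i) * v i)"
  by (simp add: sum_distrib_left mult.assoc)
 then show ?thesis unfolding int_span_def by (auto intro!: exI[of _ "\<lambda>i. n * c i"])
qed

lemma int_span_0: "0 \<in> int_span I v"
 unfolding int_span_def by (auto intro!: exI[of _ "\<lambda>_. 0"])

lemma int_span_sum: "(!!j. j \<in> J ==> f j \<in> int_span I v) ==> sum f J \<in> int_span I v"
 by (induction J rule: infinite_finite_induct) (auto intro: int_span_0 int_span_add)

lemma int_span_base:
 assumes "finite I" "i \<in> I"
 shows "v i \<in> int_span I v"
 unfolding int_span_def
proof (intro CollectI exI conjI)
 show "v i = (\<Sum>j\<in>I. of_int (if j = i then 1 else 0) * v j)"
  using assms by (simp add: if_distrib[of of_int] if_distrib[of "\<lambda>x. x * _"] sum.delta cong: if_cong)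
qed simp

lemma int_span_mult_into:
 assumes "!!i. i \<in> I ==> z * v i \<in> int_span J w" "x \<in> int_span I v"
 shows "z * x \<in> int_span J w"
proof -
 obtain c where "x = (\<Sum>i\<in>I. of_int (c i) * v i)" using assms(2) by (auto simp: int_span_def)
 then have "z * x = (\<Sum>i\<in>I. of_int (c i) * (z * v i))"
  by (simp add: sum_distrib_left algebra_simps)
 then show ?thesis using assms(1) by (auto intro!: int_span_sum int_span_smult)
qed

lemma algebraic_int_int_span:
 assumes "finite I" "b \<in> I" "v b ~= 0" and "!!i. i \<in> I ==> z * v i \<in> int_span I v"
 shows "algebraic_int z"
proof -
 obtain h where h: "bij_betw h {..<card I} I"
  using ex_bij_betw_nat_finite[OF assms(1)] by (auto simp: atLeast0LessThan)
 have "\<exists>c. z * v i = (\<Sum>j\<in>I. of_int (c j) * v j)" if "i \<in> I" for i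
  using assms(4)[OF that] by (auto simp: int_span_def)
 then obtain c where c: "!!i. i \<in> I ==> z * v i = (\<Sum>j\<in>I. of_int (c i j) * v j)"
  by metis
 obtain k0 where k0: "k0 < card I" "h k0 = b"
  using h assms(2) by (metis bij_betw_imp_surj_on imageE lessThan_iff)
 show ?thesis
 proof (rule algebraic_int_eigenvalue[of k0 "card I" "v \<circ> h" z "\<lambda>i j. c (h i) (h j)"])
  fix i assume "i < card I"
  then have "h i \<in> I" using h by (auto simp: bij_betw_def)
  then show "z * (v \<circ> h) i = (\<Sum>j<card I. of_int (c (h i) (h j)) * (v \<circ> h) j)"
   using c sum.reindex_bij_betw[OF h, of "\<lambda>j. of_int (c (h i) j) * v j"] by simp
 qed (use k0 assms in auto)
qed

lemma algebraic_int_power_reduce: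
 fixes x :: "'a::field_char_0"
 assumes "algebraic_int x"
 obtains a c where "a > 0" "x ^ a = (\<Sum>k<a. of_int (c k) * x ^ k)"
proof -
 obtain p where p: "poly (map_poly of_int p) x = 0" "lead_coeff p = 1"
  using assms algebraic_int_altdef_ipoly by blast
 define a where "a = degree p"
 have "0 = (\<Sum>k\<le>a. of_int (coeff p k) * x ^ k)"
  using p(1) by (simp add: poly_altdef a_def)
 also have "\<dots> = x ^ a + (\<Sum>k<a. of_int (coeff p k) * x ^ k)"
  using p(2) by (simp add: a_def lessThan_Suc_atMost[symmetric])
 finally have "x ^ a = (\<Sum>k<a. of_int (- coeff p k) * x ^ k)"
  by (simp add: sum_negf eq_neg_iff_add_eq_0)
 moreover have "a > 0"
 proof (rule ccontr)
  assume "\<not> a > 0"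
  then obtain b where "p = [:b:]" by (metis a_def degree_eq_zeroE gr_zeroI)
  with p show False by simp
 qed
 ultimately show ?thesis by (intro that[of a "\<lambda>k. - coeff p k"])
qed

text \<open>Adjoining an integral element a of degree d multiplies the generators by 1, a, ...,
  a^(d-1), and the equation for a^d brings products back into the span. A module shared by several
  integers is what closure under sum and product, and later integrality of eigenvalues, rest
  on.\<close>

lemma algebraic_int_module:
 fixes S :: "'a::field_char_0 set"
 assumes "finite S" "!!s. s \<in> S ==> algebraic_int s"
 shows "\<exists>U. finite U \<and> 1 \<in> U \<and> (\<forall>s\<in>S. \<forall>u\<in>U. s * u \<in> int_span U (\<lambda>x. x))"
 using assms
proof (induction S rule: finite_induct)
 case empty
 show ?case by (intro exI[of _ "{1}"]) auto
next
 case (insert a S)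
 then obtain U where U: "finite U" "1 \<in> U" "\<forall>s\<in>S. \<forall>u\<in>U. s * u \<in> int_span U (\<lambda>x. x)" by auto
 obtain d c where d: "d > 0" "a ^ d = (\<Sum>k<d. of_int (c k) * a ^ k)"
  using algebraic_int_power_reduce[of a] insert.prems by blast
 define W where "W = (\<lambda>(u, k). u * a ^ k) ` (U \<times> {..<d})"
 have W: "finite W" using U(1) by (simp add: W_def)
 have WI: "u * a ^ k \<in> int_span W (\<lambda>x. x)" if "u \<in> U" "k < d" for u k
  using int_span_base[OF W, of "u * a ^ k" "\<lambda>x. x"] that by (force simp: W_def)
 have "s * w \<in> int_span W (\<lambda>x. x)" if s: "s \<in> insert a S" and w: "w \<in> W" for s w
 proof -
  obtain u k where uk: "u \<in> U" "k < d" "w = u * a ^ k" using w by (auto simp: W_def)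
  show ?thesis
  proof (cases "s \<in> S")
   case True
   have "a ^ k * (s * u) \<in> int_span W (\<lambda>x. x)"
   proof (rule int_span_mult_into[where I = U and v = "\<lambda>x. x"])
    show "s * u \<in> int_span U (\<lambda>x. x)" using U(3) True uk by blast
    show "a ^ k * i \<in> int_span W (\<lambda>x. x)" if "i \<in> U" for i
     using WI[OF that uk(2)] by (simp add: mult.commute)
   qed
   then show ?thesis by (simp add: uk algebra_simps)
  next
   case False
   then have "s = a" using s by simp
   show ?thesis
   proof (cases "Suc k < d")
    case True
    then show ?thesis using WI[OF uk(1) True] \<open>s = a\<close> by (simp add: uk algebra_simps)
   next
    case False
    then have "Suc k = d" using uk(2) by simp
    then have "s * w = u * a ^ d"
     using uk(3) \<open>s = a\<close> by (simp flip: \<open>Suc k = d\<close>)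
    also have "\<dots> = (\<Sum>k<d. of_int (c k) * (u * a ^ k))"
     by (simp add: d(2) sum_distrib_left algebra_simps)
    finally show ?thesis using uk WI by (auto intro!: int_span_sum int_span_smult)
   qed
  qed
 qed
 moreover have "1 \<in> W" using U(2) d(1) by (force simp: W_def)
 ultimately show ?case using W by blast
qed

lemma algebraic_int_add_mult:
 fixes x y :: "'a::field_char_0"
 assumes "algebraic_int x" "algebraic_int y"
 shows "algebraic_int (x + y)" "algebraic_int (x * y)"
proof -
 obtain U where U: "finite U" "1 \<in> U" "\<forall>s\<in>{x, y}. \<forall>u\<in>U. s * u \<in> int_span U (\<lambda>x. x)"
  using algebraic_int_module[of "{x, y}"] assms by auto
 have xU: "x * u \<in> int_span U (\<lambda>x. x)" and yU: "y * u \<in> int_span U (\<lambda>x. x)" if "u \<in> U" for u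
  using U(3) that by simp_all
 note I = algebraic_int_int_span[where I = U and b = 1 and v = "\<lambda>x. x", OF U(1,2)]
 show "algebraic_int (x + y)"
  by (rule I) (simp_all add: distrib_right int_span_add xU yU)
 show "algebraic_int (x * y)"
 proof (rule I)
  fix u assume u: "u \<in> U"
  show "x * y * u \<in> int_span U (\<lambda>x. x)"
   unfolding mult.assoc
  proof (rule int_span_mult_into[where I = U and v = "\<lambda>x. x"])
   show "x * v \<in> int_span U (\<lambda>x. x)" if "v \<in> U" for v using that by (rule xU)
   show "y * u \<in> int_span U (\<lambda>x. x)" using u by (rule yU)
  qed
 qed simp
qed

lemma algebraic_int_subring: "subring_of_field {x :: 'a::field_char_0. algebraic_int x}"
 by unfold_locales (auto intro: algebraic_int_add_mult)

lemma algebraic_iff_ev: "algebraic x \<longleftrightarrow> (\<exists>c. c ~= 0 \<and> ev c x = 0)"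
 for x :: "'a::field_char_0"
proof
 assume "algebraic x"
 then obtain p where p: "p ~= 0" "poly (map_poly of_int p) x = 0" by (erule algebraicE')
 have "map_poly of_rat (map_poly of_int p) = (map_poly of_int p :: 'a poly)"
  by (rule poly_eqI) (simp add: coeff_map_poly)
 moreover have "map_poly rat_of_int p ~= 0"
  using p(1) by (simp add: poly_eq_iff coeff_map_poly)
 ultimately show "\<exists>c. c ~= 0 \<and> ev c x = 0"
  using p(2) unfolding ev_def by metis
next
 assume "\<exists>c. c ~= 0 \<and> ev c x = 0"
 then obtain c where "c ~= 0" "ev c x = 0" by blast
 then show "algebraic x"
  unfolding algebraic_altdef ev_def
  by (intro exI[of _ "map_poly of_rat c"]) (auto simp: map_poly_of_rat_eq_0 coeff_map_poly)
qed

text \<open>If l is the leading coefficient of an integer equation of degree n for x, multiplying it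
  by l^(n-1) gives a monic equation for y = l x; the modulus of l is the required
  multiplier.\<close>

lemma algebraic_int_nat_multiple:
 fixes x :: "'a::field_char_0"
 assumes "algebraic x"
 obtains d :: nat where "d > 0" "algebraic_int (of_nat d * x)"
proof -
 obtain p where p: "p ~= 0" "poly (map_poly of_int p) x = 0"
  using assms by (erule algebraicE')
 define n l y where "n = degree p" "l = lead_coeff p" "y = of_int l * x"
 have l: "l ~= 0" using p by (simp add: n_l_y_def)
 have "n > 0"
 proof (rule ccontr)
  assume "\<not> n > 0"
  then obtain b where "p = [:b:]" by (metis n_l_y_def(1) degree_eq_zeroE gr_zeroI)
  with p show False by simp
 qed
 have "0 = of_int l ^ (n - 1) * (\<Sum>k\<le>n. of_int (coeff p k) * x ^ k)"
  using p(2) by (simp add: poly_altdef n_l_y_def)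
 also have "\<dots> = (\<Sum>k<n. of_int l ^ (n - 1) * (of_int (coeff p k) * x ^ k)) + of_int l ^ (n - 1) * (of_int l * x ^ n)"
  by (simp add: lessThan_Suc_atMost[symmetric] distrib_left sum_distrib_left) (simp add: n_l_y_def)
 also have "of_int l ^ (n - 1) * (of_int l * x ^ n) = y ^ n"
  using \<open>n > 0\<close> by (cases n) (simp_all add: n_l_y_def(3) power_mult_distrib)
 also have "(\<Sum>k<n. of_int l ^ (n - 1) * (of_int (coeff p k) * x ^ k)) =
   (\<Sum>k<n. of_int (coeff p k * l ^ (n - 1 - k)) * y ^ k)"
 proof (rule sum.cong)
  fix k assume "k \<in> {..<n}"
  then have "n - 1 = (n - 1 - k) + k" by simp
  then have "(of_int l :: 'a) ^ (n - 1) = of_int l ^ (n - 1 - k) * of_int l ^ k"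
   by (metis power_add)
  then show "of_int l ^ (n - 1) * (of_int (coeff p k) * x ^ k) = of_int (coeff p k * l ^ (n - 1 - k)) * y ^ k"
   by (simp add: n_l_y_def(3) power_mult_distrib)
 qed simp
 finally have "y ^ n = (\<Sum>k<n. of_int (- (coeff p k * l ^ (n - 1 - k))) * y ^ k)"
  by (simp add: sum_negf eq_neg_iff_add_eq_0 add.commute)
 then have yn: "y ^ n \<in> int_span {..<n} (\<lambda>k. y ^ k)"
  unfolding int_span_def
  by (intro CollectI exI[of _ "\<lambda>k. - (coeff p k * l ^ (n - 1 - k))"]) simp
 have "algebraic_int y"
 proof (rule algebraic_int_int_span[of "{..<n}" 0 "\<lambda>k. y ^ k"])
  fix i assume "i \<in> {..<n}"
  then show "y * y ^ i \<in> int_span {..<n} (\<lambda>k. y ^ k)"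
   using yn int_span_base[of "{..<n}" "Suc i" "\<lambda>k. y ^ k"]
   by (cases "Suc i = n") auto
 qed (use \<open>n > 0\<close> in auto)
 then have "algebraic_int (- y)" by blast
 have "algebraic_int (of_nat (nat \<bar>l\<bar>) * x)"
  using \<open>algebraic_int y\<close> \<open>algebraic_int (- y)\<close> by (cases "l \<ge> 0") (simp_all add: n_l_y_def(3))
 then show ?thesis using that[of "nat \<bar>l\<bar>"] l by simp
qed

section \<open>Finiteness of residue rings\<close>

text \<open>Any r + 1 members are linearly dependent over the integers. Unlike the choice of a basis
  this passes at once to subsets, in particular from K to its ring of integers, whose residues can
  thus be counted without an integral basis.\<close>

definition rank_at_most :: "nat => real set => bool" where
 "rank_at_most r S \<longleftrightarrow> (\<forall>f :: nat => real. (\<forall>i\<le>r. f i \<in> S) -->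
  (\<exists>c :: nat => int. (\<exists>i\<le>r. c i ~= 0) \<and> (\<Sum>i\<le>r. of_int (c i) * f i) = 0))"

text \<open>S/pS is a vector space over the field with p elements, of dimension at most r. A maximal
  system that is independent modulo p therefore spans, and its combinations with coefficients 0,
  ..., p - 1 represent all residues.\<close>

lemma finite_residues_prime:
 assumes S: "subring_of_field S" and rank: "rank_at_most r S" and p: "prime (p :: nat)"
 shows "\<exists>F. finite F \<and> F \<subseteq> S \<and> (\<forall>x\<in>S. \<exists>y\<in>F. \<exists>z\<in>S. x = y + of_nat p * z)"
proof -
 interpret S: subring_of_field S by (rule S)
 define indep where "indep = (\<lambda>k (f :: nat => real). (\<forall>i<k. f i \<in> S) \<and>
  (\<forall>c :: nat => int. (\<exists>z\<in>S. (\<Sum>i<k. of_int (c i) * f i) = of_nat p * z) --> (\<forall>i<k. int p dvd c i)))"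
 have p1: "p > 1" using p prime_gt_1_nat by blast
 have bound: "k \<le> r" if k: "indep k f" for k f
 proof (rule ccontr)
  assume "\<not> k \<le> r"
  define rel where "rel = (\<lambda>c :: nat => int. (\<exists>i\<le>r. c i ~= 0) \<and> (\<Sum>i\<le>r. of_int (c i) * f i) = 0)"
  have "\<forall>i\<le>r. f i \<in> S" using k \<open>\<not> k \<le> r\<close> by (simp add: indep_def)
  then obtain c0 where "rel c0" using rank unfolding rank_at_most_def rel_def by blast
  \<comment> \<open>Among the relations take one of least total size: independence modulo p makes
    all its coefficients divisible by p, and dividing by p gives a smaller relation.\<close>
  then obtain c where c: "rel c"
   and min: "!!c'. rel c' ==> (\<Sum>i\<le>r. nat \<bar>c i\<bar>) \<le> (\<Sum>i\<le>r. nat \<bar>c' i\<bar>)"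
   using ex_has_least_nat[of rel c0 "\<lambda>c. \<Sum>i\<le>r. nat \<bar>c i\<bar>"] by blast
  define ce where "ce = (\<lambda>i. if i \<le> r then c i else 0)"
  have "(\<Sum>i<k. of_int (ce i) * f i) = (\<Sum>i\<le>r. of_int (c i) * f i)"
   using \<open>\<not> k \<le> r\<close> by (intro sum.mono_neutral_cong_right) (auto simp: ce_def)
  also have "\<dots> = of_nat p * 0" using c by (simp add: rel_def)
  finally have "\<forall>i<k. int p dvd ce i"
   using k S.zero_mem unfolding indep_def by blast
  then have dvd: "int p dvd c i" if "i \<le> r" for i
   using that \<open>\<not> k \<le> r\<close> by (auto simp: ce_def split: if_splits)
  define c' where "c' = (\<lambda>i. c i div int p)"
  have cc': "c i = int p * c' i" if "i \<le> r" for i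
   using dvd[OF that] by (simp add: c'_def)
  have "of_nat p * (\<Sum>i\<le>r. of_int (c' i) * f i) = (\<Sum>i\<le>r. of_int (c i) * f i)"
   unfolding sum_distrib_left by (rule sum.cong) (simp_all add: cc')
  then have "(\<Sum>i\<le>r. of_int (c' i) * f i) = 0"
   using c p1 by (auto simp: rel_def)
  moreover obtain i0 where i0: "i0 \<le> r" "c i0 ~= 0" using c by (auto simp: rel_def)
  moreover from this have c'i0: "c' i0 ~= 0" using cc' by auto
  ultimately have "rel c'" unfolding rel_def by blast
  moreover have "(\<Sum>i\<le>r. nat \<bar>c' i\<bar>) < (\<Sum>i\<le>r. nat \<bar>c i\<bar>)"
  proof (rule sum_strict_mono_ex1)
   show "\<forall>i\<in>{..r}. nat \<bar>c' i\<bar> \<le> nat \<bar>c i\<bar>"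
   proof
    fix i assume "i \<in> {..r}"
    then show "nat \<bar>c' i\<bar> \<le> nat \<bar>c i\<bar>"
     using mult_right_mono[of 1 "int p" "\<bar>c' i\<bar>"] p1 by (auto simp: cc' abs_mult intro!: nat_mono)
   qed
   show "\<exists>i\<in>{..r}. nat \<bar>c' i\<bar> < nat \<bar>c i\<bar>"
    using i0 c'i0 p1 by (auto simp: cc' abs_mult intro!: bexI[of _ i0])
  qed simp
  ultimately show False using min[of c'] by simp
 qed
 have "indep 0 (\<lambda>_. 0)" by (simp add: indep_def)
 then obtain k where k: "\<exists>f. indep k f" "!!k'. (\<exists>f. indep k' f) ==> k' \<le> k"
  using GreatestI_nat[of "\<lambda>k. \<exists>f. indep k f" 0 r] Greatest_le_nat[of "\<lambda>k. \<exists>f. indep k f" _ r] bound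
  by blast
 then obtain f where f: "indep k f" by blast
 define F where "F = (\<lambda>e. \<Sum>i<k. of_int (e i) * f i) ` ({..<k} \<rightarrow>\<^sub>E {0..<int p})"
 have "finite F" unfolding F_def by (intro finite_imageI finite_PiE) auto
 moreover have "F \<subseteq> S"
  using f unfolding F_def indep_def by (auto intro!: S.sum_mem S.mult_mem S.of_int_mem)
 moreover have "\<exists>y\<in>F. \<exists>z\<in>S. x = y + of_nat p * z" if x: "x \<in> S" for x
 proof -
  define g where "g = f(k := x)"
  have "\<not> indep (Suc k) g" using k(2)[of "Suc k"] by auto
  moreover have "\<forall>i<Suc k. g i \<in> S" using f x by (auto simp: g_def indep_def less_Suc_eq)
  ultimately obtain c z i where c: "z \<in> S" "(\<Sum>i<Suc k. of_int (c i) * g i) = of_nat p * z"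
   "i < Suc k" "\<not> int p dvd c i"
   unfolding indep_def by blast
  have cx: "(\<Sum>i<k. of_int (c i) * f i) + of_int (c k) * x = of_nat p * z"
   using c(2) by (simp add: g_def)
  have "\<not> int p dvd c k"
  proof
   assume "int p dvd c k"
   then obtain b where "c k = int p * b" by (auto elim: dvdE)
   with cx have "(\<Sum>i<k. of_int (c i) * f i) = of_nat p * (z - of_int b * x)"
    by (simp add: algebra_simps)
   moreover have "z - of_int b * x \<in> S" using c(1) x by (intro S.ring_mems)
   ultimately have "\<forall>i<k. int p dvd c i" using f unfolding indep_def by blast
   with \<open>int p dvd c k\<close> c(3,4) show False by (auto simp: less_Suc_eq)
  qed
  then have "coprime (c k) (int p)"
   using p by (simp add: prime_imp_coprime coprime_commute)
  then obtain u v where uv: "u * c k + v * int p = 1"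
   by (metis bezout_int coprime_imp_gcd_eq_1)
  define e where "e = (\<lambda>i. (- u * c i) mod int p)"
  define w where "w = (\<lambda>i. (- u * c i) div int p)"
  have ew: "- u * c i = int p * w i + e i" for i
   by (simp add: e_def w_def)
  \<comment> \<open>The relation determines only the multiple of x by c k; Bezout recovers x itself
    modulo p, and the remaining coefficients are then reduced modulo p.\<close>
  have "x = of_int (u * c k + v * int p) * x" by (simp add: uv)
  also have "\<dots> = of_int u * (of_int (c k) * x) + of_nat p * (of_int v * x)"
   by (simp add: algebra_simps)
  also have "of_int (c k) * x = of_nat p * z - (\<Sum>i<k. of_int (c i) * f i)"
   using cx by simp
  also have "of_int u * (of_nat p * z - (\<Sum>i<k. of_int (c i) * f i)) =
    of_nat p * (of_int u * z) + (\<Sum>i<k. of_int (- u * c i) * f i)"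
   by (simp add: algebra_simps sum_distrib_left sum_negf)
  also have "(\<Sum>i<k. of_int (- u * c i) * f i) =
    of_nat p * (\<Sum>i<k. of_int (w i) * f i) + (\<Sum>i<k. of_int (e i) * f i)"
   unfolding ew by (simp add: algebra_simps sum_distrib_left sum.distrib)
  finally have "x = (\<Sum>i<k. of_int (e i) * f i) +
    of_nat p * (of_int u * z + (\<Sum>i<k. of_int (w i) * f i) + of_int v * x)"
   by (simp add: algebra_simps)
  moreover have "(\<Sum>i<k. of_int (e i) * f i) \<in> F"
   unfolding F_def
  proof (rule image_eqI)
   show "restrict e {..<k} \<in> {..<k} \<rightarrow>\<^sub>E {0..<int p}"
    using p1 by (auto simp: e_def)
  qed simp
  moreover have "of_int u * z + (\<Sum>i<k. of_int (w i) * f i) + of_int v * x \<in> S"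
   using f c(1) x unfolding indep_def by (intro S.ring_mems S.sum_mem) auto
  ultimately show ?thesis by blast
 qed
 ultimately show ?thesis by blast
qed

lemma finite_residues:
 assumes S: "subring_of_field S" and rank: "rank_at_most r S" and "d > 0"
 shows "\<exists>F. finite F \<and> F \<subseteq> S \<and> (\<forall>x\<in>S. \<exists>y\<in>F. \<exists>z\<in>S. x = y + of_nat d * z)"
 using \<open>d > 0\<close>
proof (induction d rule: prime_divisors_induct)
 case (factor p d)
 interpret S: subring_of_field S by (rule S)
 from factor obtain F where F: "finite F" "F \<subseteq> S" "!!x. x \<in> S ==> \<exists>y\<in>F. \<exists>z\<in>S. x = y + of_nat d * z"
  by (metis mult_0_right gr0I)
 obtain G where G: "finite G" "G \<subseteq> S" "!!x. x \<in> S ==> \<exists>y\<in>G. \<exists>z\<in>S. x = y + of_nat p * z"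
  using finite_residues_prime[OF S rank factor(1)] by blast
 define H where "H = (\<lambda>(y, y'). y + of_nat d * y') ` (F \<times> G)"
 have "\<exists>y\<in>H. \<exists>z\<in>S. x = y + of_nat (p * d) * z" if x: "x \<in> S" for x
 proof -
  obtain y z where yz: "y \<in> F" "z \<in> S" "x = y + of_nat d * z" using F(3)[OF x] by blast
  obtain y' z' where yz': "y' \<in> G" "z' \<in> S" "z = y' + of_nat p * z'" using G(3)[OF yz(2)] by blast
  have "y + of_nat d * y' \<in> H" unfolding H_def using yz yz' by force
  moreover have "x = (y + of_nat d * y') + of_nat (p * d) * z'"
   using yz yz' by (simp add: algebra_simps)
  ultimately show ?thesis using yz' by blast
 qed
 moreover have "finite H" "H \<subseteq> S"
  using F G unfolding H_def by (auto intro!: S.ring_mems)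
 ultimately show ?case by blast
next
 case (unit d)
 interpret S: subring_of_field S by (rule S)
 have "d = 1" using unit by simp
 then show ?case by (intro exI[of _ "{0}"]) (auto intro: S.zero_mem)
qed simp

section \<open>Number fields\<close>

lemma combine_class_ring:
 "ring.combine class_ring Ks Us = (\<Sum>i<min (length Ks) (length Us). Ks ! i * Us ! i)" for Ks Us :: "real list"
proof (induction Ks arbitrary: Us)
 case Nil
 show ?case by (simp add: ring.combine.simps[OF class_ring.ring_axioms])
next
 case (Cons k Ks)
 show ?case
 proof (cases Us)
  case (Cons u Us')
  have "(\<Sum>i<Suc (min (length Ks) (length Us')). (k # Ks) ! i * (u # Us') ! i) =
    k * u + (\<Sum>i<min (length Ks) (length Us'). Ks ! i * Us' ! i)"
   by (subst sum.lessThan_Suc_shift) simp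
  then show ?thesis
   using Cons.IH[of Us'] by (simp add: ring.combine.simps[OF class_ring.ring_axioms] Cons)
 qed (simp add: ring.combine.simps[OF class_ring.ring_axioms])
qed

locale number_field = real_subfield +
 assumes finite_dim: "ring.finite_dimension class_ring \<rat> K"
begin

lemma finite_rank: "\<exists>r. rank_at_most r K"
proof -
 obtain r where r: "ring.dimension class_ring r \<rat> K"
  using finite_dim ring.finite_dimension_def[OF class_ring.ring_axioms] by blast
 have Q: "subfield \<rat> (class_ring :: real ring)"
  using subfield_Rats by (simp add: subfield_class_ring_iff)
 have "rank_at_most r K"
  unfolding rank_at_most_def
 proof (intro allI impI)
  fix f :: "nat => real" assume f: "\<forall>i\<le>r. f i \<in> K"
  define Us where "Us = map f [0..<Suc r]"
  have len: "length Us = Suc r" and Us: "set Us \<subseteq> K" using f by (auto simp: Us_def simp del: upt_Suc)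
  have "\<not> ring.independent class_ring \<rat> Us"
   using ring.independent_length_le_dimension[OF class_ring.ring_axioms Q r, of Us] len Us by auto
  then obtain Ks where Ks: "length Ks = length Us" "ring.combine class_ring Ks Us = 0" "set Ks \<subseteq> \<rat>" "set Ks ~= {0}"
   using ring.dependent_imp_non_trivial_combine[OF class_ring.ring_axioms Q, of Us] by auto
  obtain D :: nat where D: "D > 0" "!!k. k \<in> set Ks ==> of_nat D * k \<in> \<int>"
  proof -
   have "\<exists>D::nat. D > 0 \<and> of_nat D * k \<in> \<int>" if k: "k \<in> \<rat>" for k :: real
   proof -
    obtain a b where ab: "b > 0" "k = of_int a / of_int b"
     using k by (auto elim: Rats_cases')
    then have "of_nat (nat b) * k = of_int a" by simp
    then show ?thesis using ab by (intro exI[of _ "nat b"]) auto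
   qed
   then obtain E :: "real => nat" where E: "!!k. k \<in> \<rat> ==> E k > 0 \<and> of_nat (E k) * k \<in> \<int>" by metis
   define D where "D = prod E (set Ks)"
   have "of_nat D * k \<in> \<int>" if "k \<in> set Ks" for k
   proof -
    have "D = E k * prod E (set Ks - {k})" unfolding D_def using that by (intro prod.remove) auto
    then have "of_nat D * k = of_nat (prod E (set Ks - {k})) * (of_nat (E k) * k)" by simp
    then show ?thesis using E[of k] Ks(3) that by (metis Ints_mult Ints_of_nat subsetD)
   qed
   moreover have "D > 0" unfolding D_def using E Ks(3) by (intro prod_pos) blast
   ultimately show thesis using that by blast
  qed
  have "\<exists>n. real_of_int n = of_nat D * Ks ! i" if "i \<le> r" for i
   using D(2)[of "Ks ! i"] that Ks(1) len by (metis Ints_cases le_imp_less_Suc nth_mem)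
  then obtain c where c: "!!i. i \<le> r ==> real_of_int (c i) = of_nat D * Ks ! i" by metis
  have "Ks ~= []" using Ks(1) len by auto
  then obtain k where k: "k \<in> set Ks" "k ~= 0"
   using Ks(4) by (metis last_in_set singletonI subsetI subset_singleton_iff empty_iff)
  then obtain i where i: "i \<le> r" "Ks ! i = k"
   using Ks(1) len by (metis in_set_conv_nth less_Suc_eq_le)
  have "c i ~= 0" using c[OF i(1)] i(2) k D(1) by auto
  moreover have "(\<Sum>i\<le>r. of_int (c i) * f i) = of_nat D * (\<Sum>i\<le>r. Ks ! i * f i)"
   by (simp add: c sum_distrib_left mult.assoc)
  moreover have "(\<Sum>i\<le>r. Ks ! i * f i) = ring.combine class_ring Ks Us"
   unfolding combine_class_ring Ks(1) min.idem len lessThan_Suc_atMost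
   by (rule sum.cong) (auto simp: Us_def simp del: upt_Suc)
  ultimately show "\<exists>c. (\<exists>i\<le>r. c i ~= 0) \<and> (\<Sum>i\<le>r. of_int (c i) * f i) = 0"
   using i Ks(2) by (intro exI[of _ c]) auto
 qed
 then show ?thesis by blast
qed

lemma algebraic_mem:
 assumes x: "x \<in> K"
 shows "algebraic x" "algebraic_over \<rat> x"
proof -
 obtain r where "rank_at_most r K" using finite_rank by blast
 then obtain c where c: "\<exists>i\<le>r. c i ~= (0::int)" "(\<Sum>i\<le>r. of_int (c i) * x ^ i) = 0"
  using power_mem[OF x] unfolding rank_at_most_def by (elim allE[of _ "\<lambda>i. x ^ i"]) auto
 define p where "p = (\<Sum>i\<le>r. Polynomial.monom (of_int (c i)) i :: real poly)"
 have coeff: "coeff p i = (if i \<le> r then of_int (c i) else 0)" for i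
  by (simp add: p_def coeff_sum)
 show "algebraic x"
  unfolding algebraic_def
 proof (intro exI[of _ p] conjI)
  show "p ~= 0" using c(1) coeff by (metis coeff_0 of_int_eq_0_iff)
  show "poly p x = 0" using c(2) by (simp add: p_def poly_sum poly_monom)
 qed (simp add: coeff)
 then show "algebraic_over \<rat> x"
  by (simp add: algebraic_iff_ev algebraic_over_Rats_iff)
qed

lemma ring_of_integers_subring: "subring_of_field (\<O> K)"
proof -
 interpret A: subring_of_field "{x :: real. algebraic_int x}" by (rule algebraic_int_subring)
 show ?thesis
  by unfold_locales (use A.ring_mems ring_mems in \<open>auto simp: ring_of_integers_def\<close>)
qed

lemma finite_residues_integers:
 assumes "d > 0"
 obtains F where "finite F" "F \<subseteq> \<O> K"
  "!!x. x \<in> \<O> K ==> \<exists>y\<in>F. \<exists>z\<in>\<O> K. x = y + of_nat d * z"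
proof -
 obtain r where "rank_at_most r K" using finite_rank by blast
 then have "rank_at_most r (\<O> K)"
  by (auto simp: rank_at_most_def ring_of_integers_def)
 from finite_residues[OF ring_of_integers_subring this assms] that show ?thesis by blast
qed

lemma integral_multiple:
 assumes "x \<in> K"
 obtains d :: nat where "d > 0" "of_nat d * x \<in> \<O> K"
 using algebraic_int_nat_multiple[OF algebraic_mem(1)[OF assms]] assms
 by (metis (mono_tags, lifting) mem_Collect_eq mult_mem of_nat_mem ring_of_integers_def)

text \<open>The theorem on primitive elements is iterated along a finite \<rat>-basis of K, each
  step absorbing one more basis vector into a single generator.\<close>

lemma primitive:
 obtains \<theta> where "\<theta> \<in> K" "K = range (\<lambda>c. ev c \<theta>)"
proof -
 have ext: "\<exists>\<theta>\<in>K. set us \<subseteq> range (\<lambda>c. ev c \<theta>)" if "set us \<subseteq> K" for us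
  using that
 proof (induction us)
  case Nil
  then show ?case using zero_mem by auto
 next
  case (Cons u us)
  then obtain \<theta> where \<theta>: "\<theta> \<in> K" "set us \<subseteq> range (\<lambda>c. ev c \<theta>)" by auto
  have u: "u \<in> K" using Cons by simp
  obtain c :: nat where c: "\<theta> \<in> field_adjoin \<rat> (\<theta> + of_nat c * u)" "u \<in> field_adjoin \<rat> (\<theta> + of_nat c * u)"
   using primitive_element[of \<theta> u] algebraic_mem(2) \<theta>(1) u by (metis add_mem mult_mem of_nat_mem)
  define t where "t = \<theta> + of_nat c * u"
  have t: "t \<in> K" using \<theta> u by (auto simp: t_def intro: ring_mems)
  note fa = field_adjoin_Rats[OF algebraic_mem(2)[OF t]]
  obtain a b where ab: "\<theta> = ev a t" "u = ev b t" using c unfolding t_def[symmetric] fa by blast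
  have "range (\<lambda>c. ev c \<theta>) \<subseteq> range (\<lambda>c. ev c t)"
   unfolding ab(1) ev_pcompose[symmetric] by blast
  then show ?case using \<theta> ab t by (intro bexI[of _ t]) auto
 qed
 obtain r where r: "ring.dimension class_ring r \<rat> K"
  using finite_dim ring.finite_dimension_def[OF class_ring.ring_axioms] by blast
 have Q: "subfield \<rat> (class_ring :: real ring)"
  using subfield_Rats by (simp add: subfield_class_ring_iff)
 obtain Vs where Vs: "length Vs = r" "ring.Span class_ring \<rat> Vs = K" "ring.independent class_ring \<rat> Vs"
  using ring.exists_base[OF class_ring.ring_axioms Q r] by auto
 have "set Vs \<subseteq> K" using ring.Span_base_incl[OF class_ring.ring_axioms Q, of Vs] Vs by simp
 from ext[OF this] obtain \<theta> where \<theta>: "\<theta> \<in> K" "set Vs \<subseteq> range (\<lambda>c. ev c \<theta>)" by blast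
 interpret F: real_subfield "field_adjoin \<rat> \<theta>"
  using Rats.field_adjoin_eq Rats.simple_extension_subfield algebraic_mem(2)[OF \<theta>(1)]
  by (intro real_subfieldI) simp
 note fa = field_adjoin_Rats[OF algebraic_mem(2)[OF \<theta>(1)]]
 have "K \<subseteq> field_adjoin \<rat> \<theta>"
 proof
  fix x assume "x \<in> K"
  then obtain Ks where Ks: "set Ks \<subseteq> \<rat>" "length Ks = length Vs" "x = ring.combine class_ring Ks Vs"
   using ring.Span_mem_iff_length_version[OF class_ring.ring_axioms Q, of Vs x] Vs by auto
  have "Ks ! i \<in> field_adjoin \<rat> \<theta>" "Vs ! i \<in> field_adjoin \<rat> \<theta>" if "i < length Vs" for i
  proof -
   have "Ks ! i \<in> \<rat>" using that Ks by (metis nth_mem subsetD)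
   then obtain q where "Ks ! i = of_rat q" by (rule Rats_cases)
   then show "Ks ! i \<in> field_adjoin \<rat> \<theta>" by (simp add: F.Rats_mem)
   show "Vs ! i \<in> field_adjoin \<rat> \<theta>" using that \<theta>(2) fa nth_mem by blast
  qed
  then show "x \<in> field_adjoin \<rat> \<theta>"
   unfolding Ks(3) combine_class_ring Ks(2) min.idem by (auto intro!: F.sum_mem F.mult_mem)
 qed
 moreover have "range (\<lambda>c. ev c \<theta>) \<subseteq> K" using ev_mem[OF \<theta>(1)] by blast
 ultimately show ?thesis using that[OF \<theta>(1)] fa by blast
qed

end

lemma totally_real_number_field_imp: "totally_real_number_field K ==> number_field K"
 by (auto simp: totally_real_number_field_def subfield_class_ring_iff number_field_def
   number_field_axioms_def real_subfield_def)

section \<open>Linear algebra of the hyperboloid: geodesics, axes, eigenvalues and limits of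
  powers\<close>

section \<open>The hyperboloid model\<close>

lemma lorentz_comm: "lorentz n x y = lorentz n y x"
 by (simp add: lorentz_def mult.commute)

lemma lorentz_add_left:
 assumes "x \<in> Vec (n + 1)" "y \<in> Vec (n + 1)" "z \<in> Vec (n + 1)"
 shows "lorentz n (x + y) z = lorentz n x z + lorentz n y z"
proof -
 have "(\<Sum>i<n. (x + y) $ i * z $ i) = (\<Sum>i<n. x $ i * z $ i + y $ i * z $ i)"
  using assms by (intro sum.cong) (auto simp: algebra_simps)
 then show ?thesis
  using assms by (simp add: lorentz_def sum.distrib algebra_simps)
qed

lemma lorentz_smult_left:
 assumes "x \<in> Vec (n + 1)" "z \<in> Vec (n + 1)"
 shows "lorentz n (a \<cdot>\<^sub>v x) z = a * lorentz n x z"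
proof -
 have "(\<Sum>i<n. (a \<cdot>\<^sub>v x) $ i * z $ i) = (\<Sum>i<n. a * (x $ i * z $ i))"
  using assms by (intro sum.cong) (auto simp: algebra_simps)
 then show ?thesis
  using assms by (simp add: lorentz_def sum_distrib_left[symmetric] algebra_simps)
qed

lemma lorentz_add_right:
 assumes "x \<in> Vec (n + 1)" "y \<in> Vec (n + 1)" "z \<in> Vec (n + 1)"
 shows "lorentz n z (x + y) = lorentz n z x + lorentz n z y"
 using lorentz_add_left[OF assms] by (simp add: lorentz_comm)

lemma lorentz_smult_right:
 assumes "x \<in> Vec (n + 1)" "z \<in> Vec (n + 1)"
 shows "lorentz n z (a \<cdot>\<^sub>v x) = a * lorentz n z x"
 using lorentz_smult_left[OF assms] by (simp add: lorentz_comm)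

lemma lorentz_uminus_left:
 assumes "x \<in> Vec (n + 1)" "z \<in> Vec (n + 1)"
 shows "lorentz n (- x) z = - lorentz n x z"
 using assms by (simp add: lorentz_def sum_negf)

lemmas lorentz_simps = lorentz_add_left lorentz_add_right lorentz_smult_left lorentz_smult_right

lemma lorentz_form_eq: "lorentz_form n x = lorentz n x x"
 by (simp add: lorentz_form_def lorentz_def power2_eq_square)

lemma lorentz_zero_left: "lorentz n (0\<^sub>v (n + 1)) x = 0"
 by (simp add: lorentz_def)

lemma hyp_space_iff: "x \<in> hyp_space n \<longleftrightarrow> x \<in> Vec (n + 1) \<and> lorentz n x x = -1 \<and> x $ n > 0"
 by (auto simp: hyp_space_def lorentz_form_eq)

lemma lorentz_CS: "(lorentz n x y + x $ n * y $ n)\<^sup>2 \<le>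
  (lorentz n x x + (x $ n)\<^sup>2) * (lorentz n y y + (y $ n)\<^sup>2)"
 using Cauchy_Schwarz_ineq_sum[of "\<lambda>i. x $ i" "\<lambda>i. y $ i" "{..<n}"]
 by (simp add: lorentz_def power2_eq_square)

lemma lorentz_timelike_neg:
 assumes "lorentz n x x < 0" "lorentz n y y < 0" "x $ n > 0" "y $ n > 0"
 shows "lorentz n x y < 0"
proof -
 define s where "s = lorentz n x y + x $ n * y $ n"
 have nn: "0 \<le> lorentz n u u + (u $ n)\<^sup>2" for u
  by (simp add: lorentz_def power2_eq_square sum_nonneg)
 have "(lorentz n x x + (x $ n)\<^sup>2) * (lorentz n y y + (y $ n)\<^sup>2) < (x $ n)\<^sup>2 * (y $ n)\<^sup>2"
  using assms(1,2) nn[of x] nn[of y]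
  by (intro mult_strict_mono'[of "lorentz n x x + (x $ n)\<^sup>2" "(x $ n)\<^sup>2"
     "lorentz n y y + (y $ n)\<^sup>2" "(y $ n)\<^sup>2"]) linarith+
 then have "s\<^sup>2 < (x $ n * y $ n)\<^sup>2"
  using lorentz_CS[of n x y] by (simp add: s_def power_mult_distrib)
 then have "s < x $ n * y $ n"
  by (rule power2_less_imp_less) (use assms in simp)
 then show ?thesis by (simp add: s_def)
qed

text \<open>The reversed Cauchy-Schwarz inequality. It places the argument of \<open>arcosh\<close>
  in \<open>hyp_dist\<close> in the range where \<open>cosh\<close> inverts it.\<close>

lemma lorentz_hyp_space_le:
 assumes "x \<in> hyp_space n" "y \<in> hyp_space n"
 shows "lorentz n x y \<le> -1"
proof -
 define s a b where "s = lorentz n x y + x $ n * y $ n" "a = x $ n" "b = y $ n"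
 have pos: "a > 0" "b > 0" and xx: "lorentz n x x = -1" "lorentz n y y = -1"
  using assms by (auto simp: hyp_space_iff s_a_b_def)
 have nn: "0 \<le> lorentz n u u + (u $ n)\<^sup>2" for u
  by (simp add: lorentz_def power2_eq_square sum_nonneg)
 have "1 \<le> a\<^sup>2" "1 \<le> b\<^sup>2" using nn[of x] nn[of y] xx by (auto simp: s_a_b_def)
 then have ab: "1 \<le> a" "1 \<le> b"
  using pos power2_le_imp_le[of 1 a] power2_le_imp_le[of 1 b] by simp_all
 have "s\<^sup>2 \<le> (a\<^sup>2 - 1) * (b\<^sup>2 - 1)"
  using lorentz_CS[of n x y] xx by (simp add: s_a_b_def)
 also have "\<dots> = (a * b - 1)\<^sup>2 - (a - b)\<^sup>2" by (simp add: algebra_simps power2_eq_square)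
 also have "\<dots> \<le> (a * b - 1)\<^sup>2" by simp
 finally have "s \<le> a * b - 1"
  by (rule power2_le_imp_le) (use ab mult_mono[of 1 a 1 b] in simp)
 then show ?thesis by (simp add: s_a_b_def)
qed

text \<open>A quantitative form of the fact that the complement of a timelike vector is positive
  definite. The constant depends on a only, which later bounds a whole orbit of powers of an
  isometry inside the complement of its axis plane.\<close>

lemma lorentz_orthogonal_bound:
 assumes a: "a \<in> hyp_space n" and x: "x \<in> Vec (n + 1)" "lorentz n a x = 0" and "i \<le> n"
 shows "(x $ i)\<^sup>2 \<le> (a $ n)\<^sup>2 * lorentz n x x"
proof -
 define S where "S = (\<Sum>i<n. (x $ i)\<^sup>2)"
 define an xn where "an = a $ n" "xn = x $ n"
 have aa: "lorentz n a a = -1" and an: "an > 0" using a by (auto simp: hyp_space_iff an_xn_def)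
 have xx: "lorentz n x x = S - xn\<^sup>2" by (simp add: S_def an_xn_def lorentz_def power2_eq_square)
 have "(an * xn)\<^sup>2 \<le> (an\<^sup>2 - 1) * S"
  using lorentz_CS[of n a x] x(2) aa xx by (simp add: an_xn_def)
 then have 1: "an\<^sup>2 * xn\<^sup>2 \<le> an\<^sup>2 * S - S" by (simp add: algebra_simps power_mult_distrib)
 then have "S \<le> an\<^sup>2 * lorentz n x x" by (simp add: xx algebra_simps)
 moreover have "(x $ i)\<^sup>2 \<le> S"
 proof (cases "i < n")
  case True
  then show ?thesis unfolding S_def by (intro member_le_sum) auto
 next
  case False
  then have "x $ i = xn" using \<open>i \<le> n\<close> by (simp add: an_xn_def)
  have "S \<ge> 0" by (simp add: S_def sum_nonneg)
  then have "an\<^sup>2 * xn\<^sup>2 \<le> an\<^sup>2 * S" using 1 by simp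
  then show ?thesis using an \<open>x $ i = xn\<close> by simp
 qed
 ultimately show ?thesis by (simp add: an_xn_def)
qed

lemma lorentz_orthogonal_nonneg:
 assumes "a \<in> hyp_space n" "x \<in> Vec (n + 1)" "lorentz n a x = 0"
 shows "lorentz n x x \<ge> 0" and "lorentz n x x = 0 ==> x = 0\<^sub>v (n + 1)"
proof -
 have "(a $ n)\<^sup>2 > 0" using assms(1) by (simp add: hyp_space_iff)
 moreover have "0 \<le> (a $ n)\<^sup>2 * lorentz n x x"
  using lorentz_orthogonal_bound[OF assms, of n] by (meson order_refl order_trans zero_le_power2)
 ultimately show "lorentz n x x \<ge> 0" by (simp add: zero_le_mult_iff)
 show "x = 0\<^sub>v (n + 1)" if "lorentz n x x = 0"
  using lorentz_orthogonal_bound[OF assms] that assms(2) by (intro eq_vecI) auto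
qed

text \<open>\<open>v\<close> and \<open>w\<close> span the two isotropic lines of the plane of a geodesic.\<close>

definition null_frame :: "nat => real vec => real vec => bool" where
 "null_frame n v w \<longleftrightarrow> v \<in> Vec (n + 1) \<and> w \<in> Vec (n + 1) \<and>
  lorentz n v v = 0 \<and> lorentz n w w = 0 \<and> lorentz n v w = -1/2 \<and> v + w \<in> hyp_space n"

definition null_line :: "real vec => real vec => real => real vec" where
 "null_line v w t = exp t \<cdot>\<^sub>v v + exp (- t) \<cdot>\<^sub>v w"

lemma lorentz_null_line:
 assumes "null_frame n v w"
 shows "lorentz n (null_line v w s) (null_line v w t) = - cosh (s - t)"
proof -
 have "lorentz n (null_line v w s) (null_line v w t) = - (exp s * exp (- t) + exp (- s) * exp t) / 2"
  using assms unfolding null_frame_def null_line_def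
  by (simp add: lorentz_simps lorentz_comm[of n w v])
 then show ?thesis by (simp add: cosh_def exp_add[symmetric] add.commute field_simps)
qed

lemma hyp_dist_cosh: "x = - cosh d ==> arcosh (- x) = \<bar>d\<bar>" for x d :: real
 using arcosh_cosh_real[of "\<bar>d\<bar>"] by simp

lemma geodesic_line_null_line:
 assumes nf: "null_frame n v w"
 shows "geodesic_line n (null_line v w)"
proof -
 have v: "v \<in> Vec (n + 1)" "w \<in> Vec (n + 1)" and a: "v + w \<in> hyp_space n"
  using nf by (auto simp: null_frame_def)
 have "null_line v w t \<in> hyp_space n" for t
 proof -
  let ?x = "null_line v w t"
  have car: "?x \<in> Vec (n + 1)" using v by (simp add: null_line_def)
  have xx: "lorentz n ?x ?x = -1" using lorentz_null_line[OF nf, of t t] by simp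
  have "null_line v w 0 = v + w" by (simp add: null_line_def)
  then have xa: "lorentz n ?x (v + w) < 0"
   using lorentz_null_line[OF nf, of t 0] cosh_real_pos[of t] by simp
  have "?x $ n > 0"
  proof (rule ccontr)
   assume "\<not> ?x $ n > 0"
   moreover have "?x $ n ~= 0"
    using xx lorentz_orthogonal_nonneg sum_nonneg[of "{..<n}" "\<lambda>i. ?x $ i * ?x $ i"]
    by (auto simp: lorentz_def)
   ultimately have n1: "(- ?x) $ n > 0" using car by simp
   have n2: "lorentz n (- ?x) (- ?x) < 0"
    using xx car lorentz_uminus_left[of ?x n "- ?x"] lorentz_uminus_left[of ?x n ?x]
    by (simp add: lorentz_comm[of n ?x "- ?x"])
   have "lorentz n (- ?x) (v + w) < 0"
    using lorentz_timelike_neg[OF n2 _ n1] a by (simp add: hyp_space_iff)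
   then show False using xa car v by (simp add: lorentz_uminus_left)
  qed
  then show ?thesis using car xx by (simp add: hyp_space_iff)
 qed
 moreover have "hyp_dist n (null_line v w s) (null_line v w t) = \<bar>s - t\<bar>" for s t
  unfolding hyp_dist_def by (rule hyp_dist_cosh) (rule lorentz_null_line[OF nf])
 ultimately show ?thesis unfolding geodesic_line_def by blast
qed

text \<open>The points at times 0 and 1 yield a and b with candidate curve cosh t a + sinh t b. Its
  difference y from c t is orthogonal to a and isotropic, hence zero; v and w are the exponential
  components (a + b)/2 and (a - b)/2.\<close>

lemma geodesic_lineE:
 assumes "geodesic_line n c"
 obtains v w where "null_frame n v w" "c = null_line v w"
proof -
 have H: "c t \<in> hyp_space n" for t using assms by (auto simp: geodesic_line_def)
 then have car: "c t \<in> Vec (n + 1)" for t by (simp add: hyp_space_iff)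
 have L: "lorentz n (c s) (c t) = - cosh (s - t)" for s t
 proof -
  have "arcosh (- lorentz n (c s) (c t)) = \<bar>s - t\<bar>"
   using assms by (simp add: geodesic_line_def hyp_dist_def)
  moreover have "- lorentz n (c s) (c t) \<ge> 1" using lorentz_hyp_space_le[OF H H, of s t] by simp
  ultimately have "- lorentz n (c s) (c t) = cosh \<bar>s - t\<bar>" by (metis cosh_arcosh_real)
  then show ?thesis by simp
 qed
 define a where "a = c 0"
 define S C where "S = sinh (1::real)" "C = cosh (1::real)"
 define b where "b = (1 / S) \<cdot>\<^sub>v (c 1 + (- C) \<cdot>\<^sub>v a)"
 have S: "S ~= 0" by (simp add: S_C_def)
 have ab: "a \<in> Vec (n + 1)" "b \<in> Vec (n + 1)" using car by (auto simp: a_def b_def)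
 have aa: "lorentz n a a = -1" using L[of 0 0] by (simp add: a_def)
 have ca: "lorentz n (c t) a = - cosh t" for t using L[of t 0] by (simp add: a_def)
 have cb: "lorentz n (c t) b = sinh t" for t
 proof -
  have "lorentz n (c t) b = (1 / S) * (- cosh (t - 1) + C * cosh t)"
   unfolding b_def using car ab by (simp add: lorentz_simps L ca)
  also have "\<dots> = sinh t" using S by (simp add: cosh_diff S_C_def)
  finally show ?thesis .
 qed
 have ab0: "lorentz n a b = 0" using cb[of 0] by (simp add: a_def)
 have bb: "lorentz n b b = 1"
 proof -
  have "lorentz n b b = (1 / S) * (lorentz n (c 1) b + (- C) * lorentz n a b)"
   using car ab by (subst (1) b_def) (simp add: lorentz_simps)
  then show ?thesis using S by (simp add: cb ab0 S_C_def)
 qed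
 have eq: "c t = cosh t \<cdot>\<^sub>v a + sinh t \<cdot>\<^sub>v b" for t
 proof -
  define y where "y = c t + ((- cosh t) \<cdot>\<^sub>v a + (- sinh t) \<cdot>\<^sub>v b)"
  have y: "y \<in> Vec (n + 1)" using car ab by (simp add: y_def)
  have ay: "lorentz n a y = 0"
   unfolding y_def using car ab
   by (simp add: lorentz_simps aa ab0 lorentz_comm[of n a "c t"] ca)
  have "lorentz n y y = lorentz n (c t) y - sinh t * lorentz n b y"
   using car ab y ay by (subst (1) y_def) (simp add: lorentz_simps)
  also have "lorentz n (c t) y = - 1 + (cosh t)\<^sup>2 - (sinh t)\<^sup>2"
   unfolding y_def using car ab L[of t t] by (simp add: lorentz_simps ca cb power2_eq_square)
  also have "lorentz n b y = 0"
   unfolding y_def using car ab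
   by (simp add: lorentz_simps bb lorentz_comm[of n b a] ab0 lorentz_comm[of n b "c t"] cb)
  finally have "lorentz n y y = 0" by (simp add: cosh_square_eq)
  then have "y = 0\<^sub>v (n + 1)"
   using lorentz_orthogonal_nonneg(2)[OF _ y ay] H by (simp add: a_def)
  then have y0: "y $ i = 0" if "i < n + 1" for i using that by simp
  have "c t $ i = cosh t * a $ i + sinh t * b $ i" if "i < n + 1" for i
   using y0[OF that] car[of t] ab that by (simp add: y_def)
  then show ?thesis
   using car[of t] ab by (intro eq_vecI) simp_all
 qed
 define v w where "v = (1/2) \<cdot>\<^sub>v (a + b)" "w = (1/2) \<cdot>\<^sub>v (a + (-1) \<cdot>\<^sub>v b)"
 have vw: "v \<in> Vec (n + 1)" "w \<in> Vec (n + 1)" using ab by (auto simp: v_w_def)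
 have "v + w = a" using ab by (intro eq_vecI) (auto simp: v_w_def field_simps)
 then have "null_frame n v w"
  unfolding null_frame_def using vw H[of 0, folded a_def] ab
  by (simp add: v_w_def lorentz_simps aa bb ab0 lorentz_comm[of n b a])
 moreover have "c t = null_line v w t" for t
  unfolding eq[of t] null_line_def using ab
  by (intro eq_vecI) (auto simp: v_w_def cosh_def sinh_def field_simps)
 ultimately show ?thesis using that by blast
qed

text \<open>The identity g c(t) = c(t + d) is linear in e^t and e^(-t); its instances at t = 0 and t
  = 1 separate the two coefficients.\<close>

lemma translates_alongE:
 assumes g: "g \<in> Mat (n + 1)" and "translates_along n g L d"
 obtains v w where "null_frame n v w" "g *\<^sub>v v = exp d \<cdot>\<^sub>v v" "g *\<^sub>v w = exp (- d) \<cdot>\<^sub>v w"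
  "L = range (null_line v w)" "d > 0"
proof -
 obtain c where c: "d > 0" "geodesic_line n c" "L = range c" "!!t. g *\<^sub>v c t = c (t + d)"
  using assms(2) by (auto simp: translates_along_def)
 obtain v w where vw: "null_frame n v w" "c = null_line v w" using geodesic_lineE[OF c(2)] by blast
 have car: "v \<in> Vec (n + 1)" "w \<in> Vec (n + 1)" using vw by (auto simp: null_frame_def)
 have gcar: "g *\<^sub>v v \<in> Vec (n + 1)" "g *\<^sub>v w \<in> Vec (n + 1)"
  using car mult_mat_vec_carrier[OF g] by auto
 have eq: "exp t \<cdot>\<^sub>v (g *\<^sub>v v) + exp (- t) \<cdot>\<^sub>v (g *\<^sub>v w) =
   exp (t + d) \<cdot>\<^sub>v v + exp (- (t + d)) \<cdot>\<^sub>v w" for t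
  using c(4)[of t] car g unfolding vw(2) null_line_def
  by (simp add: mult_add_distrib_mat_vec[OF g] mult_mat_vec[OF g])
 then have comp: "exp t * (g *\<^sub>v v) $ i + exp (- t) * (g *\<^sub>v w) $ i =
   exp (t + d) * v $ i + exp (- (t + d)) * w $ i" if "i < n + 1" for t i
 proof -
  have "(exp t \<cdot>\<^sub>v (g *\<^sub>v v) + exp (- t) \<cdot>\<^sub>v (g *\<^sub>v w)) $ i =
    (exp (t + d) \<cdot>\<^sub>v v + exp (- (t + d)) \<cdot>\<^sub>v w) $ i"
   by (simp only: eq)
  then show ?thesis using that car g by simp
 qed
 have gv: "(g *\<^sub>v v) $ i = exp d * v $ i \<and> (g *\<^sub>v w) $ i = exp (- d) * w $ i" if i: "i < n + 1" for i
 proof -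
  define X Y V W e where "X = (g *\<^sub>v v) $ i" "Y = (g *\<^sub>v w) $ i" "V = exp d * v $ i"
   "W = exp (- d) * w $ i" "e = exp (1::real)"
  have e: "e > 1" by (simp add: X_Y_V_W_e_def)
  have 1: "X + Y = V + W" using comp[OF i, of 0] by (simp add: X_Y_V_W_e_def)
  have "e * X + inverse e * Y = e * V + inverse e * W"
   using comp[OF i, of 1] by (simp add: X_Y_V_W_e_def exp_add exp_diff exp_minus divide_inverse mult.assoc)
  then have "e * (e * X + inverse e * Y) = e * (e * V + inverse e * W)" by simp
  then have 2: "e * e * X + Y = e * e * V + W" using e by (simp add: algebra_simps)
  from 1 2 have "(e * e - 1) * (X - V) = 0" by (simp add: algebra_simps)
  moreover have "e * e > 1 * 1" using e by (intro mult_strict_mono) auto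
  ultimately have "X = V" by simp
  with 1 show ?thesis by (simp add: X_Y_V_W_e_def)
 qed
 show ?thesis
 proof (rule that[OF vw(1) _ _ _ c(1)])
  show "g *\<^sub>v v = exp d \<cdot>\<^sub>v v" "g *\<^sub>v w = exp (- d) \<cdot>\<^sub>v w"
   using gv car gcar g by (auto intro!: eq_vecI)
  show "L = range (null_line v w)" using c(3) vw(2) by simp
 qed
qed

lemma translates_alongI:
 assumes g: "g \<in> Mat (n + 1)" and nf: "null_frame n v w" and "d > 0"
  and gv: "g *\<^sub>v v = exp d \<cdot>\<^sub>v v" "g *\<^sub>v w = exp (- d) \<cdot>\<^sub>v w"
 shows "translates_along n g (range (null_line v w)) d"
 unfolding translates_along_def
proof (intro conjI exI[of _ "null_line v w"] geodesic_line_null_line[OF nf] allI)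
 have "v \<in> Vec (n + 1)" "w \<in> Vec (n + 1)" using nf by (auto simp: null_frame_def)
 then show "g *\<^sub>v null_line v w t = null_line v w (t + d)" for t
  unfolding null_line_def
  by (simp add: mult_add_distrib_mat_vec[OF g] mult_mat_vec[OF g] gv smult_smult_assoc exp_add[symmetric])
qed (use assms in auto)

text \<open>In signature (n, 1) orthogonal isotropic vectors are proportional: once s v is
  subtracted, what remains is isotropic and orthogonal to the timelike v + w. The factor -2 in s
  inverts the product -1/2 of v and w.\<close>

lemma null_vec_proportional:
 assumes nf: "null_frame n v w" and u: "u \<in> Vec (n + 1)" "lorentz n u u = 0" "lorentz n v u = 0"
 obtains s where "u = s \<cdot>\<^sub>v v"
proof -
 have car: "v \<in> Vec (n + 1)" "w \<in> Vec (n + 1)" and a: "v + w \<in> hyp_space n"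
  and vv: "lorentz n v v = 0" "lorentz n v w = -1/2"
  using nf by (auto simp: null_frame_def)
 define s where "s = - 2 * lorentz n w u"
 define x where "x = u + (- s) \<cdot>\<^sub>v v"
 have x: "x \<in> Vec (n + 1)" using u car by (simp add: x_def)
 have "lorentz n (v + w) x = 0"
  unfolding x_def using u car by (simp add: lorentz_simps vv lorentz_comm[of n w v] s_def)
 moreover have "lorentz n x x = 0"
  unfolding x_def using u car by (simp add: lorentz_simps vv lorentz_comm[of n u v])
 ultimately have "x = 0\<^sub>v (n + 1)" using lorentz_orthogonal_nonneg(2)[OF a x] by simp
 then have x0: "x $ i = 0" if "i < n + 1" for i using that by simp
 have "u $ i = s * v $ i" if "i < n + 1" for i using x0[OF that] that u car by (simp add: x_def)
 then have "u = s \<cdot>\<^sub>v v" using u car by (intro eq_vecI) simp_all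
 then show ?thesis by (rule that)
qed

lemma null_frame_swap: "null_frame n v w ==> null_frame n w v"
 unfolding null_frame_def by (auto simp: lorentz_comm comm_add_vec[of v "n + 1" w])

lemma O_plus_lorentz:
 assumes "g \<in> O_plus n" "x \<in> Vec (n + 1)" "y \<in> Vec (n + 1)"
 shows "lorentz n (g *\<^sub>v x) (g *\<^sub>v y) = lorentz n x y"
proof -
 have g: "g \<in> Mat (n + 1)" using assms by (simp add: O_plus_def)
 have car: "g *\<^sub>v x \<in> Vec (n + 1)" "g *\<^sub>v y \<in> Vec (n + 1)"
  using assms mult_mat_vec_carrier[OF g] by auto
 have q: "lorentz n (g *\<^sub>v u) (g *\<^sub>v u) = lorentz n u u" if "u \<in> Vec (n + 1)" for u
  using assms(1) that by (simp add: O_plus_def lorentz_form_eq)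
 have "lorentz n (g *\<^sub>v (x + y)) (g *\<^sub>v (x + y)) = lorentz n (x + y) (x + y)"
  using assms by (intro q) simp
 then show ?thesis
  using assms car q[OF assms(2)] q[OF assms(3)]
  by (simp add: mult_add_distrib_mat_vec[OF g] lorentz_simps lorentz_comm[of n y x]
    lorentz_comm[of n "g *\<^sub>v y" "g *\<^sub>v x"])
qed

text \<open>Invariance of the form gives <v, v'> = e^(d+d') <v, v'>, so this product vanishes and
  the expanding directions of the two axes agree; the contracting ones agree likewise. The factor s
  between v' and v only shifts the parameter by ln s.\<close>

lemma translates_along_unique:
 assumes g: "g \<in> O_plus n" and 1: "translates_along n g L d" and 2: "translates_along n g L' d'"
 shows "L = L' \<and> d = d'"
proof -
 have gc: "g \<in> Mat (n + 1)" using g by (simp add: O_plus_def)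
 obtain v w where vw: "null_frame n v w" "g *\<^sub>v v = exp d \<cdot>\<^sub>v v" "g *\<^sub>v w = exp (- d) \<cdot>\<^sub>v w"
  "L = range (null_line v w)" "d > 0"
  using translates_alongE[OF gc 1] by blast
 obtain v' w' where vw': "null_frame n v' w'" "g *\<^sub>v v' = exp d' \<cdot>\<^sub>v v'" "g *\<^sub>v w' = exp (- d') \<cdot>\<^sub>v w'"
  "L' = range (null_line v' w')" "d' > 0"
  using translates_alongE[OF gc 2] by blast
 have car: "v \<in> Vec (n + 1)" "w \<in> Vec (n + 1)"
  "v' \<in> Vec (n + 1)" "w' \<in> Vec (n + 1)"
  and nn: "lorentz n v' v' = 0" "lorentz n w' w' = 0" "lorentz n v w = -1/2" "lorentz n v' w' = -1/2"
  and a: "v + w \<in> hyp_space n" "v' + w' \<in> hyp_space n"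
  using vw vw' by (auto simp: null_frame_def)
 have "lorentz n v v' = lorentz n (g *\<^sub>v v) (g *\<^sub>v v')"
  using O_plus_lorentz[OF g car(1,3)] by simp
 also have "\<dots> = exp (d + d') * lorentz n v v'"
  using car by (simp add: vw vw' lorentz_simps exp_add)
 finally have "lorentz n v v' = exp (d + d') * lorentz n v v'" .
 moreover have "exp (d + d') ~= 1" using vw vw' by simp
 ultimately have "lorentz n v v' = 0" by (metis mult_cancel_right1)
 then obtain s where s: "v' = s \<cdot>\<^sub>v v" using null_vec_proportional[OF vw(1) car(3)] nn by blast
 have "lorentz n w w' = lorentz n (g *\<^sub>v w) (g *\<^sub>v w')"
  using O_plus_lorentz[OF g car(2,4)] by simp
 also have "\<dots> = exp (- d - d') * lorentz n w w'"
  using car exp_add[of "- d" "- d'"] by (simp add: vw vw' lorentz_simps)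
 finally have "lorentz n w w' = exp (- d - d') * lorentz n w w'" .
 moreover have "exp (- d - d') ~= 1" using vw vw' by simp
 ultimately have "lorentz n w w' = 0" by (metis mult_cancel_right1)
 then obtain r where r: "w' = r \<cdot>\<^sub>v w"
  using null_vec_proportional[OF null_frame_swap[OF vw(1)] car(4)] nn by blast
 have sr: "s * r = 1"
  using nn(3,4) car by (simp add: s r lorentz_simps mult.commute)
 have "s > 0"
 proof (rule ccontr)
  assume "\<not> s > 0"
  then have "s < 0" using sr by (metis linorder_neqE_linordered_idom mult_zero_left zero_neq_one)
  moreover from this sr have "r < 0" by (metis mult_less_0_iff not_one_less_zero linorder_neqE_linordered_idom mult_zero_right zero_neq_one zero_less_one)
  moreover have "lorentz n (v + w) (v' + w') = - (s + r) / 2"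
   using car vw(1) by (simp add: s r lorentz_simps null_frame_def lorentz_comm[of n w v])
  ultimately show False using lorentz_hyp_space_le[OF a] by simp
 qed
 have r': "r = inverse s" using sr \<open>s > 0\<close> by (simp add: field_simps)
 have shift: "null_line v' w' t = null_line v w (t + ln s)" for t
  using car \<open>s > 0\<close> unfolding null_line_def s r r'
  by (intro eq_vecI) (auto simp: exp_add exp_minus field_simps exp_diff)
 have "L' = L"
 proof
  show "L' \<subseteq> L" unfolding vw vw' shift by blast
  have "null_line v w t = null_line v' w' (t - ln s)" for t by (simp add: shift)
  then show "L \<subseteq> L'" unfolding vw(4) vw'(4) by blast
 qed
 moreover have "d = d'"
 proof -
  have "lorentz n (g *\<^sub>v v') w' = exp d' * lorentz n v' w'"
   using car by (simp add: vw' lorentz_simps)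
  moreover have "lorentz n (g *\<^sub>v v') w' = exp d * lorentz n v' w'"
   using car vw(2) mult_mat_vec[OF gc car(1), of s] by (simp add: s lorentz_simps)
  ultimately show ?thesis using nn by simp
 qed
 ultimately show ?thesis by simp
qed

lemma translation_length_eq:
 assumes "g \<in> O_plus n" "translates_along n g L d"
 shows "translation_length n g = d"
 unfolding translation_length_def
 using assms(2) translates_along_unique[OF assms(1)] by (intro the_equality) blast+

lemma hyperbolicI:
 assumes "g \<in> O_plus n" "translates_along n g L d"
 shows "hyperbolic n g"
 unfolding hyperbolic_def using assms translates_along_unique[OF assms(1)] by blast

lemma hyperbolicE:
 assumes "hyperbolic n g"
 obtains v w where "null_frame n v w" "g *\<^sub>v v = exp (translation_length n g) \<cdot>\<^sub>v v"
  "g *\<^sub>v w = exp (- translation_length n g) \<cdot>\<^sub>v w" "translation_length n g > 0" "g \<in> O_plus n"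
proof -
 have g: "g \<in> O_plus n" using assms by (simp add: hyperbolic_def)
 then have gc: "g \<in> Mat (n + 1)" by (simp add: O_plus_def)
 obtain L d where Ld: "translates_along n g L d" using assms by (auto simp: hyperbolic_def)
 show ?thesis
  using translates_alongE[OF gc Ld] translation_length_eq[OF g Ld] that g by metis
qed

section \<open>Bilinear forms and their isometries\<close>

definition bil :: "'a::field mat => 'a vec => 'a vec => 'a" where
 "bil A x y = x \<bullet> (A *\<^sub>v y)"

lemma quad_form_bil: "quad_form A x = bil A x x"
 by (simp add: quad_form_def bil_def)

lemma bil_sum:
 assumes "A \<in> Mat N" "x \<in> Vec N" "y \<in> Vec N"
 shows "bil A x y = (\<Sum>i<N. \<Sum>j<N. x $ i * A $$ (i, j) * y $ j)"
 using assms unfolding bil_def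
 by (auto simp: scalar_prod_def atLeast0LessThan sum_distrib_left mult.assoc intro!: sum.cong)

lemma bil_add_left:
 assumes "A \<in> Mat N" "x \<in> Vec N" "y \<in> Vec N" "z \<in> Vec N"
 shows "bil A (x + y) z = bil A x z + bil A y z"
 unfolding bil_def using assms by (intro add_scalar_prod_distrib[of _ N]) auto

lemma bil_add_right:
 assumes "A \<in> Mat N" "x \<in> Vec N" "y \<in> Vec N" "z \<in> Vec N"
 shows "bil A z (x + y) = bil A z x + bil A z y"
 unfolding bil_def using assms
 by (simp add: mult_add_distrib_mat_vec[of _ N N] scalar_prod_add_distrib[of _ N])

lemma bil_smult_left:
 assumes "A \<in> Mat N" "x \<in> Vec N" "y \<in> Vec N"
 shows "bil A (c \<cdot>\<^sub>v x) y = c * bil A x y"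
 unfolding bil_def using assms by (simp add: smult_scalar_prod_distrib[of _ N])

lemma bil_smult_right:
 assumes "A \<in> Mat N" "x \<in> Vec N" "y \<in> Vec N"
 shows "bil A x (c \<cdot>\<^sub>v y) = c * bil A x y"
 unfolding bil_def using assms(2) mult_mat_vec_carrier[OF assms(1,3)]
 by (simp add: mult_mat_vec[OF assms(1,3)])

lemma bil_sym:
 assumes "A \<in> Mat N" "A\<^sup>T = A" "x \<in> Vec N" "y \<in> Vec N"
 shows "bil A x y = bil A y x"
proof -
 have "bil A x y = (A\<^sup>T *\<^sub>v x) \<bullet> y"
  unfolding bil_def by (rule transpose_vec_mult_scalar[symmetric]) (use assms in auto)
 then show ?thesis using assms by (simp add: bil_def comm_scalar_prod[of _ N])
qed

lemma bil_mult:
 assumes "A \<in> Mat N" "T \<in> Mat N" "S \<in> Mat N"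
  "x \<in> Vec N" "y \<in> Vec N"
 shows "bil A (T *\<^sub>v x) (S *\<^sub>v y) = bil (T\<^sup>T * A * S) x y"
proof -
 have "bil (T\<^sup>T * A * S) x y = x \<bullet> (T\<^sup>T *\<^sub>v (A *\<^sub>v (S *\<^sub>v y)))"
  unfolding bil_def using assms
  by (simp add: assoc_mult_mat_vec[of _ N N _ N])
 also have "\<dots> = (T\<^sup>T\<^sup>T *\<^sub>v x) \<bullet> (A *\<^sub>v (S *\<^sub>v y))"
  by (rule transpose_vec_mult_scalar[symmetric]) (use assms in \<open>auto intro!: mult_mat_vec_carrier\<close>)
 finally show ?thesis by (simp add: bil_def)
qed

lemma bil_unit:
 assumes "A \<in> Mat N" "i < N" "j < N"
 shows "bil A (unit_vec N i) (unit_vec N j) = A $$ (i, j)"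
 using assms by (simp add: bil_def)

lemma bil_ext:
 assumes "A \<in> Mat N" "B \<in> Mat N"
  and "!!x y. x \<in> Vec N ==> y \<in> Vec N ==> bil A x y = bil B x y"
 shows "A = B"
proof (rule eq_matI)
 fix i j assume "i < dim_row B" "j < dim_col B"
 then show "A $$ (i, j) = B $$ (i, j)"
  using assms bil_unit[of A N i j] bil_unit[of B N i j] by simp
qed (use assms in auto)

lemma bil_polarize:
 fixes A :: "real mat"
 assumes "A \<in> Mat N" "A\<^sup>T = A" "x \<in> Vec N" "y \<in> Vec N"
 shows "bil A x y = (bil A (x + y) (x + y) - bil A x x - bil A y y) / 2"
 using assms bil_sym[OF assms] by (simp add: bil_add_left bil_add_right)

lemma isometry_iff:
 fixes A :: "'a::field mat"
 assumes "A \<in> Mat N" "B \<in> Mat N" "T \<in> Mat N"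
 shows "T\<^sup>T * A * T = B \<longleftrightarrow>
  (\<forall>x\<in>Vec N. \<forall>y\<in>Vec N. bil A (T *\<^sub>v x) (T *\<^sub>v y) = bil B x y)"
proof
 assume "T\<^sup>T * A * T = B"
 then show "\<forall>x\<in>Vec N. \<forall>y\<in>Vec N. bil A (T *\<^sub>v x) (T *\<^sub>v y) = bil B x y"
  using assms bil_mult[of A N T T] by simp
next
 assume "\<forall>x\<in>Vec N. \<forall>y\<in>Vec N. bil A (T *\<^sub>v x) (T *\<^sub>v y) = bil B x y"
 then show "T\<^sup>T * A * T = B"
  using assms bil_mult[of A N T T] by (intro bil_ext[of _ N]) auto
qed

definition lorentz_mat :: "nat => real mat" where
 "lorentz_mat n = mat_diag (n + 1) (\<lambda>i. if i < n then 1 else -1)"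

lemma lorentz_mat_carrier [simp]: "lorentz_mat n \<in> Mat (n + 1)"
 by (simp add: lorentz_mat_def)

lemma lorentz_mat_transpose [simp]: "(lorentz_mat n)\<^sup>T = lorentz_mat n"
 by (rule eq_matI) (auto simp: lorentz_mat_def mat_diag_def)

lemma lorentz_bil:
 assumes "x \<in> Vec (n + 1)" "y \<in> Vec (n + 1)"
 shows "lorentz n x y = bil (lorentz_mat n) x y"
proof -
 have "bil (lorentz_mat n) x y =
   (\<Sum>i<n + 1. \<Sum>j<n + 1. if j = i then x $ i * (if i < n then 1 else -1) * y $ i else 0)"
  unfolding bil_sum[OF lorentz_mat_carrier assms]
  by (intro sum.cong) (auto simp: lorentz_mat_def mat_diag_def)
 also have "\<dots> = (\<Sum>i<n + 1. x $ i * (if i < n then 1 else -1) * y $ i)"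
  by (intro sum.cong) auto
 also have "\<dots> = lorentz n x y" by (simp add: lorentz_def)
 finally show ?thesis by simp
qed

lemma pow_mat_vec_Suc:
 assumes "g \<in> Mat N" "x \<in> Vec N"
 shows "(g ^\<^sub>m Suc k) *\<^sub>v x = (g ^\<^sub>m k) *\<^sub>v (g *\<^sub>v x)"
 using assms by (simp add: assoc_mult_mat_vec[of _ N N _ N])

lemma isometry_pow:
 assumes "A \<in> Mat N" "g \<in> Mat N"
  and iso: "!!x y. x \<in> Vec N ==> y \<in> Vec N ==> bil A (g *\<^sub>v x) (g *\<^sub>v y) = bil A x y"
  and "x \<in> Vec N" "y \<in> Vec N"
 shows "bil A ((g ^\<^sub>m k) *\<^sub>v x) ((g ^\<^sub>m k) *\<^sub>v y) = bil A x y"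
 using assms(4,5)
proof (induction k arbitrary: x y)
 case (Suc k)
 then show ?case
  using assms mult_mat_vec_carrier[OF assms(2)] pow_mat_vec_Suc[OF assms(2)] by simp
qed (use assms in simp)

section \<open>Eigenvalues of isometries\<close>

text \<open>Real and imaginary part of a complex eigenvector of a real matrix.\<close>

lemma complex_eigenvectorE:
 fixes g :: "real mat"
 assumes g: "g \<in> Mat N" and "poly (char_poly (map_mat complex_of_real g)) z = 0"
 obtains a b where "a \<in> Vec N" "b \<in> Vec N" "a ~= 0\<^sub>v N \<or> b ~= 0\<^sub>v N"
  "g *\<^sub>v a = Re z \<cdot>\<^sub>v a + (- Im z) \<cdot>\<^sub>v b" "g *\<^sub>v b = Im z \<cdot>\<^sub>v a + Re z \<cdot>\<^sub>v b"
proof -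
 let ?G = "map_mat complex_of_real g"
 have G: "?G \<in> Mat N" using g by simp
 then obtain u where u: "u \<in> Vec N" "u ~= 0\<^sub>v N" "?G *\<^sub>v u = z \<cdot>\<^sub>v u"
  using assms(2) eigenvalue_root_char_poly[OF G, of z] unfolding eigenvalue_def eigenvector_def
  by auto
 define a b where "a = map_vec Re u" "b = map_vec Im u"
 have car: "a \<in> Vec N" "b \<in> Vec N" using u by (auto simp: a_b_def)
 have "a ~= 0\<^sub>v N \<or> b ~= 0\<^sub>v N"
 proof (rule ccontr)
  assume "\<not> ?thesis"
  then have "a $ i = 0 \<and> b $ i = 0" if "i < N" for i using that by simp
  then have "u = 0\<^sub>v N"
   using u(1) by (intro eq_vecI) (auto simp: a_b_def complex_eq_iff)
  then show False using u by simp
 qed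
 have comp: "(\<Sum>j<N. complex_of_real (g $$ (i, j)) * u $ j) = z * u $ i" if i: "i < N" for i
  using arg_cong[OF u(3), of "\<lambda>x. x $ i"] i g u(1) by (simp add: scalar_prod_def atLeast0LessThan)
 have ga: "(g *\<^sub>v a) $ i = (\<Sum>j<N. g $$ (i, j) * Re (u $ j))"
  and gb: "(g *\<^sub>v b) $ i = (\<Sum>j<N. g $$ (i, j) * Im (u $ j))" if i: "i < N" for i
  using i g u by (simp_all add: scalar_prod_def atLeast0LessThan a_b_def)
 have "g *\<^sub>v a = Re z \<cdot>\<^sub>v a + (- Im z) \<cdot>\<^sub>v b"
 proof (rule eq_vecI)
  fix i assume "i < dim_vec (Re z \<cdot>\<^sub>v a + (- Im z) \<cdot>\<^sub>v b)"
  then have i: "i < N" using car by simp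
  show "(g *\<^sub>v a) $ i = (Re z \<cdot>\<^sub>v a + (- Im z) \<cdot>\<^sub>v b) $ i"
   unfolding ga[OF i] using arg_cong[OF comp[OF i], of Re] i u(1) by (simp add: a_b_def)
 qed (use g car in auto)
 moreover have "g *\<^sub>v b = Im z \<cdot>\<^sub>v a + Re z \<cdot>\<^sub>v b"
 proof (rule eq_vecI)
  fix i assume "i < dim_vec (Im z \<cdot>\<^sub>v a + Re z \<cdot>\<^sub>v b)"
  then have i: "i < N" using car by simp
  show "(g *\<^sub>v b) $ i = (Im z \<cdot>\<^sub>v a + Re z \<cdot>\<^sub>v b) $ i"
   unfolding gb[OF i] using arg_cong[OF comp[OF i], of Im] i u(1) by (simp add: a_b_def algebra_simps)
 qed (use g car in auto)
 ultimately show ?thesis using that car \<open>a ~= 0\<^sub>v N \<or> b ~= 0\<^sub>v N\<close> by blast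
qed

text \<open>The sum of the two form values is the Hermitian norm of the complex eigenvector a + i b,
  which g preserves and multiplication by z scales by |z|^2.\<close>

lemma isometry_eigenvector_norm:
 fixes B :: "real mat"
 assumes B: "B \<in> Mat N" "B\<^sup>T = B"
  and car: "a \<in> Vec N" "b \<in> Vec N"
  and iso: "!!x y. x \<in> Vec N ==> y \<in> Vec N ==> bil B (g *\<^sub>v x) (g *\<^sub>v y) = bil B x y"
  and ga: "g *\<^sub>v a = Re z \<cdot>\<^sub>v a + (- Im z) \<cdot>\<^sub>v b" and gb: "g *\<^sub>v b = Im z \<cdot>\<^sub>v a + Re z \<cdot>\<^sub>v b"
 shows "bil B a a + bil B b b = (cmod z)\<^sup>2 * (bil B a a + bil B b b)"
proof -
 have "bil B a a + bil B b b = bil B (g *\<^sub>v a) (g *\<^sub>v a) + bil B (g *\<^sub>v b) (g *\<^sub>v b)"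
  using iso car by simp
 also have "\<dots> = ((Re z)\<^sup>2 + (Im z)\<^sup>2) * (bil B a a + bil B b b)"
  using car B(1) unfolding ga gb
  by (simp add: bil_add_left[of B N] bil_add_right[of B N] bil_smult_left[of B N] bil_smult_right[of B N]
    bil_sym[OF B car(2,1)]) (simp add: algebra_simps power2_eq_square)
 also have "(Re z)\<^sup>2 + (Im z)\<^sup>2 = (cmod z)\<^sup>2" by (simp add: cmod_power2)
 finally show ?thesis .
qed

lemma positive_definite_isometry_eigenvalue:
 assumes B: "B \<in> Mat N" "B\<^sup>T = B" "positive_definite N B"
  and g: "g \<in> Mat N" "g\<^sup>T * B * g = B"
  and z: "poly (char_poly (map_mat complex_of_real g)) z = 0"
 shows "cmod z = 1"
proof -
 obtain a b where ab: "a \<in> Vec N" "b \<in> Vec N" "a ~= 0\<^sub>v N \<or> b ~= 0\<^sub>v N"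
  "g *\<^sub>v a = Re z \<cdot>\<^sub>v a + (- Im z) \<cdot>\<^sub>v b" "g *\<^sub>v b = Im z \<cdot>\<^sub>v a + Re z \<cdot>\<^sub>v b"
  using complex_eigenvectorE[OF g(1) z] by blast
 have nn: "bil B x x \<ge> 0" "x ~= 0\<^sub>v N ==> bil B x x > 0" if "x \<in> Vec N" for x
  using B(3) that B(1) by (cases "x = 0\<^sub>v N";
   force simp: positive_definite_def quad_form_bil bil_def less_imp_le)+
 have "bil B a a + bil B b b > 0"
  using nn[OF ab(1)] nn[OF ab(2)] ab(3) by (auto intro: add_pos_nonneg add_nonneg_pos)
 moreover have "bil B a a + bil B b b = (cmod z)\<^sup>2 * (bil B a a + bil B b b)"
  using isometry_iff[OF B(1) B(1) g(1)] g(2)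
  by (intro isometry_eigenvector_norm[OF B(1,2) ab(1,2) _ ab(4,5)]) auto
 ultimately have "(cmod z)\<^sup>2 = 1" by simp
 then show ?thesis using norm_ge_zero[of z] by (auto simp: power2_eq_1_iff)
qed

text \<open>An eigenvector that pairs nontrivially with v or w must have eigenvalue 1/\<mu> or
  \<mu>. Otherwise its real and imaginary parts lie in the definite complement of v + w, where the
  Hermitian norm forces modulus one.\<close>

lemma O_plus_eigenvalue:
 assumes g: "g \<in> O_plus n" and nf: "null_frame n v w"
  and gv: "g *\<^sub>v v = \<mu> \<cdot>\<^sub>v v" "g *\<^sub>v w = inverse \<mu> \<cdot>\<^sub>v w" and mu: "\<mu> ~= 0"
  and z: "poly (char_poly (map_mat complex_of_real g)) z = 0"
 shows "z = of_real \<mu> \<or> z = of_real (inverse \<mu>) \<or> cmod z = 1"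
proof -
 have gc: "g \<in> Mat (n + 1)" using g by (simp add: O_plus_def)
 obtain a b where ab: "a \<in> Vec (n + 1)" "b \<in> Vec (n + 1)"
  "a ~= 0\<^sub>v (n + 1) \<or> b ~= 0\<^sub>v (n + 1)"
  "g *\<^sub>v a = Re z \<cdot>\<^sub>v a + (- Im z) \<cdot>\<^sub>v b" "g *\<^sub>v b = Im z \<cdot>\<^sub>v a + Re z \<cdot>\<^sub>v b"
  using complex_eigenvectorE[OF gc z] by blast
 have car: "v \<in> Vec (n + 1)" "w \<in> Vec (n + 1)" and H: "v + w \<in> hyp_space n"
  using nf by (auto simp: null_frame_def)
 define L where "L = (\<lambda>x. Complex (lorentz n x a) (lorentz n x b))"
 have L: "L x = of_real r * z * L x"
  if x: "x \<in> Vec (n + 1)" "g *\<^sub>v x = r \<cdot>\<^sub>v x" for x r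
 proof -
  have "lorentz n x a = r * (Re z * lorentz n x a - Im z * lorentz n x b)"
   using O_plus_lorentz[OF g x(1) ab(1)] x ab(1,2) by (simp add: ab(4) lorentz_simps algebra_simps)
  moreover have "lorentz n x b = r * (Im z * lorentz n x a + Re z * lorentz n x b)"
   using O_plus_lorentz[OF g x(1) ab(2)] x ab(1,2) by (simp add: ab(5) lorentz_simps algebra_simps)
  ultimately show ?thesis
   unfolding L_def complex_eq_iff by (simp add: algebra_simps)
 qed
 show ?thesis
 proof (cases "L v = 0 \<and> L w = 0")
  case True
  then have 0: "lorentz n v a = 0" "lorentz n v b = 0" "lorentz n w a = 0" "lorentz n w b = 0"
   by (auto simp: L_def complex_eq_iff)
  have perp: "lorentz n (v + w) a = 0" "lorentz n (v + w) b = 0"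
   using 0 car ab by (simp_all add: lorentz_simps)
  have "lorentz n a a + lorentz n b b > 0"
   using lorentz_orthogonal_nonneg[OF H ab(1) perp(1)] lorentz_orthogonal_nonneg[OF H ab(2) perp(2)] ab(3)
   by linarith
  moreover have "lorentz n a a + lorentz n b b = (cmod z)\<^sup>2 * (lorentz n a a + lorentz n b b)"
   unfolding lorentz_bil[OF ab(1,1)] lorentz_bil[OF ab(2,2)]
  proof (rule isometry_eigenvector_norm[OF lorentz_mat_carrier lorentz_mat_transpose ab(1,2) _ ab(4,5)])
   fix x y :: "real vec" assume xy: "x \<in> Vec (n + 1)" "y \<in> Vec (n + 1)"
   show "bil (lorentz_mat n) (g *\<^sub>v x) (g *\<^sub>v y) = bil (lorentz_mat n) x y"
    using O_plus_lorentz[OF g xy] xy mult_mat_vec_carrier[OF gc]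
    by (simp add: lorentz_bil)
  qed
  ultimately have "(cmod z)\<^sup>2 = 1" by simp
  then show ?thesis using norm_ge_zero[of z] by (auto simp: power2_eq_1_iff)
 next
  case False
  then have "of_real \<mu> * z = 1 \<or> of_real (inverse \<mu>) * z = 1"
   using L[OF car(1) gv(1)] L[OF car(2) gv(2)] by (metis mult_cancel_right1 mult.commute)
  then show ?thesis using mu by (auto simp: field_simps of_real_inverse)
 qed
qed

text \<open>Write x = p v + q w + y with y orthogonal to v and w. Powers of g multiply v by
  \<open>\<mu> ^ k\<close>, shrink w and keep y bounded, so after rescaling only p v survives. The
  factor -2 again inverts the product of v and w.\<close>

lemma O_plus_power_limit:
 assumes g: "g \<in> O_plus n" and nf: "null_frame n v w"
  and gv: "g *\<^sub>v v = \<mu> \<cdot>\<^sub>v v" "g *\<^sub>v w = inverse \<mu> \<cdot>\<^sub>v w" and mu: "\<mu> > 1"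
  and x: "x \<in> Vec (n + 1)" and i: "i < n + 1"
 shows "(\<lambda>k. ((g ^\<^sub>m k) *\<^sub>v x) $ i / \<mu> ^ k) \<longlonglongrightarrow> - 2 * lorentz n w x * v $ i"
proof -
 have gc: "g \<in> Mat (n + 1)" using g by (simp add: O_plus_def)
 have car: "v \<in> Vec (n + 1)" "w \<in> Vec (n + 1)" and H: "v + w \<in> hyp_space n"
  and vw: "lorentz n v v = 0" "lorentz n w w = 0" "lorentz n v w = -1/2" "lorentz n w v = -1/2"
  using nf lorentz_comm[of n w v] by (auto simp: null_frame_def)
 define p q where "p = - 2 * lorentz n w x" "q = - 2 * lorentz n v x"
 define y where "y = x + ((- p) \<cdot>\<^sub>v v + (- q) \<cdot>\<^sub>v w)"
 have y: "y \<in> Vec (n + 1)" using x car by (simp add: y_def)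
 have vy: "lorentz n v y = 0" "lorentz n w y = 0"
  unfolding y_def using x car by (simp_all add: lorentz_simps vw p_q_def)
 have xy: "x = p \<cdot>\<^sub>v v + (q \<cdot>\<^sub>v w + y)"
  using x car by (intro eq_vecI) (auto simp: y_def)
 have gk: "g ^\<^sub>m k \<in> Mat (n + 1)" for k using gc by simp
 have gkc: "(g ^\<^sub>m k) *\<^sub>v u \<in> Vec (n + 1)" if "u \<in> Vec (n + 1)" for k u
  using mult_mat_vec_carrier[OF gk that] .
 have gkv: "(g ^\<^sub>m k) *\<^sub>v v = \<mu> ^ k \<cdot>\<^sub>v v" "(g ^\<^sub>m k) *\<^sub>v w = inverse \<mu> ^ k \<cdot>\<^sub>v w" for k
  using gv car gc
  by (induction k)
   (simp_all add: pow_mat_vec_Suc[OF gc] mult_mat_vec[OF gk] smult_smult_assoc mult.commute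
    del: pow_mat.simps, simp_all)
 have iso: "lorentz n ((g ^\<^sub>m k) *\<^sub>v a) ((g ^\<^sub>m k) *\<^sub>v b) = lorentz n a b"
  if "a \<in> Vec (n + 1)" "b \<in> Vec (n + 1)" for a b k
  using isometry_pow[OF lorentz_mat_carrier gc, of a b k] O_plus_lorentz[OF g] that gkc
   mult_mat_vec_carrier[OF gc] by (simp add: lorentz_bil)
 have bound: "(((g ^\<^sub>m k) *\<^sub>v y) $ i)\<^sup>2 \<le> ((v + w) $ n)\<^sup>2 * lorentz n y y" for k
 proof -
  have "\<mu> ^ k * lorentz n v ((g ^\<^sub>m k) *\<^sub>v y) = 0"
   using iso[OF car(1) y, of k] car gkc[OF y, of k] by (simp add: gkv lorentz_simps vy)
  then have 1: "lorentz n v ((g ^\<^sub>m k) *\<^sub>v y) = 0" using mu by simp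
  have "inverse \<mu> ^ k * lorentz n w ((g ^\<^sub>m k) *\<^sub>v y) = 0"
   using iso[OF car(2) y, of k] car gkc[OF y, of k] by (simp add: gkv lorentz_simps vy)
  then have 2: "lorentz n w ((g ^\<^sub>m k) *\<^sub>v y) = 0" using mu by simp
  have "lorentz n (v + w) ((g ^\<^sub>m k) *\<^sub>v y) = 0"
   using 1 2 car gkc[OF y, of k] by (simp add: lorentz_simps)
  from lorentz_orthogonal_bound[OF H gkc[OF y] this, of i] i show ?thesis
   by (simp add: iso[OF y y])
 qed
 define C where "C = sqrt (((v + w) $ n)\<^sup>2 * lorentz n y y)"
 have bound': "\<bar>((g ^\<^sub>m k) *\<^sub>v y) $ i\<bar> \<le> C" for k
  using real_sqrt_le_mono[OF bound[of k]] by (simp add: C_def)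
 have inv0: "(\<lambda>k. inverse \<mu> ^ k) \<longlonglongrightarrow> 0"
  using mu by (intro LIMSEQ_realpow_zero) (auto simp: inverse_less_1_iff)
 have lim_y: "(\<lambda>k. ((g ^\<^sub>m k) *\<^sub>v y) $ i * inverse \<mu> ^ k) \<longlonglongrightarrow> 0"
 proof (rule tendsto_0_le[OF inv0])
  show "\<forall>\<^sub>F k in sequentially. norm (((g ^\<^sub>m k) *\<^sub>v y) $ i * inverse \<mu> ^ k) \<le> norm (inverse \<mu> ^ k) * C"
   using bound' mu by (auto simp: abs_mult mult.commute[of _ C] intro!: always_eventually mult_right_mono)
 qed
 have "((g ^\<^sub>m k) *\<^sub>v x) $ i / \<mu> ^ k =
   p * v $ i + q * (inverse \<mu> ^ k * inverse \<mu> ^ k) * w $ i + ((g ^\<^sub>m k) *\<^sub>v y) $ i * inverse \<mu> ^ k" for k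
 proof -
  have "(g ^\<^sub>m k) *\<^sub>v x = p \<cdot>\<^sub>v (\<mu> ^ k \<cdot>\<^sub>v v) + (q \<cdot>\<^sub>v (inverse \<mu> ^ k \<cdot>\<^sub>v w) + (g ^\<^sub>m k) *\<^sub>v y)"
   using car y by (subst xy) (simp add: mult_add_distrib_mat_vec[OF gk] mult_mat_vec[OF gk] gkv)
  then have "((g ^\<^sub>m k) *\<^sub>v x) $ i = p * (\<mu> ^ k * v $ i) + (q * (inverse \<mu> ^ k * w $ i) + ((g ^\<^sub>m k) *\<^sub>v y) $ i)"
   using car carrier_vecD[OF gkc[OF y, of k]] i by (simp del: dim_mult_mat_vec)
  then show ?thesis using mu by (simp add: field_simps power_inverse)
 qed
 moreover have "(\<lambda>k. p * v $ i + q * (inverse \<mu> ^ k * inverse \<mu> ^ k) * w $ i +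
   ((g ^\<^sub>m k) *\<^sub>v y) $ i * inverse \<mu> ^ k) \<longlonglongrightarrow> p * v $ i + q * (0 * 0) * w $ i + 0"
  by (intro tendsto_intros inv0 lim_y)
 ultimately show ?thesis by (simp add: p_q_def)
qed

text \<open>The rank one operator \<open>x \<mapsto> lorentz n w x \<cdot> v\<close> is the limit direction of the powers of \<open>g\<close>.\<close>

lemma O_plus_power_functional:
 assumes g: "g \<in> O_plus n" and nf: "null_frame n v w"
  and gv: "g *\<^sub>v v = \<mu> \<cdot>\<^sub>v v" "g *\<^sub>v w = inverse \<mu> \<cdot>\<^sub>v w" and mu: "\<mu> > 1" and m: "m > 0"
  and Z: "!!j. (\<Sum>a<n + 1. \<Sum>b<n + 1. Z a b * (g ^\<^sub>m (m * Suc j)) $$ (a, b)) = 0"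
 shows "(\<Sum>a<n + 1. \<Sum>b<n + 1. Z a b * (v $ a * lorentz n w (unit_vec (n + 1) b))) = 0"
proof -
 have gc: "g \<in> Mat (n + 1)" using g by (simp add: O_plus_def)
 define s where "s = (\<lambda>j. m * Suc j)"
 have s: "strict_mono s" using m by (simp add: s_def strict_mono_Suc_iff)
 have ent: "(g ^\<^sub>m k) $$ (a, b) = ((g ^\<^sub>m k) *\<^sub>v unit_vec (n + 1) b) $ a" if "a < n + 1" "b < n + 1" for a b k
  using that gc by simp
 have lim: "(\<lambda>j. (g ^\<^sub>m s j) $$ (a, b) / \<mu> ^ s j) \<longlonglongrightarrow> - 2 * lorentz n w (unit_vec (n + 1) b) * v $ a"
  if "a < n + 1" "b < n + 1" for a b
  using LIMSEQ_subseq_LIMSEQ[OF O_plus_power_limit[OF g nf gv mu, of "unit_vec (n + 1) b" a] s] that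
  by (simp add: ent[OF that] o_def del: index_mult_mat_vec)
 have "(\<lambda>j. \<Sum>a<n + 1. \<Sum>b<n + 1. Z a b * ((g ^\<^sub>m s j) $$ (a, b) / \<mu> ^ s j)) \<longlonglongrightarrow>
   (\<Sum>a<n + 1. \<Sum>b<n + 1. Z a b * (- 2 * lorentz n w (unit_vec (n + 1) b) * v $ a))"
  by (intro tendsto_sum tendsto_mult_left lim) auto
 moreover have "(\<Sum>a<n + 1. \<Sum>b<n + 1. Z a b * ((g ^\<^sub>m s j) $$ (a, b) / \<mu> ^ s j)) =
   (\<Sum>a<n + 1. \<Sum>b<n + 1. Z a b * (g ^\<^sub>m (m * Suc j)) $$ (a, b)) / \<mu> ^ s j" for j
  unfolding sum_divide_distrib by (simp add: s_def)
 ultimately have "(\<lambda>j. 0 :: real) \<longlonglongrightarrow>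
   (\<Sum>a<n + 1. \<Sum>b<n + 1. Z a b * (- 2 * lorentz n w (unit_vec (n + 1) b) * v $ a))"
  by (simp only: Z div_0)
 then have "0 = (\<Sum>a<n + 1. \<Sum>b<n + 1. Z a b * (- 2 * lorentz n w (unit_vec (n + 1) b) * v $ a))"
  using LIMSEQ_unique tendsto_const by blast
 also have "\<dots> = - 2 * (\<Sum>a<n + 1. \<Sum>b<n + 1. Z a b * (v $ a * lorentz n w (unit_vec (n + 1) b)))"
  unfolding sum_distrib_left by (intro sum.cong) (auto simp: algebra_simps)
 finally show ?thesis by simp
qed

section \<open>Integral matrix groups, finite index, and the sheet-preserving isometries of a
  form\<close>

section \<open>Matrices over subrings\<close>

lemma elements_mat_subset_iff:
 assumes "T \<in> carrier_mat nr nc"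
 shows "elements_mat T \<subseteq> R \<longleftrightarrow> (\<forall>i<nr. \<forall>j<nc. T $$ (i, j) \<in> R)"
 using assms by (fastforce dest: elements_matD)

context subring_of_field
begin

lemma elements_mat_mult:
 assumes "S \<in> Mat N" "T \<in> Mat N" "elements_mat S \<subseteq> R" "elements_mat T \<subseteq> R"
 shows "elements_mat (S * T) \<subseteq> R"
 using assms
 by (subst elements_mat_subset_iff[OF mult_carrier_mat[OF assms(1,2)]])
  (auto simp: elements_mat_subset_iff scalar_prod_def intro!: sum_mem mult_mem)

lemma elements_mat_one: "elements_mat (1\<^sub>m N) \<subseteq> R"
 by (subst elements_mat_subset_iff[of _ N N]) (auto intro: ring_mems)

lemma elements_mat_smult:
 "T \<in> Mat N ==> c \<in> R ==> elements_mat T \<subseteq> R ==> elements_mat (c \<cdot>\<^sub>m T) \<subseteq> R"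
 by (auto simp: elements_mat_subset_iff[of _ N N] intro: mult_mem)

lemma elements_mat_pow:
 assumes "T \<in> Mat N" "elements_mat T \<subseteq> R"
 shows "elements_mat (T ^\<^sub>m k) \<subseteq> R"
 by (induction k) (use assms elements_mat_one elements_mat_mult[of _ N] in auto)

lemma det_mem:
 assumes "T \<in> Mat N" "elements_mat T \<subseteq> R"
 shows "det T \<in> R"
proof -
 have "(signof p :: 'a) \<in> R" for p by (cases p rule: sign_cases) (auto intro: ring_mems)
 then show ?thesis
  unfolding det_def'[OF assms(1)]
  using assms by (auto simp: elements_mat_subset_iff permutes_in_image atLeast0LessThan
    intro!: sum_mem mult_mem prod_mem)
qed

text \<open>Cramer's rule: cofactors stay in the ring, so only the determinant has to be invertible
  there.\<close>

lemma elements_mat_inverse: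
 assumes T: "T \<in> Mat N" "elements_mat T \<subseteq> R" and det: "det T ~= 0" "inverse (det T) \<in> R"
 obtains S where "S \<in> Mat N" "elements_mat S \<subseteq> R" "T * S = 1\<^sub>m N" "S * T = 1\<^sub>m N"
proof -
 define S where "S = inverse (det T) \<cdot>\<^sub>m adj_mat T"
 note adj = adj_mat[OF T(1)]
 have S: "S \<in> Mat N" using adj by (simp add: S_def)
 have "mat_delete T i j \<in> carrier_mat (N - 1) (N - 1)" for i j
  using T(1) by (rule mat_delete_carrier)
 moreover have "elements_mat (mat_delete T i j) \<subseteq> R" for i j
  using T calculation by (subst elements_mat_subset_iff) (auto simp: mat_delete_def elements_mat_subset_iff)
 ultimately have "cofactor T i j \<in> R" for i j
  unfolding cofactor_def by (intro mult_mem power_mem det_mem uminus_mem one_mem)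
 then have "elements_mat S \<subseteq> R"
  using S det(2) T(1) unfolding S_def
  by (subst elements_mat_subset_iff) (auto simp: adj_mat_def intro!: mult_mem)
 moreover have one: "inverse (det T) \<cdot>\<^sub>m (det T \<cdot>\<^sub>m 1\<^sub>m N) = 1\<^sub>m N"
  using det(1) by (intro eq_matI) auto
 moreover have "T * S = 1\<^sub>m N"
  unfolding S_def using adj T det mult_smult_distrib[OF T(1) adj(1), of "inverse (det T)"]
  by (simp add: one)
 moreover have "S * T = 1\<^sub>m N"
  unfolding S_def using adj T det mult_smult_assoc_mat[OF adj(1) T(1), of "inverse (det T)"]
  by (simp add: one)
 ultimately show ?thesis using that S by blast
qed

end

section \<open>The general linear group\<close>

lemma GL_simps [simp]: "monoid.mult (GL m) = (*)" "monoid.one (GL m) = 1\<^sub>m m"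
 by (simp_all add: units_of_def ring_mat_simps)

lemma GL_carrier_iff:
 "T \<in> carrier (GL m) \<longleftrightarrow> T \<in> Mat m \<and> (\<exists>S\<in>Mat m. T * S = 1\<^sub>m m \<and> S * T = 1\<^sub>m m)"
 by (auto simp: units_of_def Units_def ring_mat_simps)

lemma GL_carrierI:
 "T \<in> Mat m ==> S \<in> Mat m ==> T * S = 1\<^sub>m m ==> S * T = 1\<^sub>m m ==> T \<in> carrier (GL m)"
 unfolding GL_carrier_iff by blast

lemma GL_group: "group (GL m)"
proof -
 interpret ring "ring_mat TYPE(real) m ()" by (rule ring_mat)
 show ?thesis by (rule units_group)
qed

lemma GL_inv:
 assumes "T \<in> carrier (GL m)"
 shows "inv\<^bsub>GL m\<^esub> T \<in> Mat m" "T * inv\<^bsub>GL m\<^esub> T = 1\<^sub>m m" "inv\<^bsub>GL m\<^esub> T * T = 1\<^sub>m m"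
proof -
 interpret group "GL m" by (rule GL_group)
 show "inv\<^bsub>GL m\<^esub> T \<in> Mat m" using inv_closed[OF assms] by (simp add: GL_carrier_iff)
 show "T * inv\<^bsub>GL m\<^esub> T = 1\<^sub>m m" "inv\<^bsub>GL m\<^esub> T * T = 1\<^sub>m m"
  using r_inv[OF assms] l_inv[OF assms] by simp_all
qed

lemma GL_subgroupI:
 assumes "H \<subseteq> carrier (GL m)" "1\<^sub>m m \<in> H" "!!S T. S \<in> H ==> T \<in> H ==> S * T \<in> H"
  and inv: "!!T. T \<in> H ==> \<exists>S\<in>H. T * S = 1\<^sub>m m"
 shows "subgroup H (GL m)"
proof -
 interpret group "GL m" by (rule GL_group)
 show ?thesis
 proof (rule subgroupI)
  fix T assume T: "T \<in> H"
  then obtain S where S: "S \<in> H" "T * S = 1\<^sub>m m" using inv by blast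
  have "inv\<^bsub>GL m\<^esub> S = T" using S T assms(1) by (intro inv_equality) auto
  then have "inv\<^bsub>GL m\<^esub> T = S" using S(1) assms(1) inv_inv[of S] by auto
  then show "inv\<^bsub>GL m\<^esub> T \<in> H" using S by simp
 qed (use assms in auto)
qed

lemma pow_mat_add_GL:
 assumes "T \<in> Mat m"
 shows "T ^\<^sub>m (i + j) = T ^\<^sub>m i * T ^\<^sub>m j"
proof (induction j)
 case (Suc j)
 have "T ^\<^sub>m (i + Suc j) = (T ^\<^sub>m i * T ^\<^sub>m j) * T" using Suc by simp
 also have "\<dots> = T ^\<^sub>m i * (T ^\<^sub>m j * T)" using assms by (intro assoc_mult_mat) auto
 finally show ?case by simp
qed (use assms in simp)

text \<open>By finiteness two powers of T lie in the same coset of the intersection; their quotient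
  is a positive power of T inside it.\<close>

lemma commensurable_power:
 assumes comm: "commensurable (GL m) H1 H2" and T: "T \<in> H1" "T \<in> carrier (GL m)"
  and H1: "1\<^sub>m m \<in> H1" "!!S T. S \<in> H1 ==> T \<in> H1 ==> S * T \<in> H1"
  and one: "1\<^sub>m m \<in> H2" and car: "H1 \<subseteq> Mat m"
 obtains k where "k > 0" "T ^\<^sub>m k \<in> H2" "T ^\<^sub>m k \<in> H1"
proof -
 let ?G = "GL m\<lparr>carrier := H1\<rparr>"
 have Tc: "T \<in> Mat m" using T(2) by (simp add: GL_carrier_iff)
 have pow: "T ^\<^sub>m k \<in> H1" for k by (induction k) (use H1 T Tc in auto)
 define f where "f = (\<lambda>k. (H1 \<inter> H2) #>\<^bsub>?G\<^esub> (T ^\<^sub>m k))"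
 have "range f \<subseteq> rcosets\<^bsub>?G\<^esub> (H1 \<inter> H2)"
  using pow unfolding f_def RCOSETS_def by auto
 then have "finite (range f)"
  using comm unfolding commensurable_def by (blast intro: finite_subset)
 then have "\<not> inj f" using finite_imageD infinite_UNIV_nat by blast
 then obtain i j where ij: "i < j" "f i = f j"
  by (metis injI linorder_neqE_nat)
 have "T ^\<^sub>m j \<in> f j"
  unfolding f_def r_coset_def using one H1 Tc by (auto intro!: bexI[of _ "1\<^sub>m m"])
 then obtain h where h: "h \<in> H1 \<inter> H2" "T ^\<^sub>m j = h * T ^\<^sub>m i"
  unfolding ij(2)[symmetric] unfolding f_def r_coset_def by auto
 obtain S where S: "S \<in> Mat m" "T * S = 1\<^sub>m m" using T(2) by (auto simp: GL_carrier_iff)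
 have TS: "T ^\<^sub>m k * S ^\<^sub>m k = 1\<^sub>m m" for k
 proof (induction k)
  case (Suc k)
  have "T ^\<^sub>m Suc k * S ^\<^sub>m Suc k = T ^\<^sub>m k * T * (S * S ^\<^sub>m k)"
   using pow_mat_add_GL[OF S(1), of 1 k] S(1) by simp
  also have "\<dots> = T ^\<^sub>m k * (T * S) * S ^\<^sub>m k"
   using Tc S(1) by (simp add: assoc_mult_mat[of _ m m _ m _ m])
  finally show ?case using Suc S Tc by simp
 qed (use Tc S in simp)
 have hc: "h \<in> Mat m" using h car by auto
 have "T ^\<^sub>m (j - i) * T ^\<^sub>m i = h * T ^\<^sub>m i"
  using pow_mat_add_GL[OF Tc, of "j - i" i] ij h by simp
 then have "T ^\<^sub>m (j - i) * T ^\<^sub>m i * S ^\<^sub>m i = h * T ^\<^sub>m i * S ^\<^sub>m i" by simp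
 then have "T ^\<^sub>m (j - i) = h"
  using TS[of i] Tc S(1) hc by (simp add: assoc_mult_mat[of _ m m _ m _ m])
 then show ?thesis using that[of "j - i"] ij h pow by auto
qed

text \<open>Finite index by colouring: if elements of one colour differ by a left factor from H,
  there are at most as many cosets as colours.\<close>

lemma finite_rcosetsI:
 assumes fin: "finite (\<chi> ` H1)"
  and sep: "!!a b. a \<in> H1 ==> b \<in> H1 ==> \<chi> a = \<chi> b ==> \<exists>h\<in>H. b = h * a"
  and H: "!!h k. h \<in> H ==> k \<in> H ==> h * k \<in> H" and car: "H \<subseteq> Mat m" "H1 \<subseteq> Mat m"
 shows "finite (rcosets\<^bsub>GL m\<lparr>carrier := H1\<rparr>\<^esub> H)"
proof -
 let ?c = "\<lambda>a. H #>\<^bsub>GL m\<lparr>carrier := H1\<rparr>\<^esub> a"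
 have c: "?c a = (\<lambda>h. h * a) ` H" for a by (auto simp: r_coset_def)
 have sub: "?c b \<subseteq> ?c a" if ab: "a \<in> H1" "b \<in> H1" "\<chi> a = \<chi> b" for a b
 proof -
  obtain h where h: "h \<in> H" "b = h * a" using sep[OF ab] by blast
  have "k * b = (k * h) * a" if "k \<in> H" for k
  proof -
   have "k \<in> Mat m" "h \<in> Mat m" "a \<in> Mat m"
    using that h ab car by auto
   then show ?thesis unfolding h(2) by (rule assoc_mult_mat[symmetric])
  qed
  then show ?thesis unfolding c using H h by auto
 qed
 have "?c a = ?c (SOME b. b \<in> H1 \<and> \<chi> b = \<chi> a)" if "a \<in> H1" for a
 proof -
  define b where "b = (SOME b. b \<in> H1 \<and> \<chi> b = \<chi> a)"
  have "b \<in> H1 \<and> \<chi> b = \<chi> a"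
   unfolding b_def by (rule someI[of _ a]) (use that in simp)
  then show ?thesis
   using sub[of a b] sub[of b a] that unfolding b_def[symmetric] by auto
 qed
 then have "rcosets\<^bsub>GL m\<lparr>carrier := H1\<rparr>\<^esub> H \<subseteq> (\<lambda>t. ?c (SOME b. b \<in> H1 \<and> \<chi> b = t)) ` (\<chi> ` H1)"
  unfolding RCOSETS_def by auto
 then show ?thesis using fin by (meson finite_imageI finite_subset)
qed

section \<open>The two sheets of the cone\<close>

text \<open>The open future cone over \<open>hyp_space\<close>. Being convex and stable under
  positive scaling, it is easier to handle than the hyperboloid in questions of sign and
  connectedness.\<close>

definition future :: "nat => real vec set" where
 "future n = {y \<in> Vec (n + 1). lorentz n y y < 0 \<and> y $ n > 0}"

lemma timelike_nonzero: "lorentz n y y < 0 ==> y $ n ~= 0"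
 using sum_nonneg[of "{..<n}" "\<lambda>i. y $ i * y $ i"] by (auto simp: lorentz_def)

lemma lorentz_uminus_uminus: "x \<in> Vec (n + 1) ==> lorentz n (- x) (- x) = lorentz n x x"
 by (simp add: lorentz_def)

lemma future_iff_lorentz:
 assumes x: "x \<in> future n" and y: "y \<in> Vec (n + 1)" "lorentz n y y < 0"
 shows "y \<in> future n \<longleftrightarrow> lorentz n x y < 0"
proof
 show "y \<in> future n ==> lorentz n x y < 0"
  using x by (auto simp: future_def intro: lorentz_timelike_neg)
 show "lorentz n x y < 0 ==> y \<in> future n"
 proof (rule ccontr)
  assume neg: "lorentz n x y < 0" "y \<notin> future n"
  then have "(- y) $ n > 0" using timelike_nonzero[OF y(2)] y by (simp add: future_def)
  then have "- y \<in> future n" using y by (simp add: future_def lorentz_uminus_uminus)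
  then have "lorentz n (- y) x < 0" using x by (auto simp: future_def intro: lorentz_timelike_neg)
  then show False using neg x y by (simp add: lorentz_uminus_left future_def lorentz_comm[of n x y])
 qed
qed

lemma future_uminus:
 "y \<in> Vec (n + 1) ==> lorentz n y y < 0 ==> y \<in> future n \<or> - y \<in> future n"
 using timelike_nonzero[of n y] by (auto simp: future_def lorentz_uminus_uminus)

lemma future_scale_hyp_space:
 assumes "y \<in> future n"
 obtains c u where "c > 0" "u \<in> hyp_space n" "y = c \<cdot>\<^sub>v u"
proof -
 define c where "c = sqrt (- lorentz n y y)"
 have c: "c > 0" "c * c = - lorentz n y y" using assms by (auto simp: c_def future_def)
 define u where "u = (1 / c) \<cdot>\<^sub>v y"
 have y: "y \<in> Vec (n + 1)" using assms by (simp add: future_def)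
 have "lorentz n u u = (1 / c) * ((1 / c) * lorentz n y y)"
  using y by (simp add: u_def lorentz_simps)
 also have "lorentz n y y = - (c * c)" using c by simp
 finally have "u \<in> hyp_space n"
  using assms y c by (auto simp: hyp_space_iff u_def future_def)
 moreover have "y = c \<cdot>\<^sub>v u" using c y by (intro eq_vecI) (auto simp: u_def)
 ultimately show ?thesis using that c by blast
qed

lemma future_smult: "y \<in> future n ==> c > 0 ==> c \<cdot>\<^sub>v y \<in> future n"
 by (auto simp: future_def lorentz_simps mult_less_0_iff)

lemma future_add:
 assumes "x \<in> future n" "y \<in> future n"
 shows "x + y \<in> future n"
proof -
 have car: "x \<in> Vec (n + 1)" "y \<in> Vec (n + 1)" using assms by (auto simp: future_def)
 have "lorentz n x y < 0" using assms by (auto simp: future_def intro: lorentz_timelike_neg)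
 then show ?thesis
  using assms car by (auto simp: future_def lorentz_simps lorentz_comm[of n y x])
qed

definition lorentz_isometry :: "nat => real mat => bool" where
 "lorentz_isometry n g \<longleftrightarrow> g \<in> Mat (n + 1) \<and>
  (\<forall>x\<in>Vec (n + 1). \<forall>y\<in>Vec (n + 1). lorentz n (g *\<^sub>v x) (g *\<^sub>v y) = lorentz n x y)"

lemma lorentz_isometry_iff:
 assumes "g \<in> Mat (n + 1)"
 shows "lorentz_isometry n g \<longleftrightarrow> g\<^sup>T * lorentz_mat n * g = lorentz_mat n"
 using assms mult_mat_vec_carrier[OF assms]
 unfolding lorentz_isometry_def isometry_iff[OF lorentz_mat_carrier lorentz_mat_carrier assms]
 by (simp add: lorentz_bil)

lemma lorentz_isometry_mult:
 assumes "lorentz_isometry n g" "lorentz_isometry n h"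
 shows "lorentz_isometry n (g * h)"
 using assms mult_mat_vec_carrier[of h "n + 1" "n + 1"] unfolding lorentz_isometry_def
 by (auto simp: assoc_mult_mat_vec[of _ "n + 1" "n + 1" _ "n + 1"])

lemma lorentz_isometry_inverse:
 assumes g: "lorentz_isometry n g" and h: "h \<in> Mat (n + 1)" "g * h = 1\<^sub>m (n + 1)"
 shows "lorentz_isometry n h"
proof -
 have gc: "g \<in> Mat (n + 1)" using g by (simp add: lorentz_isometry_def)
 have gh: "g *\<^sub>v (h *\<^sub>v x) = x" if "x \<in> Vec (n + 1)" for x
  using assoc_mult_mat_vec[OF gc h(1) that] h(2) that by simp
 have "lorentz n (h *\<^sub>v x) (h *\<^sub>v y) = lorentz n x y"
  if "x \<in> Vec (n + 1)" "y \<in> Vec (n + 1)" for x y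
 proof -
  have "lorentz n (g *\<^sub>v (h *\<^sub>v x)) (g *\<^sub>v (h *\<^sub>v y)) = lorentz n (h *\<^sub>v x) (h *\<^sub>v y)"
   using g mult_mat_vec_carrier[OF h(1)] that unfolding lorentz_isometry_def by blast
  then show ?thesis using gh that by simp
 qed
 then show ?thesis using h(1) by (simp add: lorentz_isometry_def)
qed

text \<open>With J = \<open>lorentz_mat n\<close>, the adjoint of g with respect to the form, J g^T
  J, is its inverse.\<close>

lemma lorentz_isometry_invertible:
 assumes "lorentz_isometry n g"
 obtains h where "h \<in> Mat (n + 1)" "g * h = 1\<^sub>m (n + 1)" "h * g = 1\<^sub>m (n + 1)"
proof -
 have gc: "g \<in> Mat (n + 1)" using assms by (simp add: lorentz_isometry_def)
 have JJ: "lorentz_mat n * lorentz_mat n = 1\<^sub>m (n + 1)"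
  unfolding lorentz_mat_def mat_diag_diag by (rule eq_matI) (auto simp: mat_diag_def)
 define h where "h = lorentz_mat n * (g\<^sup>T * lorentz_mat n)"
 have h: "h \<in> Mat (n + 1)"
  using gc unfolding h_def by (intro mult_carrier_mat[of _ _ "n + 1"] transpose_carrier_mat lorentz_mat_carrier) auto
 have "h * g = lorentz_mat n * (g\<^sup>T * lorentz_mat n * g)"
  unfolding h_def using gc
  by (intro assoc_mult_mat[of _ "n + 1" "n + 1" _ "n + 1"] mult_carrier_mat[of _ _ "n + 1"] lorentz_mat_carrier) auto
 then have hg: "h * g = 1\<^sub>m (n + 1)"
  using assms gc JJ by (simp add: lorentz_isometry_iff)
 then have "g * h = 1\<^sub>m (n + 1)"
  using mat_mult_left_right_inverse[OF h gc] by simp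
 then show ?thesis using that h hg by blast
qed

lemma O_plus_iff:
 "g \<in> O_plus n \<longleftrightarrow> lorentz_isometry n g \<and> (\<forall>y\<in>future n. g *\<^sub>v y \<in> future n)"
proof
 assume g: "g \<in> O_plus n"
 then have gc: "g \<in> Mat (n + 1)" by (simp add: O_plus_def)
 have "g *\<^sub>v y \<in> future n" if y: "y \<in> future n" for y
 proof -
  obtain c u where cu: "c > 0" "u \<in> hyp_space n" "y = c \<cdot>\<^sub>v u"
   using future_scale_hyp_space[OF y] by blast
  have u: "u \<in> Vec (n + 1)" using cu by (simp add: hyp_space_iff)
  have "g *\<^sub>v u \<in> hyp_space n" using g cu(2) by (auto simp: O_plus_def)
  then have "g *\<^sub>v u \<in> future n" by (simp add: future_def hyp_space_iff)
  then show ?thesis using cu u gc by (simp add: mult_mat_vec[OF gc] future_smult)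
 qed
 then show "lorentz_isometry n g \<and> (\<forall>y\<in>future n. g *\<^sub>v y \<in> future n)"
  using O_plus_lorentz[OF g] gc by (simp add: lorentz_isometry_def)
next
 assume g: "lorentz_isometry n g \<and> (\<forall>y\<in>future n. g *\<^sub>v y \<in> future n)"
 then have gc: "g \<in> Mat (n + 1)" by (simp add: lorentz_isometry_def)
 obtain h where h: "h \<in> Mat (n + 1)" "g * h = 1\<^sub>m (n + 1)" "h * g = 1\<^sub>m (n + 1)"
  using lorentz_isometry_invertible g by blast
 have hi: "lorentz_isometry n h" using lorentz_isometry_inverse g h by blast
 have hyp: "y \<in> hyp_space n \<longleftrightarrow> y \<in> future n \<and> lorentz n y y = -1" for y
  by (auto simp: hyp_space_iff future_def)
 have fwd: "g *\<^sub>v y \<in> hyp_space n" if "y \<in> hyp_space n" for y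
  using g that unfolding hyp lorentz_isometry_def by (auto simp: future_def)
 have bwd: "h *\<^sub>v y \<in> hyp_space n" if y: "y \<in> hyp_space n" for y
 proof -
  have yc: "y \<in> Vec (n + 1)" and yy: "lorentz n y y = -1" "y \<in> future n"
   using y by (auto simp: hyp hyp_space_iff future_def)
  have hc: "h *\<^sub>v y \<in> Vec (n + 1)" using mult_mat_vec_carrier[OF h(1) yc] .
  have hh: "lorentz n (h *\<^sub>v y) (h *\<^sub>v y) = -1"
   using hi yc yy by (simp add: lorentz_isometry_def)
  have ghy: "g *\<^sub>v (h *\<^sub>v y) = y"
   using assoc_mult_mat_vec[OF gc h(1) yc] h(2) yc by simp
  have "h *\<^sub>v y \<in> future n"
  proof (rule ccontr)
   assume "h *\<^sub>v y \<notin> future n"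
   then have "- (h *\<^sub>v y) \<in> future n" using future_uminus[OF hc] hh by auto
   then have "g *\<^sub>v (- (h *\<^sub>v y)) \<in> future n" using g by blast
   moreover have "g *\<^sub>v (- (h *\<^sub>v y)) = - y"
   proof -
    have "g *\<^sub>v (- (h *\<^sub>v y)) = - (g *\<^sub>v (h *\<^sub>v y))"
     using gc hc by (intro eq_vecI) (auto simp: scalar_prod_def sum_negf)
    then show ?thesis by (simp add: ghy)
   qed
   ultimately have "(- y) $ n > 0" "y $ n > 0" using yy by (auto simp: future_def)
   then show False using yc by simp
  qed
  then show ?thesis using hh by (simp add: hyp)
 qed
 have "(\<lambda>x. g *\<^sub>v x) ` hyp_space n = hyp_space n"
 proof
  show "hyp_space n \<subseteq> (\<lambda>x. g *\<^sub>v x) ` hyp_space n"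
  proof
   fix y assume y: "y \<in> hyp_space n"
   then have "y = g *\<^sub>v (h *\<^sub>v y)"
    using assoc_mult_mat_vec[OF gc h(1), of y] h(2) by (simp add: hyp_space_iff)
   then show "y \<in> (\<lambda>x. g *\<^sub>v x) ` hyp_space n" using bwd[OF y] by blast
  qed
 qed (use fwd in auto)
 then show "g \<in> O_plus n"
  using g gc unfolding O_plus_def by (auto simp: lorentz_isometry_def lorentz_form_eq)
qed

lemma O_plus_mult: "g \<in> O_plus n ==> h \<in> O_plus n ==> g * h \<in> O_plus n"
 unfolding O_plus_iff using lorentz_isometry_mult[of n g h]
 by (auto simp: lorentz_isometry_def future_def assoc_mult_mat_vec[of _ "n + 1" "n + 1" _ "n + 1"])

lemma O_plus_one: "1\<^sub>m (n + 1) \<in> O_plus n"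
 unfolding O_plus_iff by (auto simp: lorentz_isometry_def future_def)

lemma O_plus_inverse:
 assumes g: "g \<in> O_plus n" and h: "h \<in> Mat (n + 1)" "g * h = 1\<^sub>m (n + 1)"
 shows "h \<in> O_plus n"
proof -
 have gc: "g \<in> Mat (n + 1)" using g by (simp add: O_plus_def)
 have hi: "lorentz_isometry n h" using lorentz_isometry_inverse g h by (auto simp: O_plus_iff)
 have "h *\<^sub>v y \<in> future n" if y: "y \<in> future n" for y
 proof -
  have yc: "y \<in> Vec (n + 1)" "lorentz n y y < 0" using y by (auto simp: future_def)
  have hc: "h *\<^sub>v y \<in> Vec (n + 1)" using mult_mat_vec_carrier[OF h(1) yc(1)] .
  have ghy: "g *\<^sub>v (h *\<^sub>v y) = y"
   using assoc_mult_mat_vec[OF gc h(1) yc(1)] h(2) yc by simp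
  have hh: "lorentz n (h *\<^sub>v y) (h *\<^sub>v y) < 0"
   using hi yc by (simp add: lorentz_isometry_def)
  obtain c where c: "c \<in> hyp_space n" "g *\<^sub>v c \<in> hyp_space n"
   using future_scale_hyp_space[OF y] g by (metis (mono_tags, lifting) O_plus_def image_eqI mem_Collect_eq)
  have cf: "c \<in> future n" "g *\<^sub>v c \<in> future n" using c by (auto simp: hyp_space_iff future_def)
  have "lorentz n c (h *\<^sub>v y) = lorentz n (g *\<^sub>v c) y"
   using O_plus_lorentz[OF g _ hc, of c] cf ghy by (simp add: future_def)
  then show ?thesis
   using future_iff_lorentz[OF cf(1) hc hh] future_iff_lorentz[OF cf(2) yc] y by simp
 qed
 then show ?thesis using hi by (simp add: O_plus_iff)
qed

text \<open>Phrased through the form alone, preservation of the sheets survives conjugation by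
  isometries that exchange them; products of reflections may do so.\<close>

lemma O_plus_iff_timelike:
 assumes "lorentz_isometry n g"
 shows "g \<in> O_plus n \<longleftrightarrow> (\<forall>y\<in>future n. lorentz n y (g *\<^sub>v y) < 0)"
proof -
 have gc: "g \<in> Mat (n + 1)" using assms by (simp add: lorentz_isometry_def)
 have "g *\<^sub>v y \<in> future n \<longleftrightarrow> lorentz n y (g *\<^sub>v y) < 0" if y: "y \<in> future n" for y
  using future_iff_lorentz[OF y mult_mat_vec_carrier[OF gc]] assms y
  by (simp add: lorentz_isometry_def future_def)
 then show ?thesis using assms by (auto simp: O_plus_iff)
qed

lemma O_plus_conj:
 assumes r: "lorentz_isometry n r" and g: "g \<in> O_plus n"
  and s: "s \<in> Mat (n + 1)" "r * s = 1\<^sub>m (n + 1)"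
 shows "r * g * s \<in> O_plus n"
proof -
 have rc: "r \<in> Mat (n + 1)" and gc: "g \<in> Mat (n + 1)"
  using r g by (auto simp: lorentz_isometry_def O_plus_def)
 have si: "lorentz_isometry n s" using lorentz_isometry_inverse[OF r s] .
 have gi: "lorentz_isometry n g" using g by (simp add: O_plus_iff)
 have iso: "lorentz_isometry n (r * g * s)" using r gi si lorentz_isometry_mult by blast
 show ?thesis
  unfolding O_plus_iff_timelike[OF iso]
 proof
  fix y assume y: "y \<in> future n"
  then have yc: "y \<in> Vec (n + 1)" by (simp add: future_def)
  define u where "u = s *\<^sub>v y"
  have u: "u \<in> Vec (n + 1)" using mult_mat_vec_carrier[OF s(1) yc] by (simp add: u_def)
  have ru: "r *\<^sub>v u = y"
   using assoc_mult_mat_vec[OF rc s(1) yc] s(2) yc by (simp add: u_def)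
  have gu: "g *\<^sub>v u \<in> Vec (n + 1)" using mult_mat_vec_carrier[OF gc u] .
  have "(r * g * s) *\<^sub>v y = r *\<^sub>v (g *\<^sub>v u)"
   using rc gc s yc by (simp add: u_def assoc_mult_mat_vec[of _ "n + 1" "n + 1" _ "n + 1"] mult_mat_vec_carrier[of _ _ "n + 1"])
  then have "lorentz n y ((r * g * s) *\<^sub>v y) = lorentz n u (g *\<^sub>v u)"
   using r u gu ru unfolding lorentz_isometry_def by metis
  moreover have "lorentz n u u < 0"
   using r u ru y unfolding lorentz_isometry_def future_def by (metis (mono_tags, lifting) mem_Collect_eq)
  then have "u \<in> future n \<or> - u \<in> future n" by (rule future_uminus[OF u])
  then have "lorentz n u (g *\<^sub>v u) < 0"
  proof
   assume "- u \<in> future n"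
   then have "lorentz n (- u) (g *\<^sub>v (- u)) < 0" using g gi O_plus_iff_timelike by blast
   moreover have "g *\<^sub>v (- u) = - (g *\<^sub>v u)"
    using gc u by (intro eq_vecI) (auto simp: scalar_prod_def sum_negf)
   ultimately show ?thesis
    using u gu lorentz_uminus_left[of u n "- (g *\<^sub>v u)"] lorentz_uminus_left[of "g *\<^sub>v u" n u]
    by (simp add: lorentz_comm[of n u])
  qed (use g gi O_plus_iff_timelike in blast)
  ultimately show "lorentz n y ((r * g * s) *\<^sub>v y) < 0" by simp
 qed
qed

declare One_nat_def [simp del]

section \<open>Forms of signature (n, 1)\<close>

lemma topspace_vec_topology [simp]: "topspace (vec_topology m) = Vec m"
 by (auto simp: vec_topology_def topspace_pullback_topology)

lemma continuous_map_vec_index: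
 assumes "i < m"
 shows "continuous_map (vec_topology m) euclideanreal (\<lambda>x. x $ i)"
proof -
 have "continuous_map (vec_topology m) euclideanreal ((\<lambda>f. f i) \<circ> (\<lambda>x. \<lambda>i\<in>{..<m}. x $ i))"
  unfolding vec_topology_def
  by (rule continuous_map_pullback) (use assms in \<open>auto intro: continuous_map_product_projection\<close>)
 then show ?thesis using assms by (simp add: o_def)
qed

lemma continuous_map_into_vec_topology:
 assumes "!!i. i < m ==> continuous_map Y euclideanreal (\<lambda>t. g t $ i)"
  and "!!t. t \<in> topspace Y ==> g t \<in> Vec m"
 shows "continuous_map Y (vec_topology m) g"
 unfolding vec_topology_def
proof (rule continuous_map_pullback')
 show "continuous_map Y (product_topology (\<lambda>_. euclideanreal) {..<m}) ((\<lambda>x. \<lambda>i\<in>{..<m}. x $ i) \<circ> g)"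
  unfolding continuous_map_componentwise using assms by auto
qed (use assms in auto)

lemma connected_components_of_two:
 assumes U: "openin X U" "connectedin X U" "U ~= {}" and V: "openin X V" "connectedin X V" "V ~= {}"
  and UV: "U \<inter> V = {}" "U \<union> V = topspace X"
 shows "connected_components_of X = {U, V}"
proof -
 have one: "connected_component_of_set X x = U"
  if "openin X U" "connectedin X U" "openin X V" "U \<inter> V = {}" "U \<union> V = topspace X" "x \<in> U" for U V x
 proof
  show "U \<subseteq> connected_component_of_set X x" using that by (intro connected_component_of_maximal)
  have "connectedin X (connected_component_of_set X x)"
   by (rule connectedin_connected_component_of)
  moreover have "x \<in> connected_component_of_set X x"
   using that by (auto simp: connected_component_of_refl)
  moreover have "connected_component_of_set X x \<subseteq> U \<union> V"
   using that connected_component_of_subset_topspace[of X x] by simp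
  ultimately have "V \<inter> connected_component_of_set X x = {}"
   using connectedinD[of X "connected_component_of_set X x" U V] that by blast
  then show "connected_component_of_set X x \<subseteq> U"
   using \<open>connected_component_of_set X x \<subseteq> U \<union> V\<close> by blast
 qed
 have cU: "connected_component_of_set X x = U" if "x \<in> U" for x
  using one[OF U(1,2) V(1) UV that] .
 have cV: "connected_component_of_set X x = V" if "x \<in> V" for x
  using one[OF V(1,2) U(1) _ _ that] UV by auto
 show ?thesis
 proof
  show "connected_components_of X \<subseteq> {U, V}"
   unfolding connected_components_of_def using cU cV UV(2) by auto
  show "{U, V} \<subseteq> connected_components_of X"
   unfolding connected_components_of_def using cU cV UV(2) U(3) V(3) by (auto intro!: image_eqI)
 qed
qed

text \<open>M carries the standard form to A. With the inverse Mi as a further parameter, all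
  changes of coordinates reduce to rewriting with matrix identities.\<close>

locale lorentzian_form =
 fixes n :: nat and A M Mi :: "real mat"
 assumes A: "A \<in> Mat (n + 1)" "A\<^sup>T = A"
  and M: "M \<in> Mat (n + 1)" "Mi \<in> Mat (n + 1)"
   "M * Mi = 1\<^sub>m (n + 1)" "Mi * M = 1\<^sub>m (n + 1)"
  and form: "!!x. x \<in> Vec (n + 1) ==> quad_form A (M *\<^sub>v x) = lorentz_form n x"
begin

lemma Mc: "x \<in> Vec (n + 1) ==> M *\<^sub>v x \<in> Vec (n + 1)"
 and Mic: "x \<in> Vec (n + 1) ==> Mi *\<^sub>v x \<in> Vec (n + 1)"
 using M mult_mat_vec_carrier by blast+

lemma MMi: "x \<in> Vec (n + 1) ==> M *\<^sub>v (Mi *\<^sub>v x) = x"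
 and MiM: "x \<in> Vec (n + 1) ==> Mi *\<^sub>v (M *\<^sub>v x) = x"
 using M assoc_mult_mat_vec[of M "n + 1" "n + 1" Mi "n + 1" x]
  assoc_mult_mat_vec[of Mi "n + 1" "n + 1" M "n + 1" x] by auto

lemma bil_M:
 assumes "x \<in> Vec (n + 1)" "y \<in> Vec (n + 1)"
 shows "bil A (M *\<^sub>v x) (M *\<^sub>v y) = lorentz n x y"
proof -
 have q: "bil A (M *\<^sub>v u) (M *\<^sub>v u) = bil (lorentz_mat n) u u" if "u \<in> Vec (n + 1)" for u
  using form[OF that] that by (simp add: quad_form_bil lorentz_form_eq lorentz_bil)
 have "bil A (M *\<^sub>v x) (M *\<^sub>v y) = bil (lorentz_mat n) x y"
  unfolding bil_polarize[OF A Mc[OF assms(1)] Mc[OF assms(2)]]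
   bil_polarize[OF lorentz_mat_carrier lorentz_mat_transpose assms]
  using assms by (simp add: q mult_add_distrib_mat_vec[OF M(1), symmetric])
 then show ?thesis using assms by (simp add: lorentz_bil)
qed

lemma bil_Mi:
 assumes "x \<in> Vec (n + 1)" "y \<in> Vec (n + 1)"
 shows "lorentz n (Mi *\<^sub>v x) (Mi *\<^sub>v y) = bil A x y"
 using bil_M[OF Mic[OF assms(1)] Mic[OF assms(2)]] assms by (simp add: MMi)

text \<open>The return to Lorentz coordinates, undoing the conjugation by M in
  \<open>arithmetic_simplest_type\<close>.\<close>

definition toL :: "real mat => real mat" where "toL T = Mi * T * M"

lemma toL_carrier: "T \<in> Mat (n + 1) ==> toL T \<in> Mat (n + 1)"
 using M unfolding toL_def by auto

lemma toL_vec: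
 assumes "T \<in> Mat (n + 1)" "x \<in> Vec (n + 1)"
 shows "toL T *\<^sub>v x = Mi *\<^sub>v (T *\<^sub>v (M *\<^sub>v x))"
 using assms M Mc unfolding toL_def
 by (simp add: assoc_mult_mat_vec[of _ "n + 1" "n + 1" _ "n + 1"])

lemma toL_mult:
 assumes "S \<in> Mat (n + 1)" "T \<in> Mat (n + 1)"
 shows "toL (S * T) = toL S * toL T"
proof -
 have "M * (Mi * X) = X" if "X \<in> Mat (n + 1)" for X
  using assoc_mult_mat[OF M(1,2) that] that by (simp add: M(3))
 then show ?thesis using assms M unfolding toL_def
  by (simp add: assoc_mult_mat[of _ "n + 1" "n + 1" _ "n + 1" _ "n + 1"])
qed

lemma toL_one: "toL (1\<^sub>m (n + 1)) = 1\<^sub>m (n + 1)"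
 using M by (simp add: toL_def)

lemma toL_isometry_iff:
 assumes T: "T \<in> Mat (n + 1)"
 shows "T\<^sup>T * A * T = A \<longleftrightarrow> lorentz_isometry n (toL T)"
proof -
 have Tc: "T *\<^sub>v x \<in> Vec (n + 1)" if "x \<in> Vec (n + 1)" for x
  using mult_mat_vec_carrier[OF T that] .
 show ?thesis
 proof
  assume "T\<^sup>T * A * T = A"
  then have "bil A (T *\<^sub>v x) (T *\<^sub>v y) = bil A x y"
   if "x \<in> Vec (n + 1)" "y \<in> Vec (n + 1)" for x y
   using isometry_iff[OF A(1) A(1) T] that by blast
  then show "lorentz_isometry n (toL T)"
   unfolding lorentz_isometry_def
   by (simp add: toL_carrier[OF T] toL_vec[OF T] bil_Mi Tc Mc bil_M)
 next
  assume L: "lorentz_isometry n (toL T)"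
  have "bil A (T *\<^sub>v x) (T *\<^sub>v y) = bil A x y"
   if xy: "x \<in> Vec (n + 1)" "y \<in> Vec (n + 1)" for x y
  proof -
   have "lorentz n (toL T *\<^sub>v (Mi *\<^sub>v x)) (toL T *\<^sub>v (Mi *\<^sub>v y)) = lorentz n (Mi *\<^sub>v x) (Mi *\<^sub>v y)"
    using L Mic xy unfolding lorentz_isometry_def by blast
   then show ?thesis by (simp add: toL_vec[OF T Mic] xy MMi bil_Mi Tc)
  qed
  then show "T\<^sup>T * A * T = A" using isometry_iff[OF A(1) A(1) T] by blast
 qed
qed

abbreviation sheet :: "real vec set" where "sheet \<equiv> (\<lambda>y. M *\<^sub>v y) ` future n"
abbreviation other_sheet :: "real vec set" where "other_sheet \<equiv> (\<lambda>y. M *\<^sub>v (- y)) ` future n"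

text \<open>One sheet is connected through straight segments, the other as its image under negation;
  the sign of the last coordinate of Mi x separates them into open sets.\<close>

lemma cone_components_eq: "cone_components (n + 1) A = {sheet, other_sheet}"
proof -
 define cone where "cone = {x \<in> Vec (n + 1). quad_form A x < 0}"
 define X where "X = subtopology (vec_topology (n + 1)) cone"
 have topX: "topspace X = cone" by (auto simp: X_def cone_def)
 have cone_iff: "x \<in> cone \<longleftrightarrow> x \<in> Vec (n + 1) \<and> lorentz n (Mi *\<^sub>v x) (Mi *\<^sub>v x) < 0" for x
  by (auto simp: cone_def quad_form_bil bil_Mi)
 have sheet_iff: "x \<in> sheet \<longleftrightarrow> x \<in> Vec (n + 1) \<and> Mi *\<^sub>v x \<in> future n" for x
 proof
  assume "x \<in> sheet"
  then show "x \<in> Vec (n + 1) \<and> Mi *\<^sub>v x \<in> future n"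
   using Mc MiM by (auto simp: future_def)
 next
  assume "x \<in> Vec (n + 1) \<and> Mi *\<^sub>v x \<in> future n"
  then show "x \<in> sheet" using MMi by (intro image_eqI[of _ _ "Mi *\<^sub>v x"]) auto
 qed
 have uminus_Mv: "Mi *\<^sub>v (- x) = - (Mi *\<^sub>v x)" "M *\<^sub>v (- x) = - (M *\<^sub>v x)" if "x \<in> Vec (n + 1)" for x
  using that M by (auto intro!: eq_vecI simp: scalar_prod_def sum_negf)
 have other_eq: "other_sheet = uminus ` sheet"
  using uminus_Mv by (auto simp: image_image future_def intro!: image_cong)
 have other_iff: "x \<in> other_sheet \<longleftrightarrow> x \<in> Vec (n + 1) \<and> - (Mi *\<^sub>v x) \<in> future n" for x
 proof -
  have "x \<in> other_sheet \<longleftrightarrow> - x \<in> sheet"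
   unfolding other_eq by (metis (no_types, lifting) image_iff uminus_uminus_vec)
  also have "\<dots> \<longleftrightarrow> x \<in> Vec (n + 1) \<and> - (Mi *\<^sub>v x) \<in> future n"
   unfolding sheet_iff using uminus_Mv by auto
  finally show ?thesis .
 qed
 have psi: "continuous_map X euclideanreal (\<lambda>x. (Mi *\<^sub>v x) $ n)"
 proof (rule continuous_map_eq)
  show "continuous_map X euclideanreal (\<lambda>x. \<Sum>j<n + 1. Mi $$ (n, j) * x $ j)"
   unfolding X_def
   by (intro continuous_map_sum continuous_map_real_mult continuous_map_const[THEN iffD2]
     continuous_map_from_subtopology continuous_map_vec_index) auto
  show "(\<Sum>j<n + 1. Mi $$ (n, j) * x $ j) = (Mi *\<^sub>v x) $ n" if "x \<in> topspace X" for x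
   using that M by (auto simp: topX cone_def scalar_prod_def atLeast0LessThan)
 qed
 have sheet_open: "sheet = {x \<in> topspace X. (Mi *\<^sub>v x) $ n \<in> {0<..}}"
  unfolding topX
 proof (rule Set.set_eqI)
  fix x
  show "x \<in> sheet \<longleftrightarrow> x \<in> {x \<in> cone. (Mi *\<^sub>v x) $ n \<in> {0<..}}"
   unfolding sheet_iff mem_Collect_eq cone_iff using Mic[of x] by (auto simp: future_def)
 qed
 have other_open: "other_sheet = {x \<in> topspace X. (Mi *\<^sub>v x) $ n \<in> {..<0}}"
  unfolding topX
 proof (rule Set.set_eqI)
  fix x
  show "x \<in> other_sheet \<longleftrightarrow> x \<in> {x \<in> cone. (Mi *\<^sub>v x) $ n \<in> {..<0}}"
   unfolding other_iff mem_Collect_eq cone_iff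
   using Mic[of x] M(2) by (auto simp: future_def lorentz_uminus_uminus)
 qed
 have seg: "\<exists>S. connectedin X S \<and> S \<subseteq> sheet \<and> x \<in> S \<and> y \<in> S" if xy: "x \<in> sheet" "y \<in> sheet" for x y
 proof -
  define g where "g = (\<lambda>t::real. (1 - t) \<cdot>\<^sub>v x + t \<cdot>\<^sub>v y)"
  have xc: "x \<in> Vec (n + 1)" "y \<in> Vec (n + 1)" using xy sheet_iff by auto
  have g_sheet: "g t \<in> sheet" if t: "t \<in> {0..1}" for t
  proof -
   have "Mi *\<^sub>v g t = (1 - t) \<cdot>\<^sub>v (Mi *\<^sub>v x) + t \<cdot>\<^sub>v (Mi *\<^sub>v y)"
    using xc by (simp add: g_def mult_add_distrib_mat_vec[OF M(2)] mult_mat_vec[OF M(2)])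
   moreover have F: "Mi *\<^sub>v x \<in> future n" "Mi *\<^sub>v y \<in> future n" using xy sheet_iff by auto
   moreover have "(1 - t) \<cdot>\<^sub>v (Mi *\<^sub>v x) + t \<cdot>\<^sub>v (Mi *\<^sub>v y) \<in> future n"
   proof -
    consider "t = 0" | "t = 1" | "0 < t" "t < 1" using t by force
    then show ?thesis
    proof cases
     case 1
     have "(1 - t) \<cdot>\<^sub>v (Mi *\<^sub>v x) + t \<cdot>\<^sub>v (Mi *\<^sub>v y) = Mi *\<^sub>v x"
      using 1 Mic[OF xc(1)] Mic[OF xc(2)] by (intro eq_vecI) auto
     then show ?thesis using F by simp
    next
     case 2
     have "(1 - t) \<cdot>\<^sub>v (Mi *\<^sub>v x) + t \<cdot>\<^sub>v (Mi *\<^sub>v y) = Mi *\<^sub>v y"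
      using 2 Mic[OF xc(1)] Mic[OF xc(2)] by (intro eq_vecI) auto
     then show ?thesis using F by simp
    qed (use F in \<open>auto intro!: future_add future_smult\<close>)
   qed
   ultimately show ?thesis using xc by (simp add: sheet_iff g_def)
  qed
  have "continuous_map (subtopology euclideanreal {0..1}) (vec_topology (n + 1)) g"
  proof (rule continuous_map_into_vec_topology)
   fix i assume i: "i < n + 1"
   have "continuous_map (subtopology euclideanreal {0..1}) euclideanreal (\<lambda>t. (1 - t) * x $ i + t * y $ i)"
    by (simp add: continuous_map_iff_continuous) (intro continuous_intros)
   then show "continuous_map (subtopology euclideanreal {0..1}) euclideanreal (\<lambda>t. g t $ i)"
    using i xc by (simp add: g_def)
  qed (use xc in \<open>auto simp: g_def\<close>)
  then have "continuous_map (subtopology euclideanreal {0..1}) X g"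
   unfolding X_def
  proof (rule continuous_map_into_subtopology)
   show "g \<in> topspace (top_of_set {0..1}) \<rightarrow> cone"
    using g_sheet topX sheet_open by auto
  qed
  then have "connectedin X (g ` {0..1})"
   by (rule connectedin_continuous_map_image) (simp add: connectedin_subtopology)
  moreover have "g 0 = x" "g 1 = y" using xc by (auto simp: g_def intro!: eq_vecI)
  then have "x \<in> g ` {0..1}" "y \<in> g ` {0..1}" by (force intro: image_eqI)+
  moreover have "g ` {0..1} \<subseteq> sheet" using g_sheet by blast
  ultimately show ?thesis by blast
 qed
 have "unit_vec (n + 1) n \<in> future n"
  by (simp add: future_def lorentz_def)
 then obtain x0 where x0: "x0 \<in> sheet" by blast
 have conn: "connectedin X sheet"
 proof -
  obtain S where S: "!!y. y \<in> sheet ==> connectedin X (S y) \<and> S y \<subseteq> sheet \<and> x0 \<in> S y \<and> y \<in> S y"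
   using seg[OF x0] by metis
  have "connectedin X (\<Union>(S ` sheet))"
  proof (rule connectedin_Union)
   show "connectedin X T" if "T \<in> S ` sheet" for T using that S by blast
   have "x0 \<in> \<Inter>(S ` sheet)" using S by blast
   then show "\<Inter>(S ` sheet) ~= {}" by blast
  qed
  moreover have "\<Union>(S ` sheet) = sheet" using S by blast
  ultimately show ?thesis by simp
 qed
 have conn': "connectedin X other_sheet"
  unfolding other_eq
 proof (rule connectedin_continuous_map_image[OF _ conn])
  have "continuous_map X (vec_topology (n + 1)) uminus"
  proof (rule continuous_map_into_vec_topology)
   fix i assume i: "i < n + 1"
   show "continuous_map X euclideanreal (\<lambda>t. (- t) $ i)"
   proof (rule continuous_map_eq)
    show "continuous_map X euclideanreal (\<lambda>t. - t $ i)"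
     unfolding X_def using i
     by (intro continuous_map_minus continuous_map_from_subtopology continuous_map_vec_index)
   qed (use i in \<open>auto simp: topX cone_def\<close>)
  qed (auto simp: topX cone_def)
  then show "continuous_map X X uminus"
   unfolding X_def
  proof (rule continuous_map_into_subtopology)
   show "uminus \<in> topspace (subtopology (vec_topology (n + 1)) cone) \<rightarrow> cone"
    using uminus_Mv Mic by (auto simp: cone_iff lorentz_uminus_uminus)
  qed
 qed
 have "connected_components_of X = {sheet, other_sheet}"
 proof (rule connected_components_of_two)
  show "openin X sheet" unfolding sheet_open by (rule openin_continuous_map_preimage[OF psi]) simp
  show "openin X other_sheet" unfolding other_open by (rule openin_continuous_map_preimage[OF psi]) simp
  show "sheet \<inter> other_sheet = {}" unfolding sheet_open other_open by auto
  show "sheet \<union> other_sheet = topspace X"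
  proof
   show "topspace X \<subseteq> sheet \<union> other_sheet"
   proof
    fix x assume "x \<in> topspace X"
    then have "x \<in> Vec (n + 1)" "lorentz n (Mi *\<^sub>v x) (Mi *\<^sub>v x) < 0"
     by (auto simp: topX cone_iff)
    then show "x \<in> sheet \<union> other_sheet"
     using future_uminus[OF Mic, of x] unfolding Un_iff sheet_iff other_iff by blast
   qed
  qed (auto simp: sheet_open other_open)
 qed (use conn conn' x0 in \<open>auto simp: other_eq\<close>)
 then show ?thesis by (simp add: cone_components_def X_def cone_def)
qed

text \<open>This removes topology from \<open>O_prime\<close>: with the components identified as the
  two sheets, the condition on them becomes preservation of the future cone.\<close>

lemma O_prime_iff: "T \<in> O_prime (n + 1) A R \<longleftrightarrow> T \<in> GL_over (n + 1) R \<and> toL T \<in> O_plus n"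
proof (cases "T \<in> GL_over (n + 1) R")
 case True
 then have T: "T \<in> Mat (n + 1)" by (simp add: GL_over_def)
 have TM: "T *\<^sub>v (M *\<^sub>v y) = M *\<^sub>v (toL T *\<^sub>v y)" if "y \<in> Vec (n + 1)" for y
  using that mult_mat_vec_carrier[OF T Mc] by (simp add: toL_vec[OF T] MMi)
 have Mi_inj: "y = y'" if "M *\<^sub>v y = M *\<^sub>v y'" "y \<in> Vec (n + 1)" "y' \<in> Vec (n + 1)" for y y'
  using that MiM by metis
 have img: "(\<lambda>x. T *\<^sub>v x) ` sheet = (\<lambda>y. M *\<^sub>v (toL T *\<^sub>v y)) ` future n"
  unfolding image_image by (rule image_cong) (auto simp: TM future_def)
 have neg: "toL T *\<^sub>v (- y) = - (toL T *\<^sub>v y)" if "y \<in> Vec (n + 1)" for y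
  using that toL_carrier[OF T] by (intro eq_vecI) (auto simp: scalar_prod_def sum_negf)
 have img': "(\<lambda>x. T *\<^sub>v x) ` other_sheet = (\<lambda>y. M *\<^sub>v (- (toL T *\<^sub>v y))) ` future n"
  unfolding image_image by (rule image_cong) (auto simp: TM future_def neg)
 have Lc: "toL T *\<^sub>v y \<in> Vec (n + 1)" if "y \<in> Vec (n + 1)" for y
  using mult_mat_vec_carrier[OF toL_carrier[OF T] that] .
 have "T\<^sup>T * A * T = A \<and> (\<forall>C\<in>cone_components (n + 1) A. (\<lambda>x. T *\<^sub>v x) ` C = C) \<longleftrightarrow> toL T \<in> O_plus n"
 proof
  assume L: "T\<^sup>T * A * T = A \<and> (\<forall>C\<in>cone_components (n + 1) A. (\<lambda>x. T *\<^sub>v x) ` C = C)"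
  have "toL T *\<^sub>v y \<in> future n" if y: "y \<in> future n" for y
  proof -
   have "M *\<^sub>v (toL T *\<^sub>v y) \<in> sheet"
    using L y img unfolding cone_components_eq by auto
   then obtain y' where y': "y' \<in> future n" "M *\<^sub>v (toL T *\<^sub>v y) = M *\<^sub>v y'" by auto
   then have "toL T *\<^sub>v y = y'"
    using Mi_inj[of "toL T *\<^sub>v y" y'] y Lc[of y] by (simp add: future_def)
   then show ?thesis using y' by simp
  qed
  then show "toL T \<in> O_plus n" using L toL_isometry_iff[OF T] by (simp add: O_plus_iff)
 next
  assume R: "toL T \<in> O_plus n"
  obtain h where h: "h \<in> Mat (n + 1)" "toL T * h = 1\<^sub>m (n + 1)"
   using lorentz_isometry_invertible R O_plus_iff by metis
  have hO: "h \<in> O_plus n" using O_plus_inverse[OF R h] .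
  have onto: "\<exists>y'\<in>future n. y = toL T *\<^sub>v y'" if y: "y \<in> future n" for y
  proof (intro bexI)
   show "h *\<^sub>v y \<in> future n" using hO y by (simp add: O_plus_iff)
   show "y = toL T *\<^sub>v (h *\<^sub>v y)"
    using assoc_mult_mat_vec[OF toL_carrier[OF T] h(1), of y] h(2) y by (simp add: future_def)
  qed
  have into: "toL T *\<^sub>v y \<in> future n" if "y \<in> future n" for y
   using R that by (simp add: O_plus_iff)
  have F: "(\<lambda>y. toL T *\<^sub>v y) ` future n = future n" using onto into by blast
  have "(\<lambda>x. T *\<^sub>v x) ` sheet = (\<lambda>y. M *\<^sub>v y) ` (\<lambda>y. toL T *\<^sub>v y) ` future n"
   unfolding img by (simp only: image_image)
  moreover have "(\<lambda>x. T *\<^sub>v x) ` other_sheet = (\<lambda>y. M *\<^sub>v (- y)) ` (\<lambda>y. toL T *\<^sub>v y) ` future n"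
   unfolding img' by (simp only: image_image)
  ultimately have "(\<lambda>x. T *\<^sub>v x) ` sheet = sheet" "(\<lambda>x. T *\<^sub>v x) ` other_sheet = other_sheet"
   by (simp_all only: F)
  moreover have "T\<^sup>T * A * T = A" using R toL_isometry_iff[OF T] by (simp add: O_plus_iff)
  ultimately show "T\<^sup>T * A * T = A \<and> (\<forall>C\<in>cone_components (n + 1) A. (\<lambda>x. T *\<^sub>v x) ` C = C)"
   unfolding cone_components_eq by (simp only: ball_simps simp_thms)
 qed
 then show ?thesis using True by (simp add: O_prime_def)
qed (simp add: O_prime_def)

end

section \<open>Rationality of the commensurator: congruences, reflections and approximation\<close>

section \<open>The commensurator\<close>

context subfield_of_field
begin

text \<open>Induction on \<open>I\<close>, eliminating one coordinate.\<close>

lemma annihilator: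
 assumes "finite I" and "!!f i. f \<in> V ==> i \<in> I ==> f i \<in> K" and "(\<lambda>_. 0) \<in> V"
  and "!!f g c. f \<in> V ==> g \<in> V ==> c \<in> K ==> (\<lambda>i. f i + c * g i) \<in> V"
 shows "(\<forall>f. (\<forall>i\<in>I. f i \<in> K) --> (\<exists>g\<in>V. \<forall>i\<in>I. g i = f i)) \<or>
  (\<exists>\<phi>. (\<exists>i\<in>I. \<phi> i ~= 0) \<and> (\<forall>g\<in>V. (\<Sum>i\<in>I. \<phi> i * g i) = 0))"
 using assms
proof (induction I arbitrary: V rule: finite_induct)
 case empty
 then show ?case by auto
next
 case (insert i J)
 show ?case
 proof (cases "\<forall>g\<in>V. g i = 0")
  case True
  have "(\<Sum>j\<in>insert i J. (if j = i then 1 else 0) * g j) = 0" if "g \<in> V" for g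
   using True that insert.hyps by (simp add: sum.neutral)
  then show ?thesis by (intro disjI2 exI[of _ "\<lambda>j. if j = i then 1 else 0"]) auto
 next
  case False
  then obtain u0 where u0: "u0 \<in> V" "u0 i ~= 0" by blast
  define u where "u = (\<lambda>j. inverse (u0 i) * u0 j)"
  have u: "u \<in> V" "u i = 1"
   using insert.prems(3)[OF insert.prems(2) u0(1), of "inverse (u0 i)"] insert.prems(1)[OF u0(1), of i] u0(2)
   by (auto simp: u_def inverse_mem)
  define V' where "V' = {g \<in> V. g i = 0}"
  have V': "(\<lambda>_. 0) \<in> V'" "!!f g c. f \<in> V' ==> g \<in> V' ==> c \<in> K ==> (\<lambda>i. f i + c * g i) \<in> V'"
   "!!f j. f \<in> V' ==> j \<in> J ==> f j \<in> K"
   using insert.prems by (auto simp: V'_def)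
  have "(\<forall>f. (\<forall>j\<in>J. f j \<in> K) --> (\<exists>g\<in>V'. \<forall>j\<in>J. g j = f j)) \<or>
    (\<exists>\<phi>. (\<exists>j\<in>J. \<phi> j ~= 0) \<and> (\<forall>g\<in>V'. (\<Sum>j\<in>J. \<phi> j * g j) = 0))"
  proof (rule insert.IH)
   show "f j \<in> K" if "f \<in> V'" "j \<in> J" for f j using V'(3) that .
   show "(\<lambda>i. f i + c * g i) \<in> V'" if "f \<in> V'" "g \<in> V'" "c \<in> K" for f g c using V'(2) that .
  qed (rule V'(1))
  then show ?thesis
  proof
   assume full: "\<forall>f. (\<forall>j\<in>J. f j \<in> K) --> (\<exists>g\<in>V'. \<forall>j\<in>J. g j = f j)"
   have "\<exists>g\<in>V. \<forall>j\<in>insert i J. g j = f j" if f: "\<forall>j\<in>insert i J. f j \<in> K" for f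
   proof -
    have "\<forall>j\<in>J. f j - f i * u j \<in> K"
     using f insert.prems(1)[OF u(1)] by (auto intro: diff_mem mult_mem)
    then obtain g where g: "g \<in> V'" "\<forall>j\<in>J. g j = f j - f i * u j"
     using full[rule_format, of "\<lambda>j. f j - f i * u j"] by blast
    then show ?thesis
     using insert.prems(3)[of g u "f i"] u f
     by (intro bexI[of _ "\<lambda>j. g j + f i * u j"]) (auto simp: V'_def)
   qed
   then show ?thesis by blast
  next
   assume "\<exists>\<phi>. (\<exists>j\<in>J. \<phi> j ~= 0) \<and> (\<forall>g\<in>V'. (\<Sum>j\<in>J. \<phi> j * g j) = 0)"
   then obtain \<phi> where phi: "\<exists>j\<in>J. \<phi> j ~= 0" "!!g. g \<in> V' ==> (\<Sum>j\<in>J. \<phi> j * g j) = 0" by blast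
   define \<psi> where "\<psi> = (\<lambda>j. if j = i then - (\<Sum>j\<in>J. \<phi> j * u j) else \<phi> j)"
   have psiJ: "(\<Sum>j\<in>J. \<psi> j * g j) = (\<Sum>j\<in>J. \<phi> j * g j)" for g
    using insert.hyps by (intro sum.cong) (auto simp: \<psi>_def)
   have "(\<Sum>j\<in>insert i J. \<psi> j * g j) = 0" if g: "g \<in> V" for g
   proof -
    have "(\<lambda>j. g j + (- g i) * u j) \<in> V'"
     using insert.prems(1)[OF g, of i] insert.prems(3)[OF g u(1), of "- g i"] u(2) uminus_mem
     by (auto simp: V'_def)
    from phi(2)[OF this] have "(\<Sum>j\<in>J. \<phi> j * g j) = g i * (\<Sum>j\<in>J. \<phi> j * u j)"
     by (simp add: algebra_simps sum_subtractf sum_distrib_left)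
    then show ?thesis
     using insert.hyps by (simp add: psiJ) (simp add: \<psi>_def)
   qed
   moreover have "\<exists>j\<in>insert i J. \<psi> j ~= 0" using phi(1) insert.hyps by (auto simp: \<psi>_def)
   ultimately show ?thesis by blast
  qed
 qed
qed

end

lemma mat_mult_entry:
 assumes "X \<in> Mat N" "Y \<in> Mat N" "i < N" "l < N"
 shows "(X * Y) $$ (i, l) = (\<Sum>k<N. X $$ (i, k) * Y $$ (k, l))"
 using assms by (simp add: scalar_prod_def atLeast0LessThan)

context number_field
begin

interpretation O: subring_of_field "\<O> K"
 by (rule ring_of_integers_subring)

lemma integers_subset: "\<O> K \<subseteq> K"
 by (auto simp: ring_of_integers_def)

lemma GL_over_integersI:
 assumes "T \<in> Mat N" "elements_mat T \<subseteq> \<O> K"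
  and "S \<in> Mat N" "elements_mat S \<subseteq> K" "T * S = 1\<^sub>m N" "inverse (det T) \<in> \<O> K"
 shows "T \<in> GL_over N (\<O> K)"
proof -
 have "det T * det S = 1" using det_mult[OF assms(1,3)] assms(5) by simp
 then have "det T ~= 0" by auto
 from O.elements_mat_inverse[OF assms(1,2) this assms(6)]
 obtain S' where "S' \<in> Mat N" "elements_mat S' \<subseteq> \<O> K" "T * S' = 1\<^sub>m N" "S' * T = 1\<^sub>m N"
  by metis
 then show ?thesis
  unfolding GL_over_def using assms(1,2) by auto
qed

lemma GL_over_det:
 assumes "T \<in> GL_over N (\<O> K)"
 shows "inverse (det T) \<in> \<O> K" "det T ~= 0"
proof -
 obtain S where S: "S \<in> Mat N" "elements_mat S \<subseteq> \<O> K" "T * S = 1\<^sub>m N"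
  and T: "T \<in> Mat N"
  using assms by (auto simp: GL_over_def)
 have d: "det T * det S = 1" using det_mult[OF T S(1)] S(3) by simp
 then show "det T ~= 0" by auto
 have "inverse (det T) = det S" using d by (rule inverse_unique)
 then show "inverse (det T) \<in> \<O> K" using O.det_mem[OF S(1,2)] by simp
qed

lemma common_integral_multiple:
 assumes "finite S" "S \<subseteq> K"
 obtains d :: nat where "d > 0" "!!x. x \<in> S ==> of_nat d * x \<in> \<O> K"
proof -
 have "\<exists>d::nat. d > 0 \<and> (\<forall>x\<in>S. of_nat d * x \<in> \<O> K)"
  using assms
 proof (induction S rule: finite_induct)
  case (insert y S)
  then obtain d :: nat where d: "d > 0" "\<forall>x\<in>S. of_nat d * x \<in> \<O> K" by auto
  obtain e :: nat where e: "e > 0" "of_nat e * y \<in> \<O> K"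
   using integral_multiple[of y] insert by auto
  have "of_nat (d * e) * x \<in> \<O> K" if x: "x \<in> insert y S" for x
  proof (cases "x = y")
   case True
   have "of_nat d * (of_nat e * y) \<in> \<O> K" by (intro O.mult_mem O.of_nat_mem e)
   then show ?thesis using True by (simp add: mult.assoc)
  next
   case False
   then have "of_nat d * x \<in> \<O> K" using d x by auto
   then have "of_nat e * (of_nat d * x) \<in> \<O> K" by (rule O.mult_mem[OF O.of_nat_mem])
   then show ?thesis by (simp add: algebra_simps)
  qed
  then show ?case using d e by (intro exI[of _ "d * e"]) auto
 qed (auto intro: exI[of _ 1])
 then show ?thesis using that by blast
qed

text \<open>A colour records the residues modulo d of all entries. It feeds two finiteness
  arguments: a power of an integral matrix that is congruent to 1, and finite index of a congruence
  condition.\<close>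

lemma residue_coloring:
 assumes "d > 0"
 obtains \<chi> :: "real mat => real mat" where
  "finite (\<chi> ` {T \<in> Mat N. elements_mat T \<subseteq> \<O> K})"
  "!!a b. a \<in> Mat N ==> b \<in> Mat N ==> elements_mat a \<subseteq> \<O> K ==>
   elements_mat b \<subseteq> \<O> K ==> \<chi> a = \<chi> b ==>
   \<exists>Z\<in>Mat N. elements_mat Z \<subseteq> \<O> K \<and> b = a + of_nat d \<cdot>\<^sub>m Z"
proof -
 obtain F where F: "finite F"
  "!!x. x \<in> \<O> K ==> \<exists>y\<in>F. \<exists>z\<in>\<O> K. x = y + of_nat d * z"
  using finite_residues_integers[OF assms] by metis
 then obtain \<rho> \<zeta> where rz: "!!x. x \<in> \<O> K ==> \<rho> x \<in> F \<and> \<zeta> x \<in> \<O> K \<and> x = \<rho> x + of_nat d * \<zeta> x"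
  by metis
 define \<chi> where "\<chi> = (\<lambda>T. mat N N (\<lambda>(i, j). \<rho> (T $$ (i, j))))"
 have "\<chi> ` {T \<in> Mat N. elements_mat T \<subseteq> \<O> K} \<subseteq>
   mat N N ` (({..<N} \<times> {..<N}) \<rightarrow>\<^sub>E F)"
 proof
  fix c assume "c \<in> \<chi> ` {T \<in> Mat N. elements_mat T \<subseteq> \<O> K}"
  then obtain T where T: "T \<in> Mat N" "elements_mat T \<subseteq> \<O> K" "c = \<chi> T" by blast
  define f where "f = restrict (\<lambda>(i, j). \<rho> (T $$ (i, j))) ({..<N} \<times> {..<N})"
  have "f \<in> ({..<N} \<times> {..<N}) \<rightarrow>\<^sub>E F"
   using T rz by (auto simp: f_def elements_mat_subset_iff)
  moreover have "c = mat N N f"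
   unfolding T(3) \<chi>_def f_def by (rule eq_matI) auto
  ultimately show "c \<in> mat N N ` (({..<N} \<times> {..<N}) \<rightarrow>\<^sub>E F)" by blast
 qed
 moreover have "finite (mat N N ` (({..<N} \<times> {..<N}) \<rightarrow>\<^sub>E F))"
  using F(1) by (intro finite_imageI finite_PiE) auto
 ultimately have fin: "finite (\<chi> ` {T \<in> Mat N. elements_mat T \<subseteq> \<O> K})"
  by (rule finite_subset)
 have lift: "\<exists>Z\<in>Mat N. elements_mat Z \<subseteq> \<O> K \<and> b = a + of_nat d \<cdot>\<^sub>m Z"
  if a: "a \<in> Mat N" "elements_mat a \<subseteq> \<O> K"
   and b: "b \<in> Mat N" "elements_mat b \<subseteq> \<O> K" and eq: "\<chi> a = \<chi> b" for a b
 proof (intro bexI conjI)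
  let ?Z = "mat N N (\<lambda>(i, j). \<zeta> (b $$ (i, j)) - \<zeta> (a $$ (i, j)))"
  show "?Z \<in> Mat N" by simp
  show "elements_mat ?Z \<subseteq> \<O> K"
   using a b rz by (subst elements_mat_subset_iff[of _ N N]) (auto simp: elements_mat_subset_iff intro!: O.diff_mem)
  show "b = a + of_nat d \<cdot>\<^sub>m ?Z"
  proof (rule eq_matI)
   fix i j assume "i < dim_row (a + of_nat d \<cdot>\<^sub>m ?Z)" "j < dim_col (a + of_nat d \<cdot>\<^sub>m ?Z)"
   then have ij: "i < N" "j < N" by auto
   have "\<rho> (a $$ (i, j)) = \<rho> (b $$ (i, j))"
    using arg_cong[OF eq, of "\<lambda>T. T $$ (i, j)"] ij by (simp add: \<chi>_def)
   moreover have "a $$ (i, j) = \<rho> (a $$ (i, j)) + of_nat d * \<zeta> (a $$ (i, j))"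
    "b $$ (i, j) = \<rho> (b $$ (i, j)) + of_nat d * \<zeta> (b $$ (i, j))"
    using rz a b ij by (auto simp: elements_mat_subset_iff)
   ultimately have "b $$ (i, j) = a $$ (i, j) + of_nat d * (\<zeta> (b $$ (i, j)) - \<zeta> (a $$ (i, j)))"
    by (simp add: right_diff_distrib)
   then show "b $$ (i, j) = (a + of_nat d \<cdot>\<^sub>m ?Z) $$ (i, j)" using a ij by simp
  qed (use a b in auto)
 qed
 show ?thesis by (rule that[OF fin]) (rule lift)
qed

text \<open>Since g (1 + d Z) g' = 1 + d (g Z g'), it suffices that d clears the denominators of the
  finitely many products of an entry of g with an entry of g'.\<close>

lemma integral_conj:
 assumes g: "g \<in> Mat N" "g' \<in> Mat N" "g * g' = 1\<^sub>m N"
  and K: "elements_mat g \<subseteq> K" "elements_mat g' \<subseteq> K"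
 obtains d :: nat where "d > 0"
  "!!Z. Z \<in> Mat N ==> elements_mat Z \<subseteq> \<O> K ==>
   elements_mat (g * (1\<^sub>m N + of_nat d \<cdot>\<^sub>m Z) * g') \<subseteq> \<O> K"
proof -
 define S where "S = (\<lambda>(i, j, k, l). g $$ (i, j) * g' $$ (k, l)) ` ({..<N} \<times> {..<N} \<times> {..<N} \<times> {..<N})"
 have "finite S" "S \<subseteq> K"
  using K g unfolding S_def by (auto simp: elements_mat_subset_iff intro!: mult_mem)
 then obtain d :: nat where d: "d > 0" "!!x. x \<in> S ==> of_nat d * x \<in> \<O> K"
  using common_integral_multiple by blast
 have "elements_mat (g * (1\<^sub>m N + of_nat d \<cdot>\<^sub>m Z) * g') \<subseteq> \<O> K"
  if Z: "Z \<in> Mat N" "elements_mat Z \<subseteq> \<O> K" for Z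
 proof -
  have gZ: "g * Z \<in> Mat N" using g Z by simp
  have "g * (1\<^sub>m N + of_nat d \<cdot>\<^sub>m Z) * g' = (g + of_nat d \<cdot>\<^sub>m (g * Z)) * g'"
   using g Z by (simp add: mult_add_distrib_mat[of _ N N _ N] mult_smult_distrib[of _ N N _ N])
  also have "\<dots> = 1\<^sub>m N + of_nat d \<cdot>\<^sub>m (g * Z * g')"
   using g gZ by (simp add: add_mult_distrib_mat[of _ N N _ _ N] mult_smult_assoc_mat[of _ N N _ N])
  finally have eq: "g * (1\<^sub>m N + of_nat d \<cdot>\<^sub>m Z) * g' = 1\<^sub>m N + of_nat d \<cdot>\<^sub>m (g * Z * g')" .
  have c: "1\<^sub>m N + of_nat d \<cdot>\<^sub>m (g * Z * g') \<in> Mat N" using gZ g by simp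
  show ?thesis
   unfolding eq elements_mat_subset_iff[OF c]
  proof (intro allI impI)
   fix i l assume il: "i < N" "l < N"
   have "(g * Z * g') $$ (i, l) = (\<Sum>k<N. (\<Sum>j<N. g $$ (i, j) * Z $$ (j, k)) * g' $$ (k, l))"
    unfolding mat_mult_entry[OF gZ g(2) il] using il
    by (intro sum.cong arg_cong2[of _ _ _ _ "(*)"] mat_mult_entry[OF g(1) Z(1)]) auto
   then have "of_nat d * (g * Z * g') $$ (i, l) =
     (\<Sum>k<N. \<Sum>j<N. Z $$ (j, k) * (of_nat d * (g $$ (i, j) * g' $$ (k, l))))"
    by (simp add: sum_distrib_left sum_distrib_right algebra_simps)
   also have "\<dots> \<in> \<O> K"
   proof (intro O.sum_mem)
    fix k j assume kj: "k \<in> {..<N}" "j \<in> {..<N}"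
    then have "g $$ (i, j) * g' $$ (k, l) \<in> S" using il by (force simp: S_def)
    moreover have "Z $$ (j, k) \<in> \<O> K" using Z kj by (auto simp: elements_mat_subset_iff)
    ultimately show "Z $$ (j, k) * (of_nat d * (g $$ (i, j) * g' $$ (k, l))) \<in> \<O> K"
     using d(2) O.mult_mem by blast
   qed
   finally show "(1\<^sub>m N + of_nat d \<cdot>\<^sub>m (g * Z * g')) $$ (i, l) \<in> \<O> K"
    using il gZ g by (auto intro!: O.add_mem O.one_mem O.zero_mem)
  qed
 qed
 with d(1) show ?thesis using that by blast
qed

lemma det_inverse_conj:
 fixes g :: "real mat"
 assumes "g \<in> Mat N" "g' \<in> Mat N" "g * g' = 1\<^sub>m N" "h \<in> Mat N"
 shows "det (g * h * g') = det h"
proof -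
 have "det g * det g' = 1" using det_mult[OF assms(1,2)] assms(3) by simp
 moreover have "det (g * h * g') = det g * det h * det g'"
  using assms by (simp add: det_mult[of _ N])
 ultimately show ?thesis by (simp add: algebra_simps)
qed

lemma GL_over_mult:
 assumes "S \<in> GL_over N (\<O> K)" "T \<in> GL_over N (\<O> K)"
 shows "S * T \<in> GL_over N (\<O> K)"
proof -
 obtain S' T' where *: "S' \<in> Mat N" "elements_mat S' \<subseteq> \<O> K" "S * S' = 1\<^sub>m N" "S' * S = 1\<^sub>m N"
  "T' \<in> Mat N" "elements_mat T' \<subseteq> \<O> K" "T * T' = 1\<^sub>m N" "T' * T = 1\<^sub>m N"
  "S \<in> Mat N" "T \<in> Mat N"
  using assms by (auto simp: GL_over_def)
 have "S * T * (T' * S') = S * (T * T') * S'" "T' * S' * (S * T) = T' * (S' * S) * T"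
  using *(1,5,9,10) by (simp_all add: assoc_mult_mat[of _ N N _ N _ N])
 then have E: "S * T * (T' * S') = 1\<^sub>m N" "T' * S' * (S * T) = 1\<^sub>m N" using * by simp_all
 show ?thesis
  unfolding GL_over_def
  by (intro CollectI conjI bexI[of _ "T' * S'"] mult_carrier_mat[of _ N N] O.elements_mat_mult[of _ N] E)
   (use * assms in \<open>auto simp: GL_over_def\<close>)
qed

lemma GL_over_pow:
 assumes "T \<in> GL_over N (\<O> K)"
 shows "T ^\<^sub>m k \<in> GL_over N (\<O> K)"
proof (induction k)
 case 0
 have "1\<^sub>m N \<in> GL_over N (\<O> K)"
  unfolding GL_over_def using O.elements_mat_one by (auto intro!: bexI[of _ "1\<^sub>m N"])
 moreover have "dim_row T = N" using assms by (auto simp: GL_over_def)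
 ultimately show ?case by simp
qed (use assms GL_over_mult in simp)

text \<open>Two powers of h agree modulo d, so some positive power of h is congruent to 1 and its
  conjugate is integral by \<open>integral_conj\<close>. Conjugation preserves the determinant,
  which therefore remains a unit.\<close>

lemma power_conj_integral:
 assumes g: "g \<in> Mat N" "g' \<in> Mat N" "g * g' = 1\<^sub>m N"
  and K: "elements_mat g \<subseteq> K" "elements_mat g' \<subseteq> K" and h: "h \<in> GL_over N (\<O> K)"
 obtains k where "k > 0" "g * h ^\<^sub>m k * g' \<in> GL_over N (\<O> K)"
proof -
 obtain d :: nat where d: "d > 0"
  "!!Z. Z \<in> Mat N ==> elements_mat Z \<subseteq> \<O> K ==>
   elements_mat (g * (1\<^sub>m N + of_nat d \<cdot>\<^sub>m Z) * g') \<subseteq> \<O> K"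
  using integral_conj[OF g K] by metis
 obtain \<chi> :: "real mat => real mat" where chi:
  "finite (\<chi> ` {T \<in> Mat N. elements_mat T \<subseteq> \<O> K})"
  "!!a b. a \<in> Mat N ==> b \<in> Mat N ==> elements_mat a \<subseteq> \<O> K ==>
   elements_mat b \<subseteq> \<O> K ==> \<chi> a = \<chi> b ==>
   \<exists>Z\<in>Mat N. elements_mat Z \<subseteq> \<O> K \<and> b = a + of_nat d \<cdot>\<^sub>m Z"
  using residue_coloring[OF d(1), of N] by blast
 have hk: "h ^\<^sub>m k \<in> Mat N" "elements_mat (h ^\<^sub>m k) \<subseteq> \<O> K"
  "h ^\<^sub>m k \<in> GL_over N (\<O> K)" for k
  using GL_over_pow[OF h, of k] by (auto simp: GL_over_def)
 have hc: "h \<in> Mat N" using h by (simp add: GL_over_def)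
 have "range (\<lambda>k. \<chi> (h ^\<^sub>m k)) \<subseteq> \<chi> ` {T \<in> Mat N. elements_mat T \<subseteq> \<O> K}"
  using hk by auto
 then have "finite (range (\<lambda>k. \<chi> (h ^\<^sub>m k)))" using chi(1) by (rule finite_subset)
 then have "\<not> inj (\<lambda>k. \<chi> (h ^\<^sub>m k))" using finite_imageD infinite_UNIV_nat by blast
 then obtain i j where ij: "i < j" "\<chi> (h ^\<^sub>m i) = \<chi> (h ^\<^sub>m j)"
  by (metis (no_types, lifting) injI linorder_neqE_nat)
 obtain Z where Z: "Z \<in> Mat N" "elements_mat Z \<subseteq> \<O> K" "h ^\<^sub>m j = h ^\<^sub>m i + of_nat d \<cdot>\<^sub>m Z"
  using chi(2)[OF hk(1) hk(1) hk(2) hk(2) ij(2)] by blast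
 obtain s where s: "s \<in> Mat N" "elements_mat s \<subseteq> \<O> K" "h ^\<^sub>m i * s = 1\<^sub>m N" "s * h ^\<^sub>m i = 1\<^sub>m N"
  using hk(3)[of i] unfolding GL_over_def by blast
 define k where "k = j - i"
 have "s * h ^\<^sub>m j = h ^\<^sub>m k"
 proof -
  have "h ^\<^sub>m j = h ^\<^sub>m i * h ^\<^sub>m k" using pow_mat_add_GL[OF hc, of i k] ij by (simp add: k_def)
  then show ?thesis using assoc_mult_mat[OF s(1) hk(1)[of i] hk(1)[of k]] s left_mult_one_mat[OF hk(1)[of k]] by simp
 qed
 moreover have "s * h ^\<^sub>m j = 1\<^sub>m N + of_nat d \<cdot>\<^sub>m (s * Z)"
  unfolding Z(3) using s Z hk(1)[of i] by (simp add: mult_add_distrib_mat[of _ N N _ N] mult_smult_distrib[of _ N N _ N])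
 ultimately have "g * h ^\<^sub>m k * g' = g * (1\<^sub>m N + of_nat d \<cdot>\<^sub>m (s * Z)) * g'" by simp
 then have int: "elements_mat (g * h ^\<^sub>m k * g') \<subseteq> \<O> K"
  using d(2)[of "s * Z"] O.elements_mat_mult[OF s(1) Z(1) s(2) Z(2)] s Z by simp
 obtain t where t: "t \<in> Mat N" "elements_mat t \<subseteq> \<O> K" "h ^\<^sub>m k * t = 1\<^sub>m N"
  using hk(3)[of k] unfolding GL_over_def by blast
 have g'g: "g' * g = 1\<^sub>m N" using mat_mult_left_right_inverse[OF g(1,2,3)] .
 have c: "g * h ^\<^sub>m k * g' \<in> Mat N" using g hk(1)[of k] by simp
 have "(g * h ^\<^sub>m k * g') * (g * t * g') = g * (h ^\<^sub>m k * (g' * g) * t) * g'"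
  using g(1,2) t(1) hk(1)[of k] by (simp add: assoc_mult_mat[of _ N N _ N _ N])
 also have "\<dots> = 1\<^sub>m N" using g(1,2,3) t hk(1)[of k] right_mult_one_mat[OF hk(1)[of k]] right_mult_one_mat[OF g(1)] by (simp add: g'g)
 finally have inv: "(g * h ^\<^sub>m k * g') * (g * t * g') = 1\<^sub>m N" .
 have "elements_mat (g * t * g') \<subseteq> K"
  using g t K integers_subset by (intro elements_mat_mult[of _ N] mult_carrier_mat[of _ N N]) auto
 then have "g * h ^\<^sub>m k * g' \<in> GL_over N (\<O> K)"
  using c int inv g t GL_over_det[OF hk(3)[of k]] det_inverse_conj[OF g hk(1)[of k]]
  by (intro GL_over_integersI[of _ N "g * t * g'"]) auto
 moreover have "k > 0" using ij by (simp add: k_def)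
 ultimately show ?thesis using that by blast
qed

end

section \<open>Reflections\<close>

text \<open>Isotropic vectors off a hyperplane span: test vectors with coordinates \<open>\<plusminus>1\<close>, \<open>\<plusminus>3/5\<close>, \<open>\<plusminus>4/5\<close>.\<close>

lemma null_vectors_span:
 fixes l \<kappa> :: "nat => real"
 assumes n: "n \<ge> 2" and "i0 < n + 1" "\<kappa> i0 ~= 0"
  and null: "!!x. x \<in> Vec (n + 1) ==> lorentz n x x = 0 ==>
   (\<Sum>i<n + 1. \<kappa> i * x $ i) ~= 0 ==> (\<Sum>i<n + 1. l i * x $ i) = 0"
  and "i < n + 1"
 shows "l i = 0"
proof -
 have prod: "(\<Sum>i<n + 1. l i * x $ i) * (\<Sum>i<n + 1. \<kappa> i * x $ i) = 0"
  if "x \<in> Vec (n + 1)" "lorentz n x x = 0" for x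
  using null[OF that] by auto
 \<comment> \<open>On every isotropic vector one of the two functionals vanishes, hence so does
   their product. It is evaluated on a e_i + b e_j + e_n, isotropic because a^2 + b^2 = 1.\<close>
 have two: "(a * l i + b * l j + l n) * (a * \<kappa> i + b * \<kappa> j + \<kappa> n) = 0"
  if ij: "i < n" "j < n" "i ~= j" and ab: "a\<^sup>2 + b\<^sup>2 = 1" for i j a b
 proof -
  define x where "x = vec (n + 1) (\<lambda>k. if k = i then a else if k = j then b else if k = n then 1 else 0)"
  have sum3: "(\<Sum>k<n. h k * x $ k) = h i * a + h j * b" for h :: "nat => real"
  proof -
   have "(\<Sum>k<n. h k * x $ k) = (\<Sum>k<n. (if k = i then h i * a else 0) + (if k = j then h j * b else 0))"
    using ij by (intro sum.cong) (auto simp: x_def)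
   then show ?thesis using ij by (simp add: sum.distrib)
  qed
  have xn: "x $ n = 1" using ij by (simp add: x_def)
  have xij: "x $ i = a" "x $ j = b" using ij by (auto simp: x_def)
  have "lorentz n x x = 0"
   using sum3[of "\<lambda>k. x $ k"] ab by (simp add: lorentz_def xn xij power2_eq_square)
  moreover have "(\<Sum>k<n + 1. h k * x $ k) = a * h i + b * h j + h n" for h :: "nat => real"
   using sum3[of h] xn by (simp add: sum.lessThan_Suc[of _ n, unfolded Suc_eq_plus1])
  moreover have "x \<in> Vec (n + 1)" by (simp add: x_def)
  ultimately show ?thesis using prod[of x] by simp
 qed
 have one: "l i * \<kappa> i + l n * \<kappa> n = 0 \<and> l i * \<kappa> n + l n * \<kappa> i = 0" if i: "i < n" for i
 proof -
  obtain j where j: "j < n" "j ~= i"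
   using n i by (metis One_nat_def Suc_1 Suc_le_lessD less_trans nat_neq_iff zero_less_one zero_neq_one not_less_zero less_Suc_eq)
  show ?thesis
   using two[OF i j(1) j(2)[symmetric], of 1 0] two[OF i j(1) j(2)[symmetric], of "-1" 0]
   by (simp add: algebra_simps)
 qed
 \<comment> \<open>The triple 3, 4, 5 supplies points of the circle with both coordinates nonzero;
   together with \<open>one\<close> they isolate the mixed coefficient.\<close>
 have mixed: "l i * \<kappa> j + l j * \<kappa> i = 0" if ij: "i < n" "j < n" "i ~= j" for i j
 proof -
  have "(3/5)\<^sup>2 + (4/5)\<^sup>2 = (1::real)" "(3/5)\<^sup>2 + (-4/5)\<^sup>2 = (1::real)"
   "(-3/5)\<^sup>2 + (4/5)\<^sup>2 = (1::real)" "(-3/5)\<^sup>2 + (-4/5)\<^sup>2 = (1::real)"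
   by (simp_all add: power2_eq_square)
  from this[THEN two[OF ij]] one[OF ij(1)] one[OF ij(2)] show ?thesis
   by (simp add: algebra_simps)
 qed
 have all0: "l n = 0 \<and> (\<forall>i<n. l i = 0)"
 proof (cases "\<kappa> n = 0")
  case True
  then obtain j where j: "j < n" "\<kappa> j ~= 0" using assms(2,3) by (metis less_Suc_eq Suc_eq_plus1)
  have ln: "l n = 0" using one[OF j(1)] True j by simp
  have lj: "l j = 0" using one[OF j(1)] True j by simp
  have "l i = 0" if "i < n" for i using mixed[OF that j(1)] lj j by (cases "i = j") auto
  with ln show ?thesis by blast
 next
  case False
  have li: "l i = - l n * \<kappa> i / \<kappa> n" if "i < n" for i
   using one[OF that] False by (simp add: field_simps)
  have "l n = 0"
  proof (rule ccontr)
   assume ln: "l n ~= 0"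
   have sq: "(\<kappa> i)\<^sup>2 = (\<kappa> n)\<^sup>2" if "i < n" for i
    using one[OF that] li[OF that] False ln by (simp add: field_simps power2_eq_square)
   \<comment> \<open>All spatial values of \<kappa> have the same nonzero square as
     \<open>\<kappa> n\<close>, so the mixed relation for the indices 0 and 1 is
     contradictory.\<close>
   have "l 0 * \<kappa> 1 + l 1 * \<kappa> 0 = 0" using n by (intro mixed) auto
   then have "l n * (\<kappa> 0 * \<kappa> 1) = 0"
    using li[of 0] li[of 1] n False by (simp add: field_simps)
   then have "\<kappa> 0 = 0 \<or> \<kappa> 1 = 0" using ln by simp
   then show False using sq[of 0] sq[of 1] n False by auto
  qed
  then show ?thesis using li by simp
 qed
 then show ?thesis using assms(5) by (metis less_Suc_eq Suc_eq_plus1)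
qed

text \<open>The explicit entries show that the reflection is defined over K whenever A and u are;
  \<open>reflect\<close> is the same map on vectors, where the geometry is computed.\<close>

definition refl_mat :: "nat => real mat => real vec => real mat" where
 "refl_mat N A u = mat N N (\<lambda>(i, j). (if i = j then 1 else 0) - 2 / bil A u u * (u $ i * (A *\<^sub>v u) $ j))"

definition reflect :: "real mat => real vec => real vec => real vec" where
 "reflect A u x = x + (- (2 * bil A x u / bil A u u)) \<cdot>\<^sub>v u"

context lorentzian_form
begin

abbreviation N where "N \<equiv> n + 1"

lemma refl_mat_carrier [simp]: "refl_mat N A u \<in> Mat N"
 by (simp add: refl_mat_def)

lemma refl_mat_vec:
 assumes u: "u \<in> Vec N" and x: "x \<in> Vec N"
 shows "refl_mat N A u *\<^sub>v x = reflect A u x"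
proof (rule eq_vecI)
 have Au: "A *\<^sub>v u \<in> Vec N" using mult_mat_vec_carrier[OF A(1) u] .
 show "dim_vec (refl_mat N A u *\<^sub>v x) = dim_vec (reflect A u x)"
  using assms by (simp add: refl_mat_def reflect_def)
 fix i assume "i < dim_vec (reflect A u x)"
 then have i: "i < N" using u by (simp add: reflect_def)
 have "(refl_mat N A u *\<^sub>v x) $ i =
   (\<Sum>j<N. ((if i = j then 1 else 0) - 2 / bil A u u * (u $ i * (A *\<^sub>v u) $ j)) * x $ j)"
  using i x by (simp add: refl_mat_def scalar_prod_def atLeast0LessThan)
 also have "\<dots> = (\<Sum>j<N. (if i = j then x $ j else 0) - 2 / bil A u u * u $ i * (x $ j * (A *\<^sub>v u) $ j))"
  by (intro sum.cong) (auto simp: algebra_simps)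
 also have "\<dots> = x $ i - 2 / bil A u u * u $ i * (\<Sum>j<N. x $ j * (A *\<^sub>v u) $ j)"
  using i by (simp add: sum_subtractf sum_distrib_left)
 also have "(\<Sum>j<N. x $ j * (A *\<^sub>v u) $ j) = bil A x u"
  using Au carrier_vecD[OF Au] by (simp add: bil_def scalar_prod_def atLeast0LessThan del: dim_mult_mat_vec)
 finally show "(refl_mat N A u *\<^sub>v x) $ i = reflect A u x $ i"
  using i u x by (simp add: reflect_def)
qed

lemma reflect_carrier: "u \<in> Vec N ==> x \<in> Vec N ==> reflect A u x \<in> Vec N"
 by (simp add: reflect_def)

lemmas bil_simps = bil_add_left[OF A(1)] bil_add_right[OF A(1)] bil_smult_left[OF A(1)] bil_smult_right[OF A(1)]

lemma reflect_isometry: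
 assumes u: "u \<in> Vec N" "bil A u u ~= 0" and xy: "x \<in> Vec N" "y \<in> Vec N"
 shows "bil A (reflect A u x) (reflect A u y) = bil A x y"
 using assms unfolding reflect_def
 by (simp add: bil_simps bil_sym[OF A u(1) xy(2)])

lemma reflect_involution:
 assumes u: "u \<in> Vec N" "bil A u u ~= 0" and x: "x \<in> Vec N"
 shows "reflect A u (reflect A u x) = x"
proof -
 have "bil A (reflect A u x) u = - bil A x u"
  unfolding reflect_def using u x by (simp add: bil_simps)
 then show ?thesis
  unfolding reflect_def[of A u "reflect A u x"] using u x
  by (intro eq_vecI) (auto simp: reflect_def)
qed

lemma mat_eqI_vec:
 fixes S T :: "real mat"
 assumes "S \<in> Mat N" "T \<in> Mat N"
  and "!!x. x \<in> Vec N ==> S *\<^sub>v x = T *\<^sub>v x"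
 shows "S = T"
proof (rule eq_matI)
 fix i j assume "i < dim_row T" "j < dim_col T"
 then have ij: "i < N" "j < N" using assms by auto
 have "(S *\<^sub>v unit_vec N j) $ i = (T *\<^sub>v unit_vec N j) $ i" using assms(3)[of "unit_vec N j"] by simp
 then show "S $$ (i, j) = T $$ (i, j)" using assms(1,2) ij by simp
qed (use assms in auto)

lemma refl_mat_involution:
 assumes u: "u \<in> Vec N" "bil A u u ~= 0"
 shows "refl_mat N A u * refl_mat N A u = 1\<^sub>m N"
proof (rule mat_eqI_vec)
 fix x :: "real vec" assume x: "x \<in> Vec N"
 have "(refl_mat N A u * refl_mat N A u) *\<^sub>v x = refl_mat N A u *\<^sub>v (refl_mat N A u *\<^sub>v x)"
  by (rule assoc_mult_mat_vec[OF refl_mat_carrier refl_mat_carrier x])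
 also have "\<dots> = x" using u x by (simp add: refl_mat_vec reflect_carrier reflect_involution)
 finally show "(refl_mat N A u * refl_mat N A u) *\<^sub>v x = 1\<^sub>m N *\<^sub>v x" using x by simp
qed (auto intro!: mult_carrier_mat[of _ N N])

lemma refl_mat_over:
 assumes "subfield_of_field K" and u: "u \<in> Vec N" "!!i. i < N ==> u $ i \<in> K" and "elements_mat A \<subseteq> K"
 shows "elements_mat (refl_mat N A u) \<subseteq> K"
proof -
 interpret K: subfield_of_field K by fact
 have AK: "A $$ (i, j) \<in> K" if "i < N" "j < N" for i j
  using assms(4) that elements_mat_subset_iff[OF A(1)] by blast
 have "bil A u u \<in> K"
  unfolding bil_sum[OF A(1) u(1) u(1)] using u AK by (intro K.sum_mem K.mult_mem) auto
 moreover have "(A *\<^sub>v u) $ j \<in> K" if "j < N" for j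
  using that u(1) A(1) by (auto simp: scalar_prod_def intro!: K.sum_mem K.mult_mem AK u(2))
 moreover have "2 \<in> K" using K.of_nat_mem[of 2] by simp
 ultimately show ?thesis
  using u(2) by (subst elements_mat_subset_iff[OF refl_mat_carrier])
   (auto simp: refl_mat_def intro!: K.uminus_mem K.diff_mem K.mult_mem K.divide_mem K.one_mem K.zero_mem)
qed

text \<open>The reflection in the difference of two isotropic vectors exchanges them. Rescaling x by
  s gives a one-parameter family of reflections, all of which send v into the line of x.\<close>

lemma reflect_swap:
 assumes v: "v \<in> Vec N" "bil A v v = 0" and x: "x \<in> Vec N" "bil A x x = 0"
  and vx: "bil A v x ~= 0" and s: "s ~= 0"
 defines "u \<equiv> v + (- s) \<cdot>\<^sub>v x"
 shows "u \<in> Vec N" "bil A u u = - 2 * s * bil A v x" "reflect A u v = s \<cdot>\<^sub>v x"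
proof -
 show u: "u \<in> Vec N" using v x by (simp add: u_def)
 show uu: "bil A u u = - 2 * s * bil A v x"
  unfolding u_def using v x by (simp add: bil_simps bil_sym[OF A x(1) v(1)])
 have vu: "bil A v u = - s * bil A v x"
  unfolding u_def using v x by (simp add: bil_simps)
 have "2 * bil A v u / bil A u u = 1" using vx s unfolding uu vu by simp
 then show "reflect A u v = s \<cdot>\<^sub>v x"
  unfolding reflect_def using v x by (intro eq_vecI) (auto simp: u_def)
qed

text \<open>Reflections move a pair of isotropic lines far enough to detect every bilinear form.\<close>

lemma bilinear_zero_if_reflections:
 assumes n: "n \<ge> 2" and B: "B \<in> Mat N"
  and v: "v \<in> Vec N" "bil A v v = 0" and w: "w \<in> Vec N" "bil A v w ~= 0"
  and zero: "!!u1 u2. u1 \<in> Vec N ==> u2 \<in> Vec N ==> bil A u1 u1 ~= 0 ==>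
   bil A u2 u2 ~= 0 ==> bil B (reflect A u1 (reflect A u2 v)) (reflect A u1 (reflect A u2 w)) = 0"
 shows "B = 0\<^sub>m N N"
proof -
 note Bs = bil_add_left[OF B] bil_add_right[OF B] bil_smult_left[OF B] bil_smult_right[OF B]
 \<comment> \<open>A fixed reflection takes v to v1, and the reflections of the family in s take v1
   into the line of x; the assumed vanishing becomes a polynomial relation of degree two in
   s.\<close>
 have step1: "bil B x v1 = 0"
  if v1: "v1 \<in> Vec N" "bil A v1 v1 = 0" "bil A v v1 ~= 0"
   and x: "x \<in> Vec N" "bil A x x = 0" "bil A v1 x ~= 0" for v1 x
 proof -
  define u2 where "u2 = v + (- 1) \<cdot>\<^sub>v v1"
  note sw = reflect_swap[OF v v1(1,2,3), of 1, folded u2_def]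
  have u2: "u2 \<in> Vec N" "bil A u2 u2 ~= 0" and rv: "reflect A u2 v = v1"
   using sw v1 by simp_all
  define w1 where "w1 = reflect A u2 w"
  have w1: "w1 \<in> Vec N" using u2 w by (simp add: w1_def reflect_carrier)
  have c: "bil A w1 v1 ~= 0"
   using reflect_isometry[OF u2 v(1) w(1)] w(2) bil_sym[OF A w1 v1(1)] by (simp add: rv w1_def)
  define e where "e = bil A w1 x"
  have P: "s * (bil A v1 x * bil B x w1 - bil A w1 v1 * bil B x x - e * bil B x v1) +
    bil A w1 v1 * bil B x v1 + s * s * (e * bil B x x) = 0" if s: "s ~= 0" for s
  proof -
   define u where "u = v1 + (- s) \<cdot>\<^sub>v x"
   note sw1 = reflect_swap[OF v1(1,2) x s, folded u_def]
   have u: "u \<in> Vec N" "bil A u u ~= 0" using sw1 x s by simp_all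
   define k where "k = 2 * bil A w1 u / bil A u u"
   have wu: "bil A w1 u = bil A w1 v1 - s * e"
    unfolding u_def e_def using w1 v1 x by (simp add: bil_simps)
   have k: "k * (s * bil A v1 x) = - (bil A w1 v1 - s * e)"
    using x s unfolding k_def wu sw1(2) by (simp add: field_simps)
   have "0 = bil B (s \<cdot>\<^sub>v x) (reflect A u w1)"
    using zero[OF u(1) u2(1) u(2) u2(2)] by (simp add: rv w1_def sw1(3))
   also have "reflect A u w1 = w1 + (- k) \<cdot>\<^sub>v u" by (simp add: reflect_def k_def)
   also have "bil B (s \<cdot>\<^sub>v x) (w1 + (- k) \<cdot>\<^sub>v u) = s * (bil B x w1 - k * (bil B x v1 - s * bil B x x))"
    using x w1 u v1 by (simp add: Bs u_def algebra_simps)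
   finally have "bil B x w1 - k * (bil B x v1 - s * bil B x x) = 0" using s by simp
   then have "(s * bil A v1 x) * (bil B x w1 - k * (bil B x v1 - s * bil B x x)) = 0" by simp
   then have "s * bil A v1 x * bil B x w1 - (k * (s * bil A v1 x)) * (bil B x v1 - s * bil B x x) = 0"
    by (simp add: algebra_simps)
   then show ?thesis unfolding k by (simp add: algebra_simps)
  qed
  define a b c where "a = bil A v1 x * bil B x w1 - bil A w1 v1 * bil B x x - e * bil B x v1"
   "b = bil A w1 v1 * bil B x v1" "c = e * bil B x x"
  have "s * a + b + s * s * c = 0" if "s ~= 0" for s
   using P[OF that] by (simp only: a_b_c_def)
  \<comment> \<open>The value s = 0 is excluded, so the constant coefficient b is extracted from
    three nonzero values of s.\<close>
  from this[of 1] this[of "-1"] this[of 2] have "b = 0" by simp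
  then have "bil A w1 v1 * bil B x v1 = 0" by (simp only: a_b_c_def)
  then show ?thesis using c by simp
 qed
 \<comment> \<open>The isotropic vectors not orthogonal to y span the space: this is
   \<open>null_vectors_span\<close> transported by M, with \<kappa> the coordinates of the
   functional that pairs with y.\<close>
 have span: "l = 0\<^sub>v N"
  if l: "l \<in> Vec N" and y: "y \<in> Vec N" "y ~= 0\<^sub>v N"
   and lx: "!!x. x \<in> Vec N ==> bil A x x = 0 ==> bil A y x ~= 0 ==> x \<bullet> l = 0" for l y
 proof -
  define l' where "l' = M\<^sup>T *\<^sub>v l"
  define \<kappa> where "\<kappa> = M\<^sup>T *\<^sub>v (A *\<^sub>v y)"
  have Ay: "A *\<^sub>v y \<in> Vec N" using mult_mat_vec_carrier[OF A(1) y(1)] .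
  have MT: "M\<^sup>T \<in> Mat N" using M(1) by simp
  have car: "l' \<in> Vec N" "\<kappa> \<in> Vec N"
   using mult_mat_vec_carrier[OF MT l] mult_mat_vec_carrier[OF MT Ay] by (auto simp: l'_def \<kappa>_def)
  have tr: "(\<Sum>i<N. (M\<^sup>T *\<^sub>v a) $ i * x $ i) = (M *\<^sub>v x) \<bullet> a" if "a \<in> Vec N" "x \<in> Vec N" for a x
  proof -
   have "(\<Sum>i<N. (M\<^sup>T *\<^sub>v a) $ i * x $ i) = (M\<^sup>T *\<^sub>v a) \<bullet> x"
    using that by (simp add: scalar_prod_def atLeast0LessThan del: index_mult_mat_vec)
   also have "\<dots> = a \<bullet> (M *\<^sub>v x)" by (rule transpose_vec_mult_scalar[OF M(1) that(2,1)])
   finally show ?thesis using comm_scalar_prod[OF that(1) Mc[OF that(2)]] by simp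
  qed
  have inj: "a = 0\<^sub>v N" if a: "a \<in> Vec N" and z: "!!i. i < N ==> (M\<^sup>T *\<^sub>v a) $ i = 0" for a
  proof (rule eq_vecI)
   fix i assume "i < dim_vec (0\<^sub>v N :: real vec)"
   then have i: "i < N" by simp
   have "0 = (M *\<^sub>v (Mi *\<^sub>v unit_vec N i)) \<bullet> a"
    using tr[OF a Mic[of "unit_vec N i"]] z by simp
   then show "a $ i = 0\<^sub>v N $ i" using i a by (simp add: MMi)
  qed (use a in simp)
  have "A *\<^sub>v y ~= 0\<^sub>v N"
  proof
   assume "A *\<^sub>v y = 0\<^sub>v N"
   then have "bil A x y = 0" if "x \<in> Vec N" for x using that by (simp add: bil_def)
   then have L: "lorentz n x (Mi *\<^sub>v y) = 0" if "x \<in> Vec N" for x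
    using bil_Mi[of "M *\<^sub>v x" y] that Mc MiM y by simp
   have "Mi *\<^sub>v y = 0\<^sub>v N"
   proof (rule eq_vecI)
    fix i assume "i < dim_vec (0\<^sub>v N :: real vec)"
    then have i: "i < N" by simp
    have "lorentz n (unit_vec N i) (Mi *\<^sub>v y) = (if i < n then (Mi *\<^sub>v y) $ i else - (Mi *\<^sub>v y) $ i)"
    proof (cases "i < n")
     case True
     have "(\<Sum>k<n. unit_vec N i $ k * (Mi *\<^sub>v y) $ k) = (\<Sum>k<n. if k = i then (Mi *\<^sub>v y) $ i else 0)"
      using True by (intro sum.cong) (auto simp del: index_mult_mat_vec)
     then show ?thesis using True by (simp add: lorentz_def del: index_mult_mat_vec)
    next
     case False
     then have "i = n" using i by simp
     have "(\<Sum>k<n. unit_vec N i $ k * (Mi *\<^sub>v y) $ k) = (\<Sum>k<n. 0)"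
      using \<open>i = n\<close> by (intro sum.cong) (auto simp del: index_mult_mat_vec)
     then show ?thesis using \<open>i = n\<close> by (simp add: lorentz_def del: index_mult_mat_vec)
    qed
    then show "(Mi *\<^sub>v y) $ i = 0\<^sub>v N $ i"
     using L[of "unit_vec N i"] i by (auto split: if_splits simp del: index_mult_mat_vec)
   qed (use carrier_vecD[OF Mic[OF y(1)]] in simp)
   then have "y = M *\<^sub>v 0\<^sub>v N" using MMi[OF y(1)] by simp
   also have "\<dots> = 0\<^sub>v N" using M(1) by (intro eq_vecI) auto
   finally show False using y(2) by simp
  qed
  then obtain i0 where i0: "i0 < N" "\<kappa> $ i0 ~= 0" using inj[OF Ay] unfolding \<kappa>_def by blast
  have "l' $ i = 0" if "i < N" for i
  proof (rule null_vectors_span[OF n i0(1), of "\<lambda>i. \<kappa> $ i" "\<lambda>i. l' $ i"])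
   fix x assume x: "x \<in> Vec N" "lorentz n x x = 0" "(\<Sum>i<N. \<kappa> $ i * x $ i) ~= 0"
   have "bil A (M *\<^sub>v x) y ~= 0" using x tr[OF Ay x(1)] by (simp add: \<kappa>_def bil_def)
   then have "(M *\<^sub>v x) \<bullet> l = 0"
    using lx[OF Mc[OF x(1)]] bil_M[OF x(1) x(1)] x(2) bil_sym[OF A y(1) Mc[OF x(1)]] by simp
   then show "(\<Sum>i<N. l' $ i * x $ i) = 0" using tr[OF l x(1)] by (simp add: l'_def)
  qed (use i0 that in auto)
  then show "l = 0\<^sub>v N" using inj[OF l] by (simp add: l'_def)
 qed
 have v0: "v ~= 0\<^sub>v N" using w A(1) by (auto simp: bil_def)
 have step2: "B *\<^sub>v v1 = 0\<^sub>v N"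
  if v1: "v1 \<in> Vec N" "bil A v1 v1 = 0" "bil A v v1 ~= 0" for v1
 proof (rule span)
  show "B *\<^sub>v v1 \<in> Vec N" using mult_mat_vec_carrier[OF B v1(1)] .
  show "v1 ~= 0\<^sub>v N" using v1 bil_sum[OF A(1) v(1), of v1] by auto
  show "x \<bullet> (B *\<^sub>v v1) = 0" if "x \<in> Vec N" "bil A x x = 0" "bil A v1 x ~= 0" for x
   using step1[OF v1 that] by (simp add: bil_def)
 qed (rule v1(1))
 have "row B i = 0\<^sub>v N" if i: "i < N" for i
 proof (rule span[OF _ v(1) v0])
  show "row B i \<in> Vec N" using B i by simp
  fix x assume x: "x \<in> Vec N" "bil A x x = 0" "bil A v x ~= 0"
  have "(B *\<^sub>v x) $ i = 0" using step2[OF x] i by simp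
  then show "x \<bullet> row B i = 0" using B i x comm_scalar_prod[of x N "row B i"] by simp
 qed
 then show ?thesis
  using B by (intro eq_matI) (auto, metis carrier_matD index_row(1) index_zero_vec(1))
qed

end

lemma rat_sequence: "\<exists>r :: nat => real. (\<forall>k. r k \<in> \<rat>) \<and> r \<longlonglongrightarrow> x" for x :: real
proof -
 have "\<exists>q. q \<in> \<rat> \<and> x < q \<and> q < x + inverse (real (Suc k))" for k
  using Rats_dense_in_real[of x "x + inverse (real (Suc k))"] by auto
 then obtain r where r: "!!k. r k \<in> \<rat> \<and> x < r k \<and> r k < x + inverse (real (Suc k))" by metis
 have "r \<longlonglongrightarrow> x"
 proof (rule tendsto_sandwich[of "\<lambda>_. x" r sequentially "\<lambda>k. x + inverse (real (Suc k))"])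
  show "(\<lambda>k. x + inverse (real (Suc k))) \<longlonglongrightarrow> x"
   using tendsto_add[OF tendsto_const LIMSEQ_inverse_real_of_nat, of x] by simp
 qed (use r in \<open>auto intro!: always_eventually less_imp_le\<close>)
 with r show ?thesis by blast
qed

lemma mat_of_entries: "X \<in> carrier_mat m k ==> mat m k (\<lambda>p. X $$ p) = X"
 by (intro eq_matI) auto

text \<open>For the pairing tr(X^T Y) of matrices, multiplications by S and S' on one side are
  adjoint to those by the transposes on the other.\<close>

lemma mat_pairing:
 fixes X S Q S' :: "real mat"
 assumes "X \<in> Mat N" "S \<in> Mat N" "Q \<in> Mat N" "S' \<in> Mat N"
 shows "(\<Sum>a<N. \<Sum>b<N. X $$ (a, b) * (S * Q * S') $$ (a, b)) =
  (\<Sum>c<N. \<Sum>d<N. (S\<^sup>T * X * S'\<^sup>T) $$ (c, d) * Q $$ (c, d))"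
proof -
 have SQ: "S * Q \<in> Mat N" "S\<^sup>T * X \<in> Mat N" "S\<^sup>T \<in> Mat N" "S'\<^sup>T \<in> Mat N"
  using assms by auto
 have 1: "(S * Q * S') $$ (a, b) = (\<Sum>d<N. \<Sum>c<N. S $$ (a, c) * Q $$ (c, d) * S' $$ (d, b))"
  if "a < N" "b < N" for a b
  unfolding mat_mult_entry[OF SQ(1) assms(4) that]
  using that by (intro sum.cong) (simp_all add: mat_mult_entry[OF assms(2,3)] sum_distrib_right del: index_mult_mat)
 have 2: "(S\<^sup>T * X * S'\<^sup>T) $$ (c, d) = (\<Sum>b<N. \<Sum>a<N. S $$ (a, c) * X $$ (a, b) * S' $$ (d, b))"
  if "c < N" "d < N" for c d
  unfolding mat_mult_entry[OF SQ(2,4) that]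
  using that assms by (intro sum.cong) (simp_all add: mat_mult_entry[OF SQ(3) assms(1)] sum_distrib_right del: index_mult_mat)
 have "(\<Sum>a<N. \<Sum>b<N. X $$ (a, b) * (S * Q * S') $$ (a, b)) =
   (\<Sum>a<N. \<Sum>b<N. \<Sum>d<N. \<Sum>c<N. X $$ (a, b) * (S $$ (a, c) * Q $$ (c, d) * S' $$ (d, b)))"
  by (intro sum.cong) (simp_all add: 1 sum_distrib_left)
 also have "\<dots> = (\<Sum>a<N. \<Sum>d<N. \<Sum>b<N. \<Sum>c<N. X $$ (a, b) * (S $$ (a, c) * Q $$ (c, d) * S' $$ (d, b)))"
  by (intro sum.cong refl sum.swap)
 also have "\<dots> = (\<Sum>d<N. \<Sum>a<N. \<Sum>b<N. \<Sum>c<N. X $$ (a, b) * (S $$ (a, c) * Q $$ (c, d) * S' $$ (d, b)))"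
  by (rule sum.swap)
 also have "\<dots> = (\<Sum>d<N. \<Sum>a<N. \<Sum>c<N. \<Sum>b<N. X $$ (a, b) * (S $$ (a, c) * Q $$ (c, d) * S' $$ (d, b)))"
  by (intro sum.cong refl sum.swap)
 also have "\<dots> = (\<Sum>d<N. \<Sum>c<N. \<Sum>a<N. \<Sum>b<N. X $$ (a, b) * (S $$ (a, c) * Q $$ (c, d) * S' $$ (d, b)))"
  by (intro sum.cong refl sum.swap)
 also have "\<dots> = (\<Sum>c<N. \<Sum>d<N. \<Sum>a<N. \<Sum>b<N. X $$ (a, b) * (S $$ (a, c) * Q $$ (c, d) * S' $$ (d, b)))"
  by (rule sum.swap)
 also have "\<dots> = (\<Sum>c<N. \<Sum>d<N. \<Sum>b<N. \<Sum>a<N. X $$ (a, b) * (S $$ (a, c) * Q $$ (c, d) * S' $$ (d, b)))"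
  by (intro sum.cong refl sum.swap)
 also have "\<dots> = (\<Sum>c<N. \<Sum>d<N. (S\<^sup>T * X * S'\<^sup>T) $$ (c, d) * Q $$ (c, d))"
  by (intro sum.cong) (simp_all add: 2 sum_distrib_left sum_distrib_right algebra_simps)
 finally show ?thesis .
qed

context lorentzian_form
begin

definition vtends :: "(nat => real vec) => real vec => bool" where
 "vtends U u \<longleftrightarrow> (\<forall>k. U k \<in> Vec N) \<and> u \<in> Vec N \<and> (\<forall>i<N. (\<lambda>k. U k $ i) \<longlonglongrightarrow> u $ i)"

lemma vtends_const: "u \<in> Vec N ==> vtends (\<lambda>_. u) u"
 by (simp add: vtends_def)

lemma bil_tendsto:
 assumes "B \<in> Mat N" "vtends U u" "vtends V v"
 shows "(\<lambda>k. bil B (U k) (V k)) \<longlonglongrightarrow> bil B u v"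
proof -
 have "(\<lambda>k. \<Sum>i<N. \<Sum>j<N. U k $ i * B $$ (i, j) * V k $ j) \<longlonglongrightarrow> (\<Sum>i<N. \<Sum>j<N. u $ i * B $$ (i, j) * v $ j)"
  using assms by (intro tendsto_intros) (auto simp: vtends_def)
 then show ?thesis using assms by (simp add: bil_sum[of B N] vtends_def)
qed

lemma reflect_vtends:
 assumes U: "vtends U u" and X: "vtends X x" and q: "bil A u u ~= 0"
 shows "vtends (\<lambda>k. reflect A (U k) (X k)) (reflect A u x)"
 unfolding vtends_def
proof (intro conjI allI impI)
 fix i assume i: "i < N"
 have "(\<lambda>k. X k $ i + (- (2 * bil A (X k) (U k) / bil A (U k) (U k))) * U k $ i) \<longlonglongrightarrow>
   x $ i + (- (2 * bil A x u / bil A u u)) * u $ i"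
  using U X q i by (intro tendsto_intros bil_tendsto[OF A(1)]) (auto simp: vtends_def)
 moreover have "reflect A y z $ i = z $ i + (- (2 * bil A z y / bil A y y)) * y $ i"
  if "y \<in> Vec N" "z \<in> Vec N" for y z
  using that i by (simp add: reflect_def)
 ultimately show "(\<lambda>k. reflect A (U k) (X k) $ i) \<longlonglongrightarrow> reflect A u x $ i"
  using U X by (simp add: vtends_def)
qed (use U X in \<open>auto simp: vtends_def reflect_def\<close>)

text \<open>Vectors with rational coordinates are dense, and the reflected value depends
  continuously on u1 and u2 away from isotropic vectors; so vanishing over K implies vanishing over
  \<real>.\<close>

lemma reflections_density:
 assumes K: "real_subfield K" and B: "B \<in> Mat N" and vw: "v \<in> Vec N" "w \<in> Vec N"
  and zero: "!!u1 u2. u1 \<in> Vec N ==> u2 \<in> Vec N ==> (!!i. i < N ==> u1 $ i \<in> K) ==>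
   (!!i. i < N ==> u2 $ i \<in> K) ==> bil A u1 u1 ~= 0 ==> bil A u2 u2 ~= 0 ==>
   bil B (reflect A u1 (reflect A u2 v)) (reflect A u1 (reflect A u2 w)) = 0"
  and u: "u1 \<in> Vec N" "u2 \<in> Vec N" "bil A u1 u1 ~= 0" "bil A u2 u2 ~= 0"
 shows "bil B (reflect A u1 (reflect A u2 v)) (reflect A u1 (reflect A u2 w)) = 0"
proof -
 have seq: "\<exists>U. vtends U u \<and> (\<forall>k. \<forall>i<N. U k $ i \<in> K)" if u: "u \<in> Vec N" for u
 proof -
  have "\<forall>i. \<exists>r :: nat => real. (\<forall>k. r k \<in> \<rat>) \<and> r \<longlonglongrightarrow> u $ i"
   using rat_sequence by blast
  then obtain r :: "nat => nat => real" where r: "!!i. (\<forall>k. r i k \<in> \<rat>) \<and> r i \<longlonglongrightarrow> u $ i"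
   by (metis (no_types))
  have "r i k \<in> K" for i k
   using r[of i] real_subfield.Rats_mem[OF K] by (metis Rats_cases)
  moreover have "vtends (\<lambda>k. vec N (\<lambda>i. r i k)) u"
   using r u by (simp add: vtends_def)
  ultimately show ?thesis by (intro exI[of _ "\<lambda>k. vec N (\<lambda>i. r i k)"]) simp
 qed
 obtain U1 where U1: "vtends U1 u1" "!!k i. i < N ==> U1 k $ i \<in> K" using seq[OF u(1)] by blast
 obtain U2 where U2: "vtends U2 u2" "!!k i. i < N ==> U2 k $ i \<in> K" using seq[OF u(2)] by blast
 have car: "U1 k \<in> Vec N" "U2 k \<in> Vec N" for k using U1 U2 by (auto simp: vtends_def)
 let ?F = "\<lambda>k. bil B (reflect A (U1 k) (reflect A (U2 k) v)) (reflect A (U1 k) (reflect A (U2 k) w))"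
 have lim: "?F \<longlonglongrightarrow> bil B (reflect A u1 (reflect A u2 v)) (reflect A u1 (reflect A u2 w))"
  by (intro bil_tendsto[OF B] reflect_vtends U1 U2 u vtends_const vw)
 have "eventually (\<lambda>k. bil A (U1 k) (U1 k) ~= 0) sequentially" "eventually (\<lambda>k. bil A (U2 k) (U2 k) ~= 0) sequentially"
  using tendsto_imp_eventually_ne[OF bil_tendsto[OF A(1) U1(1) U1(1)] u(3)]
   tendsto_imp_eventually_ne[OF bil_tendsto[OF A(1) U2(1) U2(1)] u(4)] by auto
 then have "eventually (\<lambda>k. ?F k = 0) sequentially"
  by eventually_elim (use zero[OF car] U1(2) U2(2) in blast)
 then have "?F \<longlonglongrightarrow> 0" by (rule tendsto_eventually)
 then show ?thesis using LIMSEQ_unique[OF lim] by simp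
qed

lemma toL_pow:
 assumes T: "T \<in> Mat N"
 shows "toL (T ^\<^sub>m k) = toL T ^\<^sub>m k"
proof (induction k)
 case 0
 then show ?case using T toL_one toL_carrier[OF T] by simp
next
 case (Suc k)
 then show ?case using T toL_mult[OF pow_carrier_mat[OF T] T] by simp
qed

lemma of_toL:
 assumes T: "T \<in> Mat N"
 shows "M * toL T * Mi = T"
proof -
 have "M * toL T * Mi = (M * Mi) * T * (M * Mi)"
  using T M(1,2) unfolding toL_def by (simp add: assoc_mult_mat[of _ N N _ N _ N])
 then show ?thesis using T M left_mult_one_mat[OF T] right_mult_one_mat[OF T] by simp
qed

lemma A_invertible:
 obtains Ai where "Ai \<in> Mat N" "A * Ai = 1\<^sub>m N"
proof -
 have "M\<^sup>T * A * M = lorentz_mat n"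
  using isometry_iff[OF A(1) lorentz_mat_carrier M(1)] bil_M by (simp add: lorentz_bil)
 moreover have "lorentz_mat n * lorentz_mat n = 1\<^sub>m N"
  unfolding lorentz_mat_def mat_diag_diag by (rule eq_matI) (auto simp: mat_diag_def)
 then have "det (lorentz_mat n) * det (lorentz_mat n) = 1"
  using det_mult[OF lorentz_mat_carrier lorentz_mat_carrier, of n] by simp
 moreover have "M\<^sup>T \<in> Mat N" "M\<^sup>T * A \<in> Mat N" using M(1) A(1) by auto
 ultimately have "det A ~= 0"
  using det_mult[of "M\<^sup>T * A" N M] det_mult[of "M\<^sup>T" N A] M(1) A(1) by auto
 then show ?thesis
  using subring_of_field.elements_mat_inverse[OF subfield_of_field.axioms(1)[OF subfield_UNIV] A(1)] that
  by (metis UNIV_I top_greatest)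
qed

text \<open>V is the K-space of matrices over K that stay over K when conjugated by T. If it is
  proper, some nonzero real functional X annihilates it. V contains powers of integral conjugates of
  the hyperbolic element; in the limit X annihilates a rank one matrix for every product r of two
  reflections over K, and \<open>bilinear_zero_if_reflections\<close> gives X A = 0.\<close>

lemma commensurator_rational:
 assumes n: "n \<ge> 2" and K: "number_field K" and AK: "elements_mat A \<subseteq> K"
  and T: "T \<in> Mat N" "Ti \<in> Mat N" "T * Ti = 1\<^sub>m N"
  and g: "toL T \<in> O_plus n" and nf: "null_frame n v w"
  and gv: "toL T *\<^sub>v v = \<mu> \<cdot>\<^sub>v v" "toL T *\<^sub>v w = inverse \<mu> \<cdot>\<^sub>v w" and mu: "\<mu> > 1"
  and pow: "k0 > 0" "T ^\<^sub>m k0 \<in> O_prime N A (\<O> K)"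
  and comm: "!!y. y \<in> O_prime N A (\<O> K) ==> \<exists>k>0. elements_mat (T * y ^\<^sub>m k * Ti) \<subseteq> K"
  and Y: "Y \<in> Mat N" "elements_mat Y \<subseteq> K"
 shows "elements_mat (T * Y * Ti) \<subseteq> K"
proof -
 interpret K: number_field K by (rule K)
 define I where "I = {..<N} \<times> {..<N}"
 define V where "V = {f. (\<forall>p\<in>I. f p \<in> K) \<and> elements_mat (T * mat N N f * Ti) \<subseteq> K}"
 have TiT: "Ti * T = 1\<^sub>m N" using mat_mult_left_right_inverse[OF T] .
 have conj_c: "T * X * Ti \<in> Mat N" if "X \<in> Mat N" for X using that T by auto
 have V0: "(\<lambda>_. 0) \<in> V"
 proof -
  have "T * mat N N (\<lambda>_. 0) * Ti = 0\<^sub>m N N"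
  proof -
   have "mat N N (\<lambda>_. 0 :: real) = 0\<^sub>m N N" by (rule eq_matI) auto
   then show ?thesis using T by simp
  qed
  then show ?thesis using elements_0_mat[of N N] K.zero_mem unfolding V_def by auto
 qed
 have Vlin: "(\<lambda>p. f p + c * h p) \<in> V" if f: "f \<in> V" and h: "h \<in> V" and c: "c \<in> K" for f h c
 proof -
  have e: "mat N N (\<lambda>p. f p + c * h p) = mat N N f + c \<cdot>\<^sub>m mat N N h" by (rule eq_matI) auto
  have "T * mat N N (\<lambda>p. f p + c * h p) * Ti = T * mat N N f * Ti + c \<cdot>\<^sub>m (T * mat N N h * Ti)"
  proof -
   have "T * (mat N N f + c \<cdot>\<^sub>m mat N N h) = T * mat N N f + c \<cdot>\<^sub>m (T * mat N N h)"
    using T by (simp add: mult_add_distrib_mat[of _ N N _ N] mult_smult_distrib[of _ N N _ N])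
   moreover have "(T * mat N N f + c \<cdot>\<^sub>m (T * mat N N h)) * Ti = T * mat N N f * Ti + c \<cdot>\<^sub>m (T * mat N N h * Ti)"
   proof -
    have c1: "T * mat N N f \<in> Mat N" "T * mat N N h \<in> Mat N"
     "c \<cdot>\<^sub>m (T * mat N N h) \<in> Mat N" using T by auto
    show ?thesis
     unfolding add_mult_distrib_mat[OF c1(1,3) T(2)] mult_smult_assoc_mat[OF c1(2) T(2)] ..
   qed
   ultimately show ?thesis unfolding e by simp
  qed
  moreover have "elements_mat (T * mat N N f * Ti + c \<cdot>\<^sub>m (T * mat N N h * Ti)) \<subseteq> K"
  proof -
   have c2: "T * mat N N f * Ti \<in> Mat N" "T * mat N N h * Ti \<in> Mat N"
    by (intro conj_c mat_carrier)+
   have c3: "T * mat N N f * Ti + c \<cdot>\<^sub>m (T * mat N N h * Ti) \<in> Mat N" using c2 by simp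
   have fK: "\<forall>i<N. \<forall>j<N. (T * mat N N f * Ti) $$ (i, j) \<in> K" "\<forall>i<N. \<forall>j<N. (T * mat N N h * Ti) $$ (i, j) \<in> K"
    using f h unfolding V_def elements_mat_subset_iff[OF c2(1), symmetric] elements_mat_subset_iff[OF c2(2), symmetric]
    by auto
   show ?thesis
    unfolding elements_mat_subset_iff[OF c3]
   proof (intro allI impI)
    fix i j assume ij: "i < N" "j < N"
    have "(T * mat N N f * Ti + c \<cdot>\<^sub>m (T * mat N N h * Ti)) $$ (i, j) =
      (T * mat N N f * Ti) $$ (i, j) + c * (T * mat N N h * Ti) $$ (i, j)"
     using ij carrier_matD[OF c2(2)] by (simp del: index_mult_mat)
    then show "(T * mat N N f * Ti + c \<cdot>\<^sub>m (T * mat N N h * Ti)) $$ (i, j) \<in> K"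
     using fK ij c by (metis K.add_mem K.mult_mem)
   qed
  qed
  ultimately show ?thesis
   using f h c unfolding V_def by (auto intro!: K.add_mem K.mult_mem)
 qed
 have "(\<forall>f. (\<forall>i\<in>I. f i \<in> K) --> (\<exists>g\<in>V. \<forall>i\<in>I. g i = f i)) \<or>
   (\<exists>\<phi>. (\<exists>i\<in>I. \<phi> i ~= 0) \<and> (\<forall>g\<in>V. (\<Sum>i\<in>I. \<phi> i * g i) = 0))"
 proof (rule K.annihilator)
  show "finite I" by (simp add: I_def)
 qed (use V0 Vlin in \<open>auto simp: V_def\<close>)
 then show ?thesis
 proof
  assume full: "\<forall>f. (\<forall>i\<in>I. f i \<in> K) --> (\<exists>g\<in>V. \<forall>i\<in>I. g i = f i)"
  have "\<forall>p\<in>I. Y $$ p \<in> K" using Y by (auto simp: I_def elements_mat_subset_iff)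
  then obtain f where f: "f \<in> V" "\<forall>p\<in>I. f p = Y $$ p" using full[rule_format, of "\<lambda>p. Y $$ p"] by blast
  have "mat N N f = Y" using f(2) Y by (intro eq_matI) (auto simp: I_def)
  then show ?thesis using f(1) by (simp add: V_def)
 next
  assume "\<exists>\<phi>. (\<exists>i\<in>I. \<phi> i ~= 0) \<and> (\<forall>g\<in>V. (\<Sum>i\<in>I. \<phi> i * g i) = 0)"
  then obtain \<phi> where phi: "\<exists>i\<in>I. \<phi> i ~= (0::real)" "!!f. f \<in> V ==> (\<Sum>i\<in>I. \<phi> i * f i) = 0" by blast
  define X where "X = mat N N \<phi>"
  have X: "X \<in> Mat N" by (simp add: X_def)
  have car: "v \<in> Vec N" "w \<in> Vec N" using nf by (auto simp: null_frame_def)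
  have XA: "X * A \<in> Mat N" using X A(1) by simp
  have zero: "bil (X * A) (reflect A u1 (reflect A u2 (M *\<^sub>v v))) (reflect A u1 (reflect A u2 (M *\<^sub>v w))) = 0"
   if u: "u1 \<in> Vec N" "u2 \<in> Vec N" and uK: "!!i. i < N ==> u1 $ i \<in> K" "!!i. i < N ==> u2 $ i \<in> K"
    and q: "bil A u1 u1 ~= 0" "bil A u2 u2 ~= 0" for u1 u2
  proof -
   define R1 R2 where "R1 = refl_mat N A u1" "R2 = refl_mat N A u2"
   have Rc: "R1 \<in> Mat N" "R2 \<in> Mat N" by (auto simp: R1_R2_def)
   have RR: "R1 * R1 = 1\<^sub>m N" "R2 * R2 = 1\<^sub>m N"
    using refl_mat_involution u q by (auto simp: R1_R2_def)
   have RK: "elements_mat R1 \<subseteq> K" "elements_mat R2 \<subseteq> K"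
    using refl_mat_over[OF K.subfield_of_field_axioms _ _ AK] u uK by (auto simp: R1_R2_def)
   define r r' where "r = R1 * R2" "r' = R2 * R1"
   have rc: "r \<in> Mat N" "r' \<in> Mat N" using Rc by (auto simp: r_r'_def)
   have rr': "r * r' = 1\<^sub>m N"
   proof -
    have "r * r' = R1 * (R2 * R2) * R1"
     using Rc unfolding r_r'_def by (simp add: assoc_mult_mat[of _ N N _ N _ N])
    then show ?thesis using RR Rc right_mult_one_mat[OF Rc(1)] by simp
   qed
   have rK: "elements_mat r \<subseteq> K" "elements_mat r' \<subseteq> K"
    using K.elements_mat_mult Rc RK unfolding r_r'_def by blast+
   have rvec: "r *\<^sub>v x = reflect A u1 (reflect A u2 x)" if "x \<in> Vec N" for x
    using assoc_mult_mat_vec[OF Rc that] that u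
    by (simp add: r_r'_def R1_R2_def refl_mat_vec reflect_carrier)
   have riso: "bil A (r *\<^sub>v x) (r *\<^sub>v y) = bil A x y" if "x \<in> Vec N" "y \<in> Vec N" for x y
    using that u q by (simp add: rvec reflect_isometry reflect_carrier)
   have rL: "lorentz_isometry n (toL r)"
    using toL_isometry_iff[OF rc(1)] isometry_iff[OF A(1) A(1) rc(1)] riso by blast
   have rL1: "toL r * toL r' = 1\<^sub>m N"
    using toL_mult[OF rc] rr' toL_one by simp
   define h where "h = T ^\<^sub>m k0"
   have h: "h \<in> GL_over N (\<O> K)" "h \<in> Mat N" "toL h \<in> O_plus n"
    using pow(2) O_prime_iff T by (auto simp: h_def)
   \<comment> \<open>The conjugate of h by r is over K but not necessarily integral; a suitable
     power of it is.\<close>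
   obtain k1 where k1: "k1 > 0" "r * h ^\<^sub>m k1 * r' \<in> GL_over N (\<O> K)"
    using K.power_conj_integral[OF rc rr' rK h(1)] by blast
   define y where "y = r * h ^\<^sub>m k1 * r'"
   have hk: "h ^\<^sub>m k \<in> Mat N" for k using h(2) by simp
   have yc: "y \<in> Mat N" unfolding y_def by (rule mult_carrier_mat[OF mult_carrier_mat[OF rc(1) hk] rc(2)])
   have "toL y = toL r * toL (h ^\<^sub>m k1) * toL r'"
    using toL_mult[OF mult_carrier_mat[OF rc(1) hk] rc(2)] toL_mult[OF rc(1) hk] by (simp add: y_def)
   moreover have "toL h ^\<^sub>m k \<in> O_plus n" for k
    by (induction k) (use h O_plus_mult O_plus_one toL_carrier[OF h(2)] in auto)
   ultimately have "toL y \<in> O_plus n"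
    using O_plus_conj[OF rL _ toL_carrier[OF rc(2)] rL1, of "toL (h ^\<^sub>m k1)"] by (simp add: toL_pow[OF h(2)])
   then have yO: "y \<in> O_prime N A (\<O> K)" using k1 O_prime_iff by (simp add: y_def)
   obtain k2 where k2: "k2 > 0" "elements_mat (T * y ^\<^sub>m k2 * Ti) \<subseteq> K" using comm[OF yO] by blast
   have yK: "elements_mat (y ^\<^sub>m k) \<subseteq> K" for k
   proof -
    have "elements_mat y \<subseteq> K"
     using k1(2) K.integers_subset unfolding y_def[symmetric] GL_over_def by blast
    then show ?thesis by (rule K.elements_mat_pow[OF yc])
   qed
   have ypow: "y ^\<^sub>m k = r * h ^\<^sub>m (k1 * k) * r'" for k
   proof (induction k)
    case 0
    then show ?case using rr' rc yc h(2) right_mult_one_mat[OF rc(1)] by simp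
   next
    case (Suc k)
    have r'r: "r' * r = 1\<^sub>m N" using mat_mult_left_right_inverse[OF rc rr'] .
    have "y ^\<^sub>m Suc k = (r * h ^\<^sub>m (k1 * k) * r') * (r * h ^\<^sub>m k1 * r')" using Suc by (simp add: y_def)
    also have "\<dots> = r * (h ^\<^sub>m (k1 * k) * (r' * r) * h ^\<^sub>m k1) * r'"
     using rc hk[of "k1 * k"] hk[of k1] by (simp add: assoc_mult_mat[of _ N N _ N _ N])
    also have "h ^\<^sub>m (k1 * k) * (r' * r) * h ^\<^sub>m k1 = h ^\<^sub>m (k1 * k + k1)"
     using pow_mat_add_GL[OF h(2), of "k1 * k" k1] right_mult_one_mat[OF hk[of "k1 * k"]] r'r by simp
    finally show ?case by (simp add: add.commute)
   qed
   have Tpow: "T * y ^\<^sub>m (k2 * Suc j) * Ti = (T * y ^\<^sub>m k2 * Ti) ^\<^sub>m Suc j" for j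
   proof (induction j)
    case 0
    then show ?case using left_mult_one_mat[OF conj_c[OF pow_carrier_mat[OF yc], of k2]] carrier_matD[OF conj_c[OF pow_carrier_mat[OF yc], of k2]] by (simp add: One_nat_def)
   next
    case (Suc j)
    have yk: "y ^\<^sub>m k \<in> Mat N" for k using yc by simp
    have "(T * y ^\<^sub>m k2 * Ti) ^\<^sub>m Suc (Suc j) = (T * y ^\<^sub>m (k2 * Suc j) * Ti) * (T * y ^\<^sub>m k2 * Ti)"
     unfolding Suc by simp
    also have "\<dots> = T * (y ^\<^sub>m (k2 * Suc j) * (Ti * T) * y ^\<^sub>m k2) * Ti"
     using T(1,2) yk[of "k2 * Suc j"] yk[of k2] by (simp add: assoc_mult_mat[of _ N N _ N _ N] del: mult_Suc_right)
    also have "y ^\<^sub>m (k2 * Suc j) * (Ti * T) * y ^\<^sub>m k2 = y ^\<^sub>m (k2 * Suc j + k2)"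
     using pow_mat_add_GL[OF yc, of "k2 * Suc j" k2] right_mult_one_mat[OF yk[of "k2 * Suc j"]] TiT by simp
    finally show ?case by (simp add: add.commute)
   qed
   \<comment> \<open>The exponents chosen so far combine: \<open>y ^ (k2 (j + 1))\<close> is the
     conjugate by r of \<open>T ^ (m (j + 1))\<close>, so one arithmetic progression of powers of a
     single hyperbolic element is tested against X.\<close>
   define m where "m = k0 * k1 * k2"
   define S S' where "S = r * M" "S' = Mi * r'"
   have Sc: "S \<in> Mat N" "S' \<in> Mat N" using rc M by (auto simp: S_S'_def)
   have gc: "toL T \<in> Mat N" using toL_carrier[OF T(1)] .
   have yg: "y ^\<^sub>m (k2 * Suc j) = S * (toL T ^\<^sub>m (m * Suc j)) * S'" for j
   proof -
    have "h ^\<^sub>m k = T ^\<^sub>m (k0 * k)" for k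
    proof (induction k)
     case (Suc k)
     have "h ^\<^sub>m Suc k = T ^\<^sub>m (k0 * k) * T ^\<^sub>m k0" using Suc by (simp add: h_def)
     then show ?case using pow_mat_add_GL[OF T(1), of "k0 * k" k0] by (simp add: add.commute)
    qed (use T h_def in simp)
    then have "h ^\<^sub>m (k1 * (k2 * Suc j)) = T ^\<^sub>m (m * Suc j)" by (simp add: m_def algebra_simps)
    also have "\<dots> = M * (toL T ^\<^sub>m (m * Suc j)) * Mi"
     using of_toL[OF pow_carrier_mat[OF T(1)], of "m * Suc j"] toL_pow[OF T(1)] by simp
    finally have e: "h ^\<^sub>m (k1 * (k2 * Suc j)) = M * (toL T ^\<^sub>m (m * Suc j)) * Mi" .
    have gk: "toL T ^\<^sub>m (m * Suc j) \<in> Mat N" using gc by (rule pow_carrier_mat)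
    show ?thesis
     unfolding ypow e S_S'_def using rc M(1,2) gk by (simp add: assoc_mult_mat[of _ N N _ N _ N] del: mult_Suc_right)
   qed
   have vanish: "(\<Sum>a<N. \<Sum>b<N. X $$ (a, b) * (S * (toL T ^\<^sub>m (m * Suc j)) * S') $$ (a, b)) = 0" for j
   proof -
    define f where "f = (\<lambda>p. (y ^\<^sub>m (k2 * Suc j)) $$ p)"
    have yk: "y ^\<^sub>m (k2 * Suc j) \<in> Mat N" using yc by (rule pow_carrier_mat)
    have mf: "mat N N f = y ^\<^sub>m (k2 * Suc j)" unfolding f_def by (rule mat_of_entries[OF yk])
    have "\<forall>p\<in>I. f p \<in> K"
     using yK[of "k2 * Suc j"] elements_mat_subset_iff[OF yk, of K] unfolding f_def I_def by blast
    moreover have "elements_mat (T * mat N N f * Ti) \<subseteq> K"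
     unfolding mf Tpow using conj_c[OF pow_carrier_mat[OF yc]] k2(2) by (rule K.elements_mat_pow)
    ultimately have "f \<in> V" by (simp add: V_def)
    from phi(2)[OF this] have "(\<Sum>a<N. \<Sum>b<N. \<phi> (a, b) * f (a, b)) = 0"
     unfolding I_def by (simp add: sum.cartesian_product)
    then show ?thesis unfolding f_def yg by (simp add: X_def del: index_mult_mat mult_Suc_right)
   qed
   have gk: "toL T ^\<^sub>m k \<in> Mat N" for k using gc by (rule pow_carrier_mat)
   have Z: "(\<Sum>a<N. \<Sum>b<N. (S\<^sup>T * X * S'\<^sup>T) $$ (a, b) * (toL T ^\<^sub>m (m * Suc j)) $$ (a, b)) = 0" for j
    using vanish[of j] mat_pairing[OF X Sc(1) gk Sc(2), of "m * Suc j"] by simp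
   have m0: "m > 0" using pow k1 k2 by (simp add: m_def)
   \<comment> \<open>Q is the matrix of x -> <w, x> v, the limit direction of the powers of
     \<open>toL T\<close>. Its conjugate S Q S' has the entries of the product of the vector p with
     the covector A q', so that pairing with X gives the bilinear form X A at p and q'.\<close>
   define Q where "Q = mat N N (\<lambda>(a, b). v $ a * lorentz n w (unit_vec N b))"
   have Q: "Q \<in> Mat N" by (simp add: Q_def)
   have "(\<Sum>a<N. \<Sum>b<N. (S\<^sup>T * X * S'\<^sup>T) $$ (a, b) * Q $$ (a, b)) = 0"
    using O_plus_power_functional[OF g nf gv mu m0, of "\<lambda>a b. (S\<^sup>T * X * S'\<^sup>T) $$ (a, b)"] Z
    by (simp add: Q_def del: index_mult_mat)
   then have P: "(\<Sum>a<N. \<Sum>b<N. X $$ (a, b) * (S * Q * S') $$ (a, b)) = 0"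
    using mat_pairing[OF X Sc(1) Q Sc(2)] by simp
   define p q' where "p = r *\<^sub>v (M *\<^sub>v v)" "q' = r *\<^sub>v (M *\<^sub>v w)"
   have pq: "p \<in> Vec N" "q' \<in> Vec N"
    using mult_mat_vec_carrier[OF rc(1)] Mc car by (auto simp: p_q'_def)
   have Qv: "Q *\<^sub>v x = lorentz n w x \<cdot>\<^sub>v v" if x: "x \<in> Vec N" for x
   proof (rule eq_vecI)
    fix a assume "a < dim_vec (lorentz n w x \<cdot>\<^sub>v v)"
    then have a: "a < N" using car by simp
    have J: "lorentz_mat n *\<^sub>v w' \<in> Vec N" if "w' \<in> Vec N" for w'
     using mult_mat_vec_carrier[OF lorentz_mat_carrier that] .
    have "lorentz n w y = (\<Sum>b<N. (lorentz_mat n *\<^sub>v w) $ b * y $ b)" if y: "y \<in> Vec N" for y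
    proof -
     have "lorentz n w y = lorentz n y w" by (rule lorentz_comm)
     also have "\<dots> = y \<bullet> (lorentz_mat n *\<^sub>v w)" using lorentz_bil[OF y car(2)] by (simp add: bil_def)
     also have "\<dots> = (\<Sum>b<N. (lorentz_mat n *\<^sub>v w) $ b * y $ b)"
      using carrier_vecD[OF J[OF car(2)]] by (simp add: scalar_prod_def atLeast0LessThan mult.commute del: dim_mult_mat_vec index_mult_mat_vec)
     finally show ?thesis .
    qed
    note Lw = this
    have Lu: "lorentz n w (unit_vec N b) = (lorentz_mat n *\<^sub>v w) $ b" if "b < N" for b
    proof -
     have "lorentz n w (unit_vec N b) = (\<Sum>c<N. if c = b then (lorentz_mat n *\<^sub>v w) $ b else 0)"
      unfolding Lw[OF unit_vec_carrier] using that by (intro sum.cong) (auto simp del: index_mult_mat_vec)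
     then show ?thesis using that by simp
    qed
    have "(Q *\<^sub>v x) $ a = (\<Sum>b<N. v $ a * lorentz n w (unit_vec N b) * x $ b)"
     using a x by (simp add: Q_def scalar_prod_def atLeast0LessThan)
    also have "\<dots> = v $ a * (\<Sum>b<N. (lorentz_mat n *\<^sub>v w) $ b * x $ b)"
     by (simp add: Lu sum_distrib_left mult.assoc del: index_mult_mat_vec)
    finally show "(Q *\<^sub>v x) $ a = (lorentz n w x \<cdot>\<^sub>v v) $ a"
     using a car by (simp add: Lw[OF x] del: index_mult_mat_vec)
   qed (use Q car in auto)
   have ent: "(S * Q * S') $$ (a, b) = p $ a * (A *\<^sub>v q') $ b" if ab: "a < N" "b < N" for a b
   proof -
    let ?e = "unit_vec N b :: real vec"
    have r'e: "r' *\<^sub>v ?e \<in> Vec N" using mult_mat_vec_carrier[OF rc(2)] by simp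
    have S'e: "S' *\<^sub>v ?e = Mi *\<^sub>v (r' *\<^sub>v ?e)"
     unfolding S_S'_def by (rule assoc_mult_mat_vec[OF M(2) rc(2)]) simp
    have S'ec: "S' *\<^sub>v ?e \<in> Vec N" using mult_mat_vec_carrier[OF Sc(2)] by simp
    have "(S * Q * S') *\<^sub>v ?e = S *\<^sub>v (Q *\<^sub>v (S' *\<^sub>v ?e))"
     using Sc Q S'ec assoc_mult_mat_vec[of "S * Q" N N S' N ?e] assoc_mult_mat_vec[of S N N Q N "S' *\<^sub>v ?e"] by simp
    also have "\<dots> = lorentz n w (S' *\<^sub>v ?e) \<cdot>\<^sub>v (S *\<^sub>v v)"
     unfolding Qv[OF S'ec] by (rule mult_mat_vec[OF Sc(1) car(1)])
    also have "S *\<^sub>v v = p" unfolding S_S'_def p_q'_def by (rule assoc_mult_mat_vec[OF rc(1) M(1) car(1)])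
    also have "lorentz n w (S' *\<^sub>v ?e) = bil A (M *\<^sub>v w) (r' *\<^sub>v ?e)"
     unfolding S'e using bil_M[OF car(2) Mic[OF r'e]] MMi[OF r'e] by simp
    also have "\<dots> = bil A q' (r *\<^sub>v (r' *\<^sub>v ?e))"
     unfolding p_q'_def using riso[OF Mc[OF car(2)] r'e] by simp
    also have "r *\<^sub>v (r' *\<^sub>v ?e) = ?e"
     using assoc_mult_mat_vec[OF rc, of ?e] rr' by simp
    also have "bil A q' ?e = bil A ?e q'" by (rule bil_sym[OF A pq(2)]) simp
    also have "\<dots> = (A *\<^sub>v q') $ b"
     unfolding bil_def using mult_mat_vec_carrier[OF A(1) pq(2)] ab by (simp del: index_mult_mat_vec)
    finally have "(S * Q * S') *\<^sub>v ?e = (A *\<^sub>v q') $ b \<cdot>\<^sub>v p" .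
    moreover have "(S * Q * S') $$ (a, b) = ((S * Q * S') *\<^sub>v ?e) $ a"
    proof -
     have c: "S * Q * S' \<in> Mat N" using Sc Q by simp
     show ?thesis using c ab by (simp del: index_mult_mat assoc_mult_mat)
    qed
    ultimately show ?thesis using ab pq by (simp del: index_mult_mat_vec)
   qed
   have Aq: "A *\<^sub>v q' \<in> Vec N" using mult_mat_vec_carrier[OF A(1) pq(2)] .
   have "bil (X * A) p q' = bil X p (A *\<^sub>v q')"
    unfolding bil_def using assoc_mult_mat_vec[OF X A(1) pq(2)] by simp
   also have "\<dots> = (\<Sum>a<N. \<Sum>b<N. X $$ (a, b) * (S * Q * S') $$ (a, b))"
    unfolding bil_sum[OF X pq(1) Aq] by (intro sum.cong refl) (simp add: ent algebra_simps del: index_mult_mat index_mult_mat_vec)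
   finally have "bil (X * A) p q' = 0" using P by simp
   then show ?thesis unfolding p_q'_def rvec[OF Mc[OF car(1)]] rvec[OF Mc[OF car(2)]] .
  qed
  have "X * A = 0\<^sub>m N N"
  proof (rule bilinear_zero_if_reflections[OF n XA Mc[OF car(1)] _ Mc[OF car(2)]])
   show "bil A (M *\<^sub>v v) (M *\<^sub>v v) = 0" "bil A (M *\<^sub>v v) (M *\<^sub>v w) ~= 0"
    using nf by (auto simp: bil_M car null_frame_def)
   show "bil (X * A) (reflect A u1 (reflect A u2 (M *\<^sub>v v))) (reflect A u1 (reflect A u2 (M *\<^sub>v w))) = 0"
    if "u1 \<in> Vec N" "u2 \<in> Vec N" "bil A u1 u1 ~= 0" "bil A u2 u2 ~= 0" for u1 u2
    by (rule reflections_density[OF K.real_subfield_axioms XA Mc[OF car(1)] Mc[OF car(2)] zero that]) auto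
  qed
  moreover obtain Ai where Ai: "Ai \<in> Mat N" "A * Ai = 1\<^sub>m N" by (rule A_invertible)
  ultimately have "X = 0\<^sub>m N N"
   using assoc_mult_mat[OF X A(1) Ai(1)] right_mult_one_mat[OF X] left_mult_zero_mat[OF Ai(1)] by simp
  then have "\<phi> p = 0" if p: "p \<in> I" for p
  proof -
   obtain a b where "p = (a, b)" "a < N" "b < N" using p by (auto simp: I_def)
   then show ?thesis using arg_cong[OF \<open>X = 0\<^sub>m N N\<close>, of "\<lambda>X. X $$ p"] by (simp add: X_def)
  qed
  then show ?thesis using phi(1) by blast
 qed
qed

end

section \<open>From eigenvalues of isometries to square-rootable Salem numbers\<close>

section \<open>Salem numbers over subfields\<close>

text \<open>The E in f(X) = E(X^2) + X O(X^2), with O given by \<open>odd_part\<close>. The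
  summation bound is generous, the excess coefficients being 0.\<close>

definition even_part :: "'a::comm_ring_1 poly => 'a poly" where
 "even_part f = (\<Sum>i\<le>degree f. Polynomial.monom (coeff f (2 * i)) i)"

definition odd_part :: "'a::comm_ring_1 poly => 'a poly" where
 "odd_part f = (\<Sum>i\<le>degree f. Polynomial.monom (coeff f (2 * i + 1)) i)"

lemma coeff_even_part: "coeff (even_part f) i = coeff f (2 * i)"
 and coeff_odd_part: "coeff (odd_part f) i = coeff f (2 * i + 1)"
 by (auto simp: even_part_def odd_part_def coeff_sum coeff_eq_0)

lemma coeff_pcompose_square:
 "coeff (pcompose f [:0, 0, 1:]) i = (if even i then coeff f (i div 2) else 0)"
 for f :: "'a::comm_ring_1 poly"
proof (induction f arbitrary: i)
 case (pCons a f)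
 have rec: "pcompose (pCons a f) [:0, 0, 1:] = pCons a (pCons 0 (pcompose f [:0, 0, 1:]))"
  by (simp add: pcompose_pCons)
 show ?case
 proof (cases i)
  case (Suc k)
  then show ?thesis
   unfolding rec by (cases k) (simp_all add: pCons.IH)
 qed (simp add: rec)
qed simp

lemma even_odd_decomp:
 "f = pcompose (even_part f) [:0, 0, 1:] + [:0, 1:] * pcompose (odd_part f) [:0, 0, 1:]"
 for f :: "'a::comm_ring_1 poly"
proof (rule poly_eqI)
 fix i
 show "coeff f i = coeff (pcompose (even_part f) [:0, 0, 1:] + [:0, 1:] * pcompose (odd_part f) [:0, 0, 1:]) i"
  by (cases i) (auto simp: coeff_pcompose_square coeff_even_part coeff_odd_part coeff_pCons
    poly_0_coeff_0 One_nat_def elim!: evenE oddE)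
qed

lemma poly_even_odd: "poly f x = poly (even_part f) (x\<^sup>2) + x * poly (odd_part f) (x\<^sup>2)"
 for f :: "'a::comm_ring_1 poly"
 by (subst even_odd_decomp[of f]) (simp add: poly_pcompose power2_eq_square)

lemma poly_pcompose_uminus [simp]: "poly (pcompose f [:0, -1:]) x = poly f (- x)" for x :: "'a::comm_ring_1"
 by (simp add: poly_pcompose)

lemma field_adjoin_subfield: "subfield_of_field (field_adjoin \<rat> x)"
 using field.generate_field_is_subfield[OF class_field, of "insert x \<rat>"]
 unfolding field_adjoin_def by (simp add: subfield_class_ring_iff)

lemma field_adjoin_mem: "x \<in> field_adjoin \<rat> x"
 unfolding field_adjoin_def by (auto intro: generate_field.incl)

lemma algebraic_int_conjugate:
 assumes "algebraic_int (l :: real)" "z \<in> conjugates l"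
 shows "algebraic_int z"
proof -
 have "algebraic l" using assms by blast
 then have alg: "algebraic_over \<rat> l" by (simp add: algebraic_iff_ev algebraic_over_Rats_iff)
 obtain p where p: "poly (map_poly of_int p) l = 0" "lead_coeff p = 1"
  using assms(1) algebraic_int_altdef_ipoly by blast
 have ev: "ev (map_poly of_int p) y = poly (map_poly of_int p) y" for y :: "'a::field_char_0"
 proof -
  have "map_poly of_rat (map_poly of_int p) = (map_poly of_int p :: 'a poly)"
   by (rule poly_eqI) (simp add: coeff_map_poly)
  then show ?thesis by (simp add: ev_def)
 qed
 have "poly (map_poly of_int p) z = 0"
  using assms(2) p(1) conjugates_iff[OF alg, of z] by (simp add: ev[symmetric])
 then show ?thesis using p(2) algebraic_int_altdef_ipoly by blast
qed

lemma algebraic_over_RatsI: "algebraic_int (l :: real) ==> algebraic_over \<rat> l"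
 using algebraic_int_imp_algebraic[of l] by (simp add: algebraic_iff_ev algebraic_over_Rats_iff)

lemma salem_algebraic: "salem l ==> algebraic_over \<rat> l"
 unfolding salem_def by (intro algebraic_over_RatsI) simp

lemma salem_trace_algebraic:
 assumes "salem l"
 shows "algebraic_int (inverse l)" "algebraic_over \<rat> (l + inverse l)"
proof -
 have "algebraic_int (complex_of_real (inverse l))"
  using assms algebraic_int_conjugate[of l] by (simp add: salem_def)
 then show 1: "algebraic_int (inverse l)" by (simp only: algebraic_int_of_real_iff)
 show "algebraic_over \<rat> (l + inverse l)"
  using assms by (intro algebraic_over_RatsI algebraic_int_add_mult(1) 1) (simp add: salem_def)
qed

text \<open>Conjugates of \<open>l\<close> may be substituted in relations whose coefficients lie in \<open>\<rat>(l + l\<^sup>-\<^sup>1)\<close>.\<close>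

lemma conjugate_relation:
 assumes l: "algebraic_over \<rat> l" "l ~= 0" and z: "z \<in> conjugates l"
  and rel: "(\<Sum>i\<in>I. ev (c i) (l + inverse l) * l ^ i) = 0"
 shows "z ~= 0" "(\<Sum>i\<in>I. ev (c i) (z + inverse z) * z ^ i) = 0"
proof -
 note tr = conjugates_iff[OF l(1), THEN iffD1, OF z, rule_format]
 interpret F: subfield_of_field "field_adjoin \<rat> l" by (rule field_adjoin_subfield)
 have "inverse l \<in> field_adjoin \<rat> l" by (intro F.inverse_mem field_adjoin_mem)
 \<comment> \<open>Writing 1/l as a polynomial in l turns a relation with coefficients in l + 1/l
   into a rational relation of l alone, which z inherits.\<close>
 then obtain e where e: "inverse l = ev e l"
  unfolding field_adjoin_Rats[OF l(1)] by blast
 have "ev ([:0, 1:] * e - 1) l = 0" using l(2) e[symmetric] by simp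
 then have "z * ev e z = 1" using tr by fastforce
 then show z0: "z ~= 0" by auto
 then have ez: "ev e z = inverse z" using \<open>z * ev e z = 1\<close> by (simp add: field_simps)
 define R where "R = (\<Sum>i\<in>I. pcompose (c i) ([:0, 1:] + e) * [:0, 1:] ^ i)"
 have "ev R l = 0" using rel by (simp add: R_def ev_sum e)
 then have "ev R z = 0" by (rule tr)
 then show "(\<Sum>i\<in>I. ev (c i) (z + inverse z) * z ^ i) = 0"
  by (simp add: R_def ev_sum ez)
qed

context real_subfield
begin

lemma algebraic_over_trans: "algebraic_over \<rat> x ==> algebraic_over K x"
 unfolding algebraic_over_Rats_iff
 unfolding algebraic_over_def ev_def using poly_over_map_of_rat map_poly_of_rat_eq_0 by blast

lemma degree_min_poly_dvd_const:
 assumes x: "algebraic_over K x" and q: "poly_over q" "poly q x = 0" "q ~= 0" "degree q \<le> degree (min_poly K x)"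
 obtains c where "q = Polynomial.smult c (min_poly K x)"
proof -
 obtain a where a: "q = min_poly K x * a" using min_poly_dvd_over[OF x q(1,2)] by blast
 then have "a ~= 0" using q(3) by auto
 then have "degree q = degree (min_poly K x) + degree a"
  using a degree_mult_eq[OF min_poly_nonzero[OF x]] by simp
 then have "degree a = 0" using q(4) by simp
 then obtain c where "a = [:c:]" by (rule degree_eq_zeroE)
 then show ?thesis using a that[of c] by simp
qed

text \<open>Elements of \<rat>(l + 1/l) do not change when l is replaced by its conjugate 1/l, so
  1/l is a root as well. The reflected polynomial is thus a scalar multiple of p, with scalar 1 or
  -1; nonvanishing at 1 excludes -1, and nonvanishing at -1 makes the degree even.\<close>

lemma min_poly_palindromic:
 assumes l: "salem l" and sub: "K \<subseteq> field_adjoin \<rat> (l + inverse l)"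
 shows "poly (min_poly K l) (inverse l) = 0" "reflect_poly (min_poly K l) = min_poly K l"
  "even (degree (min_poly K l))"
proof -
 define p where "p = min_poly K l"
 have l1: "l > 1" using l by (simp add: salem_def)
 have algQ: "algebraic_over \<rat> l" using l by (rule salem_algebraic)
 have alg: "algebraic_over K l" using algQ by (rule algebraic_over_trans)
 note p = min_poly_props[OF alg, folded p_def]
 have "\<exists>c. x = ev c (l + inverse l)" if "x \<in> K" for x
  using that sub field_adjoin_Rats[OF salem_trace_algebraic(2)[OF l]] by blast
 then obtain c where c: "!!x. x \<in> K ==> x = ev (c x) (l + inverse l)" by metis
 have pK: "coeff p i \<in> K" for i using p(1) by (rule poly_over_coeff)
 have "(\<Sum>i\<le>degree p. ev (c (coeff p i)) (l + inverse l) * l ^ i) = 0"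
  using p(3) by (simp add: poly_altdef c[OF pK, symmetric])
 moreover have "complex_of_real (inverse l) \<in> conjugates l" using l by (simp add: salem_def)
 ultimately have "(\<Sum>i\<le>degree p. ev (c (coeff p i)) (complex_of_real (inverse l) + inverse (complex_of_real (inverse l))) *
   complex_of_real (inverse l) ^ i) = 0"
  using l1 by (intro conjugate_relation(2)[OF algQ]) auto
 also have "complex_of_real (inverse l) + inverse (complex_of_real (inverse l)) = complex_of_real (l + inverse l)"
  by (simp add: of_real_inverse)
 also have "(\<Sum>i\<le>degree p. ev (c (coeff p i)) (complex_of_real (l + inverse l)) * complex_of_real (inverse l) ^ i) =
   complex_of_real (poly p (inverse l))"
  unfolding ev_of_real c[OF pK, symmetric] by (simp add: poly_altdef)
 finally show root: "poly (min_poly K l) (inverse l) = 0" by (simp add: p_def)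
 have p0: "p ~= 0" using p(2) by auto
 have "poly (reflect_poly p) l = 0"
  using l1 root by (simp add: poly_reflect_poly_nz p_def)
 moreover have "reflect_poly p ~= 0" using p0 by simp
 ultimately obtain a where a: "reflect_poly p = Polynomial.smult a p"
  using degree_min_poly_dvd_const[OF alg poly_over_reflect[OF p(1)]] degree_reflect_poly_le[of p]
  unfolding p_def by metis
 have "1 = a * coeff p 0"
  using arg_cong[OF a, of "\<lambda>f. coeff f 0"] p(2) by simp
 moreover have "coeff p 0 = a"
  using arg_cong[OF a, of "\<lambda>f. coeff f (degree p)"] p(2) by (simp add: coeff_reflect_poly)
 ultimately have "a = 1 \<or> a = -1" by (metis square_eq_1_iff)
 moreover have no1: "poly p 1 ~= 0" "poly p (-1) ~= 0"
  using min_poly_root_in[OF alg, folded p_def] l1 ring_mems(2) uminus_mem[OF ring_mems(2)] by force+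
 moreover have "poly p 1 = a * poly p 1"
  using arg_cong[OF a, of "\<lambda>f. poly f 1"] by (simp add: poly_reflect_poly_nz)
 ultimately have "a = 1" by auto
 then show refl: "reflect_poly (min_poly K l) = min_poly K l" using a by (simp add: p_def)
 have "poly (reflect_poly p) (-1) = (-1) ^ degree p * poly p (-1)"
  by (subst poly_reflect_poly_nz) simp_all
 then have "poly p (-1) = (-1) ^ degree p * poly p (-1)"
  using refl by (simp add: p_def)
 then show "even (degree (min_poly K l))"
  using no1 unfolding p_def[symmetric] by (cases "even (degree p)") auto
qed

text \<open>
 The square root polynomial is the rescaled minimal polynomial \<open>r\<close> of \<open>\<nu> = t \<mu>\<close>: the relation
 \<open>r(x) r(-x) = t\<^sup>2\<^sup>m p(x\<^sup>2 / t\<^sup>2)\<close> holds because \<open>-\<nu>\<close> is not conjugate to \<open>\<nu>\<close>.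
\<close>

lemma square_rootableI:
 assumes l: "salem l" and sub: "K \<subseteq> field_adjoin \<rat> (l + inverse l)"
  and mu: "l = \<mu>\<^sup>2" "\<mu> > 0" and t: "t > 0" and pos: "totally_positive K (t\<^sup>2)"
  and chi: "poly_over \<chi>" "poly \<chi> (t * \<mu>) = 0" "poly \<chi> (- (t * \<mu>)) ~= 0" "poly \<chi> (- (t / \<mu>)) ~= 0"
 shows "square_rootable K l"
proof -
 define p where "p = min_poly K l"
 define m where "m = degree p"
 define \<alpha> where "\<alpha> = t\<^sup>2"
 define \<nu> where "\<nu> = t * \<mu>"
 define r where "r = min_poly K \<nu>"
 have l1: "l > 1" using l by (simp add: salem_def)
 have \<alpha>: "\<alpha> \<in> K" "\<alpha> > 0" using pos t by (auto simp: totally_positive_def \<alpha>_def)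
 have alg: "algebraic_over K l" using salem_algebraic[OF l] by (rule algebraic_over_trans)
 note p = min_poly_props[OF alg, folded p_def]
 note pal = min_poly_palindromic[OF l sub, folded p_def]
 have p0: "p ~= 0" using p(2) by auto
 have "\<chi> ~= 0" using chi(3) by auto
 then have algn: "algebraic_over K \<nu>"
  unfolding algebraic_over_def \<nu>_def using chi by blast
 note r = min_poly_props[OF algn, folded r_def]
 have r0: "r ~= 0" using r(2) by auto
 obtain b where b: "\<chi> = r * b"
  using min_poly_dvd_over[OF algn chi(1)] chi(2) by (auto simp: r_def \<nu>_def)
 have rneg: "poly r (- \<nu>) ~= 0" "poly r (- (t / \<mu>)) ~= 0"
  using chi(3,4) by (auto simp: b \<nu>_def)
 have \<nu>2: "\<nu>\<^sup>2 = \<alpha> * l" by (simp add: \<nu>_def \<alpha>_def mu power_mult_distrib)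
 \<comment> \<open>The roots of f are the square roots of \<alpha> times the roots of p, among them
   \<nu>. The factor \<open>\<alpha> ^ m\<close> makes f monic.\<close>
 define f where "f = Polynomial.smult (\<alpha> ^ m) (pcompose p [:0, 0, inverse \<alpha>:])"
 have f_over: "poly_over f"
  unfolding f_def using \<alpha> by (intro poly_over_smult power_mem poly_over_pcompose p poly_over_pCons
    poly_over_0 inverse_mem zero_mem)
 have f_root: "poly f \<nu> = 0"
  using p(3) \<alpha> \<nu>2 by (simp add: f_def poly_pcompose power2_eq_square field_simps)
 have f_even: "pcompose f [:0, -1:] = f"
  unfolding f_def pcompose_smult pcompose_assoc[symmetric] by (simp add: pcompose_pCons)
 have deg_f: "degree f = 2 * m"
  using \<alpha> by (simp add: f_def degree_pcompose m_def)
 have lead_f: "lead_coeff f = 1"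
 proof -
  have "lead_coeff (pcompose p [:0, 0, inverse \<alpha>:]) = lead_coeff p * lead_coeff [:0, 0, inverse \<alpha>:] ^ degree p"
   using \<alpha> by (intro lead_coeff_comp) simp
  then show ?thesis
   using \<alpha> p(2) unfolding f_def lead_coeff_smult by (simp add: m_def power_inverse)
 qed
 obtain s where s: "f = r * s" "poly_over s"
  using min_poly_dvd_over[OF algn f_over f_root] by (auto simp: r_def)
 define rm where "rm = pcompose r [:0, -1:]"
 have fm: "f = rm * pcompose s [:0, -1:]"
  using f_even unfolding s(1) rm_def by (simp add: pcompose_mult)
 \<comment> \<open>f is even and vanishes at \<nu>, whereas r(-X) does not; hence r divides the
   remaining factor s(-X), and r(X) r(-X) divides f.\<close>
 have "poly rm \<nu> ~= 0" using rneg by (simp add: rm_def)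
 then have "poly (pcompose s [:0, -1:]) \<nu> = 0" using f_root by (subst (asm) fm) simp
 moreover have "poly_over (pcompose s [:0, -1:])"
  by (intro poly_over_pcompose s poly_over_pCons poly_over_0 ring_mems)
 ultimately obtain u where u: "pcompose s [:0, -1:] = r * u"
  using min_poly_dvd_over[OF algn] unfolding r_def by blast
 have f_eq: "f = rm * (r * u)" using fm u by simp
 have f0: "f ~= 0" using lead_f by auto
 then have nz: "rm ~= 0" "r * u ~= 0" "u ~= 0" using f_eq by auto
 have deg_rm: "degree rm = degree r" by (simp add: rm_def degree_pcompose)
 have degs: "2 * m = 2 * degree r + degree u"
  using degree_mult_eq[OF nz(1,2)] degree_mult_eq[OF r0 nz(3)] deg_f f_eq deg_rm by simp
 have "m \<le> degree r"
 proof -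
  \<comment> \<open>R(X^2) = r(X) r(-X), so R(\<alpha> X) is a polynomial over K of the degree of r
    that vanishes at l; minimality of p bounds this degree from below.\<close>
  define R where "R = even_part r * even_part r - [:0, 1:] * (odd_part r * odd_part r)"
  have over: "poly_over (even_part r)" "poly_over (odd_part r)"
   using r(1) by (auto simp: poly_over_def coeff_even_part coeff_odd_part)
  have R_over: "poly_over R"
   unfolding R_def by (intro poly_over_diff poly_over_mult over poly_over_pCons poly_over_0 ring_mems)
  have "poly (pcompose R [:0, 0, 1:]) x = poly (r * rm) x" for x
  proof -
   have 1: "poly r x = poly (even_part r) (x * x) + x * poly (odd_part r) (x * x)"
    using poly_even_odd[of r x] by (simp add: power2_eq_square)
   have 2: "poly r (- x) = poly (even_part r) (x * x) - x * poly (odd_part r) (x * x)"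
    using poly_even_odd[of r "- x"] by (simp add: power2_eq_square)
   show ?thesis by (simp add: R_def rm_def poly_pcompose 1 2 algebra_simps)
  qed
  then have RR: "pcompose R [:0, 0, 1:] = r * rm" by (metis poly_eq_poly_eq_iff ext)
  have "2 * degree R = 2 * degree r"
   using arg_cong[OF RR, of degree] degree_mult_eq[OF r0 nz(1)] deg_rm by (simp add: degree_pcompose)
  define R' where "R' = pcompose R [:0, \<alpha>:]"
  have "poly_over R'"
   unfolding R'_def using \<alpha> by (intro poly_over_pcompose R_over poly_over_pCons poly_over_0 ring_mems)
  moreover have "poly R' l = 0"
  proof -
   have "poly (pcompose R [:0, 0, 1:]) \<nu> = 0" unfolding RR using r(3) by simp
   then show ?thesis using \<nu>2 by (simp add: R'_def poly_pcompose power2_eq_square mult.commute)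
  qed
  moreover have "degree R' = degree R" using \<alpha> by (simp add: R'_def degree_pcompose)
  moreover have "R' ~= 0"
  proof
   assume "R' = 0"
   then have "R = 0" using \<alpha> by (simp add: R'_def pcompose_eq_0_iff)
   then show False using RR r0 nz by simp
  qed
  ultimately show ?thesis using p(4)[of R'] \<open>2 * degree R = 2 * degree r\<close> by (simp add: m_def)
 qed
 then have deg_r: "degree r = m" and "degree u = 0" using degs by auto
 then obtain k where k: "u = [:k:]" by (metis degree_eq_zeroE)
 have "lead_coeff rm = (-1) ^ m"
  using lead_coeff_comp[of "[:0, -1:]" r] r(2) deg_r by (simp add: rm_def)
 then have lead_rm: "lead_coeff rm = 1" using pal(3) by (simp add: m_def)
 have "lead_coeff f = lead_coeff rm * (lead_coeff r * lead_coeff u)"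
  unfolding f_eq lead_coeff_mult ..
 then have "u = 1" using lead_f lead_rm r(2) k by (simp add: pCons_one)
 then have f_rr: "f = r * rm" using f_eq by (simp add: mult.commute)
 \<comment> \<open>The substitution t X moves the root t \<mu> to \<mu>. As m is even,
   \<open>t ^ m\<close> is a power of \<alpha>, so even coefficients stay in K and odd ones keep
   exactly one factor sqrt \<alpha>.\<close>
 define q where "q = Polynomial.smult (inverse (t ^ m)) (pcompose r [:0, t:])"
 have coeff_q: "coeff q i = t ^ i * coeff r i / t ^ m" for i
  by (simp add: q_def coeff_pcompose_linear divide_inverse)
 have deg_q: "degree q = m" using t by (simp add: q_def degree_pcompose deg_r)
 have lead_q: "lead_coeff q = 1" using t r(2) by (simp add: deg_q coeff_q deg_r)
 have poly_q: "poly q x = poly r (t * x) / t ^ m" for x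
  by (simp add: q_def poly_pcompose divide_inverse mult.commute[of x])
 have prod: "q * pcompose q [:0, -1:] = pcompose p [:0, 0, 1:]"
 proof -
  have "poly (q * pcompose q [:0, -1:]) x = poly (pcompose p [:0, 0, 1:]) x" for x
  proof -
   have "poly (q * pcompose q [:0, -1:]) x = poly f (t * x) / (t ^ m * t ^ m)"
    by (simp add: f_rr poly_q rm_def)
   also have "poly f (t * x) = \<alpha> ^ m * poly p (x * x)"
    using t by (simp add: f_def poly_pcompose \<alpha>_def power2_eq_square field_simps)
   also have "\<alpha> ^ m = t ^ m * t ^ m" by (simp add: \<alpha>_def power_mult_distrib power2_eq_square)
   finally show ?thesis using t by (simp add: poly_pcompose)
  qed
  then show ?thesis by (metis poly_eq_poly_eq_iff ext)
 qed
 have rK: "coeff r i \<in> K" for i using r(1) by (rule poly_over_coeff)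
 obtain m' where m': "m = 2 * m'" using pal(3) by (auto simp: m_def elim: evenE)
 have "coeff q i \<in> K" if e: "even i" for i
 proof -
  obtain j where "i = 2 * j" using e by (rule evenE)
  then have "coeff q i = \<alpha> ^ j * coeff r i / \<alpha> ^ m'" by (simp add: coeff_q m' \<alpha>_def power_mult)
  then show ?thesis using \<alpha> rK by (auto intro!: divide_mem mult_mem power_mem)
 qed
 moreover have "coeff q i \<in> (\<lambda>k. sqrt \<alpha> * k) ` K" if e: "odd i" for i
 proof -
  obtain j where "i = 2 * j + 1" using e by (rule oddE)
  then have "coeff q i = sqrt \<alpha> * (\<alpha> ^ j * coeff r i / \<alpha> ^ m')"
   using t by (simp add: coeff_q m' \<alpha>_def power_mult power_add)
  moreover have "\<alpha> ^ j * coeff r i / \<alpha> ^ m' \<in> K" using \<alpha> rK by (auto intro!: divide_mem mult_mem power_mem)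
  ultimately show ?thesis by blast
 qed
 moreover have "reflect_poly q = q"
 proof -
  have mu0: "\<mu> ~= 0" using mu by simp
  have "poly r (t / \<mu>) = 0"
  proof -
   have "poly q (inverse \<mu>) * poly q (- inverse \<mu>) = poly (pcompose p [:0, 0, 1:]) (inverse \<mu>)"
    unfolding prod[symmetric] by simp
   also have "\<dots> = poly p (inverse l)" by (simp add: poly_pcompose mu power2_eq_square)
   finally have "poly r (t / \<mu>) * poly r (- (t / \<mu>)) = 0"
    using pal(1) t by (simp add: poly_q divide_inverse)
   then show ?thesis using rneg by simp
  qed
  \<comment> \<open>The roots of rs are \<alpha> divided by the roots of r. Since t/\<mu> =
    \<alpha>/\<nu> is a root of r, rs vanishes at \<nu> and is proportional to r, which makes q
    palindromic up to sign.\<close>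
  define rs where "rs = reflect_poly (pcompose r [:0, \<alpha>:])"
  have deg_ra: "degree (pcompose r [:0, \<alpha>:]) = m" using \<alpha> by (simp add: degree_pcompose deg_r)
  have "poly_over rs"
   unfolding rs_def using \<alpha> by (intro poly_over_reflect poly_over_pcompose r poly_over_pCons poly_over_0 zero_mem)
  moreover have "poly rs \<nu> = 0"
  proof -
   have "\<nu> ~= 0" using t mu0 by (simp add: \<nu>_def)
   moreover have "\<alpha> * inverse \<nu> = t / \<mu>" using t mu0 by (simp add: \<alpha>_def \<nu>_def field_simps power2_eq_square)
   ultimately show ?thesis
    using \<open>poly r (t / \<mu>) = 0\<close> by (simp add: rs_def poly_reflect_poly_nz poly_pcompose mult.commute)
  qed
  moreover have "rs ~= 0" using r0 \<alpha> by (simp add: rs_def pcompose_eq_0_iff)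
  moreover have "degree rs \<le> degree r"
   unfolding rs_def using degree_reflect_poly_le[of "pcompose r [:0, \<alpha>:]"] deg_ra deg_r by linarith
  ultimately obtain c where c: "rs = Polynomial.smult c r"
   using degree_min_poly_dvd_const[OF algn] unfolding r_def by metis
  have cs: "\<alpha> ^ (m - i) * coeff r (m - i) = c * coeff r i" if "i \<le> m" for i
   using arg_cong[OF c, of "\<lambda>f. coeff f i"] that
   unfolding rs_def coeff_reflect_poly deg_ra by (simp add: coeff_pcompose_linear)
  define c' where "c' = c / t ^ m"
  have cq: "coeff q (m - i) = c' * coeff q i" if "i \<le> m" for i
  proof -
   have "coeff q (m - i) * \<alpha> ^ (m - i) = t ^ (m - i) * (c * coeff r i) / t ^ m"
    using cs[OF that] by (simp add: coeff_q algebra_simps)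
   moreover have "\<alpha> ^ (m - i) = t ^ (m - i) * t ^ (m - i)"
    by (simp add: \<alpha>_def power_mult_distrib power2_eq_square)
   ultimately have "coeff q (m - i) * t ^ (m - i) = c * coeff r i / t ^ m"
    using t by (simp add: field_simps)
   moreover have "t ^ m = t ^ (m - i) * t ^ i" using that by (simp add: power_add[symmetric])
   ultimately show ?thesis using t by (simp add: coeff_q c'_def field_simps)
  qed
  have "coeff q 0 = c'" using cq[of m] lead_q deg_q by simp
  moreover have "1 = c' * coeff q 0" using cq[of 0] lead_q deg_q by simp
  ultimately have "c' = 1 \<or> c' = -1" by (metis square_eq_1_iff)
  have refl: "reflect_poly q = Polynomial.smult c' q"
   by (rule poly_eqI) (auto simp: coeff_reflect_poly deg_q cq coeff_eq_0)
  have "poly q 1 = c' * poly q 1"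
   using arg_cong[OF refl, of "\<lambda>f. poly f 1"] by (simp add: poly_reflect_poly_nz)
  moreover have "poly q 1 ~= 0"
  proof
   assume "poly q 1 = 0"
   then have "poly (pcompose p [:0, 0, 1:]) 1 = 0" unfolding prod[symmetric] by simp
   then have "poly p 1 = 0" by (simp add: poly_pcompose)
   then show False using min_poly_root_in[OF alg one_mem] l1 by (simp add: p_def)
  qed
  ultimately have "c' = 1" using \<open>c' = 1 \<or> c' = -1\<close> by auto
  then show ?thesis using refl by simp
 qed
 ultimately show ?thesis
  unfolding square_rootable_def
  using l sub pos lead_q prod subfield_of_field_axioms
  by (auto simp: subfield_class_ring_iff \<alpha>_def p_def intro!: exI[of _ "t\<^sup>2"] exI[of _ q])
qed

end

section \<open>Embeddings\<close>

text \<open>The entries stabilise a common finitely generated module with generators U; the products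
  of coordinates of x with elements of U then generate a module stable under l.\<close>

lemma algebraic_int_matrix_eigenvalue:
 fixes H :: "real mat"
 assumes H: "H \<in> Mat N" "!!i j. i < N ==> j < N ==> algebraic_int (H $$ (i, j))"
  and x: "x \<in> Vec N" "x ~= 0\<^sub>v N" "H *\<^sub>v x = l \<cdot>\<^sub>v x"
 shows "algebraic_int l"
proof -
 define S where "S = (\<lambda>p. H $$ p) ` ({..<N} \<times> {..<N})"
 have "finite S" "!!s. s \<in> S ==> algebraic_int s" using H by (auto simp: S_def)
 then obtain U where U: "finite U" "1 \<in> U" "\<forall>s\<in>S. \<forall>u\<in>U. s * u \<in> int_span U (\<lambda>x. x)"
  using algebraic_int_module[of S] by blast
 define W where "W = (\<lambda>(i, u). x $ i * u) ` ({..<N} \<times> U)"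
 have W: "finite W" using U(1) by (simp add: W_def)
 have WI: "x $ i * u \<in> int_span W (\<lambda>x. x)" if "u \<in> U" "i < N" for u i
  using int_span_base[OF W, of "x $ i * u" "\<lambda>x. x"] that by (force simp: W_def)
 obtain i0 where i0: "i0 < N" "x $ i0 ~= 0"
  using x by (metis carrier_vecD eq_vecI index_zero_vec(1) index_zero_vec(2))
 have "x $ i0 * 1 \<in> W" unfolding W_def using U(2) i0 by (intro image_eqI[of _ _ "(i0, 1)"]) auto
 then have w0: "x $ i0 \<in> W" by simp
 show ?thesis
 proof (rule algebraic_int_int_span[where I = W and b = "x $ i0" and v = "\<lambda>x. x"])
  show "finite W" "x $ i0 \<in> W" "x $ i0 ~= 0" by fact+
  fix w assume "w \<in> W"
  then obtain i u where iu: "i < N" "u \<in> U" "w = x $ i * u" by (auto simp: W_def)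
  have "l * x $ i = (\<Sum>j<N. H $$ (i, j) * x $ j)"
   using arg_cong[OF x(3), of "\<lambda>y. y $ i"] iu H(1) x(1) by (simp add: scalar_prod_def atLeast0LessThan)
  then have "l * w = (\<Sum>j<N. H $$ (i, j) * x $ j) * u"
   by (simp only: iu(3) mult.assoc[symmetric])
  also have "\<dots> = (\<Sum>j<N. x $ j * (H $$ (i, j) * u))"
   unfolding sum_distrib_right by (intro sum.cong refl) (simp add: mult_ac)
  also have "\<dots> \<in> int_span W (\<lambda>x. x)"
  proof (rule int_span_sum)
   fix j assume j: "j \<in> {..<N}"
   show "x $ j * (H $$ (i, j) * u) \<in> int_span W (\<lambda>x. x)"
   proof (rule int_span_mult_into[where I = U and v = "\<lambda>x. x"])
    have "H $$ (i, j) \<in> S" using iu(1) j by (auto simp: S_def)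
    then show "H $$ (i, j) * u \<in> int_span U (\<lambda>x. x)" using U(3) iu(2) by blast
    show "x $ j * v \<in> int_span W (\<lambda>x. x)" if "v \<in> U" for v
     using WI[OF that] j by simp
   qed
  qed
  finally show "l * w \<in> int_span W (\<lambda>x. x)" .
 qed
qed

context real_subfield
begin

context
 fixes \<sigma> :: "real => 'a::field"
 assumes \<sigma>: "\<sigma> \<in> embeddings K"
begin

lemma emb_add: "x \<in> K ==> y \<in> K ==> \<sigma> (x + y) = \<sigma> x + \<sigma> y"
 and emb_mult: "x \<in> K ==> y \<in> K ==> \<sigma> (x * y) = \<sigma> x * \<sigma> y"
 and emb_1: "\<sigma> 1 = 1"
 using \<sigma> by (auto simp: embeddings_def Ring.ring_hom_def)

lemma emb_0: "\<sigma> 0 = 0"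
 using emb_add[OF zero_mem zero_mem] by (metis add.right_neutral add_cancel_left_right)

lemma emb_uminus: "x \<in> K ==> \<sigma> (- x) = - \<sigma> x"
 using emb_add[of x "- x"] uminus_mem[of x] by (simp add: emb_0 eq_neg_iff_add_eq_0 add.commute)

lemma emb_sum: "(!!i. i \<in> I ==> f i \<in> K) ==> \<sigma> (sum f I) = (\<Sum>i\<in>I. \<sigma> (f i))"
 by (induction I rule: infinite_finite_induct) (auto simp: emb_0 emb_add sum_mem)

lemma emb_nonzero: "x \<in> K ==> x ~= 0 ==> \<sigma> x ~= 0"
 using emb_mult[of x "inverse x"] inverse_mem[of x] emb_1 by auto

lemma emb_of_nat: "\<sigma> (of_nat k) = of_nat k"
 by (induction k) (auto simp: emb_0 emb_1 emb_add of_nat_mem one_mem)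

lemma emb_of_int: "\<sigma> (of_int k) = of_int k"
proof (cases k)
 case (nonneg j)
 then show ?thesis by (simp add: emb_of_nat)
next
 case (neg j)
 then show ?thesis
  using emb_uminus[OF of_nat_mem, of "Suc j"] emb_of_nat[of "Suc j"] by (simp del: of_nat_Suc)
qed

lemma map_mat_emb_mult:
 assumes "X \<in> Mat N" "Y \<in> Mat N" "elements_mat X \<subseteq> K" "elements_mat Y \<subseteq> K"
 shows "map_mat \<sigma> (X * Y) = map_mat \<sigma> X * map_mat \<sigma> Y"
proof (rule eq_matI)
 fix i j assume "i < dim_row (map_mat \<sigma> X * map_mat \<sigma> Y)" "j < dim_col (map_mat \<sigma> X * map_mat \<sigma> Y)"
 then have ij: "i < N" "j < N" using assms by auto
 have "map_mat \<sigma> (X * Y) $$ (i, j) = \<sigma> ((X * Y) $$ (i, j))" using ij assms by simp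
 also have "\<dots> = \<sigma> (\<Sum>k<N. X $$ (i, k) * Y $$ (k, j))" by (subst mat_mult_entry[OF assms(1,2) ij]) simp
 also have "\<dots> = (\<Sum>k<N. \<sigma> (X $$ (i, k)) * \<sigma> (Y $$ (k, j)))"
  using assms ij by (subst emb_sum) (auto simp: elements_mat_subset_iff emb_mult intro: mult_mem)
 also have "\<dots> = (map_mat \<sigma> X * map_mat \<sigma> Y) $$ (i, j)"
  using ij assms by (simp add: scalar_prod_def atLeast0LessThan)
 finally show "map_mat \<sigma> (X * Y) $$ (i, j) = (map_mat \<sigma> X * map_mat \<sigma> Y) $$ (i, j)" .
qed (use assms in auto)

end

lemma emb_ev:
 fixes \<sigma> :: "real => 'a::field_char_0"
 assumes \<sigma>: "\<sigma> \<in> embeddings K" and x: "x \<in> K"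
 shows "\<sigma> (ev c x) = ev c (\<sigma> x)"
proof -
 have rat: "\<sigma> (of_rat q) = of_rat q" for q
 proof (cases q)
  case (Fract a b)
  then have "of_rat q * of_int b = (of_int a :: real)" by (simp add: of_rat_rat)
  then have "\<sigma> (of_rat q) * of_int b = of_int a"
   using emb_mult[OF \<sigma> Rats_mem of_int_mem, of q b] by (simp add: emb_of_int[OF \<sigma>])
  then show ?thesis using Fract by (simp add: of_rat_rat field_simps)
 qed
 show ?thesis
  by (induction c) (simp_all add: emb_0[OF \<sigma>] emb_add[OF \<sigma>] emb_mult[OF \<sigma>] rat x Rats_mem mult_mem ev_mem)
qed

lemma id_embedding: "(\<lambda>x. x) \<in> embeddings K"
 by (simp add: embeddings_def Ring.ring_hom_def)

text \<open>A root z of the minimal polynomial prescribes \<theta> -> z; two polynomials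
  representing the same element differ by a multiple of m, so the choice does not matter.\<close>

lemma embedding_of_root:
 fixes z :: complex
 assumes K: "K = range (\<lambda>c. ev c \<theta>)" and m: "!!c. ev c \<theta> = 0 ==> m dvd c" and z: "ev m z = 0"
 obtains \<sigma> where "\<sigma> \<in> embeddings K" "!!c. \<sigma> (ev c \<theta>) = ev c z"
proof -
 define \<sigma> where "\<sigma> = (\<lambda>x. ev (SOME c. ev c \<theta> = x) z)"
 have eq: "\<sigma> (ev c \<theta>) = ev c z" for c
 proof -
  define c' where "c' = (SOME c'. ev c' \<theta> = ev c \<theta>)"
  have "ev c' \<theta> = ev c \<theta>" unfolding c'_def by (rule someI[of _ c]) simp
  then have "m dvd c' - c" by (intro m) simp
  then obtain k where k: "c' - c = m * k" by (rule dvdE)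
  have "ev (m * k) z = 0" using z by simp
  then have "ev (c' - c) z = 0" by (simp only: k)
  then show ?thesis by (simp add: \<sigma>_def c'_def)
 qed
 have "\<sigma> \<in> embeddings K"
  unfolding embeddings_def
 proof (rule ring_hom_memI)
  fix x y assume "x \<in> carrier (class_ring\<lparr>carrier := K\<rparr>)" "y \<in> carrier (class_ring\<lparr>carrier := K\<rparr>)"
  then obtain a b where ab: "x = ev a \<theta>" "y = ev b \<theta>" using K by auto
  show "\<sigma> (x \<otimes>\<^bsub>class_ring\<lparr>carrier := K\<rparr>\<^esub> y) = \<sigma> x \<otimes>\<^bsub>class_ring\<^esub> \<sigma> y"
   using eq[of "a * b"] by (simp add: eq ab)
  show "\<sigma> (x \<oplus>\<^bsub>class_ring\<lparr>carrier := K\<rparr>\<^esub> y) = \<sigma> x \<oplus>\<^bsub>class_ring\<^esub> \<sigma> y"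
   using eq[of "a + b"] by (simp add: eq ab)
 qed (use eq[of 1] in auto)
 then show ?thesis using that eq by blast
qed

end

section \<open>Translation lengths are logarithms of square-rootable Salem numbers\<close>

context lorentzian_form
begin

lemma similar_toL:
 assumes T: "T \<in> Mat N"
 shows "char_poly (map_mat complex_of_real T) = char_poly (map_mat complex_of_real (toL T))"
proof -
 have "similar_mat T (toL T)"
  unfolding similar_mat_def similar_mat_wit_def Let_def
  using T M of_toL[OF T] toL_carrier[OF T] by (intro exI[of _ M] exI[of _ Mi]) auto
 then have "char_poly T = char_poly (toL T)" by (rule char_poly_similar)
 then show ?thesis by (simp add: of_real_hom.char_poly_hom[OF T] of_real_hom.char_poly_hom[OF toL_carrier[OF T]])
qed

text \<open>Applied to matrix units, the assumption puts every product of an entry of T with an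
  entry of Ti into K. A nonzero entry s of Ti therefore makes s T a matrix over K; comparing values
  of the form puts its similitude factor s^2 into K.\<close>

lemma similitude_of_rational_conj:
 assumes K: "real_subfield K" and AK: "elements_mat A \<subseteq> K"
  and T: "T \<in> Mat N" "Ti \<in> Mat N" "T * Ti = 1\<^sub>m N" and iso: "T\<^sup>T * A * T = A"
  and rat: "!!Y. Y \<in> Mat N ==> elements_mat Y \<subseteq> K ==> elements_mat (T * Y * Ti) \<subseteq> K"
 obtains t where "t > 0" "t\<^sup>2 \<in> K" "elements_mat (t \<cdot>\<^sub>m T) \<subseteq> K"
proof -
 interpret K: real_subfield K by (rule K)
 have "\<exists>j<N. Ti $$ (j, 0) ~= 0"
 proof (rule ccontr)
  assume "\<not> ?thesis"
  then have "(T * Ti) $$ (0, 0) = 0" using mat_mult_entry[OF T(1,2), of 0 0] by simp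
  then show False using T(3) by simp
 qed
 then obtain j where j: "j < N" "Ti $$ (j, 0) ~= 0" by blast
 define s where "s = Ti $$ (j, 0)"
 have sT: "s * T $$ (a, i) \<in> K" if ai: "a < N" "i < N" for a i
 proof -
  define E where "E = mat N N (\<lambda>p. if p = (i, j) then 1 else 0 :: real)"
  have E: "E \<in> Mat N" by (simp add: E_def)
  have "elements_mat E \<subseteq> K"
   unfolding elements_mat_subset_iff[OF E] by (auto simp: E_def intro: K.ring_mems)
  then have TE: "elements_mat (T * E * Ti) \<subseteq> K" by (rule rat[OF E])
  have TEc: "T * E \<in> Mat N" "T * E * Ti \<in> Mat N" using T E by auto
  have te: "(T * E) $$ (a, k) = (if k = j then T $$ (a, i) else 0)" if "k < N" for k
  proof -
   have "(T * E) $$ (a, k) = (\<Sum>l<N. if l = i then (if k = j then T $$ (a, i) else 0) else 0)"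
    unfolding mat_mult_entry[OF T(1) E ai(1) that] using ai that by (intro sum.cong) (auto simp: E_def)
   then show ?thesis using ai by simp
  qed
  have "(T * E * Ti) $$ (a, 0) = (\<Sum>k<N. (T * E) $$ (a, k) * Ti $$ (k, 0))"
   by (rule mat_mult_entry[OF TEc(1) T(2) ai(1)]) simp
  also have "\<dots> = (\<Sum>k<N. if k = j then T $$ (a, i) * s else 0)"
   by (intro sum.cong) (auto simp: te s_def)
  finally have "(T * E * Ti) $$ (a, 0) = s * T $$ (a, i)" using j by simp
  moreover have "(T * E * Ti) $$ (a, 0) \<in> K"
   using TE ai unfolding elements_mat_subset_iff[OF TEc(2)] by simp
  ultimately show ?thesis by simp
 qed
 define t where "t = \<bar>s\<bar>"
 have t: "t > 0" using j by (simp add: t_def s_def)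
 have tT: "t * T $$ (a, i) \<in> K" if "a < N" "i < N" for a i
  using sT[OF that] K.uminus_mem[OF sT[OF that]] by (auto simp: t_def abs_if)
 have tTK: "elements_mat (t \<cdot>\<^sub>m T) \<subseteq> K"
  using tT T(1) by (subst elements_mat_subset_iff[of _ N N]) auto
 have "t\<^sup>2 \<in> K"
 proof -
  have "\<exists>a b. a < N \<and> b < N \<and> A $$ (a, b) ~= 0"
  proof (rule ccontr)
   assume "\<not> ?thesis"
   then have z: "bil A x y = 0" if "x \<in> Vec N" "y \<in> Vec N" for x y
    using that bil_sum[OF A(1)] by simp
   have "bil A (M *\<^sub>v unit_vec N n) (M *\<^sub>v unit_vec N n) = -1"
    by (subst bil_M) (simp_all add: lorentz_def)
   then show False using z[OF Mc Mc, of "unit_vec N n" "unit_vec N n"] by simp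
  qed
  then obtain a b where ab: "a < N" "b < N" "A $$ (a, b) ~= 0" by blast
  define S where "S = t \<cdot>\<^sub>m T"
  have S: "S \<in> Mat N" using T by (simp add: S_def)
  have AK': "A $$ (i, j) \<in> K" if "i < N" "j < N" for i j
   using AK that elements_mat_subset_iff[OF A(1)] by blast
  have cS: "col S c \<in> Vec N" for c
   by (rule carrier_vecI) (use S in simp)
  have cK: "col S c $ i \<in> K" if "c < N" "i < N" for c i
  proof -
   have "col S c $ i = t * T $$ (i, c)" using that T(1) by (simp add: S_def)
   then show ?thesis using tT that by simp
  qed
  have "bil A (col S a) (col S b) \<in> K"
   unfolding bil_sum[OF A(1) cS cS]
   using ab by (intro K.sum_mem K.mult_mem AK' cK) auto
  moreover have "bil A (col S a) (col S b) = t\<^sup>2 * A $$ (a, b)"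
  proof -
   have "col S a = t \<cdot>\<^sub>v (T *\<^sub>v unit_vec N a)" "col S b = t \<cdot>\<^sub>v (T *\<^sub>v unit_vec N b)"
    using T ab by (auto simp: S_def intro!: eq_vecI)
   then have "bil A (col S a) (col S b) = t * (t * bil A (T *\<^sub>v unit_vec N a) (T *\<^sub>v unit_vec N b))"
    using mult_mat_vec_carrier[OF T(1)] by (simp add: bil_simps del: index_mult_mat_vec)
   also have "bil A (T *\<^sub>v unit_vec N a) (T *\<^sub>v unit_vec N b) = bil A (unit_vec N a) (unit_vec N b)"
    using isometry_iff[OF A(1) A(1) T(1)] iso by simp
   finally show ?thesis using bil_unit[OF A(1) ab(1,2)] by (simp add: power2_eq_square)
  qed
  ultimately have "(t\<^sup>2 * A $$ (a, b)) / A $$ (a, b) \<in> K" using AK' ab K.divide_mem by metis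
  then show ?thesis using ab by simp
 qed
 then show ?thesis using that t tTK by blast
qed

text \<open>t T is a similitude over K with factor t^2. Evaluating the conjugate form at the image
  of its first column exhibits \<sigma>(t^2) as a quotient of two values of a positive definite
  form.\<close>

lemma totally_positive_similitude:
 assumes K: "real_subfield K" and AK: "elements_mat A \<subseteq> K"
  and pd: "!!\<sigma> :: real => real. \<sigma> \<in> embeddings K ==> (\<exists>x\<in>K. \<sigma> x ~= x) ==> positive_definite N (map_mat \<sigma> A)"
  and T: "T \<in> Mat N" "T\<^sup>T * A * T = A" and t: "t > 0" "t\<^sup>2 \<in> K" "elements_mat (t \<cdot>\<^sub>m T) \<subseteq> K"
 shows "totally_positive K (t\<^sup>2)"
proof -
 interpret K: real_subfield K by (rule K)
 have "\<sigma> (t\<^sup>2) > 0" if \<sigma>: "\<sigma> \<in> embeddings K" for \<sigma> :: "real => real"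
 proof (cases "\<exists>x\<in>K. \<sigma> x ~= x")
  case False
  then show ?thesis using t by simp
 next
  case True
  have pos: "positive_definite N (map_mat \<sigma> A)" using pd[OF \<sigma> True] .
  have A\<sigma>: "map_mat \<sigma> A \<in> Mat N" using A(1) by simp
  define s where "s = col (t \<cdot>\<^sub>m T) 0"
  have s: "s \<in> Vec N" "s $ i \<in> K" if "i < N" for i
  proof -
   show "s \<in> Vec N" unfolding s_def by (rule carrier_vecI) (use T in simp)
   have "s $ i = (t \<cdot>\<^sub>m T) $$ (i, 0)" using T(1) that by (simp add: s_def)
   then show "s $ i \<in> K"
    using t(3) elements_mat_subset_iff[OF smult_carrier_mat[OF T(1)]] that by simp
  qed
  note s = s(1)[of 0, simplified] s(2)
  have AK': "A $$ (i, j) \<in> K" if "i < N" "j < N" for i j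
   using AK that elements_mat_subset_iff[OF A(1)] by blast
  have "s = t \<cdot>\<^sub>v (T *\<^sub>v unit_vec N 0)" using T by (auto simp: s_def intro!: eq_vecI)
  then have "bil A s s = t * (t * bil A (T *\<^sub>v unit_vec N 0) (T *\<^sub>v unit_vec N 0))"
   using mult_mat_vec_carrier[OF T(1)] by (simp add: bil_simps del: index_mult_mat_vec)
  also have "bil A (T *\<^sub>v unit_vec N 0) (T *\<^sub>v unit_vec N 0) = A $$ (0, 0)"
   using isometry_iff[OF A(1) A(1) T(1)] T(2) bil_unit[OF A(1), of 0 0] by simp
  finally have q: "bil A s s = t\<^sup>2 * A $$ (0, 0)" by (simp add: power2_eq_square)
  have "\<sigma> (t\<^sup>2) * \<sigma> (A $$ (0, 0)) = \<sigma> (bil A s s)"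
   unfolding q by (rule K.emb_mult[OF \<sigma> t(2) AK', symmetric]) auto
  also have "\<dots> = (\<Sum>i<N. \<Sum>j<N. \<sigma> (s $ i) * \<sigma> (A $$ (i, j)) * \<sigma> (s $ j))"
  proof -
   have in_K: "s $ i * A $$ (i, j) * s $ j \<in> K" if "i < N" "j < N" for i j
    using that s AK' by (intro K.mult_mem) auto
   have "\<sigma> (bil A s s) = (\<Sum>i<N. \<Sum>j<N. \<sigma> (s $ i * A $$ (i, j) * s $ j))"
    unfolding bil_sum[OF A(1) s(1) s(1)]
    by (subst K.emb_sum[OF \<sigma>], (intro K.sum_mem in_K; simp), intro sum.cong refl K.emb_sum[OF \<sigma>] in_K) auto
   also have "\<dots> = (\<Sum>i<N. \<Sum>j<N. \<sigma> (s $ i) * \<sigma> (A $$ (i, j)) * \<sigma> (s $ j))"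
    by (intro sum.cong refl) (simp add: K.emb_mult[OF \<sigma>] s AK' K.mult_mem)
   finally show ?thesis .
  qed
  also have "\<dots> = bil (map_mat \<sigma> A) (map_vec \<sigma> s) (map_vec \<sigma> s)"
   using s A by (subst bil_sum[OF A\<sigma>]) auto
  also have "\<dots> \<ge> 0"
  proof (cases "map_vec \<sigma> s = 0\<^sub>v N")
   case True
   then show ?thesis using bil_sum[OF A\<sigma>, of "map_vec \<sigma> s" "map_vec \<sigma> s"] by simp
  next
   case False
   then show ?thesis using pos s by (auto simp: positive_definite_def quad_form_bil intro: less_imp_le)
  qed
  finally have "\<sigma> (t\<^sup>2) * \<sigma> (A $$ (0, 0)) \<ge> 0" .
  moreover have "\<sigma> (A $$ (0, 0)) > 0"
  proof -
   have "unit_vec N 0 ~= (0\<^sub>v N :: real vec)" by (rule unit_vec_nonzero) simp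
   then have "bil (map_mat \<sigma> A) (unit_vec N 0) (unit_vec N 0) > 0"
    using pos by (simp add: positive_definite_def quad_form_bil)
   then show ?thesis using bil_unit[OF A\<sigma>, of 0 0] A(1) by simp
  qed
  moreover have "\<sigma> (t\<^sup>2) ~= 0" using K.emb_nonzero[OF \<sigma> t(2)] t(1) by simp
  ultimately show ?thesis by (simp add: zero_le_mult_iff)
 qed
 then show ?thesis using t by (simp add: totally_positive_def)
qed

end

lemma poly_prod_list_linear_zero: "poly (\<Prod>a\<leftarrow>as. [:- a, 1:]) x = 0 \<longleftrightarrow> x \<in> set as"
 for x :: "'a::field"
 by (induction as) auto

lemma norm_prod_list_roots:
 assumes "l > 0" "\<forall>a\<in>set as. cmod a = 1 \<or> a = of_real l"
 shows "\<exists>k. cmod (poly (\<Prod>a\<leftarrow>as. [:- a, 1:]) 0) = l ^ k \<and> (of_real l \<in> set as --> k > 0)"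
 using assms(2)
proof (induction as)
 case (Cons a as)
 then obtain k where k: "cmod (poly (\<Prod>a\<leftarrow>as. [:- a, 1:]) 0) = l ^ k" "of_real l \<in> set as --> k > 0" by auto
 show ?case
 proof (cases "a = of_real l")
  case True
  then show ?thesis using k assms(1) by (intro exI[of _ "Suc k"]) (simp add: norm_mult)
 next
  case False
  then have "cmod a = 1" using Cons.prems by simp
  then show ?thesis using k False by (intro exI[of _ k]) (auto simp: norm_mult)
 qed
qed (auto intro: exI[of _ 0])

text \<open>
 If \<open>l\<^sup>-\<^sup>1\<close> were not conjugate to \<open>l\<close>, the constant term of the minimal polynomial would be a
 power of \<open>l\<close> up to sign, so that power and its inverse would both be rational integers.
\<close>

lemma salemI:
 assumes l: "l > 1" "algebraic_int l" "algebraic_int (inverse l)"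
  and conj: "!!z. z \<in> conjugates l ==> z = of_real l \<or> z = of_real (inverse l) \<or> cmod z = 1"
 shows "salem l"
proof -
 have "complex_of_real (inverse l) \<in> conjugates l"
 proof (rule ccontr)
  assume no: "complex_of_real (inverse l) \<notin> conjugates l"
  define p where "p = min_poly \<rat> l"
  define P where "P = map_poly complex_of_real p"
  note p = Rats.min_poly_props[OF algebraic_over_RatsI[OF l(2)], folded p_def]
  obtain as where as: "Polynomial.smult (lead_coeff P) (\<Prod>a\<leftarrow>as. [:- a, 1:]) = P"
   using fundamental_theorem_algebra_factorized[of P] by blast
  have "lead_coeff P = 1" using p(2) by (simp add: P_def)
  then have P: "P = (\<Prod>a\<leftarrow>as. [:- a, 1:])" using as by simp
  have root: "a \<in> set as \<longleftrightarrow> a \<in> conjugates l" for a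
   using poly_prod_list_linear_zero[of as a] by (simp add: P[symmetric] conjugates_def P_def p_def)
  have "poly P (of_real l) = 0" using p(3) by (simp add: P_def)
  then have l_as: "of_real l \<in> set as" unfolding P poly_prod_list_linear_zero .
  have "\<forall>a\<in>set as. cmod a = 1 \<or> a = of_real l" using conj no root by blast
  then obtain k where k: "cmod (poly P 0) = l ^ k" "k > 0"
   using norm_prod_list_roots[of l as] l l_as unfolding P by auto
  have "coeff p 0 \<in> \<rat>" using p(1) by (rule Rats.poly_over_coeff)
  moreover have "cmod (poly P 0) = \<bar>coeff p 0\<bar>" by (simp add: P_def poly_0_coeff_0)
  ultimately have rat: "l ^ k \<in> \<rat>" using k(1) by (metis Rats_abs_iff)
  then have rat': "inverse l ^ k \<in> \<rat>" by (simp add: power_inverse)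
  have "algebraic_int (inverse l ^ k)"
   using subring_of_field.power_mem[OF algebraic_int_subring, of "inverse l" k] l(3) by simp
  then have "inverse l ^ k \<in> \<int>" using rational_algebraic_int_is_int rat' by blast
  then obtain j where j: "inverse l ^ k = of_int j" by (auto elim: Ints_cases)
  have "0 < inverse l ^ k" "inverse l ^ k < 1"
   using l(1) k(2) by (auto simp: power_less_one_iff inverse_less_1_iff)
  then show False unfolding j by simp
 qed
 then show ?thesis using l conj by (auto simp: salem_def)
qed

text \<open>If a b = 1, the symmetrised coefficients are polynomials in a + b; for a = l and b = 1/l
  they thus lie in \<rat>(l + 1/l).\<close>

lemma sum_product_symmetric:
 fixes g :: "nat => complex"
 shows "(\<Sum>i\<in>I. \<Sum>j\<in>I. (a ^ i * b ^ j + a ^ j * b ^ i) / 2 * (g i * g j)) =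
  (\<Sum>i\<in>I. g i * a ^ i) * (\<Sum>i\<in>I. g i * b ^ i)"
proof -
 define P where "P = (\<Sum>i\<in>I. \<Sum>j\<in>I. a ^ i * b ^ j * (g i * g j))"
 have Q: "(\<Sum>i\<in>I. \<Sum>j\<in>I. a ^ j * b ^ i * (g i * g j)) = P"
  unfolding P_def by (subst sum.swap) (simp add: mult_ac)
 have "(a ^ i * b ^ j + a ^ j * b ^ i) / 2 * (g i * g j) =
   a ^ i * b ^ j * (g i * g j) / 2 + a ^ j * b ^ i * (g i * g j) / 2" for i j
  by (simp add: add_divide_distrib distrib_right)
 then have "(\<Sum>i\<in>I. \<Sum>j\<in>I. (a ^ i * b ^ j + a ^ j * b ^ i) / 2 * (g i * g j)) = P / 2 + P / 2"
  by (simp only: sum.distrib sum_divide_distrib[symmetric] Q P_def[symmetric])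
 also have "\<dots> = P" by simp
 also have "\<dots> = (\<Sum>i\<in>I. g i * a ^ i) * (\<Sum>i\<in>I. g i * b ^ i)"
  unfolding sum_product P_def by (intro sum.cong refl) (simp add: mult_ac)
 finally show ?thesis .
qed

lemma poly_map_of_real_sum:
 "poly (map_poly complex_of_real (sum f I)) y = (\<Sum>i\<in>I. poly (map_poly of_real (f i)) y)"
proof -
 interpret oh: map_poly_comm_ring_hom "of_real :: real => complex" ..
 show ?thesis by (simp add: oh.hom_sum poly_sum)
qed

lemma poly_map_of_real_smult_rat:
 "poly (map_poly complex_of_real (Polynomial.smult a (map_poly of_rat c))) y = of_real a * ev c y"
proof -
 have "map_poly complex_of_real (Polynomial.smult a (map_poly of_rat c)) =
   Polynomial.smult (of_real a) (map_poly of_rat c)"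
  by (rule poly_eqI) (simp add: coeff_map_poly)
 then show ?thesis by (simp add: ev_def)
qed

lemma null_frame_carrier:
 assumes "null_frame n v w"
 shows "v \<in> Vec (n + 1)" "w \<in> Vec (n + 1)" "v ~= 0\<^sub>v (n + 1)" "w ~= 0\<^sub>v (n + 1)"
proof -
 show "v \<in> Vec (n + 1)" "w \<in> Vec (n + 1)" using assms by (auto simp: null_frame_def)
 have "lorentz n v w = -1/2" using assms by (simp add: null_frame_def)
 then show "v ~= 0\<^sub>v (n + 1)" "w ~= 0\<^sub>v (n + 1)"
  using lorentz_zero_left[of n w] lorentz_zero_left[of n v] lorentz_comm[of n v w] by auto
qed

context lorentzian_form
begin

text \<open>
 An element of \<open>K\<close> lies in \<open>\<rat>(l + l\<^sup>-\<^sup>1)\<close> because only the identity embedding makes the image of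
 \<open>Y\<close> have an eigenvalue off the unit circle; the same dichotomy describes the conjugates of \<open>l\<close>.
\<close>

lemma salem_isometry:
 assumes K: "totally_real_number_field K" and AK: "elements_mat A \<subseteq> K"
  and pd: "!!\<sigma> :: real => real. \<sigma> \<in> embeddings K ==> (\<exists>x\<in>K. \<sigma> x ~= x) ==> positive_definite N (map_mat \<sigma> A)"
  and Y: "Y \<in> Mat N" "elements_mat Y \<subseteq> K" "Y\<^sup>T * A * Y = A" "toL Y \<in> O_plus n"
  and nf: "null_frame n v w" and gv: "toL Y *\<^sub>v v = l \<cdot>\<^sub>v v" "toL Y *\<^sub>v w = inverse l \<cdot>\<^sub>v w" and l: "l > 1"
  and ai: "algebraic_int l" "algebraic_int (inverse l)"
 shows "salem l" "K \<subseteq> field_adjoin \<rat> (l + inverse l)"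
proof -
 interpret K: number_field K by (rule totally_real_number_field_imp[OF K])
 obtain \<theta> where \<theta>: "\<theta> \<in> K" "K = range (\<lambda>c. ev c \<theta>)" by (rule K.primitive)
 obtain m where m: "m ~= 0" "ev m \<theta> = 0" "!!c. ev c \<theta> = 0 ==> m dvd c"
  "!!z :: complex. ev m z = 0 ==> ev (pderiv m) z ~= 0"
  by (rule minimal_rat_poly[OF K.algebraic_mem(2)[OF \<theta>(1)]]) blast
 define c where "c x = (SOME e. ev e \<theta> = x)" for x
 have c: "ev (c x) \<theta> = x" if "x \<in> K" for x
 proof -
  have "\<exists>e. ev e \<theta> = x" using that unfolding \<theta>(2) by auto
  then show ?thesis unfolding c_def by (rule someI_ex)
 qed
 have YK: "Y $$ (i, j) \<in> K" if "i < N" "j < N" for i j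
  using Y(2) elements_mat_subset_iff[OF Y(1)] that by blast
 \<comment> \<open>The entries of Y are written as rational polynomials in \<theta>. Evaluation at a
   conjugate y of \<theta> gives the corresponding conjugate of Y, so the single polynomial G
   records all their characteristic polynomials.\<close>
 define C where "C = map_mat c Y"
 define G where "G = char_poly C"
 define d where "d = degree G"
 have C: "C \<in> Mat N" using Y by (simp add: C_def)
 have G: "poly (char_poly (map_mat (\<lambda>e. ev e y) C)) x = (\<Sum>i\<le>d. ev (coeff G i) y * x ^ i)" for x y :: complex
 proof -
  interpret h: comm_ring_hom "\<lambda>e. ev e y" by (rule ev_comm_ring_hom)
  have "poly (char_poly (map_mat (\<lambda>e. ev e y) C)) x = poly (map_poly (\<lambda>e. ev e y) G) x"
   unfolding G_def by (simp add: h.char_poly_hom[OF C])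
  also have "\<dots> = (\<Sum>i\<le>d. coeff (map_poly (\<lambda>e. ev e y) G) i * x ^ i)"
   unfolding poly_altdef d_def by (rule sum.mono_neutral_left) (auto simp: degree_map_poly_le intro: le_degree)
  finally show ?thesis by (simp add: coeff_map_poly)
 qed
 have circle: "cmod x = 1"
  if root: "ev m y = 0" and y: "y ~= of_real \<theta>"
   and x: "poly (char_poly (map_mat (\<lambda>e. ev e y) C)) x = 0" for x y :: complex
 proof -
  have "\<exists>\<sigma> :: real => complex. \<sigma> \<in> embeddings K \<and> (\<forall>e. \<sigma> (ev e \<theta>) = ev e y)"
   by (rule K.embedding_of_root[OF \<theta>(2) m(3) root]) auto
  then obtain \<sigma> :: "real => complex" where \<sigma>: "\<sigma> \<in> embeddings K" "!!e. \<sigma> (ev e \<theta>) = ev e y" by auto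
  define \<tau> where "\<tau> = (\<lambda>x. Re (\<sigma> x))"
  have \<tau>: "of_real (\<tau> x) = \<sigma> x" if "x \<in> K" for x
  proof -
   have "\<sigma> x \<in> \<real>" using K \<sigma>(1) that by (auto simp: totally_real_number_field_def)
   then show ?thesis by (simp add: \<tau>_def)
  qed
  have emb: "\<tau> \<in> embeddings K"
   unfolding embeddings_def
  proof (rule ring_hom_memI)
   fix a b assume "a \<in> carrier (class_ring\<lparr>carrier := K\<rparr>)" "b \<in> carrier (class_ring\<lparr>carrier := K\<rparr>)"
   then have ab: "a \<in> K" "b \<in> K" by simp_all
   have "complex_of_real (\<tau> (a * b)) = of_real (\<tau> a * \<tau> b)"
    using ab by (simp add: \<tau> K.mult_mem K.emb_mult[OF \<sigma>(1)])
   then show "\<tau> (a \<otimes>\<^bsub>class_ring\<lparr>carrier := K\<rparr>\<^esub> b) = \<tau> a \<otimes>\<^bsub>class_ring\<^esub> \<tau> b"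
    by (simp only: of_real_eq_iff) simp
   show "\<tau> (a \<oplus>\<^bsub>class_ring\<lparr>carrier := K\<rparr>\<^esub> b) = \<tau> a \<oplus>\<^bsub>class_ring\<^esub> \<tau> b"
    using ab by (simp add: \<tau>_def K.emb_add[OF \<sigma>(1)])
  qed (simp_all add: \<tau>_def K.emb_1[OF \<sigma>(1)])
  have "\<sigma> \<theta> = y" using \<sigma>(2)[of "[:0, 1:]"] by simp
  then have "\<tau> \<theta> ~= \<theta>" using y \<tau>[OF \<theta>(1)] by auto
  then have pos: "positive_definite N (map_mat \<tau> A)" using pd[OF emb] \<theta>(1) by blast
  have A\<tau>: "map_mat \<tau> A \<in> Mat N" "(map_mat \<tau> A)\<^sup>T = map_mat \<tau> A"
   using A by (simp_all add: map_mat_transpose)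
  have Y\<tau>: "map_mat \<tau> Y \<in> Mat N" using Y(1) by simp
  have Yt: "Y\<^sup>T \<in> Mat N" "elements_mat (Y\<^sup>T) \<subseteq> K"
  proof -
   show *: "Y\<^sup>T \<in> Mat N" using Y(1) by simp
   show "elements_mat (Y\<^sup>T) \<subseteq> K"
    unfolding elements_mat_subset_iff[OF *] using Y(1) YK by simp
  qed
  have YtA: "Y\<^sup>T * A \<in> Mat N" using Yt(1) A(1) by simp
  have "map_mat \<tau> (Y\<^sup>T * A * Y) = map_mat \<tau> (Y\<^sup>T * A) * map_mat \<tau> Y"
   by (rule K.map_mat_emb_mult[OF emb YtA Y(1) K.elements_mat_mult[OF Yt(1) A(1) Yt(2) AK] Y(2)])
  also have "map_mat \<tau> (Y\<^sup>T * A) = map_mat \<tau> (Y\<^sup>T) * map_mat \<tau> A"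
   by (rule K.map_mat_emb_mult[OF emb Yt(1) A(1) Yt(2) AK])
  finally have iso: "(map_mat \<tau> Y)\<^sup>T * map_mat \<tau> A * map_mat \<tau> Y = map_mat \<tau> A"
   unfolding Y(3) map_mat_transpose ..
  have "map_mat (\<lambda>e. ev e y) C = map_mat complex_of_real (map_mat \<tau> Y)"
  proof (rule eq_matI)
   fix i j assume "i < dim_row (map_mat complex_of_real (map_mat \<tau> Y))"
    "j < dim_col (map_mat complex_of_real (map_mat \<tau> Y))"
   then have ij: "i < N" "j < N" using Y(1) by auto
   have "ev (c (Y $$ (i, j))) y = of_real (\<tau> (Y $$ (i, j)))"
    using \<sigma>(2)[of "c (Y $$ (i, j))"] c[OF YK[OF ij]] \<tau>[OF YK[OF ij]] by simp
   then show "map_mat (\<lambda>e. ev e y) C $$ (i, j) = map_mat complex_of_real (map_mat \<tau> Y) $$ (i, j)"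
    using ij Y(1) by (simp add: C_def)
  qed (simp_all add: C_def)
  then show ?thesis
   using positive_definite_isometry_eigenvalue[OF A\<tau> pos Y\<tau> iso, of x] x by simp
 qed
 have YC: "map_mat (\<lambda>e. ev e (complex_of_real \<theta>)) C = map_mat complex_of_real Y"
  using Y(1) YK by (intro eq_matI) (auto simp: C_def ev_of_real c)
 have spec: "x = of_real l \<or> x = of_real (inverse l) \<or> cmod x = 1"
  if "poly (char_poly (map_mat complex_of_real Y)) x = 0" for x
  using O_plus_eigenvalue[OF Y(4) nf gv, of x] that l similar_toL[OF Y(1)] by auto
 have eig: "poly (char_poly (map_mat complex_of_real Y)) (of_real l) = 0"
 proof -
  have "eigenvector (toL Y) v l"
   unfolding eigenvector_def using null_frame_carrier[OF nf] gv toL_carrier[OF Y(1)] by auto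
  then have "poly (char_poly (toL Y)) l = 0"
   using eigenvalue_root_char_poly[OF toL_carrier[OF Y(1)]] unfolding eigenvalue_def by blast
  then show ?thesis
   by (simp add: similar_toL[OF Y(1)] of_real_hom.char_poly_hom[OF toL_carrier[OF Y(1)]])
 qed
 have algl: "algebraic_over \<rat> l" and alg_tr: "algebraic_over \<rat> (l + inverse l)"
  using algebraic_over_RatsI ai algebraic_int_add_mult(1) by blast+
 define F where "F = field_adjoin \<rat> (l + inverse l)"
 interpret F: real_subfield F
  unfolding F_def by (rule real_subfieldI[OF field_adjoin_subfield])
 have trF: "l + inverse l \<in> F" unfolding F_def by (rule field_adjoin_mem)
 have li: "l * inverse l = 1" using l by simp
 have pF: "l ^ k + inverse l ^ k \<in> F" for k
 proof (induction k rule: induct_nat_012)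
  case 0
  show ?case using F.of_nat_mem[of 2] by simp
 next
  case 1
  show ?case using trF by simp
 next
  case (ge2 k)
  have e: "l ^ Suc (Suc k) + inverse l ^ Suc (Suc k) =
    (l + inverse l) * (l ^ Suc k + inverse l ^ Suc k) - (l * inverse l) * (l ^ k + inverse l ^ k)"
   by (simp add: algebra_simps del: left_inverse right_inverse)
  have "(l + inverse l) * (l ^ Suc k + inverse l ^ Suc k) - 1 * (l ^ k + inverse l ^ k) \<in> F"
   using ge2 trF F.one_mem F.diff_mem F.mult_mem by presburger
  then show ?case unfolding e li .
 qed
 define s where "s = (\<lambda>i j. (l ^ i * inverse l ^ j + l ^ j * inverse l ^ i) / 2)"
 have s_aux: "s i (i + k) \<in> F" "s (i + k) i \<in> F" for i k
 proof -
  have "l ^ i * inverse l ^ i = 1" using li by (metis power_mult_distrib power_one)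
  then have "l ^ i * inverse l ^ (i + k) + l ^ (i + k) * inverse l ^ i = l ^ k + inverse l ^ k"
   by (simp add: power_add mult.assoc[symmetric])
  then have "s i (i + k) = (l ^ k + inverse l ^ k) / of_nat 2" "s (i + k) i = (l ^ k + inverse l ^ k) / of_nat 2"
   by (simp_all add: s_def add.commute)
  then show "s i (i + k) \<in> F" "s (i + k) i \<in> F"
   using F.divide_mem[OF pF F.of_nat_mem[of 2]] by metis+
 qed
 have sF: "s i j \<in> F" for i j
  using s_aux by (metis le_Suc_ex nat_le_linear)
 \<comment> \<open>As a function of y, h(y) = G_y(l) G_y(1/l). It vanishes at \<theta> because l is
   an eigenvalue of Y, and at no other conjugate of \<theta>, where all eigenvalues have modulus
   one. Taking the product over l and 1/l puts the coefficients into F.\<close>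
 define h where "h = (\<Sum>i\<le>d. \<Sum>j\<le>d. Polynomial.smult (s i j) (map_poly of_rat (coeff G i * coeff G j)))"
 have h_eval: "poly (map_poly complex_of_real h) y =
   poly (char_poly (map_mat (\<lambda>e. ev e y) C)) (of_real l) *
   poly (char_poly (map_mat (\<lambda>e. ev e y) C)) (of_real (inverse l))" for y
  unfolding h_def poly_map_of_real_sum poly_map_of_real_smult_rat G sum_product_symmetric[symmetric]
  by (simp add: s_def)
 have "\<theta> \<in> F"
 proof (rule F.unique_common_root_mem[OF m(1,2)])
  show "ev (pderiv m) (complex_of_real \<theta>) ~= 0"
   using m(4)[of "of_real \<theta>"] m(2) by (simp add: ev_of_real)
  show "F.poly_over h"
   unfolding h_def using sF by (intro F.poly_over_sum F.poly_over_smult F.poly_over_map_of_rat)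
  have "complex_of_real (poly h \<theta>) = poly (map_poly complex_of_real h) (of_real \<theta>)" by simp
  also have "\<dots> = 0" unfolding h_eval YC using eig by simp
  finally show "poly h \<theta> = 0" by simp
  show "z = of_real \<theta>" if z: "ev m z = 0" "poly (map_poly of_real h) z = 0" for z :: complex
  proof (rule ccontr)
   assume nz: "z ~= of_real \<theta>"
   have "cmod (of_real l) = 1 \<or> cmod (of_real (inverse l)) = 1"
    using z(2) circle[OF z(1) nz] unfolding h_eval mult_eq_0_iff by blast
   then have "\<bar>l\<bar> = 1 \<or> \<bar>inverse l\<bar> = 1" by (simp only: norm_of_real)
   then show False using l by auto
  qed
 qed
 then show sub: "K \<subseteq> field_adjoin \<rat> (l + inverse l)"
  unfolding \<theta>(2) F_def[symmetric] using F.ev_mem by blast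
 obtain c0 where c0: "\<theta> = ev c0 (l + inverse l)"
  using \<open>\<theta> \<in> F\<close> unfolding F_def field_adjoin_Rats[OF alg_tr] by blast
 show "salem l"
 proof (rule salemI[OF l ai])
  fix z assume z: "z \<in> conjugates l"
  \<comment> \<open>Substituting z in \<theta> = c0(l + 1/l) yields a conjugate y of \<theta>, and z
    is an eigenvalue of the conjugate of Y belonging to y.\<close>
  define y where "y = ev c0 (z + inverse z)"
  have l0: "l ~= 0" using l by simp
  have "(\<Sum>i\<in>{0::nat}. ev (pcompose m c0) (l + inverse l) * l ^ i) = 0"
   using m(2) c0 by simp
  from conjugate_relation(2)[OF algl l0 z this] have my: "ev m y = 0" by (simp add: y_def)
  have "complex_of_real (\<Sum>i\<le>d. ev (pcompose (coeff G i) c0) (l + inverse l) * l ^ i) =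
    poly (char_poly (map_mat (\<lambda>e. ev e (complex_of_real \<theta>)) C)) (of_real l)"
   unfolding G by (simp add: c0[symmetric] ev_of_real)
  then have "complex_of_real (\<Sum>i\<le>d. ev (pcompose (coeff G i) c0) (l + inverse l) * l ^ i) = of_real 0"
   unfolding YC eig by simp
  then have "(\<Sum>i\<le>d. ev (pcompose (coeff G i) c0) (l + inverse l) * l ^ i) = 0"
   by (simp only: of_real_eq_iff)
  from conjugate_relation(2)[OF algl l0 z this]
  have Gz: "poly (char_poly (map_mat (\<lambda>e. ev e y) C)) z = 0"
   unfolding G by (simp add: y_def)
  show "z = of_real l \<or> z = of_real (inverse l) \<or> cmod z = 1"
  proof (cases "y = of_real \<theta>")
   case True
   then show ?thesis using spec[of z] Gz YC by simp
  next
   case False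
   then show ?thesis using circle[OF my False Gz] by simp
  qed
 qed
qed

end

context subring_of_field
begin

lemma poly_over_prod: "(!!i. i \<in> I ==> poly_over (f i)) ==> poly_over (prod f I)"
 by (induction I rule: infinite_finite_induct) (auto simp: poly_over_1 poly_over_mult)

lemma char_poly_over:
 assumes T: "T \<in> Mat N" "elements_mat T \<subseteq> R"
 shows "poly_over (char_poly T)"
proof -
 have B: "char_poly_matrix T \<in> Mat N" using T(1) by simp
 have entry: "poly_over (char_poly_matrix T $$ (i, j))" if "i < N" "j < N" for i j
 proof -
  have "T $$ (i, j) \<in> R" using T(2) that unfolding elements_mat_subset_iff[OF T(1)] by blast
  then have "poly_over [:- (T $$ (i, j)):]" by (intro poly_over_pCons poly_over_0 uminus_mem)
  moreover have "poly_over (if i = j then [:0, 1:] else 0)"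
   by (auto intro!: poly_over_pCons poly_over_0 zero_mem one_mem)
  ultimately have "poly_over ((if i = j then [:0, 1:] else 0) + [:- (T $$ (i, j)):])"
   by (intro poly_over_add)
  moreover have "char_poly_matrix T $$ (i, j) = (if i = j then [:0, 1:] else 0) + [:- (T $$ (i, j)):]"
   using T(1) that by (simp add: char_poly_matrix_def)
  ultimately show ?thesis by simp
 qed
 show ?thesis
  unfolding char_poly_def det_def'[OF B]
 proof (rule poly_over_sum, rule poly_over_mult)
  fix p assume p: "p \<in> {p. p permutes {0..<N}}"
  show "poly_over (signof p)"
   using poly_over_1 poly_over_uminus[OF poly_over_1] by (auto simp: sign_def)
  show "poly_over (\<Prod>i = 0..<N. char_poly_matrix T $$ (i, p i))"
   using p permutes_in_image[of p "{0..<N}"] by (intro poly_over_prod entry) auto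
 qed
qed

end

lemma conj_mat_mult:
 fixes P :: "real mat"
 assumes P: "P \<in> Mat N" "P' \<in> Mat N" "P' * P = 1\<^sub>m N"
  and gh: "g \<in> Mat N" "h \<in> Mat N"
 shows "(P * g * P') * (P * h * P') = P * (g * h) * P'"
proof -
 have "P' * (P * X) = X" if "X \<in> Mat N" for X
  using assoc_mult_mat[OF P(2,1) that] that by (simp add: P(3))
 then show ?thesis using gh P by (simp add: assoc_mult_mat[of _ N N _ N _ N])
qed

lemma conj_mat_pow:
 fixes P :: "real mat"
 assumes P: "P \<in> Mat N" "P' \<in> Mat N" "P' * P = 1\<^sub>m N" "P * P' = 1\<^sub>m N"
  and g: "g \<in> Mat N"
 shows "(P * g * P') ^\<^sub>m k = P * g ^\<^sub>m k * P'"
proof (induction k)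
 case 0
 show ?case using P g by simp
next
 case (Suc k)
 then show ?case using conj_mat_mult[OF P(1-3) pow_carrier_mat[OF g] g] by simp
qed

lemma pow_mat_mult_GL:
 assumes "T \<in> Mat m"
 shows "T ^\<^sub>m (i * j) = (T ^\<^sub>m i) ^\<^sub>m j"
proof (induction j)
 case (Suc j)
 have "T ^\<^sub>m (i * Suc j) = T ^\<^sub>m (i * j) * T ^\<^sub>m i"
  using pow_mat_add_GL[OF assms, of "i * j" i] by (simp add: add.commute)
 then show ?case using Suc by simp
qed (use assms in simp)

text \<open>Three matrices share the work: the power \<open>T ^ k0\<close> is integral and makes
  \<mu> integral, the square Y is over K and has the eigenvalue l, and the multiple t T is over K
  and has an eigenvalue t \<mu> from which the square root polynomial is built.\<close>

lemma translation_length_square_rootable: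
 assumes n: "n \<ge> 2" and K: "totally_real_number_field K" and arith: "arithmetic_simplest_type n K \<Gamma>"
  and \<gamma>: "\<gamma> \<in> \<Gamma>" "hyperbolic n \<gamma>" and l: "l = exp (2 * translation_length n \<gamma>)"
 shows "square_rootable K l"
proof -
 interpret K: number_field K by (rule totally_real_number_field_imp[OF K])
 interpret O: subring_of_field "\<O> K" by (rule K.ring_of_integers_subring)
 obtain A M where adm: "admissible n K A" and MG: "M \<in> carrier (GL (n + 1))"
  and form: "!!x. x \<in> Vec (n + 1) ==> quad_form A (M *\<^sub>v x) = lorentz_form n x"
  and comm: "commensurable (GL (n + 1)) ((\<lambda>T. M * T * inv\<^bsub>GL (n + 1)\<^esub> M) ` \<Gamma>)
   (O_prime (n + 1) A (\<O> K))"
  and sub: "subgroup \<Gamma> (GL (n + 1))" and \<Gamma>O: "\<Gamma> \<subseteq> O_plus n"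
  using arith unfolding arithmetic_simplest_type_def by blast
 define Mi where "Mi = inv\<^bsub>GL (n + 1)\<^esub> M"
 have Mc: "M \<in> Mat (n + 1)" using MG by (simp add: GL_carrier_iff)
 note Mi = GL_inv[OF MG, folded Mi_def]
 have A: "A \<in> Mat (n + 1)" "A\<^sup>T = A" and AK: "elements_mat A \<subseteq> K"
  and pd: "!!\<sigma> :: real => real. \<sigma> \<in> embeddings K ==> (\<exists>x\<in>K. \<sigma> x ~= x) ==> positive_definite (n + 1) (map_mat \<sigma> A)"
  using adm by (auto simp: admissible_def)
 interpret lorentzian_form n A M Mi
  using A Mc Mi form by unfold_locales auto
 have \<Gamma>c: "g \<in> Mat N" if "g \<in> \<Gamma>" for g using that \<Gamma>O by (auto simp: O_plus_def)
 have \<Gamma>m: "g * h \<in> \<Gamma>" if "g \<in> \<Gamma>" "h \<in> \<Gamma>" for g h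
  using subgroup.m_closed[OF sub that] by simp
 have \<Gamma>1: "1\<^sub>m N \<in> \<Gamma>" using subgroup.one_closed[OF sub] by simp
 have toL_conj: "toL (M * g * Mi) = g" if g: "g \<in> Mat N" for g
 proof -
  have "toL (M * g * Mi) = (Mi * M) * g * (Mi * M)"
   using g M(1,2) unfolding toL_def by (simp add: assoc_mult_mat[of _ N N _ N _ N])
  then show ?thesis using g M left_mult_one_mat[OF g] right_mult_one_mat[OF g] by simp
 qed
 define H1 where "H1 = (\<lambda>T. M * T * Mi) ` \<Gamma>"
 define H2 where "H2 = O_prime N A (\<O> K)"
 have comm1: "commensurable (GL N) H1 H2" using comm by (simp add: H1_def H2_def Mi_def)
 then have comm2: "commensurable (GL N) H2 H1" by (simp add: commensurable_def Int_commute)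
 have H1c: "H1 \<subseteq> Mat N" using M \<Gamma>c by (auto simp: H1_def)
 have H1m: "S * T \<in> H1" if "S \<in> H1" "T \<in> H1" for S T
  using that \<Gamma>m \<Gamma>c conj_mat_mult[OF M(1,2,4)] by (auto simp: H1_def)
 have H11: "1\<^sub>m N \<in> H1"
 proof -
  have "M * 1\<^sub>m N * Mi = 1\<^sub>m N" using M by simp
  then show ?thesis unfolding H1_def using \<Gamma>1 by (metis image_eqI)
 qed
 have H2_iff: "T \<in> H2 \<longleftrightarrow> T \<in> GL_over N (\<O> K) \<and> toL T \<in> O_plus n" for T
  unfolding H2_def by (rule O_prime_iff)
 have H2c: "H2 \<subseteq> Mat N" by (auto simp: H2_iff GL_over_def)
 have H2G: "T \<in> carrier (GL N)" if "T \<in> H2" for T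
  using that by (auto simp: H2_iff GL_over_def GL_carrier_iff)
 have H2K: "elements_mat T \<subseteq> K" "elements_mat T \<subseteq> \<O> K" if "T \<in> H2" for T
  using that K.integers_subset by (auto simp: H2_iff GL_over_def)
 have H2m: "S * T \<in> H2" if "S \<in> H2" "T \<in> H2" for S T
  using that K.GL_over_mult O_plus_mult toL_mult H2c by (auto simp: H2_iff subset_iff)
 have H21: "1\<^sub>m N \<in> H2"
  unfolding H2_iff using O.elements_mat_one toL_one O_plus_one by (auto simp: GL_over_def intro!: bexI[of _ "1\<^sub>m N"])
 have \<gamma>c: "\<gamma> \<in> Mat N" and \<gamma>G: "\<gamma> \<in> carrier (GL N)"
  using \<gamma>(1) \<Gamma>c subgroup.subset[OF sub] by auto
 define \<gamma>' where "\<gamma>' = inv\<^bsub>GL N\<^esub> \<gamma>"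
 have \<gamma>': "\<gamma>' \<in> \<Gamma>" "\<gamma>' \<in> Mat N" "\<gamma> * \<gamma>' = 1\<^sub>m N"
 proof -
  show 1: "\<gamma>' \<in> \<Gamma>"
   using subgroup.m_inv_closed[OF sub \<gamma>(1)] by (simp add: \<gamma>'_def)
  show "\<gamma>' \<in> Mat N" "\<gamma> * \<gamma>' = 1\<^sub>m N" using GL_inv[OF \<gamma>G] by (auto simp: \<gamma>'_def)
 qed
 define T where "T = M * \<gamma> * Mi"
 define Ti where "Ti = M * \<gamma>' * Mi"
 have TH: "T \<in> H1" "Ti \<in> H1" using \<gamma>(1) \<gamma>'(1) by (auto simp: T_def Ti_def H1_def)
 then have Tc: "T \<in> Mat N" "Ti \<in> Mat N" using H1c by auto
 have TTi: "T * Ti = 1\<^sub>m N"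
  unfolding T_def Ti_def conj_mat_mult[OF M(1,2,4) \<gamma>c \<gamma>'(2)] \<gamma>'(3) using M by simp
 have TiT: "Ti * T = 1\<^sub>m N" using mat_mult_left_right_inverse[OF Tc TTi] .
 have TG: "T \<in> carrier (GL N)" by (rule GL_carrierI[OF Tc TTi TiT])
 have toLT: "toL T = \<gamma>" unfolding T_def by (rule toL_conj[OF \<gamma>c])
 define \<mu> where "\<mu> = exp (translation_length n \<gamma>)"
 obtain v w where nf: "null_frame n v w" and gv: "\<gamma> *\<^sub>v v = exp (translation_length n \<gamma>) \<cdot>\<^sub>v v"
   "\<gamma> *\<^sub>v w = exp (- translation_length n \<gamma>) \<cdot>\<^sub>v w" and tl: "translation_length n \<gamma> > 0" and \<gamma>O: "\<gamma> \<in> O_plus n"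
  by (rule hyperbolicE[OF \<gamma>(2)])
 have gv: "toL T *\<^sub>v v = \<mu> \<cdot>\<^sub>v v" "toL T *\<^sub>v w = inverse \<mu> \<cdot>\<^sub>v w" and mu: "\<mu> > 1"
  using gv tl by (simp_all add: toLT \<mu>_def exp_minus)
 have l\<mu>: "l = \<mu>\<^sup>2" unfolding l \<mu>_def by (simp add: exp_double)
 have TO: "toL T \<in> O_plus n" using \<gamma>O by (simp add: toLT)
 obtain k0 where k0: "k0 > 0" "T ^\<^sub>m k0 \<in> H2"
  using commensurable_power[OF comm1 TH(1) TG H11 H1m H21 H1c] by metis
 \<comment> \<open>A power of y lies in the conjugated lattice and so does its conjugate by T; a
   further power of the latter returns to the integral group, whose entries are in K.\<close>
 have commK: "\<exists>k>0. elements_mat (T * y ^\<^sub>m k * Ti) \<subseteq> K" if y: "y \<in> H2" for y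
 proof -
  obtain k where k: "k > 0" "y ^\<^sub>m k \<in> H1"
   using commensurable_power[OF comm2 y H2G[OF y] H21 H2m H11 H2c] by metis
  have yk: "y ^\<^sub>m k \<in> Mat N" using k(2) H1c by blast
  have yc: "y \<in> Mat N" using y H2c by blast
  define x where "x = T * y ^\<^sub>m k * Ti"
  have xH: "x \<in> H1" unfolding x_def using H1m TH k(2) by blast
  have "x \<in> carrier (GL N)"
  proof -
   have "y ^\<^sub>m k \<in> H2"
   proof (induction k)
    case 0
    show ?case using H21 yc by simp
   next
    case (Suc k)
    then show ?case using H2m y by simp
   qed
   then obtain s where s: "s \<in> Mat N" "y ^\<^sub>m k * s = 1\<^sub>m N" "s * y ^\<^sub>m k = 1\<^sub>m N"
    using H2G unfolding GL_carrier_iff by blast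
   show ?thesis
   proof (rule GL_carrierI)
    show "x \<in> Mat N" using xH H1c by blast
    show "T * s * Ti \<in> Mat N" using Tc s by simp
    show "x * (T * s * Ti) = 1\<^sub>m N" "T * s * Ti * x = 1\<^sub>m N"
     unfolding x_def conj_mat_mult[OF Tc TiT yk s(1)] conj_mat_mult[OF Tc TiT s(1) yk] s
     using Tc TTi by simp_all
   qed
  qed
  then obtain k' where k': "k' > 0" "x ^\<^sub>m k' \<in> H2"
   using commensurable_power[OF comm1 xH _ H11 H1m H21 H1c] by metis
  have "x ^\<^sub>m k' = T * y ^\<^sub>m (k * k') * Ti"
   unfolding x_def conj_mat_pow[OF Tc TiT TTi yk] pow_mat_mult_GL[OF yc] ..
  then show ?thesis using k' k(1) H2K(1) by (metis nat_0_less_mult_iff)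
 qed
 have rat: "elements_mat (T * Y * Ti) \<subseteq> K" if Y: "Y \<in> Mat N" "elements_mat Y \<subseteq> K" for Y
  by (rule commensurator_rational[OF n K.number_field_axioms AK Tc TTi TO nf gv mu k0(1) _ _ Y])
   (use k0(2) commK in \<open>auto simp: H2_def\<close>)
 have isoT: "T\<^sup>T * A * T = A"
  unfolding toL_isometry_iff[OF Tc(1)] using TO by (simp add: O_plus_iff)
 obtain t where t: "t > 0" "t\<^sup>2 \<in> K" "elements_mat (t \<cdot>\<^sub>m T) \<subseteq> K"
  by (rule similitude_of_rational_conj[OF K.real_subfield_axioms AK Tc TTi isoT rat])
 have pos: "totally_positive K (t\<^sup>2)"
  by (rule totally_positive_similitude[OF K.real_subfield_axioms AK pd Tc(1) isoT t])
 have car: "M *\<^sub>v v \<in> Vec N" "M *\<^sub>v w \<in> Vec N" "v \<in> Vec N" "w \<in> Vec N"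
  using null_frame_carrier[OF nf] Mc by auto
 have nz: "M *\<^sub>v v ~= 0\<^sub>v N" "M *\<^sub>v w ~= 0\<^sub>v N"
 proof -
  have "Mi *\<^sub>v 0\<^sub>v N = 0\<^sub>v N" using M(2) by (intro eq_vecI) auto
  then show "M *\<^sub>v v ~= 0\<^sub>v N" "M *\<^sub>v w ~= 0\<^sub>v N"
   using MiM[OF car(3)] MiM[OF car(4)] null_frame_carrier(3,4)[OF nf] by metis+
 qed
 have powv: "T ^\<^sub>m k *\<^sub>v (M *\<^sub>v x) = r ^ k \<cdot>\<^sub>v (M *\<^sub>v x)"
  if x: "x \<in> Vec N" and e: "toL T *\<^sub>v x = r \<cdot>\<^sub>v x" for x r k
 proof -
  have Mx: "M *\<^sub>v x \<in> Vec N" using x by (rule Mc)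
  have "Mi *\<^sub>v (T *\<^sub>v (M *\<^sub>v x)) = r \<cdot>\<^sub>v x" using e toL_vec[OF Tc(1) x] by simp
  then have "M *\<^sub>v (Mi *\<^sub>v (T *\<^sub>v (M *\<^sub>v x))) = M *\<^sub>v (r \<cdot>\<^sub>v x)" by simp
  then have T1: "T *\<^sub>v (M *\<^sub>v x) = r \<cdot>\<^sub>v (M *\<^sub>v x)"
   using MMi[OF mult_mat_vec_carrier[OF Tc(1) Mx]] mult_mat_vec[OF M(1) x] by simp
  show ?thesis
  proof (induction k)
   case 0
   show ?case using Tc Mx by simp
  next
   case (Suc k)
   show ?case
    unfolding pow_mat_vec_Suc[OF Tc(1) Mx] T1
     mult_mat_vec[OF pow_carrier_mat[OF Tc(1)] Mx] Suc by (simp add: smult_smult_assoc)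
  qed
 qed
 have "algebraic_int (r ^ k0)" if "x \<in> Vec N" "M *\<^sub>v x ~= 0\<^sub>v N" "toL T *\<^sub>v x = r \<cdot>\<^sub>v x" for x r
 proof (rule algebraic_int_matrix_eigenvalue)
  show H: "T ^\<^sub>m k0 \<in> Mat N" using Tc by simp
  show "algebraic_int ((T ^\<^sub>m k0) $$ (i, j))" if "i < N" "j < N" for i j
   using H2K(2)[OF k0(2)] that unfolding elements_mat_subset_iff[OF H] by (auto simp: ring_of_integers_def)
  show "M *\<^sub>v x \<in> Vec N" using that(1) by (rule Mc)
  show "M *\<^sub>v x ~= 0\<^sub>v N" by fact
  show "T ^\<^sub>m k0 *\<^sub>v (M *\<^sub>v x) = r ^ k0 \<cdot>\<^sub>v (M *\<^sub>v x)" by (rule powv[OF that(1,3)])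
 qed
 then have "algebraic_int (\<mu> ^ k0)" "algebraic_int (inverse \<mu> ^ k0)" using car nz gv by auto
 \<comment> \<open>Only the \<open>k0\<close>-th power of \<mu> is an eigenvalue of an integral
   matrix; a root of an algebraic integer is one as well.\<close>
 moreover have "algebraic_int x" if "algebraic_int (x ^ k0)" for x :: real
  by (rule algebraic_int_root[OF that, of "Polynomial.monom 1 k0"])
   (use k0(1) in \<open>auto simp: poly_monom degree_monom_eq\<close>)
 ultimately have "algebraic_int \<mu>" "algebraic_int (inverse \<mu>)" by blast+
 then have ai: "algebraic_int l" "algebraic_int (inverse l)"
  using algebraic_int_add_mult(2) by (auto simp: l\<mu> power2_eq_square)
 \<comment> \<open>The scalar t disappears in the square: Y is (t T)(t T) divided by t^2, and both
   are defined over K.\<close>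
 define Y where "Y = T * T"
 have Yc: "Y \<in> Mat N" using Tc by (simp add: Y_def)
 have YK: "elements_mat Y \<subseteq> K"
 proof -
  have tT: "t \<cdot>\<^sub>m T \<in> Mat N" using Tc by simp
  have "elements_mat ((t \<cdot>\<^sub>m T) * (t \<cdot>\<^sub>m T)) \<subseteq> K" by (rule K.elements_mat_mult[OF tT tT t(3) t(3)])
  moreover have "(t \<cdot>\<^sub>m T) * (t \<cdot>\<^sub>m T) \<in> Mat N" using tT by simp
  ultimately have "elements_mat (inverse (t\<^sup>2) \<cdot>\<^sub>m ((t \<cdot>\<^sub>m T) * (t \<cdot>\<^sub>m T))) \<subseteq> K"
   by (intro K.elements_mat_smult K.inverse_mem t(2))
  also have "inverse (t\<^sup>2) \<cdot>\<^sub>m ((t \<cdot>\<^sub>m T) * (t \<cdot>\<^sub>m T)) = Y"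
  proof (rule eq_matI)
   fix i j assume "i < dim_row Y" "j < dim_col Y"
   then have ij: "i < N" "j < N" using Yc by auto
   have "((t \<cdot>\<^sub>m T) * (t \<cdot>\<^sub>m T)) $$ (i, j) = (\<Sum>k<N. t\<^sup>2 * (T $$ (i, k) * T $$ (k, j)))"
    unfolding mat_mult_entry[OF tT tT ij]
    using ij Tc by (intro sum.cong) (simp_all add: power2_eq_square mult_ac)
   also have "\<dots> = t\<^sup>2 * Y $$ (i, j)"
    unfolding Y_def mat_mult_entry[OF Tc(1) Tc(1) ij] by (simp only: sum_distrib_left)
   finally have e: "((t \<cdot>\<^sub>m T) * (t \<cdot>\<^sub>m T)) $$ (i, j) = t\<^sup>2 * Y $$ (i, j)" .
   have "(inverse (t\<^sup>2) \<cdot>\<^sub>m ((t \<cdot>\<^sub>m T) * (t \<cdot>\<^sub>m T))) $$ (i, j) =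
     inverse (t\<^sup>2) * ((t \<cdot>\<^sub>m T) * (t \<cdot>\<^sub>m T)) $$ (i, j)"
    by (rule index_smult_mat(1)) (use ij Tc in auto)
   then show "(inverse (t\<^sup>2) \<cdot>\<^sub>m ((t \<cdot>\<^sub>m T) * (t \<cdot>\<^sub>m T))) $$ (i, j) = Y $$ (i, j)"
    unfolding e using t(1) by simp
  qed (use Tc Yc in auto)
  finally show ?thesis .
 qed
 have YL: "toL Y = toL T * toL T" unfolding Y_def by (rule toL_mult[OF Tc(1) Tc(1)])
 have YO: "toL Y \<in> O_plus n" unfolding YL by (rule O_plus_mult[OF TO TO])
 have Yiso: "Y\<^sup>T * A * Y = A"
  unfolding toL_isometry_iff[OF Yc] using YO by (simp add: O_plus_iff)
 have Yev: "toL Y *\<^sub>v x = (r * r) \<cdot>\<^sub>v x" if "x \<in> Vec N" "toL T *\<^sub>v x = r \<cdot>\<^sub>v x" for x r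
  unfolding YL using that toL_carrier[OF Tc(1)]
  by (simp add: assoc_mult_mat_vec[of _ N N _ N] mult_mat_vec[of _ N N] smult_smult_assoc)
 have Yvw: "toL Y *\<^sub>v v = l \<cdot>\<^sub>v v" "toL Y *\<^sub>v w = inverse l \<cdot>\<^sub>v w"
  using Yev[OF car(3) gv(1)] Yev[OF car(4) gv(2)] by (simp_all add: l\<mu> power2_eq_square)
 have l1: "l > 1" using mu by (simp add: l\<mu>)
 note sal = salem_isometry[OF K AK pd Yc YK Yiso YO nf Yvw l1 ai]
 define \<chi> where "\<chi> = char_poly (t \<cdot>\<^sub>m T)"
 have tT: "t \<cdot>\<^sub>m T \<in> Mat N" using Tc by simp
 have chi_over: "K.poly_over \<chi>" unfolding \<chi>_def by (rule K.char_poly_over[OF tT t(3)])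
 have chi_root: "poly \<chi> (t * r) = 0 \<longleftrightarrow> poly (char_poly T) r = 0" for r
 proof -
  have "poly \<chi> (t * r) = 0 \<longleftrightarrow> eigenvalue (t \<cdot>\<^sub>m T) (t * r)"
   unfolding \<chi>_def by (rule eigenvalue_root_char_poly[OF tT, symmetric])
  also have "\<dots> \<longleftrightarrow> eigenvalue T r"
  proof -
   have "(t \<cdot>\<^sub>m T) *\<^sub>v x = (t * r) \<cdot>\<^sub>v x \<longleftrightarrow> T *\<^sub>v x = r \<cdot>\<^sub>v x" if x: "x \<in> Vec N" for x
   proof -
    have "(t \<cdot>\<^sub>m T) *\<^sub>v x = t \<cdot>\<^sub>v (T *\<^sub>v x)" using x Tc(1) by (intro eq_vecI) auto
    moreover have "(t * r) \<cdot>\<^sub>v x = t \<cdot>\<^sub>v (r \<cdot>\<^sub>v x)" by (simp add: smult_smult_assoc)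
    moreover have "t \<cdot>\<^sub>v a = t \<cdot>\<^sub>v b ==> a = b" if "a \<in> Vec N" "b \<in> Vec N" for a b :: "real vec"
     using t(1) that by (auto simp: vec_eq_iff)
    ultimately show ?thesis using x Tc(1) by (metis mult_mat_vec_carrier smult_carrier_vec)
   qed
   then show ?thesis using Tc(1) by (auto simp: eigenvalue_def eigenvector_def)
  qed
  also have "\<dots> \<longleftrightarrow> poly (char_poly T) r = 0" by (rule eigenvalue_root_char_poly[OF Tc(1)])
  finally show ?thesis .
 qed
 have Tspec: "r = \<mu> \<or> r = inverse \<mu> \<or> \<bar>r\<bar> = 1" if "poly (char_poly T) r = 0" for r
 proof -
  have "poly (char_poly (map_mat complex_of_real (toL T))) (of_real r) = 0"
   unfolding similar_toL[OF Tc(1), symmetric] using that by (simp add: of_real_hom.char_poly_hom[OF Tc(1)])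
  from O_plus_eigenvalue[OF TO nf gv _ this] mu show ?thesis
   by (auto simp only: of_real_eq_iff norm_of_real)
 qed
 have "poly (char_poly T) \<mu> = 0"
 proof -
  have "eigenvector T (M *\<^sub>v v) \<mu>"
   unfolding eigenvector_def using powv[OF car(3) gv(1), of 1] car nz Tc(1)
   by (auto simp: One_nat_def left_mult_one_mat[OF Tc(1)])
  then show ?thesis using eigenvalue_root_char_poly[OF Tc(1)] unfolding eigenvalue_def by blast
 qed
 then have chi0: "poly \<chi> (t * \<mu>) = 0" by (simp add: chi_root)
 \<comment> \<open>The real spectrum of T contains \<mu> but neither -\<mu> nor -1/\<mu>; this
   separates r(X) from r(-X) in \<open>square_rootableI\<close>.\<close>
 have no: "r ~= \<mu> \<and> r ~= inverse \<mu> \<and> \<bar>r\<bar> ~= 1" if "r = - \<mu> \<or> r = - inverse \<mu>" for r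
 proof -
  define \<nu> where "\<nu> = inverse \<mu>"
  have "\<nu> < 1" "\<nu> > 0" using mu by (auto simp: \<nu>_def inverse_less_1_iff)
  then show ?thesis using that mu unfolding \<nu>_def[symmetric] by auto
 qed
 have chi1: "poly \<chi> (- (t * \<mu>)) ~= 0" "poly \<chi> (- (t / \<mu>)) ~= 0"
  using chi_root[of "- \<mu>"] chi_root[of "- inverse \<mu>"] Tspec[of "- \<mu>"] Tspec[of "- inverse \<mu>"]
   no[of "- \<mu>"] no[of "- inverse \<mu>"] by (auto simp: divide_inverse)
 have mu0: "\<mu> > 0" using mu by linarith
 show ?thesis
  by (rule K.square_rootableI[OF sal l\<mu> mu0 t(1) pos chi_over chi0 chi1])
qed

section \<open>The converse: a lattice from a square-rootable Salem number\<close>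

section \<open>Lattices containing a square root of an integral isometry\<close>

text \<open>Gram--Schmidt: complete \<open>u\<close> by an orthonormal basis of its positive definite complement.\<close>

lemma lorentzian_basis:
 fixes A :: "real mat"
 assumes A: "A \<in> Mat (n + 1)" "A\<^sup>T = A"
  and u: "u \<in> Vec (n + 1)" "bil A u u = -1"
  and pos: "!!x. x \<in> Vec (n + 1) ==> x ~= 0\<^sub>v (n + 1) ==> bil A x u = 0 ==> bil A x x > 0"
 obtains M Mi where "lorentzian_form n A M Mi" "M *\<^sub>v unit_vec (n + 1) n = u"
proof -
 define N where "N = n + 1"
 note A = A[folded N_def] note u = u[folded N_def] note pos = pos[folded N_def]
 have "\<exists>e :: nat => real vec. \<forall>i<k. e i \<in> Vec N \<and> bil A (e i) u = 0 \<and>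
   (\<forall>j<k. bil A (e i) (e j) = (if i = j then 1 else 0))" if "k \<le> n" for k
  using that
 proof (induction k)
  case (Suc k)
  then obtain e :: "nat => real vec" where e: "!!i. i < k ==> e i \<in> Vec N"
    "!!i. i < k ==> bil A (e i) u = 0"
    "!!i j. i < k ==> j < k ==> bil A (e i) (e j) = (if i = j then 1 else 0)" by auto
  \<comment> \<open>Orthogonality to u and the k vectors found so far gives k + 1 \<le> n equations
    in n + 1 unknowns; zero rows make the matrix square and singular.\<close>
  define B where "B = mat N N (\<lambda>(i, j). if i < k then (A *\<^sub>v e i) $ j else if i = k then (A *\<^sub>v u) $ j else 0)"
  have B: "B \<in> Mat N" by (simp add: B_def)
  have "det (B\<^sup>T) = 0"
   unfolding det_0_iff_vec_prod_zero[OF transpose_carrier_mat[THEN iffD2, OF B]]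
  proof (intro exI conjI)
   show "unit_vec N n \<in> Vec N" "unit_vec N n ~= (0\<^sub>v N :: real vec)"
    by (simp_all add: N_def unit_vec_nonzero)
   show "B\<^sup>T *\<^sub>v unit_vec N n = 0\<^sub>v N"
    using Suc.prems by (intro eq_vecI) (auto simp: B_def N_def)
  qed
  then have "det B = 0" by (simp add: det_transpose[OF B])
  then obtain x where x: "x \<in> Vec N" "x ~= 0\<^sub>v N" "B *\<^sub>v x = 0\<^sub>v N"
   unfolding det_0_iff_vec_prod_zero[OF B] by blast
  have Ay: "A *\<^sub>v y \<in> Vec N" if "y \<in> Vec N" for y using A that by simp
  have perp: "bil A x y = 0"
   if y: "y \<in> Vec N" and i: "i < N" and row: "!!j. j < N ==> B $$ (i, j) = (A *\<^sub>v y) $ j" for y i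
  proof -
   have "bil A x y = (\<Sum>j<N. x $ j * (A *\<^sub>v y) $ j)"
    using carrier_vecD[OF Ay[OF y]]
    by (simp add: bil_def scalar_prod_def atLeast0LessThan del: index_mult_mat_vec dim_mult_mat_vec)
   also have "\<dots> = (\<Sum>j<N. B $$ (i, j) * x $ j)"
    by (intro sum.cong refl) (simp add: row mult.commute del: index_mult_mat_vec)
   also have "\<dots> = (B *\<^sub>v x) $ i"
    using B x(1) i by (simp add: scalar_prod_def atLeast0LessThan)
   finally show ?thesis using x(3) i by simp
  qed
  have kN: "k < N" using Suc.prems by (simp add: N_def)
  have xe: "bil A x (e i) = 0" if "i < k" for i
   using that kN by (intro perp[OF e(1)[OF that], of i]) (auto simp: B_def)
  have xu: "bil A x u = 0"
   using kN by (intro perp[OF u(1), of k]) (auto simp: B_def)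
  define r where "r = inverse (sqrt (bil A x x))"
  have px: "bil A x x > 0" using pos[OF x(1,2) xu] .
  define e' where "e' = e(k := r \<cdot>\<^sub>v x)"
  have rr: "r * r * bil A x x = 1"
   using px by (simp add: r_def field_simps)
  have "\<forall>i<Suc k. e' i \<in> Vec N \<and> bil A (e' i) u = 0 \<and>
   (\<forall>j<Suc k. bil A (e' i) (e' j) = (if i = j then 1 else 0))"
  proof (intro allI impI conjI)
   fix i assume i: "i < Suc k"
   show c: "e' i \<in> Vec N" using i e(1) x(1) by (auto simp: e'_def less_Suc_eq)
   show "bil A (e' i) u = 0"
    using i e(2) xu by (auto simp: e'_def less_Suc_eq bil_smult_left[OF A(1) x(1) u(1)])
   fix j assume j: "j < Suc k"
   have ex: "bil A (e l) x = 0" if "l < k" for l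
    using bil_sym[OF A e(1)[OF that] x(1)] xe[OF that] by simp
   have rx: "r \<cdot>\<^sub>v x \<in> Vec N" using x by simp
   have 1: "bil A (e l) (r \<cdot>\<^sub>v x) = 0" "bil A (r \<cdot>\<^sub>v x) (e l) = 0" if "l < k" for l
    using ex[OF that] xe[OF that]
    by (simp_all add: bil_smult_right[OF A(1) e(1)[OF that] x(1)] bil_smult_left[OF A(1) x(1) e(1)[OF that]])
   have 2: "bil A (r \<cdot>\<^sub>v x) (r \<cdot>\<^sub>v x) = 1"
    using rr by (simp add: bil_smult_left[OF A(1) x(1) rx] bil_smult_right[OF A(1) x(1) x(1)] mult.assoc)
   show "bil A (e' i) (e' j) = (if i = j then 1 else 0)"
    using i j e(3) 1 2 by (auto simp: e'_def less_Suc_eq)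
  qed
  then show ?case by blast
 qed simp
 then obtain e :: "nat => real vec" where e: "!!i. i < n ==> e i \<in> Vec N"
    "!!i. i < n ==> bil A (e i) u = 0"
    "!!i j. i < n ==> j < n ==> bil A (e i) (e j) = (if i = j then 1 else 0)" by blast
 define f where "f = e(n := u)"
 define M where "M = mat N N (\<lambda>(i, j). f j $ i)"
 have M: "M \<in> Mat N" by (simp add: M_def)
 have fc: "f j \<in> Vec N" if "j < N" for j using that e(1) u by (auto simp: f_def N_def less_Suc_eq)
 have Mu: "M *\<^sub>v unit_vec N j = f j" if "j < N" for j
  using that fc[OF that] by (intro eq_vecI) (auto simp: M_def)
 have form: "M\<^sup>T * A * M = lorentz_mat n"
 proof (rule eq_matI)
  fix i j assume "i < dim_row (lorentz_mat n)" "j < dim_col (lorentz_mat n)"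
  then have ij: "i < N" "j < N" 
   using carrier_matD[OF lorentz_mat_carrier[of n]] by (simp_all add: N_def)
  have "M\<^sup>T * A * M \<in> Mat N" using M A by simp
  then have "(M\<^sup>T * A * M) $$ (i, j) = bil (M\<^sup>T * A * M) (unit_vec N i) (unit_vec N j)"
   by (rule bil_unit[symmetric]) fact+
  also have "\<dots> = bil A (f i) (f j)"
   using bil_mult[OF A(1) M M, of "unit_vec N i" "unit_vec N j"] Mu ij by simp
  also have "\<dots> = (if i = j then (if i < n then 1 else -1) else 0)"
  proof -
   have ue: "bil A u (e i) = 0" if "i < n" for i
    using bil_sym[OF A u(1) e(1)[OF that]] e(2)[OF that] by simp
   show ?thesis using ij e ue u by (auto simp: f_def N_def less_Suc_eq)
  qed
  also have "\<dots> = lorentz_mat n $$ (i, j)"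
   using ij by (simp add: lorentz_mat_def N_def mat_diag_def)
  finally show "(M\<^sup>T * A * M) $$ (i, j) = lorentz_mat n $$ (i, j)" .
 qed (use M carrier_matD[OF lorentz_mat_carrier[of n]] in \<open>auto simp: N_def\<close>)
 have J: "lorentz_mat n \<in> Mat N" by (simp add: N_def)
 have JJ: "lorentz_mat n * lorentz_mat n = 1\<^sub>m N"
  unfolding lorentz_mat_def N_def[symmetric] mat_diag_mult_left[OF mat_diag_dim]
  by (rule eq_matI) (auto simp: mat_diag_def)
 define Mi where "Mi = lorentz_mat n * (M\<^sup>T * A)"
 have Mt: "M\<^sup>T \<in> Mat N" using M by simp
 have MtA: "M\<^sup>T * A \<in> Mat N" using Mt A by simp
 have Mi: "Mi \<in> Mat N" unfolding Mi_def using J MtA by (rule mult_carrier_mat)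
 have MiM: "Mi * M = 1\<^sub>m N"
  unfolding Mi_def assoc_mult_mat[OF J MtA M] form JJ ..
 have MMi: "M * Mi = 1\<^sub>m N" using mat_mult_left_right_inverse[OF Mi M MiM] .
 have "lorentzian_form n A M Mi"
 proof
  fix x :: "real vec" assume x: "x \<in> Vec (n + 1)"
  show "quad_form A (M *\<^sub>v x) = lorentz_form n x"
   unfolding quad_form_bil lorentz_form_eq lorentz_bil[OF x x]
   using bil_mult[OF A(1) M M, of x x] x by (simp add: form N_def)
 qed (use A M Mi MMi MiM in \<open>simp_all add: N_def\<close>)
 moreover have "M *\<^sub>v unit_vec (n + 1) n = u"
  using Mu[of n] by (simp add: N_def f_def)
 ultimately show ?thesis by (rule that)
qed

text \<open>One future vector decides the sheet: v + w and its image \<mu> v + w/\<mu> have negative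
  product, and the form compares every other future vector with v + w.\<close>

lemma O_plus_null_frame:
 assumes g: "lorentz_isometry n g" and nf: "null_frame n v w" and mu: "\<mu> > 0"
  and gv: "g *\<^sub>v v = \<mu> \<cdot>\<^sub>v v" "g *\<^sub>v w = inverse \<mu> \<cdot>\<^sub>v w"
 shows "g \<in> O_plus n"
proof -
 have gc: "g \<in> Mat (n + 1)"
  and iso: "lorentz n (g *\<^sub>v x) (g *\<^sub>v y) = lorentz n x y"
   if "x \<in> Vec (n + 1)" "y \<in> Vec (n + 1)" for x y
  using g that by (auto simp: lorentz_isometry_def)
 then have gc: "g \<in> Mat (n + 1)" using g by (simp add: lorentz_isometry_def)
 have vw: "v \<in> Vec (n + 1)" "w \<in> Vec (n + 1)" "lorentz n v v = 0" "lorentz n w w = 0"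
  "lorentz n v w = -1/2" "lorentz n w v = -1/2" "v + w \<in> hyp_space n"
  using nf lorentz_comm[of n v w] by (auto simp: null_frame_def)
 define u where "u = v + w"
 have uf: "u \<in> future n" using vw(7) by (simp add: u_def future_def hyp_space_iff)
 have uc: "u \<in> Vec (n + 1)" using vw by (simp add: u_def)
 have gu: "g *\<^sub>v u = \<mu> \<cdot>\<^sub>v v + inverse \<mu> \<cdot>\<^sub>v w"
  unfolding u_def using gc vw gv by (simp add: mult_add_distrib_mat_vec[of _ "n + 1" "n + 1"])
 have guc: "g *\<^sub>v u \<in> Vec (n + 1)" using gc uc by simp
 have "lorentz n u (g *\<^sub>v u) = - (\<mu> + inverse \<mu>) / 2"
  unfolding gu unfolding u_def using vw by (simp add: lorentz_simps)
 moreover have "\<mu> + inverse \<mu> > 0" using mu by (simp add: add_pos_pos)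
 ultimately have "lorentz n u (g *\<^sub>v u) < 0" by simp
 moreover have "lorentz n (g *\<^sub>v u) (g *\<^sub>v u) < 0"
  using iso[OF uc uc] uf by (simp add: future_def)
 ultimately have guf: "g *\<^sub>v u \<in> future n" using future_iff_lorentz[OF uf guc] by simp
 have "g *\<^sub>v y \<in> future n" if y: "y \<in> future n" for y
 proof -
  have yc: "y \<in> Vec (n + 1)" "lorentz n y y < 0" using y by (auto simp: future_def)
  have "lorentz n u y < 0" using future_iff_lorentz[OF uf yc] y by simp
  then have "lorentz n (g *\<^sub>v u) (g *\<^sub>v y) < 0" using iso[OF uc yc(1)] by simp
  moreover have "g *\<^sub>v y \<in> Vec (n + 1)" "lorentz n (g *\<^sub>v y) (g *\<^sub>v y) < 0"
   using gc yc iso[OF yc(1) yc(1)] by auto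
  ultimately show ?thesis using future_iff_lorentz[OF guf] by blast
 qed
 then show ?thesis unfolding O_plus_iff using g by blast
qed

context lorentzian_form
begin

lemma form_mat: "M\<^sup>T * A * M = lorentz_mat n"
 using isometry_iff[OF A(1) lorentz_mat_carrier M(1)] bil_M by (simp add: lorentz_bil)

lemma has_signature: "has_signature A n 1"
 unfolding has_signature_def
 using form_mat GL_carrierI[OF M] by (auto simp: lorentz_mat_def)

text \<open>
 With \<open>H = O'(f, \<oo>\<^sub>K)\<close> and \<open>G = H \<inter> T H T\<^sup>-\<^sup>1\<close>, the lattice is \<open>G \<union> T G\<close>; it is a group because
 \<open>T\<^sup>2 \<in> H\<close>, and \<open>G\<close> has finite index in \<open>H\<close> because \<open>T\<close> is proportional to a matrix over \<open>K\<close>.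
\<close>

lemma square_root_lattice:
 assumes adm: "admissible n K A"
  and S: "S \<in> Mat N" "elements_mat S \<subseteq> K" and T: "T = r \<cdot>\<^sub>m S"
  and TO: "toL T \<in> O_plus n" and T2: "T * T \<in> GL_over N (\<O> K)"
 obtains \<Gamma> where "arithmetic_simplest_type n K \<Gamma>" "toL T \<in> \<Gamma>"
proof -
 have K: "totally_real_number_field K" using adm by (simp add: admissible_def)
 interpret K: number_field K by (rule totally_real_number_field_imp[OF K])
 interpret O: subring_of_field "\<O> K" by (rule K.ring_of_integers_subring)
 have Tc: "T \<in> Mat N" using S by (simp add: T)
 obtain h where h: "h \<in> Mat N" "toL T * h = 1\<^sub>m N" "h * toL T = 1\<^sub>m N"
  using lorentz_isometry_invertible[of n "toL T"] TO by (auto simp: O_plus_iff)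
 define Ti where "Ti = M * h * Mi"
 have Tic: "Ti \<in> Mat N" using M h by (simp add: Ti_def)
 have TTi: "T * Ti = 1\<^sub>m N"
 proof -
  have "T * Ti = (M * toL T * Mi) * (M * h * Mi)" by (simp add: Ti_def of_toL[OF Tc])
  also have "\<dots> = M * (toL T * h) * Mi" by (rule conj_mat_mult[OF M(1,2,4) toL_carrier[OF Tc] h(1)])
  finally show ?thesis using M h by simp
 qed
 have TiT: "Ti * T = 1\<^sub>m N" using mat_mult_left_right_inverse[OF Tc Tic TTi] .
 \<comment> \<open>Si is the inverse of S, so conjugation by T equals conjugation by S: the scalar r
   cancels, and only matrices over K are involved.\<close>
 define Si where "Si = r \<cdot>\<^sub>m Ti"
 have Sic: "Si \<in> Mat N" using Tic by (simp add: Si_def)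
 have SSi: "S * Si = 1\<^sub>m N"
  using TTi S(1) Tic by (simp add: Si_def T mult_smult_distrib[of _ N N _ N] mult_smult_assoc_mat[of _ N N _ N])
 have SiS: "Si * S = 1\<^sub>m N" using mat_mult_left_right_inverse[OF S(1) Sic SSi] .
 have SiK: "elements_mat Si \<subseteq> K"
 proof -
  have "det S * det Si = 1" using det_mult[OF S(1) Sic] SSi by simp
  then have "det S ~= 0" by auto
  then obtain S' where S': "S' \<in> Mat N" "elements_mat S' \<subseteq> K" "S * S' = 1\<^sub>m N"
   using K.elements_mat_inverse[OF S] K.inverse_mem[OF K.det_mem[OF S]] by metis
  have "Si * (S * S') = (Si * S) * S'" using assoc_mult_mat[OF Sic S(1) S'(1)] by simp
  then have "Si = S'" unfolding SiS S'(3) using Sic S'(1) by simp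
  then show ?thesis using S' by simp
 qed
 have conj_eq: "Ti * X * T = Si * X * S" if X: "X \<in> Mat N" for X
  using S(1) Tic X by (simp add: Si_def T mult_smult_distrib[of _ N N _ N] mult_smult_assoc_mat[of _ N N _ N])
 note asc = assoc_mult_mat[of _ N N _ N _ N]
 have car: "X * Y \<in> Mat N" if "X \<in> Mat N" "Y \<in> Mat N" for X Y :: "real mat"
  using that by simp
 have c1: "T * (Ti * X) = X" and c2: "Ti * (T * X) = X" if "X \<in> Mat N" for X
  using assoc_mult_mat[OF Tc Tic that] assoc_mult_mat[OF Tic Tc that] that by (simp_all add: TTi TiT)
 define H where "H = O_prime N A (\<O> K)"
 have H_iff: "X \<in> H \<longleftrightarrow> X \<in> GL_over N (\<O> K) \<and> toL X \<in> O_plus n" for X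
  unfolding H_def by (rule O_prime_iff)
 have Hc: "X \<in> Mat N" if "X \<in> H" for X using that by (auto simp: H_iff GL_over_def)
 have HO: "elements_mat X \<subseteq> \<O> K" if "X \<in> H" for X using that by (auto simp: H_iff GL_over_def)
 have Hm: "X * Y \<in> H" if "X \<in> H" "Y \<in> H" for X Y
  using that K.GL_over_mult O_plus_mult by (simp add: H_iff toL_mult[OF Hc[OF that(1)] Hc[OF that(2)]])
 have H1: "1\<^sub>m N \<in> H"
  unfolding H_iff using O.elements_mat_one toL_one O_plus_one by (auto simp: GL_over_def intro!: bexI[of _ "1\<^sub>m N"])
 have Hinv: "\<exists>Y\<in>H. X * Y = 1\<^sub>m N \<and> Y * X = 1\<^sub>m N" if X: "X \<in> H" for X
 proof -
  obtain Y where Y: "Y \<in> Mat N" "elements_mat Y \<subseteq> \<O> K" "X * Y = 1\<^sub>m N" "Y * X = 1\<^sub>m N"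
   using X by (auto simp: H_iff GL_over_def)
  have "toL X * toL Y = 1\<^sub>m N" using toL_mult[OF Hc[OF X] Y(1)] Y(3) toL_one by simp
  then have "toL Y \<in> O_plus n"
   using X O_plus_inverse[of "toL X" n "toL Y"] toL_carrier[OF Y(1)] by (simp add: H_iff)
  moreover have "Y \<in> GL_over N (\<O> K)"
   unfolding GL_over_def using Y Hc[OF X] HO[OF X] by blast
  ultimately show ?thesis using Y by (auto simp: H_iff)
 qed
 have T2H: "T * T \<in> H"
  using T2 TO O_plus_mult by (simp add: H_iff toL_mult[OF Tc Tc])
 obtain T2i where T2i: "T2i \<in> H" "T * T * T2i = 1\<^sub>m N" using Hinv[OF T2H] by blast
 have T2i_eq: "T2i = Ti * Ti"
 proof -
  have "Ti * (Ti * (T * T * T2i)) = T2i"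
   using Tc Tic Hc[OF T2i(1)] by (simp add: asc car c2)
  then show ?thesis unfolding T2i(2) using Tic by simp
 qed
 define G where "G = {X \<in> H. Ti * X * T \<in> H}"
 have GH: "X \<in> H" "Ti * X * T \<in> H" "X \<in> Mat N" if "X \<in> G" for X
  using that Hc by (auto simp: G_def)
 have Gm: "X * Y \<in> G" if X: "X \<in> G" and Y: "Y \<in> G" for X Y
 proof -
  have "Ti * (X * Y) * T = (Ti * X * T) * (Ti * Y * T)"
   by (rule conj_mat_mult[OF Tic Tc TTi GH(3)[OF X] GH(3)[OF Y], symmetric])
  then show ?thesis using GH[OF X] GH[OF Y] Hm by (simp add: G_def)
 qed
 have G1: "1\<^sub>m N \<in> G" using H1 Tc Tic TiT by (simp add: G_def)
 have Ginv: "\<exists>Y\<in>G. X * Y = 1\<^sub>m N \<and> Y * X = 1\<^sub>m N" if X: "X \<in> G" for X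
 proof -
  obtain Y where Y: "Y \<in> H" "X * Y = 1\<^sub>m N" "Y * X = 1\<^sub>m N" using Hinv[OF GH(1)[OF X]] by blast
  obtain Z where Z: "Z \<in> H" "Z * (Ti * X * T) = 1\<^sub>m N" using Hinv[OF GH(2)[OF X]] by blast
  have XY: "(Ti * X * T) * (Ti * Y * T) = 1\<^sub>m N"
   unfolding conj_mat_mult[OF Tic Tc TTi GH(3)[OF X] Hc[OF Y(1)]] Y(2) using Tic TiT by simp
  have cX: "Ti * X * T \<in> Mat N" and cY: "Ti * Y * T \<in> Mat N"
   using Tc Tic GH(3)[OF X] Hc[OF Y(1)] by simp_all
  have "Z * ((Ti * X * T) * (Ti * Y * T)) = (Z * (Ti * X * T)) * (Ti * Y * T)"
   by (rule assoc_mult_mat[OF Hc[OF Z(1)] cX cY, symmetric])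
  then have "Z = Ti * Y * T"
   unfolding XY Z(2) left_mult_one_mat[OF cY] right_mult_one_mat[OF Hc[OF Z(1)]] .
  then have "Y \<in> G" using Y(1) Z(1) by (simp add: G_def)
  then show ?thesis using Y by blast
 qed
 have GT: "T * X * Ti \<in> G" and TG: "Ti * X * T \<in> G" if X: "X \<in> G" for X
 proof -
  note Xc = GH(3)[OF X]
  have c: "T * X * Ti \<in> Mat N" "Ti * X * T \<in> Mat N" using Tc Tic Xc by simp_all
  have "T * X * Ti = (T * T) * (Ti * X * T) * T2i" "Ti * (T * X * Ti) * T = X"
   "Ti * (Ti * X * T) * T = T2i * X * (T * T)"
   using Tc Tic Xc right_mult_one_mat[OF Xc] left_mult_one_mat[OF Xc] unfolding T2i_eq
   by (simp_all add: asc car c1 c2 TiT TTi)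
  then show "T * X * Ti \<in> G" "Ti * X * T \<in> G"
   using GH[OF X] Hm T2H T2i(1) by (auto simp: G_def)
 qed
 have T2G: "T * T \<in> G"
 proof -
  have "Ti * (T * T) * T = T * T" using Tc Tic by (simp add: asc car c2)
  then show ?thesis using T2H by (simp add: G_def)
 qed
 define \<Gamma> where "\<Gamma> = G \<union> (\<lambda>X. T * X) ` G"
 have \<Gamma>c: "X \<in> Mat N" if "X \<in> \<Gamma>" for X using that GH(3) Tc by (auto simp: \<Gamma>_def)
 have \<Gamma>O: "toL X \<in> O_plus n" if "X \<in> \<Gamma>" for X
  using that GH TO O_plus_mult by (auto simp: \<Gamma>_def H_iff toL_mult[OF Tc])
 have \<Gamma>1: "1\<^sub>m N \<in> \<Gamma>" using G1 by (simp add: \<Gamma>_def)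
 have mixed: "X * (T * Y) \<in> (\<lambda>X. T * X) ` G" "(T * X) * Y \<in> (\<lambda>X. T * X) ` G" "(T * X) * (T * Y) \<in> G"
  if X: "X \<in> G" and Y: "Y \<in> G" for X Y
 proof -
  note c = GH(3)[OF X] GH(3)[OF Y]
  have "X * (T * Y) = T * ((Ti * X * T) * Y)" "(T * X) * Y = T * (X * Y)"
   "(T * X) * (T * Y) = (T * T) * ((Ti * X * T) * Y)"
   using Tc Tic c by (simp_all add: asc car c1 c2)
  moreover have "(Ti * X * T) * Y \<in> G" "X * Y \<in> G" "(T * T) * ((Ti * X * T) * Y) \<in> G"
   using Gm[OF TG[OF X] Y] Gm[OF X Y] Gm[OF T2G Gm[OF TG[OF X] Y]] by blast+
  ultimately show "X * (T * Y) \<in> (\<lambda>X. T * X) ` G" "(T * X) * Y \<in> (\<lambda>X. T * X) ` G" "(T * X) * (T * Y) \<in> G"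
   by auto
 qed
 have \<Gamma>m: "X * Y \<in> \<Gamma>" if "X \<in> \<Gamma>" "Y \<in> \<Gamma>" for X Y
 proof -
  have "X \<in> G \<or> (\<exists>x\<in>G. X = T * x)" "Y \<in> G \<or> (\<exists>y\<in>G. Y = T * y)"
   using that by (auto simp: \<Gamma>_def)
  then show ?thesis
   by (elim disjE bexE) (simp_all only: \<Gamma>_def Un_iff mixed Gm simp_thms)
 qed
 have \<Gamma>inv: "\<exists>Y\<in>\<Gamma>. X * Y = 1\<^sub>m N \<and> Y * X = 1\<^sub>m N" if X: "X \<in> \<Gamma>" for X
 proof (cases "X \<in> G")
  case True
  then show ?thesis using Ginv by (auto simp: \<Gamma>_def)
 next
  case False
  then obtain X' where X': "X' \<in> G" "X = T * X'" using X by (auto simp: \<Gamma>_def)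
  obtain Y where Y: "Y \<in> G" "X' * Y = 1\<^sub>m N" "Y * X' = 1\<^sub>m N" using Ginv[OF X'(1)] by blast
  note c = GH(3)[OF X'(1)] GH(3)[OF Y(1)]
  have T2iG: "T2i \<in> G"
  proof -
   have "Ti * T2i * T = T2i" unfolding T2i_eq using Tc Tic by (simp add: asc car TiT)
   then show ?thesis using T2i(1) by (simp add: G_def)
  qed
  have eq: "Y * Ti = T * (T2i * (T * Y * Ti))"
   unfolding T2i_eq using Tc Tic c by (simp add: asc car c1 c2)
  have "T2i * (T * Y * Ti) \<in> G" using Gm[OF T2iG GT[OF Y(1)]] .
  then have "Y * Ti \<in> \<Gamma>" unfolding eq \<Gamma>_def by blast
  moreover have "X * (Y * Ti) = 1\<^sub>m N"
  proof -
   have "X * (Y * Ti) = T * ((X' * Y) * Ti)" using Tc Tic c X'(2) by (simp add: asc car)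
   then show ?thesis unfolding Y(2) using Tic TTi by simp
  qed
  moreover have "(Y * Ti) * X = 1\<^sub>m N"
   using Tc Tic c X'(2) Y(3) by (simp add: asc car c2)
  ultimately show ?thesis by blast
 qed
 obtain d :: nat where d: "d > 0"
  "!!Z. Z \<in> Mat N ==> elements_mat Z \<subseteq> \<O> K ==>
   elements_mat (Si * (1\<^sub>m N + of_nat d \<cdot>\<^sub>m Z) * S) \<subseteq> \<O> K"
  using K.integral_conj[OF Sic S(1) SiS SiK S(2)] by metis
 obtain \<chi> :: "real mat => real mat" where chi:
  "finite (\<chi> ` {T \<in> Mat N. elements_mat T \<subseteq> \<O> K})"
  "!!a b. a \<in> Mat N ==> b \<in> Mat N ==> elements_mat a \<subseteq> \<O> K ==>
   elements_mat b \<subseteq> \<O> K ==> \<chi> a = \<chi> b ==>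
   \<exists>Z\<in>Mat N. elements_mat Z \<subseteq> \<O> K \<and> b = a + of_nat d \<cdot>\<^sub>m Z"
  using K.residue_coloring[OF d(1), of N] by blast
 \<comment> \<open>For a and b congruent modulo d the quotient x is congruent to 1, so its conjugate
   by S stays integral and x lies in G.\<close>
 have quot: "\<exists>h\<in>G. b = h * a" if a: "a \<in> H" and b: "b \<in> H" and ab: "\<chi> a = \<chi> b" for a b
 proof -
  obtain Z where Z: "Z \<in> Mat N" "elements_mat Z \<subseteq> \<O> K" "b = a + of_nat d \<cdot>\<^sub>m Z"
   using chi(2)[OF Hc[OF a] Hc[OF b] HO[OF a] HO[OF b] ab] by blast
  obtain a' where a': "a' \<in> H" "a * a' = 1\<^sub>m N" "a' * a = 1\<^sub>m N" using Hinv[OF a] by blast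
  define x where "x = b * a'"
  have xH: "x \<in> H" unfolding x_def using Hm[OF b a'(1)] .
  have xc: "x \<in> Mat N" using Hc[OF xH] .
  have Za: "Z * a' \<in> Mat N" using Z Hc[OF a'(1)] by simp
  have x_eq: "x = 1\<^sub>m N + of_nat d \<cdot>\<^sub>m (Z * a')"
   unfolding x_def Z(3) using Z(1) Hc[OF a] Hc[OF a'(1)] a'(2)
   by (simp add: add_mult_distrib_mat[of _ N N _ _ N] mult_smult_assoc_mat[of _ N N _ N])
  have "elements_mat (Si * x * S) \<subseteq> \<O> K"
   unfolding x_eq by (rule d(2)[OF Za O.elements_mat_mult[OF Z(1) Hc[OF a'(1)] Z(2) HO[OF a'(1)]]])
  then have int: "elements_mat (Ti * x * T) \<subseteq> \<O> K" by (simp only: conj_eq[OF xc])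
  have yc: "Ti * x * T \<in> Mat N" using Tic Tc xc by simp
  have dt: "det (Ti * x * T) = det x" by (rule K.det_inverse_conj[OF Tic Tc TiT xc])
  have "x \<in> GL_over N (\<O> K)" using xH by (simp add: H_iff)
  note dx = K.GL_over_det[OF this]
  obtain y where "y \<in> Mat N" "elements_mat y \<subseteq> \<O> K"
   "Ti * x * T * y = 1\<^sub>m N" "y * (Ti * x * T) = 1\<^sub>m N"
   using O.elements_mat_inverse[OF yc int] dx unfolding dt by metis
  then have "Ti * x * T \<in> GL_over N (\<O> K)"
   unfolding GL_over_def using yc int by blast
  moreover have "toL (Ti * x * T) \<in> O_plus n"
  proof -
   have "toL T * toL Ti = 1\<^sub>m N" using toL_mult[OF Tc Tic] TTi toL_one by simp
   then have "toL Ti \<in> O_plus n" using O_plus_inverse[OF TO toL_carrier[OF Tic]] by simp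
   moreover have "toL (Ti * x * T) = toL Ti * toL x * toL T"
    using toL_mult[OF _ Tc, of "Ti * x"] toL_mult[OF Tic xc] Tic xc by simp
   ultimately show ?thesis using O_plus_mult TO xH by (simp add: H_iff)
  qed
  ultimately have "x \<in> G" using xH by (simp add: G_def H_iff)
  moreover have "b = x * a"
   unfolding x_def using Hc[OF a] Hc[OF b] Hc[OF a'(1)] a'(3) by (simp add: asc)
  ultimately show ?thesis by blast
 qed
 have fin1: "finite (rcosets\<^bsub>GL N\<lparr>carrier := H\<rparr>\<^esub> (\<Gamma> \<inter> H))"
 proof (rule finite_rcosetsI[where \<chi> = \<chi>])
  show "finite (\<chi> ` H)" using chi(1) by (rule finite_subset[rotated]) (use Hc HO in auto)
  show "\<exists>h\<in>\<Gamma> \<inter> H. b = h * a" if "a \<in> H" "b \<in> H" "\<chi> a = \<chi> b" for a b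
   using quot[OF that] GH(1) by (auto simp: \<Gamma>_def)
  show "h * k \<in> \<Gamma> \<inter> H" if "h \<in> \<Gamma> \<inter> H" "k \<in> \<Gamma> \<inter> H" for h k
   using that \<Gamma>m Hm by blast
 qed (use Hc in auto)
 \<comment> \<open>Two colours suffice, membership in G or in its complement: the quotient of two
   elements of T G is T g Ti with g in G, and \<open>GT\<close> returns it to G.\<close>
 have fin2: "finite (rcosets\<^bsub>GL N\<lparr>carrier := \<Gamma>\<rparr>\<^esub> (\<Gamma> \<inter> H))"
 proof (rule finite_rcosetsI[where \<chi> = "\<lambda>a. a \<in> G"])
  show "finite ((\<lambda>a. a \<in> G) ` \<Gamma>)" by (rule finite_subset[of _ UNIV]) auto
  show "\<exists>h\<in>\<Gamma> \<inter> H. b = h * a" if a: "a \<in> \<Gamma>" and b: "b \<in> \<Gamma>" and ab: "(a \<in> G) = (b \<in> G)" for a b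
  proof -
   have "\<exists>a'\<in>\<Gamma>. a' * a = 1\<^sub>m N \<and> b * a' \<in> G"
   proof (cases "a \<in> G")
    case True
    then obtain a' where "a' \<in> G" "a' * a = 1\<^sub>m N" using Ginv by blast
    then show ?thesis using True ab Gm by (auto simp: \<Gamma>_def intro!: bexI[of _ a'])
   next
    case False
    then obtain x y where x: "x \<in> G" "a = T * x" and y: "y \<in> G" "b = T * y"
     using a b ab by (auto simp: \<Gamma>_def)
    obtain a' where a': "a' \<in> \<Gamma>" "a * a' = 1\<^sub>m N" "a' * a = 1\<^sub>m N" using \<Gamma>inv[OF a] by blast
    obtain x' where x': "x' \<in> G" "x * x' = 1\<^sub>m N" "x' * x = 1\<^sub>m N" using Ginv[OF x(1)] by blast
    note c = GH(3)[OF x(1)] GH(3)[OF y(1)] GH(3)[OF x'(1)] \<Gamma>c[OF a'(1)]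
    have "(x' * Ti) * (a * a') = a'"
    proof -
     have "(x' * Ti) * (a * a') = (x' * x) * a'" using Tc Tic c unfolding x(2) by (simp add: asc car c2)
     then show ?thesis unfolding x'(3) using c by simp
    qed
    then have "a' = x' * Ti" unfolding a'(2) using c Tic by simp
    then have "b * a' = T * (y * x') * Ti" using Tc Tic c y(2) by (simp add: asc car)
    then have "b * a' \<in> G" using GT[OF Gm[OF y(1) x'(1)]] by simp
    then show ?thesis using a' by blast
   qed
   then obtain a' where a': "a' \<in> \<Gamma>" "a' * a = 1\<^sub>m N" "b * a' \<in> G" by blast
   have "b = b * a' * a"
    using \<Gamma>c[OF a] \<Gamma>c[OF b] \<Gamma>c[OF a'(1)] a'(2) by (simp add: asc)
   then show ?thesis using a'(3) GH(1) by (auto simp: \<Gamma>_def intro!: bexI[of _ "b * a'"])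
  qed
  show "h * k \<in> \<Gamma> \<inter> H" if "h \<in> \<Gamma> \<inter> H" "k \<in> \<Gamma> \<inter> H" for h k
   using that \<Gamma>m Hm by blast
 qed (use \<Gamma>c Hc in auto)
 define \<Gamma>' where "\<Gamma>' = toL ` \<Gamma>"
 have MG: "M \<in> carrier (GL N)" by (rule GL_carrierI[OF M])
 have inv_M: "inv\<^bsub>GL N\<^esub> M = Mi"
 proof -
  note i = GL_inv[OF MG]
  have "Mi * (M * inv\<^bsub>GL N\<^esub> M) = (Mi * M) * inv\<^bsub>GL N\<^esub> M"
   by (rule assoc_mult_mat[OF M(2,1) i(1), symmetric])
  then show ?thesis unfolding i(2) M(4) using i(1) M(2) by simp
 qed
 have "(\<lambda>T. M * T * inv\<^bsub>GL N\<^esub> M) ` \<Gamma>' = \<Gamma>"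
  unfolding \<Gamma>'_def image_image inv_M using of_toL[OF \<Gamma>c] by (simp cong: image_cong)
 then have comm: "commensurable (GL N) ((\<lambda>T. M * T * inv\<^bsub>GL N\<^esub> M) ` \<Gamma>') H"
  using fin1 fin2 by (simp add: commensurable_def)
 have "subgroup \<Gamma>' (GL N)"
 proof (rule GL_subgroupI)
  have inv: "\<exists>S\<in>\<Gamma>'. X * S = 1\<^sub>m N \<and> S * X = 1\<^sub>m N" if X: "X \<in> \<Gamma>'" for X
  proof -
   obtain Y where Y: "Y \<in> \<Gamma>" "X = toL Y" using X by (auto simp: \<Gamma>'_def)
   obtain Z where Z: "Z \<in> \<Gamma>" "Y * Z = 1\<^sub>m N" "Z * Y = 1\<^sub>m N" using \<Gamma>inv[OF Y(1)] by blast
   have "X * toL Z = 1\<^sub>m N" "toL Z * X = 1\<^sub>m N"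
    using toL_mult[OF \<Gamma>c[OF Y(1)] \<Gamma>c[OF Z(1)]] toL_mult[OF \<Gamma>c[OF Z(1)] \<Gamma>c[OF Y(1)]] Z Y(2) toL_one by simp_all
   then show ?thesis using Z(1) by (auto simp: \<Gamma>'_def)
  qed
  then show "\<exists>S\<in>\<Gamma>'. X * S = 1\<^sub>m N" if "X \<in> \<Gamma>'" for X using that by blast
  have c: "X \<in> Mat N" if "X \<in> \<Gamma>'" for X using that \<Gamma>c toL_carrier by (auto simp: \<Gamma>'_def)
  show "\<Gamma>' \<subseteq> carrier (GL N)" using inv c by (metis GL_carrierI subsetI)
  show "1\<^sub>m N \<in> \<Gamma>'" using \<Gamma>1 toL_one by (metis \<Gamma>'_def image_eqI)
  show "X * Y \<in> \<Gamma>'" if X: "X \<in> \<Gamma>'" and Y: "Y \<in> \<Gamma>'" for X Y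
  proof -
   obtain X' Y' where XY: "X' \<in> \<Gamma>" "X = toL X'" "Y' \<in> \<Gamma>" "Y = toL Y'"
    using X Y by (auto simp: \<Gamma>'_def)
   then have "X * Y = toL (X' * Y')" using toL_mult[OF \<Gamma>c[OF XY(1)] \<Gamma>c[OF XY(3)]] by simp
   then show ?thesis using \<Gamma>m[OF XY(1,3)] by (simp add: \<Gamma>'_def)
  qed
 qed
 moreover have "\<Gamma>' \<subseteq> O_plus n" using \<Gamma>O by (auto simp: \<Gamma>'_def)
 ultimately have "arithmetic_simplest_type n K \<Gamma>'"
  unfolding arithmetic_simplest_type_def using adm MG form comm[unfolded H_def] by blast
 moreover have "toL T \<in> \<Gamma>'"
 proof -
  have "T * 1\<^sub>m N \<in> \<Gamma>" using G1 unfolding \<Gamma>_def by blast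
  then show ?thesis using Tc by (simp add: \<Gamma>'_def)
 qed
 ultimately show ?thesis by (rule that)
qed

end

section \<open>The field of definition of a Salem number\<close>

context real_subfield
begin

lemma subfield_class_ring: "subfield K class_ring"
 using subfield_of_field_axioms by (simp add: subfield_class_ring_iff)

text \<open>The powers of x below the degree form a basis: independence is minimality of p, and
  spanning is reduction modulo p.\<close>

lemma dimension_field_adjoin:
 assumes x: "algebraic_over K x"
 shows "ring.dimension class_ring (degree (min_poly K x)) K (field_adjoin K x)"
proof -
 define p where "p = min_poly K x"
 define m where "m = degree p"
 note p = min_poly_props[OF x, folded p_def]
 define Us where "Us = map (\<lambda>i. x ^ i) [0..<m]"
 have Us: "length Us = m" "!!i. i < m ==> Us ! i = x ^ i" by (simp_all add: Us_def)
 have UsR: "set Us \<subseteq> carrier (class_ring :: real ring)" by simp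
 have coeffs: "poly_over (\<Sum>i<k. Polynomial.monom (Ks ! i) i)"
  if "set Ks \<subseteq> K" "k \<le> length Ks" for Ks k
  using that by (intro poly_over_sum poly_over_monom) (auto simp: subset_iff)
 have indep: "ring.independent class_ring K Us"
 proof (rule ring.trivial_combine_imp_independent[OF class_ring.ring_axioms subfield_class_ring UsR])
  fix Ks assume Ks: "set Ks \<subseteq> K" and "ring.combine class_ring Ks Us = \<zero>\<^bsub>class_ring\<^esub>"
  then have z: "(\<Sum>i<min (length Ks) m. Ks ! i * x ^ i) = 0"
   using Us by (simp add: combine_class_ring)
  define c where "c = (\<Sum>i<min (length Ks) m. Polynomial.monom (Ks ! i) i)"
  have cc: "coeff c i = (if i < min (length Ks) m then Ks ! i else 0)" for i
   unfolding c_def coeff_sum coeff_monom by (simp add: sum.delta)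
  have c_over: "poly_over c" unfolding c_def by (rule coeffs[OF Ks]) simp
  have cx: "poly c x = 0" using z by (simp add: c_def poly_sum poly_monom)
  have "c = 0"
  proof (rule ccontr)
   assume c0: "c ~= 0"
   then have "m \<le> degree c" using p(4)[OF c0 c_over cx] by (simp add: m_def)
   then have "coeff c (degree c) = 0" unfolding cc by simp
   then show False using c0 by simp
  qed
  then have "Ks ! i = 0" if "i < min (length Ks) m" for i using cc[of i] that by simp
  then show "set (take (length Us) Ks) \<subseteq> {\<zero>\<^bsub>class_ring\<^esub>}"
   by (auto simp: Us(1) in_set_conv_nth)
 qed
 have cmb: "ring.combine class_ring Ks Us = (\<Sum>i<m. Ks ! i * x ^ i)" if "length Ks = m" for Ks
  using that Us by (simp add: combine_class_ring)
 have "ring.Span class_ring K Us = field_adjoin K x"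
 proof (rule Set.set_eqI)
  fix y
  have "y \<in> ring.Span class_ring K Us \<longleftrightarrow>
    (\<exists>Ks. length Ks = m \<and> set Ks \<subseteq> K \<and> y = (\<Sum>i<m. Ks ! i * x ^ i))"
   unfolding ring.Span_eq_combine_set_length_version[OF class_ring.ring_axioms subfield_class_ring UsR]
    mem_Collect_eq Us(1) using cmb by metis
  also have "\<dots> \<longleftrightarrow> (\<exists>c. poly_over c \<and> y = poly c x)"
  proof
   assume "\<exists>Ks. length Ks = m \<and> set Ks \<subseteq> K \<and> y = (\<Sum>i<m. Ks ! i * x ^ i)"
   then obtain Ks where Ks: "length Ks = m" "set Ks \<subseteq> K" "y = (\<Sum>i<m. Ks ! i * x ^ i)" by blast
   have "poly_over (\<Sum>i<m. Polynomial.monom (Ks ! i) i)" by (rule coeffs) (use Ks in auto)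
   moreover have "y = poly (\<Sum>i<m. Polynomial.monom (Ks ! i) i) x"
    using Ks(3) by (simp add: poly_sum poly_monom)
   ultimately show "\<exists>c. poly_over c \<and> y = poly c x" by blast
  next
   assume "\<exists>c. poly_over c \<and> y = poly c x"
   then obtain c where c: "poly_over c" "y = poly c x" by blast
   obtain a r where ar: "poly_over a" "poly_over r" "c = p * a + r" "r = 0 \<or> degree r < degree p"
    using poly_over_divide_monic[OF p(1,2) c(1)] by blast
   have m0: "m > 0" using min_poly_degree_pos[OF x] by (simp add: m_def p_def)
   have y: "y = poly r x" using c(2) ar(3) p(3) by simp
   have "degree r < m" using ar(4) m0 by (auto simp: m_def)
   then have "poly r x = (\<Sum>i<m. coeff r i * x ^ i)"
    unfolding poly_altdef by (intro sum.mono_neutral_left) (auto simp: coeff_eq_0)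
   then have "y = (\<Sum>i<m. map (coeff r) [0..<m] ! i * x ^ i)" using y by simp
   moreover have "set (map (coeff r) [0..<m]) \<subseteq> K" using poly_over_coeff[OF ar(2)] by auto
   ultimately show "\<exists>Ks. length Ks = m \<and> set Ks \<subseteq> K \<and> y = (\<Sum>i<m. Ks ! i * x ^ i)"
    by (intro exI[of _ "map (coeff r) [0..<m]"]) simp
  qed
  also have "\<dots> \<longleftrightarrow> y \<in> field_adjoin K x" unfolding field_adjoin_eq[OF x] by blast
  finally show "y \<in> ring.Span class_ring K Us \<longleftrightarrow> y \<in> field_adjoin K x" .
 qed
 then show ?thesis
  using indep ring.dimension_independent[OF class_ring.ring_axioms, of K Us]
  by (simp add: Us(1) m_def p_def)
qed

lemma deg_over_eq:
 assumes "algebraic_over K x"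
 shows "deg_over K x = degree (min_poly K x)"
 using ring.dimI[OF class_ring.ring_axioms subfield_class_ring dimension_field_adjoin[OF assms]]
 by (simp add: deg_over_def over_def)

lemma map_poly_emb_mult:
 assumes \<sigma>: "\<sigma> \<in> embeddings K" and ab: "poly_over a" "poly_over b"
 shows "map_poly \<sigma> (a * b) = map_poly \<sigma> a * map_poly \<sigma> b"
proof (rule poly_eqI)
 fix k
 have "coeff (map_poly \<sigma> (a * b)) k = \<sigma> (\<Sum>i\<le>k. coeff a i * coeff b (k - i))"
  by (simp add: coeff_map_poly emb_0[OF \<sigma>] coeff_mult)
 also have "\<dots> = (\<Sum>i\<le>k. \<sigma> (coeff a i * coeff b (k - i)))"
  by (intro emb_sum[OF \<sigma>] mult_mem poly_over_coeff ab)
 also have "\<dots> = (\<Sum>i\<le>k. \<sigma> (coeff a i) * \<sigma> (coeff b (k - i)))"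
  by (intro sum.cong refl emb_mult[OF \<sigma>] poly_over_coeff ab)
 also have "\<dots> = coeff (map_poly \<sigma> a * map_poly \<sigma> b) k"
  by (simp add: coeff_map_poly emb_0[OF \<sigma>] coeff_mult)
 finally show "coeff (map_poly \<sigma> (a * b)) k = coeff (map_poly \<sigma> a * map_poly \<sigma> b) k" .
qed

lemma emb_rat:
 fixes \<sigma> :: "real => 'a::field_char_0"
 assumes "\<sigma> \<in> embeddings K"
 shows "\<sigma> (of_rat a) = of_rat a"
 using emb_ev[OF assms zero_mem, of "[:a:]"] by simp

lemma map_poly_emb_rat:
 fixes \<sigma> :: "real => 'a::field_char_0"
 assumes "\<sigma> \<in> embeddings K"
 shows "map_poly \<sigma> (map_poly of_rat e) = map_poly of_rat e"
 by (rule poly_eqI) (simp add: coeff_map_poly emb_0[OF assms] emb_rat[OF assms])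

lemma of_real_embedding: "complex_of_real \<in> embeddings K"
 unfolding embeddings_def by (rule ring_hom_memI) auto

lemma of_real_emb: "\<sigma> \<in> embeddings K ==> (\<lambda>x. complex_of_real (\<sigma> x)) \<in> embeddings K"
 for \<sigma> :: "real => real"
 unfolding embeddings_def by (rule ring_hom_memI) (auto simp: Ring.ring_hom_def)

end

text \<open>Horner's scheme: the coefficients of P/(X - z), read from the top, are the partial
  Horner values of P at z.\<close>

lemma synthetic_division_coeff:
 fixes P :: "'a::idom poly"
 assumes P: "P = [:- z, 1:] * Q" "P ~= 0" "degree P = m" and j: "j < m"
 shows "coeff Q (m - 1 - j) = (\<Sum>t\<le>j. coeff P (m - j + t) * z ^ t)"
 using j
proof (induction j)
 have Q0: "Q ~= 0" using P by auto
 have step: "coeff P (Suc i) = coeff Q i - z * coeff Q (Suc i)" for i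
  unfolding P(1) by simp
 case 0
 have "degree P = Suc (degree Q)"
  unfolding P(1) using Q0 by (subst degree_mult_eq) auto
 then have "coeff Q m = 0" using P(3) by (intro coeff_eq_0) simp
 then show ?case using step[of "m - 1"] 0 by (simp add: One_nat_def)
next
 case (Suc j)
 have "coeff P (Suc i) = coeff Q i - z * coeff Q (Suc i)" for i
  unfolding P(1) by simp
 from this[of "m - 1 - Suc j"]
 have "coeff Q (m - 1 - Suc j) = coeff P (m - Suc j) + z * coeff Q (m - 1 - j)"
  using Suc.prems by (simp add: One_nat_def Suc_diff_Suc)
 also have "coeff Q (m - 1 - j) = (\<Sum>t\<le>j. coeff P (m - j + t) * z ^ t)"
  using Suc by simp
 also have "coeff P (m - Suc j) + z * (\<Sum>t\<le>j. coeff P (m - j + t) * z ^ t) =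
   (\<Sum>t\<le>Suc j. coeff P (m - Suc j + t) * z ^ t)"
 proof -
  have "m - Suc j + Suc t = m - j + t" for t using Suc.prems by simp
  then have "(\<Sum>t\<le>Suc j. coeff P (m - Suc j + t) * z ^ t) =
    coeff P (m - Suc j) + (\<Sum>t\<le>j. coeff P (m - j + t) * z ^ Suc t)"
   by (subst sum.atMost_Suc_shift) (simp del: power_Suc add_Suc_right)
  then show ?thesis
   by (simp add: sum_distrib_left mult_ac)
 qed
 finally show ?case .
qed

text \<open>Newton's identities, read off from \<open>P' = \<Sum> P / (x - z)\<close>.\<close>

lemma newton_identity:
 fixes P :: "'a::idom poly"
 assumes Z: "finite Z" "P = (\<Prod>z\<in>Z. [:- z, 1:])" and m: "degree P = m" "lead_coeff P = 1" and j: "j < m"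
 shows "(\<Sum>z\<in>Z. z ^ j) = of_nat (m - j) * coeff P (m - j) - (\<Sum>t<j. coeff P (m - j + t) * (\<Sum>z\<in>Z. z ^ t))"
proof -
 have P0: "P ~= 0" using m by auto
 have Q: "coeff (\<Prod>w\<in>Z - {z}. [:- w, 1:]) (m - 1 - j) = (\<Sum>t\<le>j. coeff P (m - j + t) * z ^ t)" if "z \<in> Z" for z
  by (rule synthetic_division_coeff[OF _ P0 m(1) j])
   (use Z that in \<open>simp add: prod.remove[of Z z]\<close>)
 have "of_nat (m - j) * coeff P (m - j) = coeff (pderiv P) (m - 1 - j)"
  using j by (simp add: coeff_pderiv One_nat_def Suc_diff_Suc)
 also have "pderiv P = (\<Sum>z\<in>Z. \<Prod>w\<in>Z - {z}. [:- w, 1:])"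
  unfolding Z(2) pderiv_prod by (simp add: pderiv_pCons)
 also have "coeff \<dots> (m - 1 - j) = (\<Sum>z\<in>Z. \<Sum>t\<le>j. coeff P (m - j + t) * z ^ t)"
  unfolding coeff_sum by (rule sum.cong[OF refl Q])
 also have "\<dots> = (\<Sum>t\<le>j. coeff P (m - j + t) * (\<Sum>z\<in>Z. z ^ t))"
  by (subst sum.swap) (simp add: sum_distrib_left)
 also have "\<dots> = (\<Sum>t<j. coeff P (m - j + t) * (\<Sum>z\<in>Z. z ^ t)) + (\<Sum>z\<in>Z. z ^ j)"
  using j m by (simp add: lessThan_Suc_atMost[symmetric])
 finally show ?thesis by (simp add: algebra_simps)
qed

locale salem_field = real_subfield +
 fixes l :: real
 assumes salem: "salem l" and sub: "K \<subseteq> field_adjoin \<rat> (l + inverse l)"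
begin

definition p :: "real poly" where "p = min_poly K l"

lemma l_gt_1: "l > 1" using salem by (simp add: salem_def)

lemma algQ: "algebraic_over \<rat> l" by (rule salem_algebraic[OF salem])

lemma algK: "algebraic_over K l" by (rule algebraic_over_trans[OF algQ])

lemmas p_props = min_poly_props[OF algK, folded p_def]

lemmas p_pal = min_poly_palindromic[OF salem sub, folded p_def]

lemma p_dvd: "poly_over g ==> poly g l = 0 ==> \<exists>a. poly_over a \<and> g = p * a"
 using min_poly_dvd_over[OF algK] by (simp add: p_def)

lemma degree_p_pos: "degree p > 0"
 using min_poly_degree_pos[OF algK] by (simp add: p_def)

lemma trace_form: "x \<in> K ==> \<exists>c. x = ev c (l + inverse l)"
 using sub field_adjoin_Rats[OF salem_trace_algebraic(2)[OF salem]] by blast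

context
 fixes \<sigma> :: "real => complex" assumes \<sigma>: "\<sigma> \<in> embeddings K"
begin

abbreviation P :: "complex poly" where "P \<equiv> map_poly \<sigma> p"

lemma coeff_P: "coeff P i = \<sigma> (coeff p i)"
 by (simp add: coeff_map_poly emb_0[OF \<sigma>])

lemma degree_P: "degree P = degree p" and lead_P: "lead_coeff P = 1"
proof -
 have 1: "coeff P (degree p) = 1" using p_props(2) by (simp add: coeff_P emb_1[OF \<sigma>])
 then have "degree p \<le> degree P" by (intro le_degree) simp
 then show "degree P = degree p" using degree_map_poly_le[of \<sigma> p] by simp
 then show "lead_coeff P = 1" using 1 by simp
qed

lemma P_root_transfer:
 assumes "poly P z = 0" "poly_over g" "poly g l = 0"
 shows "poly (map_poly \<sigma> g) z = 0"
proof -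
 obtain a where "poly_over a" "g = p * a" using p_dvd assms by blast
 then show ?thesis using assms(1) by (simp add: map_poly_emb_mult[OF \<sigma> p_props(1)])
qed

text \<open>In effect l -> z extends \<sigma> to K(l). No extension is constructed; only the
  relation x = e(l), a multiple of p, is carried over to z.\<close>

lemma emb_eval:
 assumes z: "poly P z = 0" and x: "x \<in> K" "x = ev e l"
 shows "\<sigma> x = ev e z"
proof -
 define g where "g = map_poly of_rat e - [:x:]"
 have "poly_over g"
  unfolding g_def using x by (intro poly_over_diff poly_over_map_of_rat poly_over_pCons poly_over_0)
 moreover have "poly g l = 0" using x(2) by (simp add: g_def ev_def)
 ultimately have "poly (map_poly \<sigma> g) z = 0" by (rule P_root_transfer[OF z])
 moreover have "map_poly \<sigma> g = map_poly of_rat e - [:\<sigma> x:]"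
 proof (rule poly_eqI)
  fix i
  have "\<sigma> (of_rat (coeff e i) - x) = of_rat (coeff e i) - \<sigma> x"
   using emb_add[OF \<sigma> Rats_mem uminus_mem[OF x(1)]] by (simp add: emb_rat[OF \<sigma>] emb_uminus[OF \<sigma> x(1)])
  then show "coeff (map_poly \<sigma> g) i = coeff (map_poly of_rat e - [:\<sigma> x:]) i"
   by (cases i) (simp_all add: coeff_map_poly emb_0[OF \<sigma>] g_def emb_rat[OF \<sigma>])
 qed
 ultimately show ?thesis by (simp add: ev_def)
qed

lemma root_conjugate: "poly P z = 0 ==> z \<in> conjugates l"
 using emb_eval[OF _ zero_mem] by (auto simp: conjugates_iff[OF algQ] emb_0[OF \<sigma>])

lemma emb_trace:
 assumes z: "poly P z = 0" and x: "x \<in> K" "x = ev c (l + inverse l)"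
 shows "\<sigma> x = ev c (z + inverse z)"
proof -
 interpret F: subfield_of_field "field_adjoin \<rat> l" by (rule field_adjoin_subfield)
 have "inverse l \<in> field_adjoin \<rat> l" by (intro F.inverse_mem field_adjoin_mem)
 then obtain f where f: "inverse l = ev f l"
  unfolding field_adjoin_Rats[OF algQ] by blast
 have "ev ([:0, 1:] * f - 1) l = 0" using l_gt_1 f[symmetric] by simp
 then have "ev ([:0, 1:] * f - 1) z = 0"
  using root_conjugate[OF z] unfolding conjugates_iff[OF algQ] by blast
 then have 1: "z * ev f z = 1" by simp
 then have "z ~= 0" by auto
 then have fz: "ev f z = inverse z" using 1 by (simp add: field_simps)
 have "x = ev (pcompose c ([:0, 1:] + f)) l" using x(2) f by simp
 from emb_eval[OF z x(1) this] show ?thesis by (simp add: fz)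
qed

lemma root_cases:
 assumes "poly P z = 0"
 shows "z = of_real l \<or> z = of_real (inverse l) \<or> cmod z = 1"
 using root_conjugate[OF assms] salem unfolding salem_def by blast

lemma root_nonzero: "poly P z = 0 ==> z ~= 0"
 using root_cases[of z] l_gt_1 by auto

lemma P_has_root: "\<exists>z. poly P z = 0"
 using fundamental_theorem_of_algebra[of P] constant_degree[of P] degree_P degree_p_pos by auto

lemma inverse_eq_cnj: "cmod z = 1 ==> inverse z = cnj z"
 using complex_norm_square[of z] by (simp add: inverse_unique)

text \<open>Every root z has real z + 1/z, either because z is real or because 1/z is its complex
  conjugate, and the image of K is computed from this number.\<close>

lemma emb_in_Reals:
 assumes "x \<in> K"
 shows "\<sigma> x \<in> \<real>"
proof -
 obtain z where z: "poly P z = 0" using P_has_root by blast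
 obtain c where c: "x = ev c (l + inverse l)" using trace_form[OF assms] by blast
 have "z + inverse z \<in> \<real>"
  using root_cases[OF z] inverse_eq_cnj[of z] by (auto simp: complex_add_cnj)
 then obtain r where "z + inverse z = of_real r" by (auto elim: Reals_cases)
 then show ?thesis using emb_trace[OF z assms c] by (simp add: ev_of_real)
qed

text \<open>Off the unit circle z + 1/z equals l + 1/l, and then \<sigma> is the inclusion on K.
  This is the source of definiteness at the nonidentity embeddings.\<close>

lemma nonidentity_root:
 assumes x: "x \<in> K" "\<sigma> x ~= of_real x" and z: "poly P z = 0"
 shows "cmod z = 1"
proof (rule ccontr)
 assume "cmod z ~= 1"
 then have "z + inverse z = of_real (l + inverse l)" using root_cases[OF z] by auto
 moreover obtain c where c: "x = ev c (l + inverse l)" using trace_form[OF x(1)] by blast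
 ultimately have "\<sigma> x = ev c (complex_of_real (l + inverse l))" using emb_trace[OF z x(1) c] by simp
 then show False using x(2) unfolding ev_of_real c[symmetric] by simp
qed

text \<open>P divides the rational minimal polynomial of l, which \<sigma> leaves fixed and whose
  complex roots are simple.\<close>

lemma P_simple: "poly P z = 0 ==> poly (pderiv P) z ~= 0"
proof
 assume z: "poly P z = 0" "poly (pderiv P) z = 0"
 obtain k where k: "k ~= 0" "ev k l = 0" "!!c. ev c l = 0 ==> k dvd c"
  "!!z :: complex. ev k z = 0 ==> ev (pderiv k) z ~= 0"
  by (rule minimal_rat_poly[OF algQ]) blast
 obtain a where a: "poly_over a" "map_poly of_rat k = p * a"
  using p_dvd[OF poly_over_map_of_rat, of k] k(2) by (auto simp: ev_def)
 have "map_poly of_rat k = P * map_poly \<sigma> a"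
  using arg_cong[OF a(2), of "map_poly \<sigma>"]
  by (simp add: map_poly_emb_rat[OF \<sigma>] map_poly_emb_mult[OF \<sigma> p_props(1) a(1)])
 then have "poly (map_poly of_rat k) z = 0" "poly (pderiv (map_poly of_rat k)) z = 0"
  using z by (simp_all add: pderiv_mult)
 then show False using k(4)[of z] by (simp add: ev_def of_rat_hom.map_poly_pderiv)
qed

lemma P_factor: "P = (\<Prod>z | poly P z = 0. [:- z, 1:])" and finite_roots: "finite {z. poly P z = 0}"
proof -
 have "rsquarefree P" unfolding rsquarefree_roots using P_simple by blast
 then show "P = (\<Prod>z | poly P z = 0. [:- z, 1:])"
  using complex_poly_decompose_rsquarefree[of P] lead_P by simp
 show "finite {z. poly P z = 0}" using lead_P by (intro poly_roots_finite) auto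
qed

lemma card_roots: "card {z. poly P z = 0} = degree p"
proof -
 have "degree (\<Prod>z | poly P z = 0. [:- z, 1:]) = (\<Sum>z | poly P z = 0. 1)"
  by (subst degree_prod_eq_sum_degree) auto
 then show ?thesis using P_factor degree_P by simp
qed

lemma root_inverse:
 assumes "poly P z = 0"
 shows "poly P (inverse z) = 0"
proof -
 have "reflect_poly P = P"
 proof (rule poly_eqI)
  fix i
  show "coeff (reflect_poly P) i = coeff P i"
   using arg_cong[OF p_pal(2), of "\<lambda>f. \<sigma> (coeff f i)"]
   by (simp add: coeff_reflect_poly degree_P coeff_P emb_0[OF \<sigma>] split: if_splits)
 qed
 then show ?thesis
  using poly_reflect_poly_nz[of "inverse z" P] root_nonzero[OF assms] assms by simp
qed

end

text \<open>The traces of powers of l over K. Newton's identities express them through the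
  coefficients of p, compatibly with every embedding; exponents below the degree are those that
  occur in the Gram matrix.\<close>

lemma power_sums:
 obtains s :: "nat => real" where "!!j. j < degree p ==> s j \<in> K"
  "!!(\<sigma> :: real => complex) j. \<sigma> \<in> embeddings K ==> j < degree p ==>
   \<sigma> (s j) = (\<Sum>z | poly (map_poly \<sigma> p) z = 0. z ^ j)"
proof -
 define m where "m = degree p"
 have "j < m --> (\<exists>s\<in>K. \<forall>\<sigma> :: real => complex. \<sigma> \<in> embeddings K -->
   \<sigma> s = (\<Sum>z | poly (map_poly \<sigma> p) z = 0. z ^ j))" for j
 proof (induction j rule: less_induct)
  case (less j)
  show ?case
  proof
   assume j: "j < m"
   then have "\<forall>t\<in>{..<j}. \<exists>s. s \<in> K \<and> (\<forall>\<sigma> :: real => complex. \<sigma> \<in> embeddings K -->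
     \<sigma> s = (\<Sum>z | poly (map_poly \<sigma> p) z = 0. z ^ t))"
    using less by fastforce
   then obtain s :: "nat => real" where s: "\<forall>t\<in>{..<j}. s t \<in> K \<and> (\<forall>\<sigma> :: real => complex. \<sigma> \<in> embeddings K -->
     \<sigma> (s t) = (\<Sum>z | poly (map_poly \<sigma> p) z = 0. z ^ t))"
    by (auto dest!: bchoice)
   define y where "y = of_nat (m - j) * coeff p (m - j) + - (\<Sum>t<j. coeff p (m - j + t) * s t)"
   have pK: "coeff p i \<in> K" for i using p_props(1) by (rule poly_over_coeff)
   have terms: "of_nat (m - j) * coeff p (m - j) \<in> K" "!!t. t \<in> {..<j} ==> coeff p (m - j + t) * s t \<in> K"
    using pK s by (auto intro!: mult_mem of_nat_mem)
   have sumK: "(\<Sum>t<j. coeff p (m - j + t) * s t) \<in> K" using terms(2) by (rule sum_mem)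
   have "y \<in> K" unfolding y_def by (intro add_mem uminus_mem terms sumK)
   moreover have "\<sigma> y = (\<Sum>z | poly (map_poly \<sigma> p) z = 0. z ^ j)" if \<sigma>: "\<sigma> \<in> embeddings K" for \<sigma> :: "real => complex"
   proof -
    have "\<sigma> y = \<sigma> (of_nat (m - j) * coeff p (m - j)) - \<sigma> (\<Sum>t<j. coeff p (m - j + t) * s t)"
     unfolding y_def using emb_add[OF \<sigma> terms(1) uminus_mem[OF sumK]] emb_uminus[OF \<sigma> sumK] by simp
    also have "\<sigma> (of_nat (m - j) * coeff p (m - j)) = of_nat (m - j) * coeff (map_poly \<sigma> p) (m - j)"
     using emb_mult[OF \<sigma> of_nat_mem pK] by (simp add: emb_of_nat[OF \<sigma>] coeff_P[OF \<sigma>])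
    also have "\<sigma> (\<Sum>t<j. coeff p (m - j + t) * s t) =
      (\<Sum>t<j. coeff (map_poly \<sigma> p) (m - j + t) * (\<Sum>z | poly (map_poly \<sigma> p) z = 0. z ^ t))"
    proof -
     have "\<sigma> (\<Sum>t<j. coeff p (m - j + t) * s t) = (\<Sum>t<j. \<sigma> (coeff p (m - j + t) * s t))"
      by (rule emb_sum[OF \<sigma>]) (rule terms(2))
     also have "\<dots> = (\<Sum>t<j. coeff (map_poly \<sigma> p) (m - j + t) * (\<Sum>z | poly (map_poly \<sigma> p) z = 0. z ^ t))"
      using s \<sigma> by (intro sum.cong refl) (simp add: emb_mult[OF \<sigma> pK] coeff_P[OF \<sigma>])
     finally show ?thesis .
    qed
    also have "of_nat (m - j) * coeff (map_poly \<sigma> p) (m - j) - \<dots> = (\<Sum>z | poly (map_poly \<sigma> p) z = 0. z ^ j)"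
     by (rule newton_identity[OF finite_roots[OF \<sigma>] P_factor[OF \<sigma>] _ lead_P[OF \<sigma>] j, symmetric])
      (simp add: degree_P[OF \<sigma>] m_def)
    finally show ?thesis .
   qed
   ultimately show "\<exists>s\<in>K. \<forall>\<sigma> :: real => complex. \<sigma> \<in> embeddings K -->
     \<sigma> s = (\<Sum>z | poly (map_poly \<sigma> p) z = 0. z ^ j)" by blast
  qed
 qed
 then have "\<forall>j\<in>{..<m}. \<exists>s. s \<in> K \<and> (\<forall>\<sigma> :: real => complex. \<sigma> \<in> embeddings K -->
   \<sigma> s = (\<Sum>z | poly (map_poly \<sigma> p) z = 0. z ^ j))" by auto
 then obtain s :: "nat => real" where "\<forall>j\<in>{..<m}. s j \<in> K \<and> (\<forall>\<sigma> :: real => complex. \<sigma> \<in> embeddings K -->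
   \<sigma> (s j) = (\<Sum>z | poly (map_poly \<sigma> p) z = 0. z ^ j))"
  by (auto dest!: bchoice)
 then show ?thesis using that[of s] by (simp add: m_def)
qed

lemma finite_dimension_K: "ring.finite_dimension class_ring \<rat> K"
proof -
 have Q: "subfield \<rat> (class_ring :: real ring)" by (rule Rats.subfield_class_ring)
 have fin: "ring.finite_dimension class_ring \<rat> (field_adjoin \<rat> l)"
  by (rule ring.finite_dimensionI[OF class_ring.ring_axioms Rats.dimension_field_adjoin[OF algQ]])
 have "K \<subseteq> field_adjoin \<rat> l"
 proof -
  interpret F: real_subfield "field_adjoin \<rat> l" by (rule real_subfieldI[OF field_adjoin_subfield])
  have "l + inverse l \<in> field_adjoin \<rat> l" by (intro F.add_mem F.inverse_mem field_adjoin_mem)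
  then show ?thesis using trace_form F.ev_mem by blast
 qed
 moreover have "subalgebra \<rat> K (class_ring :: real ring)"
 proof (rule subalgebra.intro)
  show "subgroup K (add_monoid (class_ring :: real ring))"
   using subring.axioms(1)[OF subfieldE(1)[OF subfield_class_ring]] .
  show "subalgebra_axioms \<rat> K (class_ring :: real ring)"
   unfolding subalgebra_axioms_def using mult_mem Rats_mem by (auto elim!: Rats_cases)
 qed
 ultimately show ?thesis
  using ring.subalbegra_incl_imp_finite_dimension[OF class_ring.ring_axioms Q fin] by blast
qed

lemma totally_real: "totally_real_number_field K"
 unfolding totally_real_number_field_def
 using subfield_class_ring finite_dimension_K emb_in_Reals by blast

end

section \<open>The hyperbolic form of a square-rootable Salem number\<close>

context salem_field
begin

text \<open>
 The sign ambiguity in \<open>c(l\<^sup>-\<^sup>1) = \<plusminus> \<surd>(\<alpha> / l)\<close> is resolved by \<open>q\<close> being palindromic: \<open>c\<close> is the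
 quotient of the even by the odd part of \<open>q\<close>.
\<close>

lemma square_root_polynomial:
 assumes "square_rootable K l"
 obtains \<alpha> c where "totally_positive K \<alpha>" "poly_over c"
  "poly c l = sqrt \<alpha> * sqrt l" "poly c (inverse l) = sqrt \<alpha> * inverse (sqrt l)"
  "!!z. poly (map_poly complex_of_real p) z = 0 ==> (poly (map_poly of_real c) z)\<^sup>2 = of_real \<alpha> * z"
  "!!z. poly (map_poly complex_of_real p) z = 0 ==>
   poly (map_poly of_real c) z * poly (map_poly of_real c) (inverse z) = of_real \<alpha>"
proof -
 obtain \<alpha> q where tp: "totally_positive K \<alpha>" and q: "lead_coeff q = 1" "reflect_poly q = q"
  and even: "!!i. even i ==> coeff q i \<in> K" and odd: "!!i. odd i ==> coeff q i \<in> (\<lambda>k. sqrt \<alpha> * k) ` K"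
  and qq: "q * pcompose q [:0, -1:] = pcompose p [:0, 0, 1:]"
  using assms unfolding square_rootable_def p_def[symmetric] by blast
 have \<alpha>: "\<alpha> \<in> K" "\<alpha> > 0" using tp id_embedding by (auto simp: totally_positive_def)
 define \<mu> where "\<mu> = sqrt l"
 have mu: "\<mu> > 0" "\<mu> * \<mu> = l" using l_gt_1 by (auto simp: \<mu>_def)
 define R where "R = Polynomial.smult (inverse (sqrt \<alpha>)) (odd_part q)"
 have R_over: "poly_over R"
  unfolding poly_over_def
 proof
  fix i
  obtain k where "k \<in> K" "coeff q (2 * i + 1) = sqrt \<alpha> * k" using odd[of "2 * i + 1"] by auto
  then show "coeff R i \<in> K" using \<alpha>(2) by (simp add: R_def coeff_odd_part mult.assoc[symmetric])
 qed
 have E_over: "poly_over (even_part q)" using even by (simp add: poly_over_def coeff_even_part)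
 have O_eq: "poly (odd_part q) x = sqrt \<alpha> * poly R x" for x using \<alpha>(2) by (simp add: R_def)
 have "poly q \<mu> * poly q (- \<mu>) = poly (q * pcompose q [:0, -1:]) \<mu>" by simp
 also have "\<dots> = 0" unfolding qq using mu p_props(3) by (simp add: poly_pcompose)
 finally have "poly q \<mu> = 0 \<or> poly q (- \<mu>) = 0" by simp
 \<comment> \<open>q vanishes at one of \<mu> and -\<mu>. The sign is absorbed into the odd part, so
   that c takes exactly the value sqrt \<alpha> sqrt l at l.\<close>
 then have "\<exists>\<epsilon>. \<epsilon> * \<epsilon> = 1 \<and> \<epsilon> \<in> K \<and> poly q (\<epsilon> * \<mu>) = 0"
 proof
  assume "poly q \<mu> = 0"
  then show ?thesis using one_mem by (intro exI[of _ 1]) simp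
 next
  assume "poly q (- \<mu>) = 0"
  then show ?thesis using uminus_mem[OF one_mem] by (intro exI[of _ "- 1"]) simp
 qed
 then obtain \<epsilon> where eps: "\<epsilon> * \<epsilon> = 1" "\<epsilon> \<in> K" "poly q (\<epsilon> * \<mu>) = 0" by blast
 have eps0: "\<epsilon> ~= 0" using eps(1) by auto
 define R' where "R' = Polynomial.smult \<epsilon> R"
 have R'_over: "poly_over R'" unfolding R'_def by (rule poly_over_smult[OF eps(2) R_over])
 define v where "v = sqrt \<alpha> * \<mu>"
 have q_eval: "poly q (\<epsilon> * y) = poly (even_part q) (y * y) + (sqrt \<alpha> * y) * poly R' (y * y)" for y
 proof -
  have "(\<epsilon> * y)\<^sup>2 = (\<epsilon> * \<epsilon>) * (y * y)" by (simp only: power2_eq_square mult_ac)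
  then have "(\<epsilon> * y)\<^sup>2 = y * y" by (simp add: eps(1))
  then show ?thesis
   unfolding poly_even_odd[of q "\<epsilon> * y"] by (simp add: O_eq R'_def)
 qed
 have rel1: "poly (even_part q) l + v * poly R' l = 0"
  using eps(3) q_eval[of \<mu>] mu by (simp add: v_def)
 have rel2: "poly (even_part q) (inverse l) + sqrt \<alpha> * inverse \<mu> * poly R' (inverse l) = 0"
 proof -
  have "inverse (\<epsilon> * \<mu>) = \<epsilon> * inverse \<mu>"
   using eps0 eps(1) mu by (simp add: field_simps)
  then have "poly q (\<epsilon> * inverse \<mu>) = 0"
   using poly_reflect_poly_nz[of "\<epsilon> * \<mu>" q] eps0 eps(3) mu by (simp add: q(2))
  moreover have "inverse \<mu> * inverse \<mu> = inverse l" using mu by (metis inverse_mult_distrib)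
  ultimately show ?thesis using q_eval[of "inverse \<mu>"] by simp
 qed
 \<comment> \<open>If the odd part vanished at l, so would the even part; both have degree below
   that of p, so q would be zero.\<close>
 have R'l: "poly R' l ~= 0"
 proof
  assume z: "poly R' l = 0"
  have "pcompose q [:0, -1:] ~= 0" using q(1) by (auto simp: pcompose_eq_0_iff)
  then have "degree q + degree q = 2 * degree p"
   using arg_cong[OF qq, of degree] q(1) by (subst (asm) degree_mult_eq) (auto simp: degree_pcompose)
  then have dq: "degree q = degree p" by simp
  have small: "g = 0" if "poly_over g" "poly g l = 0" "!!i. i \<ge> degree p ==> coeff g i = 0" for g
  proof (rule ccontr)
   assume g0: "g ~= 0"
   then have "degree p \<le> degree g" using p_props(4)[OF g0 that(1,2)] by simp
   then show False using that(3)[of "degree g"] g0 by simp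
  qed
  have "even_part q = 0"
   using rel1 z degree_p_pos by (intro small E_over) (auto simp: coeff_even_part dq intro!: coeff_eq_0)
  moreover have "R' = 0"
   using z degree_p_pos by (intro small R'_over) (auto simp: R'_def R_def coeff_odd_part dq intro!: coeff_eq_0)
  then have "odd_part q = 0" using eps0 \<alpha>(2) by (simp add: R'_def R_def)
  ultimately have "q = 0" using even_odd_decomp[of q] by simp
  then show False using q(1) by simp
 qed
 interpret S: subfield_of_field "{poly c l | c. poly_over c}"
  by (rule simple_extension_subfield[OF algK])
 have v_eq: "v = - poly (even_part q) l / poly R' l" using rel1 R'l by (simp add: field_simps)
 have "poly (even_part q) l \<in> {poly c l | c. poly_over c}" "poly R' l \<in> {poly c l | c. poly_over c}"
  using E_over R'_over by blast+
 then have "v \<in> {poly c l | c. poly_over c}" unfolding v_eq by (intro S.divide_mem S.uminus_mem)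
 then obtain c where c: "poly_over c" "poly c l = v" by auto
 have "v * v = (sqrt \<alpha> * sqrt \<alpha>) * (\<mu> * \<mu>)" unfolding v_def by (simp only: mult_ac)
 then have vv: "v * v = \<alpha> * l" using \<alpha>(2) mu(2) by simp
 have root_inv: "poly g (inverse l) = 0" if g: "poly_over g" "poly g l = 0" for g
 proof -
  obtain a where "g = p * a" using p_dvd[OF g] by blast
  then show ?thesis using p_pal(1) by simp
 qed
 have c_inv: "poly c (inverse l) = sqrt \<alpha> * inverse \<mu>"
 proof -
  have "poly (c * R' + even_part q) (inverse l) = 0"
   using c R'_over E_over rel1 by (intro root_inv poly_over_add poly_over_mult) auto
  then have "poly c (inverse l) * poly R' (inverse l) = sqrt \<alpha> * inverse \<mu> * poly R' (inverse l)"
   using rel2 unfolding poly_add poly_mult by linarith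
  moreover obtain a where "poly_over a" "poly a l * poly R' l = 1"
   using poly_value_inverse[OF algK R'_over R'l] by blast
  then have "poly (a * R' - 1) (inverse l) = 0"
   using R'_over poly_over_1 by (intro root_inv poly_over_diff poly_over_mult) auto
  then have "poly R' (inverse l) ~= 0" by auto
  ultimately show ?thesis by simp
 qed
 interpret oh: map_poly_comm_ring_hom "of_real :: real => complex" ..
 note transfer = P_root_transfer[OF of_real_embedding]
 have lin: "map_poly complex_of_real [:0, \<alpha>:] = [:0, of_real \<alpha>:]"
  by (rule poly_eqI) (simp add: coeff_map_poly coeff_pCons split: nat.split)
 have sq: "(poly (map_poly of_real c) z)\<^sup>2 = of_real \<alpha> * z" if z: "poly (map_poly complex_of_real p) z = 0" for z
 proof -
  have "poly (map_poly complex_of_real (c * c - [:0, \<alpha>:])) z = 0"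
   using c \<alpha> vv by (intro transfer[OF z] poly_over_diff poly_over_mult poly_over_pCons poly_over_0 zero_mem) auto
  then show ?thesis by (simp add: oh.hom_minus oh.hom_mult lin power2_eq_square mult.commute)
 qed
 have inv: "poly (map_poly of_real c) z * poly (map_poly of_real c) (inverse z) = of_real \<alpha>"
  if z: "poly (map_poly complex_of_real p) z = 0" for z
 proof -
  \<comment> \<open>The reflected polynomial clears the negative powers, so that c(X) c(1/X) =
    \<alpha> becomes a polynomial relation of l and passes to every root z.\<close>
  define d where "d = degree c"
  have l0: "l ~= 0" using l_gt_1 by simp
  have "poly c l * poly c (inverse l) = (sqrt \<alpha> * sqrt \<alpha>) * (\<mu> * inverse \<mu>)"
   unfolding c(2) c_inv v_def by (simp only: mult_ac)
  then have "poly c l * poly c (inverse l) = \<alpha>" using \<alpha>(2) mu(1) by simp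
  then have "poly (c * reflect_poly c - Polynomial.monom \<alpha> d) l = 0"
   using l0 by (simp add: poly_reflect_poly_nz poly_monom d_def mult.left_commute[of "poly c l"])
  then have "poly (map_poly complex_of_real (c * reflect_poly c - Polynomial.monom \<alpha> d)) z = 0"
   using c \<alpha> by (intro transfer[OF z] poly_over_diff poly_over_mult poly_over_monom poly_over_reflect)
  moreover have "map_poly complex_of_real (reflect_poly c) = reflect_poly (map_poly of_real c)"
   by (rule poly_eqI) (simp add: coeff_map_poly coeff_reflect_poly)
  moreover have "map_poly complex_of_real (Polynomial.monom \<alpha> d) = Polynomial.monom (of_real \<alpha>) d"
   by (rule poly_eqI) (simp add: coeff_map_poly)
  ultimately have "poly (map_poly of_real c) z * (z ^ d * poly (map_poly of_real c) (inverse z)) = of_real \<alpha> * z ^ d"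
   using root_nonzero[OF of_real_embedding z]
   by (simp add: oh.hom_minus oh.hom_mult poly_reflect_poly_nz poly_monom d_def)
  then show ?thesis using root_nonzero[OF of_real_embedding z] by (simp add: mult_ac)
 qed
 show ?thesis
  by (rule that[OF tp c(1) _ _ sq inv]) (simp_all add: c(2) c_inv v_def \<mu>_def)
qed

text \<open>The roots are conjugates of the algebraic integer l, and expanding the product of linear
  factors keeps the coefficients integral.\<close>

lemma p_integral: "poly_over p" "coeff p i \<in> \<O> K"
proof -
 interpret AI: subring_of_field "{x :: complex. algebraic_int x}" by (rule algebraic_int_subring)
 have "algebraic_int z" if "poly (map_poly complex_of_real p) z = 0" for z
  using algebraic_int_conjugate[OF _ root_conjugate[OF of_real_embedding that]] salem by (simp add: salem_def)
 then have "AI.poly_over (\<Prod>z | poly (map_poly complex_of_real p) z = 0. [:- z, 1:])"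
  by (intro AI.poly_over_prod AI.poly_over_pCons AI.poly_over_0) auto
 then have "AI.poly_over (map_poly complex_of_real p)"
  unfolding P_factor[OF of_real_embedding, symmetric] .
 then have "algebraic_int (complex_of_real (coeff p i))" for i
  by (auto simp: AI.poly_over_def coeff_map_poly)
 then show "coeff p i \<in> \<O> K"
  using poly_over_coeff[OF p_props(1), of i] by (simp add: ring_of_integers_def)
qed (rule p_props(1))

end

text \<open>The remainders r j are the columns of multiplication by g modulo q in the power basis.
  Over the ring of integers this makes the matrix of multiplication by X integral.\<close>

lemma (in subring_of_field) reductions:
 assumes q: "poly_over q" "lead_coeff q = 1" "degree q > 0" and g: "poly_over g"
 obtains r where "!!j. poly_over (r j)" "!!j. \<exists>a. Polynomial.monom 1 j * g = q * a + r j"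
  "!!i j. i \<ge> degree q ==> coeff (r j) i = 0"
proof -
 have "\<forall>j. \<exists>r. poly_over r \<and> (\<exists>a. Polynomial.monom 1 j * g = q * a + r) \<and> (\<forall>i\<ge>degree q. coeff r i = 0)"
 proof
  fix j
  have "poly_over (Polynomial.monom 1 j * g)" by (intro poly_over_mult poly_over_monom one_mem g)
  then obtain a r where "poly_over a" "poly_over r" "Polynomial.monom 1 j * g = q * a + r" "r = 0 \<or> degree r < degree q"
   using poly_over_divide_monic[OF q(1,2)] by blast
  then show "\<exists>r. poly_over r \<and> (\<exists>a. Polynomial.monom 1 j * g = q * a + r) \<and> (\<forall>i\<ge>degree q. coeff r i = 0)"
   by (intro exI[of _ r]) (auto intro: coeff_eq_0)
 qed
 then show ?thesis using that by metis
qed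

lemma poly_eq_sum_lessThan:
 fixes q :: "'a::comm_ring_1 poly"
 assumes "!!i. i \<ge> m ==> coeff q i = 0"
 shows "poly q z = (\<Sum>i<m. coeff q i * z ^ i)"
proof -
 have "(\<Sum>i\<le>degree q. coeff q i * z ^ i) = (\<Sum>i\<in>{..<m} \<union> {..degree q}. coeff q i * z ^ i)"
  by (rule sum.mono_neutral_left) (auto simp: coeff_eq_0)
 also have "\<dots> = (\<Sum>i<m. coeff q i * z ^ i)"
  by (rule sum.mono_neutral_right) (use assms in auto)
 finally show ?thesis by (simp add: poly_altdef)
qed

lemma sum_lessThan_split: "m \<le> k ==> (\<Sum>i<k. f i) = (\<Sum>i<m. f i) + (\<Sum>i=m..<k. f i)"
 for f :: "nat => 'a::comm_monoid_add" and m k :: nat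
 by (subst ivl_disj_un_one(2)[symmetric, of m k]) (auto intro: sum.union_disjoint)

locale square_root_data = salem_field +
 fixes n :: nat and \<alpha> :: real and c :: "real poly" and s :: "nat => real"
 assumes n: "odd n" "degree p \<le> n + 1"
  and tp: "totally_positive K \<alpha>"
  and c: "poly_over c" "poly c l = sqrt \<alpha> * sqrt l" "poly c (inverse l) = sqrt \<alpha> * inverse (sqrt l)"
  and c_square: "!!z. poly (map_poly complex_of_real p) z = 0 ==>
   (poly (map_poly of_real c) z)\<^sup>2 = of_real \<alpha> * z"
  and c_inverse: "!!z. poly (map_poly complex_of_real p) z = 0 ==>
   poly (map_poly of_real c) z * poly (map_poly of_real c) (inverse z) = of_real \<alpha>"
  and s_mem: "!!j. j < degree p ==> s j \<in> K"
  and s_emb: "!!(\<sigma> :: real => complex) j. \<sigma> \<in> embeddings K ==> j < degree p ==>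
   \<sigma> (s j) = (\<Sum>z | poly (map_poly \<sigma> p) z = 0. z ^ j)"
begin

abbreviation N :: nat where "N \<equiv> n + 1"

definition m :: nat where "m = degree p"

lemma m: "m \<le> N" "m > 0" "even m" "even N"
 using n degree_p_pos p_pal(3) by (auto simp: m_def)

lemma \<alpha>: "\<alpha> \<in> K" "\<alpha> > 0"
 using tp id_embedding by (auto simp: totally_positive_def)

text \<open>
 A vector \<open>x\<close> stands for the pair of the polynomial \<open>\<Sum>\<^sub>i\<^sub><\<^sub>m x\<^sub>i X\<^sup>i\<close> modulo \<open>p\<close> and the remaining coordinates; on
 the first part the form is \<open>(g, h) \<mapsto> Tr (g(X) h(X\<^sup>-\<^sup>1))\<close>, on the second \<open>\<langle>1, \<alpha>, 1, \<alpha>, \<dots>\<rangle>\<close>.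
\<close>

definition E :: "complex => real vec => complex" where
 "E z x = (\<Sum>i<m. of_real (x $ i) * z ^ i)"

definition w :: "nat => real" where "w i = (if even i then 1 else \<alpha>)"

text \<open>The Gram matrix of the trace form. Since the roots are closed under inversion, the trace
  of X^i X^(-j) depends on |i - j| only, which \<open>max i j - min i j\<close> expresses in natural
  numbers.\<close>

definition A :: "real mat" where
 "A = mat N N (\<lambda>(i, j). if i < m \<and> j < m then s (max i j - min i j)
  else if i = j then w i else 0)"

text \<open>Column j of the first block holds the polynomial r j in the power basis. Multiplication
  by c and by X modulo p, each with its own map on the padding, have this shape.\<close>

definition block :: "(nat => real poly) => (nat => nat => real) => real mat" where
 "block r B = mat N N (\<lambda>(i, j). if i < m \<and> j < m then coeff (r j) i
  else if m \<le> i \<and> m \<le> j then B i j else 0)"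

abbreviation Z :: "(real => real) => complex set" where
 "Z \<tau> \<equiv> {z. poly (map_poly (\<lambda>x. complex_of_real (\<tau> x)) p) z = 0}"

abbreviation Z0 :: "complex set" where "Z0 \<equiv> {z. poly (map_poly complex_of_real p) z = 0}"

lemma A_carrier: "A \<in> Mat N" by (simp add: A_def)

lemma A_sym: "A\<^sup>T = A"
 by (rule eq_matI) (auto simp: A_def max.commute min.commute)

lemma w_mem: "w i \<in> K" using \<alpha> one_mem by (simp add: w_def)

lemma A_over: "elements_mat A \<subseteq> K"
 unfolding elements_mat_subset_iff[OF A_carrier]
 using s_mem w_mem zero_mem by (auto simp: A_def m_def)

lemma block_carrier: "block r B \<in> Mat N" by (simp add: block_def)

lemma block_mult:
 assumes x: "x \<in> Vec N" and i: "i < N"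
 shows "(block r B *\<^sub>v x) $ i =
  (if i < m then (\<Sum>j<m. coeff (r j) i * x $ j) else (\<Sum>j=m..<N. B i j * x $ j))"
proof -
 have "(block r B *\<^sub>v x) $ i = (\<Sum>j<N. block r B $$ (i, j) * x $ j)"
  using x i block_carrier[of r B] by (simp add: scalar_prod_def atLeast0LessThan)
 also have "\<dots> = (\<Sum>j<m. block r B $$ (i, j) * x $ j) + (\<Sum>j=m..<N. block r B $$ (i, j) * x $ j)"
  by (rule sum_lessThan_split[OF m(1)])
 also have "(\<Sum>j<m. block r B $$ (i, j) * x $ j) = (if i < m then \<Sum>j<m. coeff (r j) i * x $ j else 0)"
  using i m(1) by (auto simp: block_def intro!: sum.cong sum.neutral)
 also have "(\<Sum>j=m..<N. block r B $$ (i, j) * x $ j) = (if i < m then 0 else \<Sum>j=m..<N. B i j * x $ j)"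
  using i m(1) by (auto simp: block_def intro!: sum.cong sum.neutral)
 finally show ?thesis by simp
qed

text \<open>Evaluation at a root of p undoes the reduction modulo p, leaving multiplication by
  g(z).\<close>

lemma E_block:
 assumes x: "x \<in> Vec N" and z: "z \<in> Z0"
  and r: "!!j. \<exists>a. Polynomial.monom 1 j * g = p * a + r j" "!!i j. i \<ge> m ==> coeff (r j) i = 0"
 shows "E z (block r B *\<^sub>v x) = poly (map_poly of_real g) z * E z x"
proof -
 interpret oh: map_poly_comm_ring_hom "of_real :: real => complex" ..
 have rj: "(\<Sum>i<m. of_real (coeff (r j) i) * z ^ i) = z ^ j * poly (map_poly of_real g) z" for j
 proof -
  obtain a where a: "Polynomial.monom 1 j * g = p * a + r j" using r(1) by blast
  have "map_poly complex_of_real (Polynomial.monom 1 j) = Polynomial.monom 1 j"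
   by (rule poly_eqI) (simp add: coeff_map_poly)
  then have "z ^ j * poly (map_poly of_real g) z = poly (map_poly complex_of_real (Polynomial.monom 1 j * g)) z"
   by (simp add: oh.hom_mult poly_monom)
  also have "\<dots> = poly (map_poly of_real (r j)) z"
   unfolding a using z by (simp add: oh.hom_mult oh.hom_add)
  also have "\<dots> = (\<Sum>i<m. of_real (coeff (r j) i) * z ^ i)"
   using poly_eq_sum_lessThan[of m "map_poly complex_of_real (r j)" z] r(2) by (simp add: coeff_map_poly)
  finally show ?thesis by simp
 qed
 have "E z (block r B *\<^sub>v x) = (\<Sum>i<m. \<Sum>j<m. of_real (x $ j) * (of_real (coeff (r j) i) * z ^ i))"
  unfolding E_def using m(1) x
  by (intro sum.cong refl) (simp add: block_mult sum_distrib_left sum_distrib_right mult_ac del: index_mult_mat_vec)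
 also have "\<dots> = (\<Sum>j<m. of_real (x $ j) * (\<Sum>i<m. of_real (coeff (r j) i) * z ^ i))"
  by (subst sum.swap) (simp only: sum_distrib_left)
 also have "\<dots> = poly (map_poly of_real g) z * E z x"
  unfolding rj E_def by (simp add: sum_distrib_left mult_ac)
 finally show ?thesis .
qed

text \<open>The first block is a polynomial of degree below m, determined by its values at the m
  distinct roots.\<close>

lemma vec_eqI_roots:
 assumes \<tau>: "\<tau> \<in> embeddings K" and xy: "x \<in> Vec N" "y \<in> Vec N"
  and E: "!!z. z \<in> Z \<tau> ==> E z x = E z y" and ext: "!!i. m \<le> i ==> i < N ==> x $ i = y $ i"
 shows "x = y"
proof -
 define f where "f = (\<Sum>i<m. Polynomial.monom (complex_of_real (x $ i - y $ i)) i)"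
 have cf: "coeff f i = (if i < m then complex_of_real (x $ i - y $ i) else 0)" for i
  unfolding f_def coeff_sum coeff_monom by (simp add: sum.delta)
 have "poly f z = E z x - E z y" for z
  by (simp add: f_def E_def poly_sum poly_monom sum_subtractf[symmetric] algebra_simps)
 then have roots: "Z \<tau> \<subseteq> {z. poly f z = 0}" using E by auto
 have "f = 0"
 proof (rule ccontr)
  assume f0: "f ~= 0"
  have "m = card (Z \<tau>)" using card_roots[OF of_real_emb[OF \<tau>]] by (simp add: m_def)
  also have "\<dots> \<le> card {z. poly f z = 0}" using roots f0 by (intro card_mono poly_roots_finite)
  also have "\<dots> \<le> degree f" using f0 by (rule poly_roots_degree)
  finally have "coeff f (degree f) = 0" unfolding cf by simp
  then show False using f0 by simp
 qed
 then have "x $ i = y $ i" if "i < m" for i using cf[of i] that by simp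
 then show ?thesis using ext xy by (intro eq_vecI) (auto simp: not_less[symmetric])
qed

lemma power_sum_diff:
 assumes \<tau>: "\<tau> \<in> embeddings K" and ij: "i < m" "j < m"
 shows "complex_of_real (\<tau> (s (max i j - min i j))) = (\<Sum>z\<in>Z \<tau>. z ^ i * inverse z ^ j)"
proof -
 note \<sigma> = of_real_emb[OF \<tau>]
 have e: "complex_of_real (\<tau> (s k)) = (\<Sum>z\<in>Z \<tau>. z ^ k)" if "k < m" for k
  using s_emb[OF \<sigma>] that by (simp add: m_def)
 have nz: "z ~= 0" if "z \<in> Z \<tau>" for z using root_nonzero[OF \<sigma>] that by simp
 show ?thesis
 proof (cases "j \<le> i")
  case True
  then have "complex_of_real (\<tau> (s (max i j - min i j))) = (\<Sum>z\<in>Z \<tau>. z ^ (i - j))"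
   using e[of "i - j"] ij(1) by (simp only: max_absorb1 min_absorb2 less_imp_diff_less)
  also have "\<dots> = (\<Sum>z\<in>Z \<tau>. z ^ i * inverse z ^ j)"
   using nz True by (intro sum.cong refl) (simp add: power_diff divide_inverse power_inverse)
  finally show ?thesis .
 next
  case False
  then have "complex_of_real (\<tau> (s (max i j - min i j))) = (\<Sum>z\<in>Z \<tau>. z ^ (j - i))"
   using e[of "j - i"] ij(2) by (simp only: max_absorb2 min_absorb1 less_imp_diff_less not_le less_imp_le)
  also have "\<dots> = (\<Sum>z\<in>Z \<tau>. inverse z ^ (j - i))"
   by (rule sum.reindex_bij_witness[of _ inverse inverse]) (use root_inverse[OF \<sigma>] in auto)
  also have "\<dots> = (\<Sum>z\<in>Z \<tau>. z ^ i * inverse z ^ j)"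
   using nz False by (intro sum.cong refl) (simp add: power_diff divide_inverse power_inverse mult.commute)
  finally show ?thesis .
 qed
qed

text \<open>Evaluation at the roots diagonalises the trace form, so that isometry and definiteness
  can be checked root by root.\<close>

lemma form_eq:
 assumes \<tau>: "\<tau> \<in> embeddings K" and x: "x \<in> Vec N" and y: "y \<in> Vec N"
 shows "complex_of_real (bil (map_mat \<tau> A) x y) =
  (\<Sum>z\<in>Z \<tau>. E z x * E (inverse z) y) + of_real (\<Sum>i=m..<N. x $ i * \<tau> (w i) * y $ i)"
proof -
 have A\<tau>: "map_mat \<tau> A \<in> Mat N" using A_carrier by simp
 define t where "t i j = x $ i * (map_mat \<tau> A) $$ (i, j) * y $ j" for i j
 have tval: "t i j = (if i < m \<and> j < m then x $ i * \<tau> (s (max i j - min i j)) * y $ j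
   else if i = j then x $ i * \<tau> (w i) * y $ i else 0)" if "i < N" "j < N" for i j
  using that by (simp add: t_def A_def emb_0[OF \<tau>])
 have "bil (map_mat \<tau> A) x y = (\<Sum>i<N. \<Sum>j<N. t i j)"
  unfolding bil_sum[OF A\<tau> x y] t_def ..
 also have "\<dots> = (\<Sum>i<m. \<Sum>j<N. t i j) + (\<Sum>i=m..<N. \<Sum>j<N. t i j)"
  by (rule sum_lessThan_split[OF m(1)])
 also have "(\<Sum>i<m. \<Sum>j<N. t i j) = (\<Sum>i<m. \<Sum>j<m. t i j)"
  using m(1) by (intro sum.cong refl sum.mono_neutral_right) (auto simp: tval)
 also have "(\<Sum>i=m..<N. \<Sum>j<N. t i j) = (\<Sum>i=m..<N. x $ i * \<tau> (w i) * y $ i)"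
 proof (rule sum.cong[OF refl])
  fix i assume i: "i \<in> {m..<N}"
  have "(\<Sum>j<N. t i j) = (\<Sum>j\<in>{i}. t i j)"
   using i by (intro sum.mono_neutral_right) (auto simp: tval)
  then show "(\<Sum>j<N. t i j) = x $ i * \<tau> (w i) * y $ i" using i by (simp add: tval)
 qed
 finally have 1: "bil (map_mat \<tau> A) x y = (\<Sum>i<m. \<Sum>j<m. t i j) + (\<Sum>i=m..<N. x $ i * \<tau> (w i) * y $ i)" .
 have "complex_of_real (\<Sum>i<m. \<Sum>j<m. t i j) =
   (\<Sum>i<m. \<Sum>j<m. \<Sum>z\<in>Z \<tau>. of_real (x $ i) * z ^ i * (of_real (y $ j) * inverse z ^ j))"
  unfolding of_real_sum
 proof (intro sum.cong refl)
  fix i j assume "i \<in> {..<m}" "j \<in> {..<m}"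
  then have ij: "i < m" "j < m" "i < N" "j < N" using m(1) by auto
  show "complex_of_real (t i j) = (\<Sum>z\<in>Z \<tau>. of_real (x $ i) * z ^ i * (of_real (y $ j) * inverse z ^ j))"
   using ij by (simp add: tval power_sum_diff[OF \<tau>] sum_distrib_left sum_distrib_right mult_ac)
 qed
 also have "\<dots> = (\<Sum>i<m. \<Sum>z\<in>Z \<tau>. \<Sum>j<m. of_real (x $ i) * z ^ i * (of_real (y $ j) * inverse z ^ j))"
  by (intro sum.cong refl sum.swap)
 also have "\<dots> = (\<Sum>z\<in>Z \<tau>. \<Sum>i<m. \<Sum>j<m. of_real (x $ i) * z ^ i * (of_real (y $ j) * inverse z ^ j))"
  by (rule sum.swap)
 also have "\<dots> = (\<Sum>z\<in>Z \<tau>. E z x * E (inverse z) y)"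
  by (simp only: E_def sum_product)
 finally show ?thesis unfolding 1 by simp
qed

lemma map_mat_id: "map_mat (\<lambda>x. x) A = A"
 by (rule eq_matI) auto

lemmas form_eq_id = form_eq[OF id_embedding, unfolded map_mat_id]

lemma E_zero: "E z (0\<^sub>v N) = 0"
 unfolding E_def by (rule sum.neutral) (use m(1) in auto)

lemma form_pos:
 assumes \<tau>: "\<tau> \<in> embeddings K" and x: "x \<in> Vec N" "x ~= 0\<^sub>v N"
  and nonneg: "!!z. z \<in> Z \<tau> ==> Re (E z x * E (inverse z) x) \<ge> 0"
  and zero: "!!z. z \<in> Z \<tau> ==> Re (E z x * E (inverse z) x) = 0 ==> E z x = 0"
 shows "bil (map_mat \<tau> A) x x > 0"
proof -
 have w\<tau>: "\<tau> (w i) > 0" for i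
  using tp \<tau> emb_1[OF \<tau>] by (auto simp: w_def totally_positive_def)
 define f where "f z = Re (E z x * E (inverse z) x)" for z
 define h where "h i = x $ i * \<tau> (w i) * x $ i" for i
 have h: "h i \<ge> 0" "h i = 0 \<longleftrightarrow> x $ i = 0" for i
 proof -
  have "h i = \<tau> (w i) * (x $ i)\<^sup>2" by (simp only: h_def power2_eq_square mult_ac)
  then show "h i \<ge> 0" "h i = 0 \<longleftrightarrow> x $ i = 0" using w\<tau>[of i] by simp_all
 qed
 have eq: "bil (map_mat \<tau> A) x x = (\<Sum>z\<in>Z \<tau>. f z) + (\<Sum>i=m..<N. h i)"
  using arg_cong[OF form_eq[OF \<tau> x(1) x(1)], of Re] by (simp add: f_def h_def)
 have nn: "(\<Sum>z\<in>Z \<tau>. f z) \<ge> 0" "(\<Sum>i=m..<N. h i) \<ge> 0"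
  using nonneg h by (auto simp: f_def intro!: sum_nonneg)
 have "bil (map_mat \<tau> A) x x ~= 0"
 proof
  assume "bil (map_mat \<tau> A) x x = 0"
  then have "(\<Sum>z\<in>Z \<tau>. f z) = 0" "(\<Sum>i=m..<N. h i) = 0" using eq nn by linarith+
  then have "\<forall>z\<in>Z \<tau>. f z = 0" "\<forall>i\<in>{m..<N}. h i = 0"
   using sum_nonneg_eq_0_iff[of "Z \<tau>" f] sum_nonneg_eq_0_iff[of "{m..<N}" h] nonneg h
    finite_roots[OF of_real_emb[OF \<tau>]] by (auto simp: f_def)
  then have "x = 0\<^sub>v N"
   using zero h x(1) by (intro vec_eqI_roots[OF \<tau>]) (auto simp: f_def E_zero simp del: times_complex.sel)
  then show False using x(2) by simp
 qed
 then show ?thesis using eq nn by linarith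
qed

lemma E_cnj: "E (cnj z) x = cnj (E z x)"
 by (simp add: E_def)

lemma Re_norm_term:
 assumes "cmod z = 1"
 shows "Re (E z x * E (inverse z) x) = (cmod (E z x))\<^sup>2"
 unfolding inverse_eq_cnj[OF of_real_embedding assms] E_cnj complex_norm_square[symmetric] by simp

text \<open>At a nonidentity embedding all roots lie on the unit circle, so each term of the
  diagonalised form is |E z x|^2.\<close>

lemma positive_definite_A:
 assumes \<tau>: "\<tau> \<in> embeddings K" "\<exists>x\<in>K. \<tau> x ~= x"
 shows "positive_definite N (map_mat \<tau> A)"
 unfolding positive_definite_def quad_form_bil
proof (intro ballI impI)
 fix x :: "real vec" assume x: "x \<in> Vec N" "x ~= 0\<^sub>v N"
 have e: "Re (E z x * E (inverse z) x) = (cmod (E z x))\<^sup>2" if "z \<in> Z \<tau>" for z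
  using nonidentity_root[OF of_real_emb[OF \<tau>(1)], of _ z] \<tau>(2) that by (intro Re_norm_term) auto
 show "bil (map_mat \<tau> A) x x > 0"
 proof (rule form_pos[OF \<tau>(1) x])
  fix z assume z: "z \<in> Z \<tau>"
  show "Re (E z x * E (inverse z) x) \<ge> 0" unfolding e[OF z] by simp
  show "E z x = 0" if "Re (E z x * E (inverse z) x) = 0" using that unfolding e[OF z] by simp
 qed
qed

end

lemma mat_eq_vecI:
 fixes X Y :: "'a::comm_ring_1 mat"
 assumes X: "X \<in> carrier_mat nr nc" and Y: "Y \<in> carrier_mat nr nc"
  and eq: "!!x. x \<in> Vec nc ==> X *\<^sub>v x = Y *\<^sub>v x"
 shows "X = Y"
proof (rule eq_matI)
 fix i j assume "i < dim_row Y" "j < dim_col Y"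
 then have ij: "i < nr" "j < nc" using Y by auto
 have "(X *\<^sub>v unit_vec nc j) $ i = (Y *\<^sub>v unit_vec nc j) $ i" using eq by simp
 then show "X $$ (i, j) = Y $$ (i, j)" using X Y ij by simp
qed (use X Y in auto)

lemma smult_mat_mult_vec:
 fixes X :: "'a::comm_ring_1 mat"
 assumes "X \<in> carrier_mat nr nc" "x \<in> Vec nc"
 shows "(k \<cdot>\<^sub>m X) *\<^sub>v x = k \<cdot>\<^sub>v (X *\<^sub>v x)"
 using assms by (intro eq_vecI) auto

context square_root_data
begin

definition e :: "real => real vec => real" where
 "e r x = (\<Sum>i<m. x $ i * r ^ i)"

lemma E_of_real: "E (of_real r) x = of_real (e r x)"
 by (simp add: E_def e_def)

lemma Z0_l: "of_real l \<in> Z0" "of_real (inverse l) \<in> Z0"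
proof -
 have "poly (map_poly complex_of_real p) (of_real r) = of_real (poly p r)" for r by simp
 then show "of_real l \<in> Z0" "of_real (inverse l) \<in> Z0"
  using p_props(3) p_pal(1) by (simp_all del: of_real_inverse)
qed

text \<open>The quotient p/(X - r) vanishes at all other roots and, the roots being simple, not at
  r. For r = l and r = 1/l these vectors become the isotropic eigenvectors of the isometry.\<close>

lemma delta_vector:
 assumes r: "poly p r = 0"
 obtains v a where "v \<in> Vec N" "a ~= 0"
  "!!z. z \<in> Z0 ==> E z v = (if z = of_real r then of_real a else 0)"
  "!!i. m \<le> i ==> i < N ==> v $ i = 0"
proof -
 interpret oh: map_poly_comm_ring_hom "of_real :: real => complex" ..
 obtain h where h: "p = [:- r, 1:] * h" using r by (meson poly_eq_0_iff_dvd dvdE)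
 define H where "H = map_poly complex_of_real h"
 have PH: "map_poly complex_of_real p = [:- of_real r, 1:] * H"
  unfolding h H_def oh.hom_mult by (simp add: map_poly_pCons)
 have "h ~= 0" using h p_props(2) by auto
 then have "degree p = Suc (degree h)" unfolding h by (subst degree_mult_eq) auto
 then have ch: "coeff h i = 0" if "i \<ge> m" for i using that by (intro coeff_eq_0) (simp add: m_def)
 define v where "v = vec N (\<lambda>i. if i < m then coeff h i else 0)"
 have Ev: "E z v = poly H z" for z
  using poly_eq_sum_lessThan[of m H z] ch m(1) by (simp add: H_def coeff_map_poly E_def v_def)
 have Hr: "poly H (of_real r) = of_real (poly h r)" by (simp add: H_def)
 have "poly h r ~= 0"
 proof
  assume "poly h r = 0"
  then have z: "poly H (of_real r) = 0" using Hr by simp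
  have "poly (map_poly complex_of_real p) (of_real r) = 0" unfolding PH by simp
  then have "poly (pderiv (map_poly complex_of_real p)) (of_real r) ~= 0"
   by (rule P_simple[OF of_real_embedding])
  then show False unfolding PH pderiv_mult using z by (simp add: pderiv_pCons del: mult_pCons_left)
 qed
 moreover have "E z v = (if z = of_real r then of_real (poly h r) else 0)" if "z \<in> Z0" for z
  using that unfolding Ev PH using Hr by auto
 ultimately show ?thesis by (intro that[of v "poly h r"]) (auto simp: v_def)
qed

text \<open>Only one term of the diagonalised form survives, the one in which the inverse of z
  equals r.\<close>

lemma bil_delta:
 assumes v: "v \<in> Vec N" "!!z. z \<in> Z0 ==> E z v = (if z = of_real r then of_real a else 0)"
   "!!i. m \<le> i ==> i < N ==> v $ i = 0"
  and r: "of_real (inverse r) \<in> Z0" and x: "x \<in> Vec N"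
 shows "bil A x v = e (inverse r) x * a"
proof -
 have inv: "inverse z \<in> Z0" if "z \<in> Z0" for z using root_inverse[OF of_real_embedding] that by simp
 have "complex_of_real (bil A x v) = (\<Sum>z\<in>Z0. E z x * E (inverse z) v)"
  unfolding form_eq_id[OF x v(1)] using v(3) by simp
 also have "\<dots> = (\<Sum>z\<in>Z0. if z = of_real (inverse r) then E z x * of_real a else 0)"
 proof (rule sum.cong[OF refl])
  fix z assume z: "z \<in> Z0"
  have "inverse z = of_real r \<longleftrightarrow> z = of_real (inverse r)"
   by (metis inverse_inverse_eq of_real_inverse)
  then show "E z x * E (inverse z) v = (if z = of_real (inverse r) then E z x * of_real a else 0)"
   using v(2)[OF inv[OF z]] by simp
 qed
 also have "\<dots> = E (of_real (inverse r)) x * of_real a"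
  using r finite_roots[OF of_real_embedding] by (subst sum.delta) (auto simp del: of_real_inverse)
 finally have "complex_of_real (bil A x v) = of_real (e (inverse r) x * a)" unfolding E_of_real by simp
 then show ?thesis by (simp only: of_real_eq_iff)
qed

text \<open>On each plane \<langle>1, \<alpha>\<rangle> the map e_j -> e_(j+1) -> \<alpha> e_j for
  even j. Its square is \<alpha> and it multiplies the form by \<alpha>, the same factor as
  multiplication by c on the first block. As m and N are even, the padding indices split into such
  pairs.\<close>

definition flip :: "nat => nat => real" where
 "flip i j = (if even j \<and> i = j + 1 then 1 else if odd j \<and> j = i + 1 then \<alpha> else 0)"

definition partner :: "nat => nat" where "partner i = (if even i then i + 1 else i - 1)"

lemma partner:
 assumes "i \<in> {m..<N}"
 shows "partner i \<in> {m..<N}" "partner (partner i) = i" "even (partner i) = odd i"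
proof -
 have "even i ==> i + 1 < N" using assms m(4) by simp presburger
 moreover have "odd i ==> m \<le> i - 1 \<and> i \<ge> 1" using assms m(3) by simp presburger
 ultimately show "partner i \<in> {m..<N}" "partner (partner i) = i" "even (partner i) = odd i"
  using assms by (auto simp: partner_def)
qed

lemma flip_sum:
 assumes i: "i \<in> {m..<N}"
 shows "(\<Sum>j=m..<N. flip i j * f j) = (if even i then \<alpha> else 1) * f (partner i)"
proof -
 have "(\<Sum>j=m..<N. flip i j * f j) = (\<Sum>j=m..<N. if j = partner i then (if even i then \<alpha> else 1) * f j else 0)"
 proof (rule sum.cong[OF refl])
  fix j
  show "flip i j * f j = (if j = partner i then (if even i then \<alpha> else 1) * f j else 0)"
  proof (cases "even i")
   case False
   then obtain t where "i = Suc t" by (cases i) auto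
   then show ?thesis using False by (auto simp: flip_def partner_def)
  qed (auto simp: flip_def partner_def)
 qed
 then show ?thesis using partner(1)[OF i] by simp
qed

theorem lattice_exists:
 "\<exists>\<Gamma> \<gamma>. arithmetic_simplest_type n K \<Gamma> \<and> \<gamma> \<in> \<Gamma> \<and> hyperbolic n \<gamma> \<and>
  sqrt l = exp (translation_length n \<gamma>)"
proof -
 interpret K: number_field K by (rule totally_real_number_field_imp[OF totally_real])
 interpret O: subring_of_field "\<O> K" by (rule K.ring_of_integers_subring)
 interpret oh: map_poly_comm_ring_hom "of_real :: real => complex" ..
 note idE = id_embedding
 define k where "k = inverse (sqrt \<alpha>)"
 have k: "k * sqrt \<alpha> = 1" "k ~= 0" "k * k * \<alpha> = 1"
 proof -
  show "k ~= 0" using \<alpha>(2) by (simp add: k_def)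
  show 1: "k * sqrt \<alpha> = 1" using \<alpha>(2) by (simp add: k_def)
  have "k * k * (sqrt \<alpha> * sqrt \<alpha>) = (k * sqrt \<alpha>) * (k * sqrt \<alpha>)" by (simp only: mult_ac)
  then show "k * k * \<alpha> = 1" using 1 \<alpha>(2) by simp
 qed
 obtain r where r: "!!j. poly_over (r j)" "!!j. \<exists>a. Polynomial.monom 1 j * c = p * a + r j"
  "!!i j. i \<ge> m ==> coeff (r j) i = 0"
  unfolding m_def by (rule reductions[OF p_props(1,2) degree_p_pos c(1)]) blast
 define S where "S = block r flip"
 define T where "T = k \<cdot>\<^sub>m S"
 have Sc: "S \<in> Mat N" unfolding S_def by (rule block_carrier)
 have Tc: "T \<in> Mat N" using Sc by (simp add: T_def)
 have SK: "elements_mat S \<subseteq> K"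
  unfolding elements_mat_subset_iff[OF Sc]
  using poly_over_coeff[OF r(1)] \<alpha>(1) zero_mem one_mem by (auto simp: S_def block_def flip_def)
 have Sx: "S *\<^sub>v x \<in> Vec N" and Tx: "T *\<^sub>v x \<in> Vec N" if "x \<in> Vec N" for x :: "real vec"
  using that Sc Tc by auto
 have T_S: "T *\<^sub>v x = k \<cdot>\<^sub>v (S *\<^sub>v x)" if "x \<in> Vec N" for x :: "real vec"
  unfolding T_def by (rule smult_mat_mult_vec[OF Sc that])
 have ES: "E z (S *\<^sub>v x) = poly (map_poly of_real c) z * E z x" if "x \<in> Vec N" "z \<in> Z0" for x :: "real vec" and z
  unfolding S_def by (rule E_block[OF that r(2,3)])
 have E_smult: "E z (a \<cdot>\<^sub>v x) = of_real a * E z x" if "x \<in> Vec N" for z a and x :: "real vec"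
  using that m(1) by (simp add: E_def sum_distrib_left mult.assoc)
 have ET: "E z (T *\<^sub>v x) = of_real k * (poly (map_poly of_real c) z * E z x)" if "x \<in> Vec N" "z \<in> Z0" for x :: "real vec" and z
  using T_S[OF that(1)] E_smult[OF Sx[OF that(1)]] ES[OF that] by simp
 have S_ext: "(S *\<^sub>v x) $ i = (if even i then \<alpha> else 1) * x $ partner i" if "x \<in> Vec N" "i \<in> {m..<N}" for x :: "real vec" and i
  using block_mult[OF that(1), of i r flip] flip_sum[OF that(2), of "\<lambda>j. x $ j"] that(2) by (simp add: S_def)
 have T_ext: "(T *\<^sub>v x) $ i = k * ((if even i then \<alpha> else 1) * x $ partner i)" if "x \<in> Vec N" "i \<in> {m..<N}" for x :: "real vec" and i
  using T_S[OF that(1)] S_ext[OF that] carrier_vecD[OF Sx[OF that(1)]] that(2) by (simp del: index_mult_mat_vec)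
 have inv: "inverse z \<in> Z0" if "z \<in> Z0" for z using root_inverse[OF of_real_embedding] that by simp
 have isoS: "bil A (S *\<^sub>v x) (S *\<^sub>v y) = \<alpha> * bil A x y" if x: "x \<in> Vec N" and y: "y \<in> Vec N" for x y :: "real vec"
 proof -
  have 1: "(\<Sum>z\<in>Z0. E z (S *\<^sub>v x) * E (inverse z) (S *\<^sub>v y)) = of_real \<alpha> * (\<Sum>z\<in>Z0. E z x * E (inverse z) y)"
   unfolding sum_distrib_left
  proof (rule sum.cong[OF refl])
   fix z assume z: "z \<in> Z0"
   have "E z (S *\<^sub>v x) * E (inverse z) (S *\<^sub>v y) =
     (poly (map_poly of_real c) z * poly (map_poly of_real c) (inverse z)) * (E z x * E (inverse z) y)"
    unfolding ES[OF x z] ES[OF y inv[OF z]] by (simp only: mult_ac)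
   then show "E z (S *\<^sub>v x) * E (inverse z) (S *\<^sub>v y) = of_real \<alpha> * (E z x * E (inverse z) y)"
    using c_inverse z by simp
  qed
  have "(\<Sum>i=m..<N. (S *\<^sub>v x) $ i * w i * (S *\<^sub>v y) $ i) = (\<Sum>i=m..<N. \<alpha> * (x $ partner i * w (partner i) * y $ partner i))"
  proof (rule sum.cong[OF refl])
   fix i assume i: "i \<in> {m..<N}"
   show "(S *\<^sub>v x) $ i * w i * (S *\<^sub>v y) $ i = \<alpha> * (x $ partner i * w (partner i) * y $ partner i)"
    unfolding S_ext[OF x i] S_ext[OF y i] using partner(3)[OF i] by (simp add: w_def)
  qed
  also have "\<dots> = (\<Sum>i=m..<N. \<alpha> * (x $ i * w i * y $ i))"
   by (rule sum.reindex_bij_witness[of _ partner partner]) (use partner in auto)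
  finally have 2: "(\<Sum>i=m..<N. (S *\<^sub>v x) $ i * w i * (S *\<^sub>v y) $ i) = \<alpha> * (\<Sum>i=m..<N. x $ i * w i * y $ i)"
   by (simp only: sum_distrib_left)
  have "complex_of_real (bil A (S *\<^sub>v x) (S *\<^sub>v y)) = of_real (\<alpha> * bil A x y)"
   unfolding form_eq_id[OF Sx[OF x] Sx[OF y]] 1 2 of_real_mult form_eq_id[OF x y] by (simp add: distrib_left)
  then show ?thesis by (simp only: of_real_eq_iff)
 qed
 have isoT: "T\<^sup>T * A * T = A"
  unfolding isometry_iff[OF A_carrier A_carrier Tc]
 proof (intro ballI)
  fix x y :: "real vec" assume xy: "x \<in> Vec N" "y \<in> Vec N"
  have "bil A (T *\<^sub>v x) (T *\<^sub>v y) = k * k * bil A (S *\<^sub>v x) (S *\<^sub>v y)"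
   unfolding T_S[OF xy(1)] T_S[OF xy(2)]
   by (simp add: bil_smult_left[OF A_carrier Sx[OF xy(1)]] bil_smult_right[OF A_carrier Sx[OF xy(1)] Sx[OF xy(2)]] Sx[OF xy(2)])
  then show "bil A (T *\<^sub>v x) (T *\<^sub>v y) = bil A x y"
   using k(3) by (simp add: isoS[OF xy] mult.assoc[symmetric])
 qed
 obtain r' where r': "!!j. O.poly_over (r' j)" "!!j. \<exists>a. Polynomial.monom 1 j * [:0, 1:] = p * a + r' j"
  "!!i j. i \<ge> m ==> coeff (r' j) i = 0"
  unfolding m_def
  by (rule O.reductions[OF _ p_props(2) degree_p_pos, of "[:0, 1:]"])
   (use p_integral(2) in \<open>auto simp: O.poly_over_def coeff_pCons O.zero_mem O.one_mem split: nat.splits\<close>)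
 \<comment> \<open>D is multiplication by X, integral because p has integral coefficients, together
   with the identity on the padding.\<close>
 define D where "D = block r' (\<lambda>i j. if i = j then 1 else 0)"
 have Dc: "D \<in> Mat N" unfolding D_def by (rule block_carrier)
 have DO: "elements_mat D \<subseteq> \<O> K"
  unfolding elements_mat_subset_iff[OF Dc]
  using O.poly_over_coeff[OF r'(1)] O.zero_mem O.one_mem by (auto simp: D_def block_def)
 have TD: "T * T = D"
 proof (rule mat_eq_vecI)
  fix x :: "real vec" assume x: "x \<in> Vec N"
  have "(T * T) *\<^sub>v x = T *\<^sub>v (T *\<^sub>v x)" by (rule assoc_mult_mat_vec[OF Tc Tc x])
  also have "\<dots> = D *\<^sub>v x"
  proof (rule vec_eqI_roots[OF idE])
   show "T *\<^sub>v (T *\<^sub>v x) \<in> Vec N" by (rule Tx[OF Tx[OF x]])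
   show "D *\<^sub>v x \<in> Vec N" using Dc x by simp
   fix z assume z: "z \<in> Z (\<lambda>x. x)"
   have "E z (T *\<^sub>v (T *\<^sub>v x)) = of_real (k * k) * ((poly (map_poly of_real c) z)\<^sup>2 * E z x)"
    unfolding ET[OF Tx[OF x] z] ET[OF x z] by (simp add: power2_eq_square mult_ac)
   also have "\<dots> = of_real (k * k * \<alpha>) * (z * E z x)"
    using c_square z by (simp add: mult_ac)
   also have "\<dots> = z * E z x" unfolding k(3) by simp
   also have "\<dots> = E z (D *\<^sub>v x)"
   proof -
    have "E z (D *\<^sub>v x) = poly (map_poly of_real [:0, 1:]) z * E z x"
     unfolding D_def by (rule E_block[OF x z r'(2,3)])
    then show ?thesis by (simp add: map_poly_pCons)
   qed
   finally show "E z (T *\<^sub>v (T *\<^sub>v x)) = E z (D *\<^sub>v x)" .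
  next
   fix i assume "m \<le> i" "i < N"
   then have i: "i \<in> {m..<N}" by simp
   have "(T *\<^sub>v (T *\<^sub>v x)) $ i = (k * k * \<alpha>) * x $ i"
    unfolding T_ext[OF Tx[OF x] i] T_ext[OF x partner(1)[OF i]] partner(2)[OF i] using partner(3)[OF i]
    by (simp add: mult_ac)
   also have "\<dots> = (D *\<^sub>v x) $ i"
   proof -
    have "(\<Sum>j=m..<N. (if i = j then 1 else 0) * x $ j) = (\<Sum>j=m..<N. if j = i then x $ j else 0)"
     by (intro sum.cong) auto
    then show ?thesis
     unfolding D_def k(3) using block_mult[OF x, of i] i by simp
   qed
   finally show "(T *\<^sub>v (T *\<^sub>v x)) $ i = (D *\<^sub>v x) $ i" .
  qed
  finally show "(T * T) *\<^sub>v x = D *\<^sub>v x" .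
 qed (use Tc Dc in auto)
 obtain v a where v: "v \<in> Vec N" "a ~= 0"
  "!!z. z \<in> Z0 ==> E z v = (if z = of_real l then of_real a else 0)" "!!i. m \<le> i ==> i < N ==> v $ i = 0"
  by (rule delta_vector[OF p_props(3)]) blast
 obtain w0 b where w0: "w0 \<in> Vec N" "b ~= 0"
  "!!z. z \<in> Z0 ==> E z w0 = (if z = of_real (inverse l) then of_real b else 0)" "!!i. m \<le> i ==> i < N ==> w0 $ i = 0"
  by (rule delta_vector[OF p_pal(1)]) blast
 have eigen: "T *\<^sub>v y = \<rho> \<cdot>\<^sub>v y"
  if y: "y \<in> Vec N" "!!z. z \<in> Z0 ==> E z y = (if z = of_real t then of_real d else 0)"
    "!!i. m \<le> i ==> i < N ==> y $ i = 0" and ct: "poly c t = sqrt \<alpha> * \<rho>" for y :: "real vec" and t d \<rho>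
 proof (rule vec_eqI_roots[OF idE])
  show "T *\<^sub>v y \<in> Vec N" by (rule Tx[OF y(1)])
  show "\<rho> \<cdot>\<^sub>v y \<in> Vec N" using y(1) by simp
  fix z assume z: "z \<in> Z (\<lambda>x. x)"
  show "E z (T *\<^sub>v y) = E z (\<rho> \<cdot>\<^sub>v y)"
  proof (cases "z = of_real t")
   case True
   have "of_real k * poly (map_poly of_real c) (complex_of_real t) = of_real (k * sqrt \<alpha> * \<rho>)"
    by (simp add: ct)
   then have "of_real k * poly (map_poly of_real c) z = of_real \<rho>" unfolding k(1) True by simp
   then show ?thesis
    unfolding ET[OF y(1) z] E_smult[OF y(1)] by (simp only: mult.assoc[symmetric])
  next
   case False
   then have "E z y = 0" using y(2) z by simp
   then show ?thesis unfolding ET[OF y(1) z] E_smult[OF y(1)] by simp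
  qed
 next
  fix i assume "m \<le> i" "i < N"
  then have i: "i \<in> {m..<N}" by simp
  have "y $ partner i = 0" "y $ i = 0" using y(3) partner(1)[OF i] i by auto
  then show "(T *\<^sub>v y) $ i = (\<rho> \<cdot>\<^sub>v y) $ i"
   unfolding T_ext[OF y(1) i] using i y(1) by simp
 qed
 define \<mu> where "\<mu> = sqrt l"
 have mu: "\<mu> > 1" using l_gt_1 by (simp add: \<mu>_def)
 have Tv: "T *\<^sub>v v = \<mu> \<cdot>\<^sub>v v"
  by (rule eigen[OF v(1,3,4)]) (simp_all add: c(2) \<mu>_def)
 have Tw0: "T *\<^sub>v w0 = inverse \<mu> \<cdot>\<^sub>v w0"
  by (rule eigen[OF w0(1,3,4)]) (simp_all add: c(3) \<mu>_def)
 have bv: "bil A x v = e (inverse l) x * a" if "x \<in> Vec N" for x :: "real vec"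
  by (rule bil_delta[OF v(1,3,4) Z0_l(2) that])
 have bw: "bil A x w0 = e l x * b" if "x \<in> Vec N" for x :: "real vec"
  using bil_delta[OF w0(1,3,4) _ that] Z0_l(1) by simp
 have l_ne: "l ~= inverse l"
 proof
  assume "l = inverse l"
  then have "l * l = 1" using l_gt_1 by (metis right_inverse less_numeral_extra(1) order_less_trans less_irrefl)
  then show False using l_gt_1 by (metis less_1_mult less_irrefl)
 qed
 have ev: "e l v = a" "e (inverse l) v = 0" "e l w0 = 0" "e (inverse l) w0 = b"
 proof -
  have "complex_of_real (e l v) = of_real a" "complex_of_real (e (inverse l) v) = of_real 0"
   "complex_of_real (e l w0) = of_real 0" "complex_of_real (e (inverse l) w0) = of_real b"
   unfolding E_of_real[symmetric] v(3)[OF Z0_l(1)] v(3)[OF Z0_l(2)] w0(3)[OF Z0_l(1)] w0(3)[OF Z0_l(2)]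
   using l_ne by (simp_all only: of_real_eq_iff if_True if_False of_real_0 not_sym simp_thms eq_commute[of "inverse l" l])
  then show "e l v = a" "e (inverse l) v = 0" "e l w0 = 0" "e (inverse l) w0 = b"
   by (simp_all only: of_real_eq_iff)
 qed
 \<comment> \<open>Chosen so that the product of v and u' is -1/2, as \<open>null_frame\<close>
   demands.\<close>
 define \<kappa> where "\<kappa> = - (1 / (2 * a * b))"
 define u' where "u' = \<kappa> \<cdot>\<^sub>v w0"
 have u'c: "u' \<in> Vec N" using w0(1) by (simp add: u'_def)
 have bu': "bil A x u' = \<kappa> * (e l x * b)" if "x \<in> Vec N" for x :: "real vec"
  unfolding u'_def bil_smult_right[OF A_carrier that w0(1)] bw[OF that] ..
 have ev': "e r u' = \<kappa> * e r w0" for r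
  using w0(1) m(1) by (simp add: u'_def e_def sum_distrib_left mult.assoc)
 have bvv: "bil A v v = 0" "bil A u' u' = 0" "bil A v u' = -1/2" "bil A u' v = -1/2"
  using v(1,2) w0(2) u'c by (simp_all add: bv bu' ev ev' \<kappa>_def)
 define u where "u = v + u'"
 have uc: "u \<in> Vec N" using v(1) u'c by (simp add: u_def)
 have buu: "bil A u u = -1"
  unfolding u_def bil_add_left[OF A_carrier v(1) u'c uc[unfolded u_def]]
   bil_add_right[OF A_carrier v(1) u'c v(1)] bil_add_right[OF A_carrier v(1) u'c u'c] bvv by simp
 \<comment> \<open>Orthogonality to u makes the value of x at 1/l a positive multiple of its value
   at l, so the two real roots contribute nonnegative terms; all other roots lie on the unit
   circle.\<close>
 have pos: "bil A x x > 0" if x: "x \<in> Vec N" "x ~= 0\<^sub>v N" and xu: "bil A x u = 0" for x :: "real vec"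
 proof -
  have "e (inverse l) x * a + \<kappa> * (e l x * b) = 0"
   using xu unfolding u_def bil_add_right[OF A_carrier v(1) u'c x(1)] bv[OF x(1)] bu'[OF x(1)] .
  then have rel: "e (inverse l) x = e l x / (2 * a\<^sup>2)"
   using v(2) w0(2) by (simp add: \<kappa>_def field_simps power2_eq_square)
  then have prod: "e l x * e (inverse l) x = (e l x)\<^sup>2 / (2 * a\<^sup>2)"
   by (simp add: power2_eq_square)
  have "Re (E z x * E (inverse z) x) \<ge> 0 \<and> (Re (E z x * E (inverse z) x) = 0 --> E z x = 0)"
   if z: "z \<in> Z0" for z
  proof -
   consider "z = of_real l" | "z = of_real (inverse l)" | "cmod z = 1"
    using root_cases[OF of_real_embedding] z by blast
   then show ?thesis
   proof cases
    case 1
    have "E z x * E (inverse z) x = of_real (e l x * e (inverse l) x)"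
     unfolding 1 of_real_inverse[symmetric] E_of_real by simp
    then have "Re (E z x * E (inverse z) x) = (e l x)\<^sup>2 / (2 * a\<^sup>2)" by (simp only: prod Re_complex_of_real)
    then show ?thesis unfolding 1 E_of_real using v(2) by simp
   next
    case 2
    have iz: "inverse z = of_real l" unfolding 2 by simp
    have "E z x * E (inverse z) x = of_real (e l x * e (inverse l) x)"
     unfolding iz unfolding 2 E_of_real by simp
    then have "Re (E z x * E (inverse z) x) = (e l x)\<^sup>2 / (2 * a\<^sup>2)" by (simp only: prod Re_complex_of_real)
    then show ?thesis unfolding 2 E_of_real using v(2) rel by simp
   next
    case 3
    show ?thesis unfolding Re_norm_term[OF 3] by simp
   qed
  qed
  then have "bil (map_mat (\<lambda>x. x) A) x x > 0" by (intro form_pos[OF idE x]) blast+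
  then show ?thesis unfolding map_mat_id .
 qed
 obtain M Mi where LF: "lorentzian_form n A M Mi" and Mu: "M *\<^sub>v unit_vec N n = u"
  by (rule lorentzian_basis[OF A_carrier A_sym uc buu pos])
 interpret L: lorentzian_form n A M Mi by (rule LF)
 have adm: "admissible n K A"
  unfolding admissible_def
  using totally_real A_carrier A_over A_sym L.has_signature positive_definite_A by blast
 have nf: "null_frame n (Mi *\<^sub>v v) (Mi *\<^sub>v u')"
 proof -
  have "Mi *\<^sub>v v + Mi *\<^sub>v u' = Mi *\<^sub>v u"
   unfolding u_def using L.M(2) v(1) u'c by (simp add: mult_add_distrib_mat_vec)
  also have "\<dots> = unit_vec N n" unfolding Mu[symmetric] by (rule L.MiM) simp
  finally have "Mi *\<^sub>v v + Mi *\<^sub>v u' \<in> hyp_space n" by (simp add: hyp_space_iff lorentz_def)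
  then show ?thesis
   unfolding null_frame_def L.bil_Mi[OF v(1) v(1)] L.bil_Mi[OF u'c u'c] L.bil_Mi[OF v(1) u'c] bvv
   using L.Mic[OF v(1)] L.Mic[OF u'c] by simp
 qed
 have toLT: "L.toL T *\<^sub>v (Mi *\<^sub>v y) = t \<cdot>\<^sub>v (Mi *\<^sub>v y)" if y: "y \<in> Vec N" and ty: "T *\<^sub>v y = t \<cdot>\<^sub>v y" for y :: "real vec" and t
  unfolding L.toL_vec[OF Tc L.Mic[OF y]] L.MMi[OF y] ty by (rule mult_mat_vec[OF L.M(2) y])
 have Tu': "T *\<^sub>v u' = inverse \<mu> \<cdot>\<^sub>v u'"
  unfolding u'_def mult_mat_vec[OF Tc w0(1)] Tw0 by (simp add: smult_smult_assoc mult.commute)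
 note gv = toLT[OF v(1) Tv] toLT[OF u'c Tu']
 have mu0: "\<mu> > 0" using mu by linarith
 have "lorentz_isometry n (L.toL T)" using isoT L.toL_isometry_iff[OF Tc] by simp
 then have TO: "L.toL T \<in> O_plus n" by (rule O_plus_null_frame[OF _ nf mu0 gv])
 \<comment> \<open>An isometry of a nondegenerate form has determinant 1 or -1, so D = T T has
   determinant 1 and an integral inverse.\<close>
 have "D \<in> GL_over N (\<O> K)"
 proof -
  obtain Ai where Ai: "Ai \<in> Mat N" "A * Ai = 1\<^sub>m N" by (rule L.A_invertible)
  have "det A * det Ai = 1" using det_mult[OF A_carrier Ai(1)] Ai(2) by simp
  then have "det A ~= 0" by auto
  moreover have "det (T\<^sup>T) * det A * det T = det A"
   using arg_cong[OF isoT, of det] Tc A_carrier by (simp add: det_mult[of _ N])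
  ultimately have "det T * det T = 1" using det_transpose[OF Tc] by simp
  then have dD: "det D = 1" unfolding TD[symmetric] using det_mult[OF Tc Tc] by simp
  obtain Y where "Y \<in> Mat N" "elements_mat Y \<subseteq> \<O> K" "D * Y = 1\<^sub>m N" "Y * D = 1\<^sub>m N"
   using O.elements_mat_inverse[OF Dc DO] O.one_mem unfolding dD by (metis inverse_1 zero_neq_one)
  then show ?thesis unfolding GL_over_def using Dc DO by blast
 qed
 then have T2: "T * T \<in> GL_over N (\<O> K)" unfolding TD .
 obtain \<Gamma> where \<Gamma>: "arithmetic_simplest_type n K \<Gamma>" "L.toL T \<in> \<Gamma>"
  by (rule L.square_root_lattice[OF adm Sc SK T_def TO T2])
 have tr: "translates_along n (L.toL T) (range (null_line (Mi *\<^sub>v v) (Mi *\<^sub>v u'))) (ln \<mu>)"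
  by (rule translates_alongI[OF L.toL_carrier[OF Tc] nf]) (use mu mu0 gv in \<open>simp_all add: exp_minus\<close>)
 have "sqrt l = exp (translation_length n (L.toL T))"
  unfolding translation_length_eq[OF TO tr] using mu0 by (simp add: \<mu>_def)
 then show ?thesis using \<Gamma> hyperbolicI[OF TO tr] by blast
qed

end

theorem theorem1p6:
  fixes n :: nat
  assumes "n \<ge> 3" and "odd n"
  shows
    "(\<forall>\<Gamma> K \<gamma> l.
        totally_real_number_field K \<and> arithmetic_simplest_type n K \<Gamma> \<and>
        \<gamma> \<in> \<Gamma> \<and> hyperbolic n \<gamma> \<and> l = exp (2 * translation_length n \<gamma>)
        \<longrightarrow> salem l \<and> square_rootable K l) \<and>
     (\<forall>l K.
        salem l \<and> subfield K class_ring \<and> K \<subseteq> field_adjoin \<rat> (l + inverse l) \<and>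
        deg_over K l \<le> n + 1 \<and> square_rootable K l
        \<longrightarrow> (\<exists>\<Gamma> \<gamma>. arithmetic_simplest_type n K \<Gamma> \<and> \<gamma> \<in> \<Gamma> \<and> hyperbolic n \<gamma> \<and>
               sqrt l = exp (translation_length n \<gamma>)))"
proof (intro conjI allI impI)
 fix \<Gamma> K \<gamma> l
 assume h: "totally_real_number_field K \<and> arithmetic_simplest_type n K \<Gamma> \<and>
  \<gamma> \<in> \<Gamma> \<and> hyperbolic n \<gamma> \<and> l = exp (2 * translation_length n \<gamma>)"
 then show "square_rootable K l"
  using assms(1) by (intro translation_length_square_rootable[of n K \<Gamma> \<gamma> l]) auto
 then show "salem l" by (simp add: square_rootable_def)
next
 fix l K
 assume h: "salem l \<and> subfield K class_ring \<and> K \<subseteq> field_adjoin \<rat> (l + inverse l) \<and>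
  deg_over K l \<le> n + 1 \<and> square_rootable K l"
 \<comment> \<open>That K is a totally real number field is not assumed here; it follows from its
   inclusion in \<rat>(l + 1/l).\<close>
 interpret salem_field K l
  using h by (simp add: salem_field_def salem_field_axioms_def real_subfield_def subfield_class_ring_iff)
 obtain \<alpha> c where c: "totally_positive K \<alpha>" "poly_over c"
  "poly c l = sqrt \<alpha> * sqrt l" "poly c (inverse l) = sqrt \<alpha> * inverse (sqrt l)"
  "!!z. poly (map_poly complex_of_real p) z = 0 ==> (poly (map_poly of_real c) z)\<^sup>2 = of_real \<alpha> * z"
  "!!z. poly (map_poly complex_of_real p) z = 0 ==>
   poly (map_poly of_real c) z * poly (map_poly of_real c) (inverse z) = of_real \<alpha>"
  using h by (elim conjE) (rule square_root_polynomial, assumption, blast)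
 obtain s :: "nat => real" where s: "!!j. j < degree p ==> s j \<in> K"
  "!!(\<sigma> :: real => complex) j. \<sigma> \<in> embeddings K ==> j < degree p ==>
   \<sigma> (s j) = (\<Sum>z | poly (map_poly \<sigma> p) z = 0. z ^ j)"
  by (rule power_sums) blast
 have "degree p \<le> n + 1" using h deg_over_eq[OF algK] by (simp add: p_def)
 then interpret square_root_data K l n \<alpha> c s
  using assms(2) c s by unfold_locales
 show "\<exists>\<Gamma> \<gamma>. arithmetic_simplest_type n K \<Gamma> \<and> \<gamma> \<in> \<Gamma> \<and> hyperbolic n \<gamma> \<and>
   sqrt l = exp (translation_length n \<gamma>)"
  by (rule lattice_exists)
qed

end
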